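(* Let the data $P,\mu,\lambda,K,f,\rho_0,u_0$ satisfy the standing assumptions (A1)--(A7) listed in the context (including that $C_0$ and $C_f$ are sufficiently small), and let $(\rho,u)$ be the corresponding Hoff solution on $\mathbb{R}^3_+\times(0,\infty)$, with $F$, $\omega$, $P=P(\rho)$ and $\tilde P=P(\tilde\rho)$ as in the context. Then the velocity field $u$ can be written as $u=u_P+u_{F,\omega}$ for some vector fields $u_P$, $u_{F,\omega}$ satisfying (at each time $t>0$), for any $p\in(1,\infty)$, $$\|\nabla u_P\|_p\le C\|P-\tilde P\|_p,$$ $$\|\nabla u_{F,\omega}\|_p\le C\left(\|F\|_p+\|\omega\|_p+\|P-\tilde P\|_p+\|u\|_p\right)$$ and $$\|D^2u_{F,\omega}\|_p\le C\left(\|\nabla F\|_p+\|\nabla\omega\|_p+\|F\|_p+\|\omega\|_p+\|P-\tilde P\|_p+\|u\|_p\right),$$ where $C$ is a constant depending on the space dimension $n=3$, on $p$ and on arbitrary positive numbers $\underline K,\overline K$ such that $\underline K\le K\le\overline K$.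
   Context: Notation. $\mathbb{R}^3_+=\{x\in\mathbb{R}^3: x_3>0\}$; $\|\cdot\|_p$ is the $L^p(\mathbb{R}^3_+)$ norm in the space variable; $\sigma(t)=\min\{t,1\}$; subscripts $x_j$, $t$ denote partial derivatives. Problem. The unknowns are the density $\rho$ and velocity $u=(u^1,u^2,u^3)$, subject to the compressible isentropic Navier--Stokes system for $x\in\mathbb{R}^3_+$, $t>0$: $$\rho_t+\operatorname{div}(\rho u)=0,\qquad (\rho u^j)_t+\operatorname{div}(\rho u^ju)+P(\rho)_{x_j}=\mu\Delta u^j+\lambda(\operatorname{div}u)_{x_j}+\rho f^j,\quad j=1,2,3,$$ with the Navier boundary condition $u(x,t)=K(x)\,(u^1_{x_3}(x,t),u^2_{x_3}(x,t),0)$ for $x=(x_1,x_2,0)\in\partial\mathbb{R}^3_+$, $t>0$, and the initial condition $(\rho,u)|_{t=0}=(\rho_0,u_0)$. Here $P$ is the pressure function, $f=(f^1,f^2,f^3)$ a given external force density, $\mu,\lambda$ constant viscosities, and $K$ a smooth, strictly positive function on $\partial\mathbb{R}^3_+\cong\mathbb{R}^2$. Standing assumptions. Fix $0<\tilde\rho<\bar\rho$. (A1) $P\in C^2([0,\bar\rho])$, $P(0)=0$, $P'(\tilde\rho)>0$, and $(\rho-\tilde\rho)[P(\rho)-P(\tilde\rho)]>0$ for $\rho\in[0,\bar\rho]$, $\rho\ne\tilde\rho$. (A2) $\mu>0$, $0<\lambda<5\mu/4$. (A3) $K\in(W^{2,\infty}\cap W^{1,3})(\mathbb{R}^2)$,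 $K(x)\ge\underline K>0$ for some constant $\underline K$. (A4) $\int_{\mathbb{R}^3_+}[\tfrac12\rho_0|u_0|^2+G(\rho_0)]dx\le C_0$, where $G(\rho)=\rho\int_{\tilde\rho}^{\rho}\frac{P(s)-P(\tilde\rho)}{s^2}ds$. (A5) $\sup_{t\ge0}\|f(\cdot,t)\|_2+\int_0^\infty(\|f(\cdot,t)\|_2+\sigma^7\|\nabla f(\cdot,t)\|_4)dt+\int_0^\infty\int_{\mathbb{R}^3_+}(|f|^2+\sigma^5|f_t|^2)dxdt\le C_f$. (A6) $q>6$ satisfies $\frac{(q-2)^2}{4(q-1)}<\frac{\mu}{\lambda}$, and $M_q:=\int_{\mathbb{R}^3_+}\rho_0|u_0|^q\,dx+\sup_{t>0}\|f(\cdot,t)\|_q+\int_0^\infty\int_{\mathbb{R}^3_+}|f|^q\,dxdt$ is finite. (A7) For given $M>0$ (not necessarily small) and $\bar\rho_1\in(\tilde\rho,\bar\rho)$: $0\le\inf\rho_0\le\sup\rho_0\le\bar\rho_1$, $M_q\le M$, and the positive numbers $C_0,C_f$ are sufficiently small, i.e. $C_0+C_f\le\varepsilon$, where $\varepsilon>0$ depends on $\tilde\rho,\bar\rho_1,\bar\rho,P,\lambda,\mu,q,M$ and the function $K$. Hoff solution. By a theorem of D. Hoff, under these assumptions there is a (global) weak solution $(\rho,u)$ of the initial boundary value problem consisting of the system $\rho_t+\operatorname{div}(\rho u)=0$, $(\rho u^j)_t+\operatorname{div}(\rho u^ju)+P(\rho)_{x_j}=\mu\Delta u^j+\lambda(\operatorname{div}u)_{x_j}+\rho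 f^j$ ($j=1,2,3$) in $\mathbb{R}^3_+\times(0,\infty)$, the Navier boundary condition $u=K\,(u^1_{x_3},u^2_{x_3},0)$ on $\partial\mathbb{R}^3_+\times(0,\infty)$ and the initial condition $(\rho,u)|_{t=0}=(\rho_0,u_0)$, obtained as a limit of smooth solutions of the problem with smooth data; it is called the Hoff solution. Set $F=(\lambda+\mu)\operatorname{div}u-P(\rho)+P(\tilde\rho)$ (effective viscous flow), $\omega=(\omega^{j,k})$ with $\omega^{j,k}=u^j_{x_k}-u^k_{x_j}$ (vorticity matrix), and $\dot u=u_t+(\nabla u)u$ (convective derivative). Among its properties: $u,F,\omega$ are Hölder continuous in $\overline{\mathbb{R}^3_+}\times[\tau,\infty)$ for any $\tau>0$; $C^{-1}\inf\rho_0\le\rho\le\bar\rho$ a.e.; and, with a constant $\bar C$ depending on $\tilde\rho,\bar\rho_1,\bar\rho,P,\lambda,\mu,q,M,K$ and a universal $\theta>0$, $$\sup_{t>0}\int_{\mathbb{R}^3_+}\Big[\tfrac12\rho|u|^2+|\rho-\tilde\rho|^2+\sigma|\nabla u|^2\Big]dx+\int_0^\infty\int_{\mathbb{R}^3_+}\Big[|\nabla u|^2+\sigma^3|\nabla\dot u|^2\Big]dxdt\le\bar C(C_0+C_f)^\theta;$$ if $\inf\rho_0>0$, the term $\int_0^\infty\int_{\mathbb{R}^3_+}\sigma|\dot u|^2dxdt$ may be added on the left side.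
   Formalization: The constant C may also depend on the viscosities μ, λ (it cannot be uniform as they tend to 0), and in (A3) the W^{1,3} condition is imposed only on the gradient of K, since a K bounded below by a positive constant is never in L^3(R^2). *)

theory Defs
  imports "HOL-Analysis.Analysis"
begin

section \<open>Domain and smooth functions\<close>

type_synonym spacetime = "(real^3) \<times> real"

definition half :: "(real^3) set" where
  "half = {x. x $ 3 > 0}"

definition cylinder :: "spacetime set" where
  "cylinder = half \<times> {0<..}"

definition bdpt :: "real^2 \<Rightarrow> real^3" where
  "bdpt y = vector [y $ 1, y $ 2, 0]"

definition ex :: "3 \<Rightarrow> spacetime" where
  "ex k = (axis k 1, 0)"

definition et :: spacetime where
  "et = (0, 1)"

definition pd :: "('a::real_normed_vector \<Rightarrow> 'b::real_normed_vector) \<Rightarrow> 'a \<Rightarrow> 'a \<Rightarrow> 'b" where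
  "pd g v z = frechet_derivative g (at z) v"

primrec Ck :: "nat \<Rightarrow> ('a::euclidean_space \<Rightarrow> 'b::real_normed_vector) \<Rightarrow> bool" where
  "Ck 0 g \<longleftrightarrow> continuous_on UNIV g"
| "Ck (Suc k) g \<longleftrightarrow> (\<forall>x. g differentiable (at x)) \<and> (\<forall>v. Ck k (pd g v))"

definition smooth :: "('a::euclidean_space \<Rightarrow> 'b::real_normed_vector) \<Rightarrow> bool" where
  "smooth g \<longleftrightarrow> (\<forall>k. Ck k g)"

definition test_fun :: "'a::euclidean_space set \<Rightarrow> ('a \<Rightarrow> 'b::real_normed_vector) \<Rightarrow> bool" where
  "test_fun \<Omega> \<phi> \<longleftrightarrow> smooth \<phi> \<and> compact (closure {x. \<phi> x \<noteq> 0}) \<and> closure {x. \<phi> x \<noteq> 0} \<subseteq> \<Omega>"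

section \<open>Weak derivatives and Lebesgue norms\<close>

definition has_weak_deriv ::
  "'a::euclidean_space set \<Rightarrow> 'a \<Rightarrow> ('a \<Rightarrow> 'b::euclidean_space) \<Rightarrow> ('a \<Rightarrow> 'b) \<Rightarrow> bool" where
  "has_weak_deriv \<Omega> v f g \<longleftrightarrow>
     (\<forall>C. compact C \<and> C \<subseteq> \<Omega> \<longrightarrow> set_integrable lebesgue C f \<and> set_integrable lebesgue C g) \<and>
     (\<forall>\<phi>::'a \<Rightarrow> real. test_fun \<Omega> \<phi> \<longrightarrow>
        (LINT x:\<Omega>|lebesgue. pd \<phi> v x *\<^sub>R f x) = - (LINT x:\<Omega>|lebesgue. \<phi> x *\<^sub>R g x))"

text \<open>
  The derivative index comes first: \<open>g x $ k\<close> is the derivative of \<open>f\<close> in direction \<open>k\<close>, so for a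
  vector field \<open>u\<close> with weak gradient \<open>Du\<close> the entry \<open>Du x $ k $ j\<close> is the \<open>k\<close>-th derivative of the
  \<open>j\<close>-th component. The norm of the type \<open>_ ^ 'n\<close> is the Euclidean (Frobenius) one.
\<close>

definition has_weak_grad ::
  "(real^'n) set \<Rightarrow> (real^'n \<Rightarrow> 'b::euclidean_space) \<Rightarrow> (real^'n \<Rightarrow> 'b^'n) \<Rightarrow> bool" where
  "has_weak_grad \<Omega> f g \<longleftrightarrow> (\<forall>k. has_weak_deriv \<Omega> (axis k 1) f (\<lambda>x. g x $ k))"

definition Lp :: "'a::euclidean_space set \<Rightarrow> real \<Rightarrow> ('a \<Rightarrow> 'b::real_normed_vector) \<Rightarrow> ennreal" where
  "Lp \<Omega> p f = (let I = (\<integral>\<^sup>+x\<in>\<Omega>. ennreal (norm (f x) powr p) \<partial>lebesgue) in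
     if I = \<infinity> then \<infinity> else ennreal (enn2real I powr (1 / p)))"

text \<open>
  A weak gradient is unique almost everywhere, so each infimum below is over at most one value; it
  is \<open>\<infinity>\<close> when the weak derivatives do not exist.
\<close>

definition grad_Lp :: "(real^'n) set \<Rightarrow> real \<Rightarrow> (real^'n \<Rightarrow> 'b::euclidean_space) \<Rightarrow> ennreal" where
  "grad_Lp \<Omega> p f = (INF g \<in> {g. has_weak_grad \<Omega> f g}. Lp \<Omega> p g)"

definition hess_Lp :: "(real^'n) set \<Rightarrow> real \<Rightarrow> (real^'n \<Rightarrow> 'b::euclidean_space) \<Rightarrow> ennreal" where
  "hess_Lp \<Omega> p f =
     (INF h \<in> {h. \<exists>g. has_weak_grad \<Omega> f g \<and> has_weak_grad \<Omega> g h}. Lp \<Omega> p h)"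

text \<open>Local integrability and convergence up to the boundary: \<open>C\<close> need not lie inside \<open>S\<close>.\<close>

definition loc_integrable :: "'a::euclidean_space set \<Rightarrow> ('a \<Rightarrow> 'b::euclidean_space) \<Rightarrow> bool" where
  "loc_integrable S g \<longleftrightarrow> (\<forall>C. compact C \<longrightarrow> set_integrable lebesgue (S \<inter> C) g)"

definition L1loc_limit ::
  "'a::euclidean_space set \<Rightarrow> (nat \<Rightarrow> 'a \<Rightarrow> 'b::real_normed_vector) \<Rightarrow> ('a \<Rightarrow> 'b) \<Rightarrow> bool" where
  "L1loc_limit S gs g \<longleftrightarrow> (\<forall>C. compact C \<longrightarrow>
     ((\<lambda>n. \<integral>\<^sup>+z\<in>S \<inter> C. ennreal (norm (gs n z - g z)) \<partial>lebesgue) \<longlongrightarrow> 0) sequentially)"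

definition Hoelder_on :: "'a::metric_space set \<Rightarrow> ('a \<Rightarrow> 'b::real_normed_vector) \<Rightarrow> bool" where
  "Hoelder_on S g \<longleftrightarrow> (\<exists>\<alpha> L. 0 < \<alpha> \<and> \<alpha> \<le> 1 \<and>
     (\<forall>z\<in>S. \<forall>w\<in>S. norm (g z - g w) \<le> L * dist z w powr \<alpha>))"

definition ess_inf :: "(real^3 \<Rightarrow> real) \<Rightarrow> real" where
  "ess_inf r = Sup {m. AE x in lebesgue. x \<in> half \<longrightarrow> m \<le> r x}"

definition sigma :: "real \<Rightarrow> real" where
  "sigma t = min t 1"

section \<open>Assumptions on the data\<close>

definition pressure_law :: "(real \<Rightarrow> real) \<Rightarrow> real \<Rightarrow> real \<Rightarrow> bool" where
  "pressure_law P rho_t rho_b \<longleftrightarrow>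
     (\<exists>P1 P2. (\<forall>s\<in>{0..rho_b}.
          (P has_real_derivative P1 s) (at s within {0..rho_b}) \<and>
          (P1 has_real_derivative P2 s) (at s within {0..rho_b})) \<and>
        continuous_on {0..rho_b} P2 \<and> P1 rho_t > 0) \<and>
     P 0 = 0 \<and>
     (\<forall>s\<in>{0..rho_b}. s \<noteq> rho_t \<longrightarrow> (s - rho_t) * (P s - P rho_t) > 0)"

text \<open>
  The \<open>W\<^sup>1\<^sup>,\<^sup>3\<close> requirement on \<open>K\<close> is imposed on the gradient only: a function bounded below by a
  positive constant on the whole plane is never in \<open>L\<^sup>3\<close>. The function \<open>K\<close> itself is taken to be the
  continuous representative.
\<close>

definition friction_coeff :: "(real^2 \<Rightarrow> real) \<Rightarrow> bool" where
  "friction_coeff K \<longleftrightarrow>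
     continuous_on UNIV K \<and> (\<exists>k0>0. \<forall>y. k0 \<le> K y) \<and>
     (\<exists>DK DDK B. has_weak_grad UNIV K DK \<and> has_weak_grad UNIV DK DDK \<and>
        (AE y in lebesgue. \<bar>K y\<bar> \<le> B \<and> norm (DK y) \<le> B \<and> norm (DDK y) \<le> B) \<and>
        Lp UNIV 3 DK < \<infinity>)"

text \<open>
  At vacuum the defining formula \<open>r * \<integral>\<dots>\<close> is read as its limit for \<open>r \<rightarrow> 0\<^sup>+\<close>, which is \<open>P rho_t\<close>
  because \<open>P 0 = 0\<close> and \<open>P\<close> is continuously differentiable at \<open>0\<close>.
\<close>

definition potential_energy :: "(real \<Rightarrow> real) \<Rightarrow> real \<Rightarrow> real \<Rightarrow> real" where
  "potential_energy P rho_t r =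
     (if r = 0 then P rho_t
      else r * (LBINT s=ereal rho_t..ereal r. (P s - P rho_t) / s\<^sup>2))"

definition initial_energy ::
  "(real \<Rightarrow> real) \<Rightarrow> real \<Rightarrow> (real^3 \<Rightarrow> real) \<Rightarrow> (real^3 \<Rightarrow> real^3) \<Rightarrow> ennreal" where
  "initial_energy P rho_t rho0 u0 =
     (\<integral>\<^sup>+x\<in>half. ennreal (rho0 x * (norm (u0 x))\<^sup>2 / 2 + potential_energy P rho_t (rho0 x)) \<partial>lebesgue)"

definition force_bound :: "(spacetime \<Rightarrow> real^3) \<Rightarrow> real \<Rightarrow> bool" where
  "force_bound f Cf \<longleftrightarrow>
     f \<in> borel_measurable borel \<and>
     (\<exists>Df ft.
        (\<forall>k. has_weak_deriv cylinder (ex k) f (\<lambda>z. Df z $ k)) \<and>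
        has_weak_deriv cylinder et f ft \<and>
        (SUP t\<in>{0..}. Lp half 2 (\<lambda>x. f (x, t)))
        + (\<integral>\<^sup>+t\<in>{0<..}. (Lp half 2 (\<lambda>x. f (x, t))
             + ennreal (sigma t ^ 7) * Lp half 4 (\<lambda>x. (Df (x, t) :: real^3^3))) \<partial>lebesgue)
        + (\<integral>\<^sup>+z\<in>cylinder. ennreal ((norm (f z))\<^sup>2 + sigma (snd z) ^ 5 * (norm (ft z))\<^sup>2) \<partial>lebesgue)
        \<le> ennreal Cf)"

definition Mq ::
  "real \<Rightarrow> (real^3 \<Rightarrow> real) \<Rightarrow> (real^3 \<Rightarrow> real^3) \<Rightarrow> (spacetime \<Rightarrow> real^3) \<Rightarrow> ennreal" where
  "Mq q rho0 u0 f =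
     (\<integral>\<^sup>+x\<in>half. ennreal (rho0 x * norm (u0 x) powr q) \<partial>lebesgue)
     + (SUP t\<in>{0<..}. Lp half q (\<lambda>x. f (x, t)))
     + (\<integral>\<^sup>+z\<in>cylinder. ennreal (norm (f z) powr q) \<partial>lebesgue)"

section \<open>Solutions\<close>

text \<open>
  Smooth functions on the closed set \<open>closure half \<times> {0..}\<close> are represented by smooth extensions to
  all of space-time, so that \<open>pd\<close> is also available on the boundary.
\<close>

definition smooth_solution ::
  "real \<Rightarrow> real \<Rightarrow> (real \<Rightarrow> real) \<Rightarrow> (real^2 \<Rightarrow> real) \<Rightarrow> (spacetime \<Rightarrow> real^3) \<Rightarrow>
   (real^3 \<Rightarrow> real) \<Rightarrow> (real^3 \<Rightarrow> real^3) \<Rightarrow> (spacetime \<Rightarrow> real) \<Rightarrow> (spacetime \<Rightarrow> real^3) \<Rightarrow> bool" where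
  "smooth_solution mu lam P K f rho0 u0 rho u \<longleftrightarrow>
     smooth rho \<and> smooth u \<and>
     (\<forall>z\<in>cylinder. pd rho et z + (\<Sum>k\<in>UNIV. pd (\<lambda>w. rho w * u w $ k) (ex k) z) = 0) \<and>
     (\<forall>z\<in>cylinder. \<forall>j.
        pd (\<lambda>w. rho w * u w $ j) et z
        + (\<Sum>k\<in>UNIV. pd (\<lambda>w. rho w * u w $ j * u w $ k) (ex k) z)
        + pd (\<lambda>w. P (rho w)) (ex j) z
        = mu * (\<Sum>k\<in>UNIV. pd (pd (\<lambda>w. u w $ j) (ex k)) (ex k) z)
        + lam * pd (\<lambda>w. \<Sum>k\<in>UNIV. pd (\<lambda>v. u v $ k) (ex k) w) (ex j) z
        + rho z * f z $ j) \<and>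
     (\<forall>y. \<forall>t>0. u (bdpt y, t) = K y *\<^sub>R
        vector [pd (\<lambda>w. u w $ 1) (ex 3) (bdpt y, t), pd (\<lambda>w. u w $ 2) (ex 3) (bdpt y, t), 0]) \<and>
     (\<forall>x\<in>half. rho (x, 0) = rho0 x \<and> u (x, 0) = u0 x)"

text \<open>
  Weak form of the problem, \<open>Du\<close> being the spatial weak gradient of \<open>u\<close>. The third component of the
  boundary condition is imposed directly; the other two are the natural boundary condition obtained
  by integrating by parts against test fields \<open>\<phi>\<close> tangential to the boundary, where the outer normal
  derivative of \<open>u\<close> is \<open>- inverse K * u\<close>. The identities on all time intervals also pin down the
  representatives of \<open>rho\<close> and \<open>rho * u\<close> at every single time.
\<close>

definition weak_solution ::
  "real \<Rightarrow> real \<Rightarrow> (real \<Rightarrow> real) \<Rightarrow> (real^2 \<Rightarrow> real) \<Rightarrow> (spacetime \<Rightarrow> real^3) \<Rightarrow>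
   (real^3 \<Rightarrow> real) \<Rightarrow> (real^3 \<Rightarrow> real^3) \<Rightarrow>
   (spacetime \<Rightarrow> real) \<Rightarrow> (spacetime \<Rightarrow> real^3) \<Rightarrow> (spacetime \<Rightarrow> real^3^3) \<Rightarrow> bool" where
  "weak_solution mu lam P K f rho0 u0 rho u Du \<longleftrightarrow>
     rho \<in> borel_measurable borel \<and> u \<in> borel_measurable borel \<and> Du \<in> borel_measurable borel \<and>
     (\<forall>t>0. has_weak_grad half (\<lambda>x. u (x, t)) (\<lambda>x. Du (x, t))) \<and>
     loc_integrable cylinder rho \<and>
     loc_integrable cylinder (\<lambda>z. rho z *\<^sub>R u z) \<and>
     loc_integrable cylinder (\<lambda>z. rho z * (norm (u z))\<^sup>2) \<and>
     loc_integrable cylinder (\<lambda>z. P (rho z)) \<and>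
     loc_integrable cylinder Du \<and>
     loc_integrable cylinder (\<lambda>z. rho z *\<^sub>R f z) \<and>
     loc_integrable (UNIV \<times> {0<..}) (\<lambda>(y, t). u (bdpt y, t)) \<and>
     (\<forall>t\<ge>0. loc_integrable half (\<lambda>x. rho (x, t)) \<and>
             loc_integrable half (\<lambda>x. rho (x, t) *\<^sub>R u (x, t))) \<and>
     (AE x in lebesgue. x \<in> half \<longrightarrow> rho (x, 0) = rho0 x \<and> u (x, 0) = u0 x) \<and>
     (\<forall>y. \<forall>t>0. u (bdpt y, t) $ 3 = 0) \<and>
     (\<forall>\<phi>::spacetime \<Rightarrow> real. test_fun UNIV \<phi> \<longrightarrow> (\<forall>t1 t2. 0 \<le> t1 \<and> t1 < t2 \<longrightarrow>
        (LINT x:half|lebesgue. rho (x, t2) * \<phi> (x, t2))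
        - (LINT x:half|lebesgue. rho (x, t1) * \<phi> (x, t1))
        = (LINT z:half \<times> {t1<..<t2}|lebesgue.
             rho z * pd \<phi> et z + rho z * (\<Sum>k\<in>UNIV. u z $ k * pd \<phi> (ex k) z)))) \<and>
     (\<forall>\<phi>::spacetime \<Rightarrow> real^3. test_fun UNIV \<phi> \<and> (\<forall>y t. \<phi> (bdpt y, t) $ 3 = 0) \<longrightarrow>
        (\<forall>t1 t2. 0 \<le> t1 \<and> t1 < t2 \<longrightarrow>
        (LINT x:half|lebesgue. rho (x, t2) * (u (x, t2) \<bullet> \<phi> (x, t2)))
        - (LINT x:half|lebesgue. rho (x, t1) * (u (x, t1) \<bullet> \<phi> (x, t1)))
        = (LINT z:half \<times> {t1<..<t2}|lebesgue.
             rho z * (u z \<bullet> pd \<phi> et z)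
             + rho z * (\<Sum>k\<in>UNIV. u z $ k * (u z \<bullet> pd \<phi> (ex k) z))
             + P (rho z) * (\<Sum>k\<in>UNIV. pd \<phi> (ex k) z $ k)
             - mu * (\<Sum>k\<in>UNIV. Du z $ k \<bullet> pd \<phi> (ex k) z)
             - lam * (\<Sum>k\<in>UNIV. Du z $ k $ k) * (\<Sum>k\<in>UNIV. pd \<phi> (ex k) z $ k)
             + rho z * (f z \<bullet> \<phi> z))
          - mu * (LINT (y, t):UNIV \<times> {t1<..<t2}|lebesgue.
             inverse (K y) * (u (bdpt y, t) \<bullet> \<phi> (bdpt y, t)))))"

definition limit_of_smooth_solutions ::
  "real \<Rightarrow> real \<Rightarrow> real \<Rightarrow> (real \<Rightarrow> real) \<Rightarrow> (real^2 \<Rightarrow> real) \<Rightarrow> (spacetime \<Rightarrow> real^3) \<Rightarrow>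
   (real^3 \<Rightarrow> real) \<Rightarrow> (real^3 \<Rightarrow> real^3) \<Rightarrow>
   (spacetime \<Rightarrow> real) \<Rightarrow> (spacetime \<Rightarrow> real^3) \<Rightarrow> bool" where
  "limit_of_smooth_solutions mu lam rho_b P K f rho0 u0 rho u \<longleftrightarrow>
     (\<exists>(Ps :: nat \<Rightarrow> real \<Rightarrow> real) (Ks :: nat \<Rightarrow> real^2 \<Rightarrow> real) (fs :: nat \<Rightarrow> spacetime \<Rightarrow> real^3)
        (rho0s :: nat \<Rightarrow> real^3 \<Rightarrow> real) (u0s :: nat \<Rightarrow> real^3 \<Rightarrow> real^3)
        (rhos :: nat \<Rightarrow> spacetime \<Rightarrow> real) (us :: nat \<Rightarrow> spacetime \<Rightarrow> real^3).
        (\<forall>n. smooth (Ps n) \<and> smooth (Ks n) \<and> (\<forall>y. 0 < Ks n y) \<and> smooth (fs n) \<and>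
             smooth (rho0s n) \<and> smooth (u0s n) \<and>
             smooth_solution mu lam (Ps n) (Ks n) (fs n) (rho0s n) (u0s n) (rhos n) (us n) \<and>
             (\<forall>z \<in> closure half \<times> {0..}. 0 \<le> rhos n z \<and> rhos n z \<le> rho_b)) \<and>
        uniform_limit {0..rho_b} Ps P sequentially \<and>
        (\<forall>C. compact C \<longrightarrow> uniform_limit C Ks K sequentially) \<and>
        L1loc_limit cylinder fs f \<and>
        L1loc_limit half rho0s rho0 \<and>
        L1loc_limit half (\<lambda>n x. rho0s n x *\<^sub>R u0s n x) (\<lambda>x. rho0 x *\<^sub>R u0 x) \<and>
        L1loc_limit cylinder rhos rho \<and>
        (\<forall>C. compact C \<and> C \<subseteq> closure half \<times> {0<..} \<longrightarrow> uniform_limit C us u sequentially))"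

text \<open>Both quantities are functions of a gradient matrix \<open>A\<close> with \<open>A $ k $ j\<close> the \<open>k\<close>-th derivative of
  the \<open>j\<close>-th velocity component.\<close>

definition eff_flux :: "real \<Rightarrow> real \<Rightarrow> (real \<Rightarrow> real) \<Rightarrow> real \<Rightarrow> real^3^3 \<Rightarrow> real \<Rightarrow> real" where
  "eff_flux mu lam P rho_t A r = (lam + mu) * (\<Sum>k\<in>UNIV. A $ k $ k) - P r + P rho_t"

definition vorticity :: "real^3^3 \<Rightarrow> real^3^3" where
  "vorticity A = (\<chi> j k. A $ k $ j - A $ j $ k)"

text \<open>
  The energy estimate, with right-hand side \<open>B\<close>; \<open>ut\<close> is the weak time derivative of \<open>u\<close>, \<open>udot\<close> the
  convective derivative and \<open>Dudot\<close> its spatial weak gradient. The term in \<open>udot\<close> itself is only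
  included when the initial density is bounded away from zero.
\<close>

definition energy_estimate ::
  "real \<Rightarrow> (real^3 \<Rightarrow> real) \<Rightarrow> (spacetime \<Rightarrow> real) \<Rightarrow> (spacetime \<Rightarrow> real^3) \<Rightarrow>
   (spacetime \<Rightarrow> real^3^3) \<Rightarrow> real \<Rightarrow> bool" where
  "energy_estimate rho_t rho0 rho u Du B \<longleftrightarrow>
     (\<exists>ut udot Dudot.
        has_weak_deriv cylinder et u ut \<and>
        udot = (\<lambda>z. ut z + (\<Sum>k\<in>UNIV. u z $ k *\<^sub>R Du z $ k)) \<and>
        (\<forall>k. has_weak_deriv cylinder (ex k) udot (\<lambda>z. Dudot z $ k)) \<and>
        (SUP t\<in>{0<..}. \<integral>\<^sup>+x\<in>half. ennreal (rho (x, t) * (norm (u (x, t)))\<^sup>2 / 2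
            + \<bar>rho (x, t) - rho_t\<bar>\<^sup>2 + sigma t * (norm (Du (x, t)))\<^sup>2) \<partial>lebesgue)
        + (\<integral>\<^sup>+z\<in>cylinder. ennreal ((norm (Du z))\<^sup>2
            + sigma (snd z) ^ 3 * (norm (Dudot z :: real^3^3))\<^sup>2) \<partial>lebesgue)
        + (if ess_inf rho0 > 0
           then \<integral>\<^sup>+z\<in>cylinder. ennreal (sigma (snd z) * (norm (udot z))\<^sup>2) \<partial>lebesgue else 0)
        \<le> ennreal B)"

text \<open>
  The argument \<open>B\<close> is the right-hand side of Hoff's energy estimate, to be instantiated by
  \<open>Cbar * (C0 + Cf) powr \<theta>\<close> with constants fixed before the data. The quantities
  \<open>F\<close> and \<open>\<omega>\<close> are built from the weak gradient, hence determined at each time up to null sets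
  only, and their Hoelder continuity is that of a representative.
\<close>

definition Hoff_solution ::
  "real \<Rightarrow> real \<Rightarrow> real \<Rightarrow> real \<Rightarrow> (real \<Rightarrow> real) \<Rightarrow> (real^2 \<Rightarrow> real) \<Rightarrow> (spacetime \<Rightarrow> real^3) \<Rightarrow>
   (real^3 \<Rightarrow> real) \<Rightarrow> (real^3 \<Rightarrow> real^3) \<Rightarrow> real \<Rightarrow>
   (spacetime \<Rightarrow> real) \<Rightarrow> (spacetime \<Rightarrow> real^3) \<Rightarrow> (spacetime \<Rightarrow> real^3^3) \<Rightarrow> bool" where
  "Hoff_solution mu lam rho_t rho_b P K f rho0 u0 B rho u Du \<longleftrightarrow>
     weak_solution mu lam P K f rho0 u0 rho u Du \<and>
     limit_of_smooth_solutions mu lam rho_b P K f rho0 u0 rho u \<and>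
     (\<exists>F \<omega>.
        (\<forall>t>0. AE x in lebesgue. x \<in> half \<longrightarrow>
           F (x, t) = eff_flux mu lam P rho_t (Du (x, t)) (rho (x, t)) \<and>
           \<omega> (x, t) = vorticity (Du (x, t))) \<and>
        (\<forall>\<tau>>0. Hoelder_on (closure half \<times> {\<tau>..}) u \<and>
                Hoelder_on (closure half \<times> {\<tau>..}) F \<and>
                Hoelder_on (closure half \<times> {\<tau>..}) \<omega>)) \<and>
     (\<exists>c>0. \<forall>t>0. AE x in lebesgue. x \<in> half \<longrightarrow>
        inverse c * ess_inf rho0 \<le> rho (x, t) \<and> rho (x, t) \<le> rho_b) \<and>
     energy_estimate rho_t rho0 rho u Du B"

end

theory Submission
  imports Defs
begin

text \<open>
 The decomposition is made separately at each time; the boundary condition enters through the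
 vanishing of the normal velocity.
 Divergence and curl of \<open>u\<close> are \<open>(F + (P - P(\<rho>\<^sub>t))) / (\<lambda> + \<mu>)\<close> and \<open>\<omega>\<close>. Let \<open>u\<^sub>P\<close> be the gradient of the
 Newtonian potential of the even reflection of the pressure part of the divergence; its normal
 component is odd, so \<open>u\<^sub>F = u - u\<^sub>P\<close> still has vanishing normal component, and it has divergence
 \<open>F / (\<lambda> + \<mu>)\<close> and curl \<open>\<omega>\<close>. Reflected evenly in the tangential and oddly in the normal component,
 \<open>u\<^sub>F\<close> lives on the whole space, where \<open>\<Delta>w = \<nabla>div w + div curl w\<close> expresses its gradient by second order
 Riesz transforms of the reflected \<open>F\<close> and \<open>\<omega>\<close>. Tangential derivatives commute with this
 representation; the purely normal second derivatives are recovered algebraically from those of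
 divergence and curl.

 For the Calderon--Zygmund bound let \<open>A\<close> average \<open>(2 f(x) + f(x + e\<^sub>i) + f(x - e\<^sub>i)) / 4\<close> over \<open>i\<close>. A function
 \<open>B\<close> of two variables, of \<open>p\<close>-growth in one and dual growth in the other and such that \<open>B(x, y) \<plusminus> xy\<close>
 are convex, loses under each application of \<open>A\<close> to a pair \<open>(f, g)\<close> a multiple of the product of the
 differences of \<open>f\<close> and \<open>g\<close>. Summing over the iterates of \<open>A\<close> bounds pure second differences by the
 discrete Laplacian, and the step size is sent to \<open>0\<close>.
\<close>

text \<open>No weak type bound and no interpolation is used: convexity gives each exponent directly,
  with a constant that does not see the directions or their number. The price is that the method
  compares a pure second derivative with the sum of all pure ones in the family. Mixed derivatives
  are therefore reached by polarization, from a family of directions whose total sum is still a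
  multiple of the Laplacian. At a fixed time only the energy is available: the velocity gradient and
  the pressure difference are square integrable, and the latter is bounded. The splitting is hence
  built once, in exponent 2, and the bounds for other exponents are carried over to these same
  functions through a.e. convergent subsequences; so one pair of fields serves all exponents. For
  second derivatives the obstacle is that oddly reflected curl entries jump across the plane. Such a
  jump is invisible to tangential derivatives only, which is why the normal ones need a separate
  argument.\<close>

abbreviation (input) borel_fun :: "('a::topological_space \<Rightarrow> 'b::topological_space) \<Rightarrow> bool" where
 "borel_fun f \<equiv> f \<in> borel_measurable borel"

section \<open>A Bellman function and the Calderon--Zygmund inequality\<close>

lemma has_derivative_powr_line:
 fixes x0 a s t :: real
 assumes "x0 + t * a > 0"
 shows "((\<lambda>t. (x0 + t * a) powr s) has_real_derivative s * a * (x0 + t * a) powr (s - 1)) (at t)"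
proof -
 have "((\<lambda>t. x0 + t * a) has_real_derivative a) (at t)" by (auto intro!: derivative_eq_intros)
 from DERIV_fun_powr[OF this assms, of s] show ?thesis by (simp add: mult_ac)
qed

text \<open>A smooth relative of the Nazarov-Treil function. For \<open>p > 2\<close> the term
  \<open>x powr p\<close> has a degenerate second \<open>x\<close>-derivative near
  \<open>x = 0\<close>; the quotient supplies convexity in \<open>x\<close> of order
  \<open>y powr (2 - q)\<close> where \<open>x\<close> is below \<open>y powr (q - 1)\<close>, and
  \<open>M * y powr q\<close> pays for its mixed and negative contributions.\<close>

definition bellman :: "real => real => real => real => real => real" where
 "bellman p q M x y = x powr p + M * y powr q + y powr q / (1 + x * y powr (1 - q))"

text \<open>This is the second derivative of \<open>bellman\<close> in direction
  \<open>(a, b)\<close>; \<open>r1\<close> and \<open>r2\<close> are the first two derivatives of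
  \<open>r\<close> along the line. The weights \<open>Z\<close> of \<open>a\<^sup>2\<close> and
  \<open>Y\<close> of \<open>b\<^sup>2\<close> are reciprocal, so their sum dominates
  \<open>\<bar>a * b\<bar>\<close>. The mixed terms have bounded coefficients because
  \<open>g * r\<close> is at most 1.\<close>

lemma bellman_hessian_bound:
 fixes p q x y a b :: real
 defines "E \<equiv> y powr (1 - q)" and "r \<equiv> x * y powr (1 - q)"
 assumes p: "2 < p" and q: "q = p / (p - 1)" and M: "M = 146 / (q * (q - 1))" and xy: "0 < x" "0 < y"
 defines "r1 \<equiv> a * E + (1 - q) * x * b * y powr (- q)"
  and "r2 \<equiv> 2 * (1 - q) * a * b * y powr (- q) + (1 - q) * (- q) * x * b\<^sup>2 * y powr (- q - 1)"
  and "g \<equiv> inverse (1 + r)"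
 shows "p * (p - 1) * a\<^sup>2 * x powr (p - 2) + M * q * (q - 1) * b\<^sup>2 * y powr (q - 2)
   + (q * (q - 1) * b\<^sup>2 * y powr (q - 2) * g + 2 * (q * b * y powr (q - 1)) * (- (g\<^sup>2 * r1))
    + y powr q * (2 * g^3 * r1\<^sup>2 - g\<^sup>2 * r2)) \<ge> 2 * \<bar>a * b\<bar>"
proof -
 have q12: "1 < q" "q < 2" using p unfolding q by (simp_all add: divide_simps)
 have qq0: "q * (q - 1) > 0" using q12 by simp
 define Y where "Y = y powr (q - 2)"
 define Z where "Z = y powr (2 - q)"
 have YZ: "Y * Z = 1" unfolding Y_def Z_def using xy by (simp add: powr_add[symmetric])
 have YZpos: "Y > 0" "Z > 0" unfolding Y_def Z_def using xy by auto
 have r0: "r > 0" unfolding r_def using xy by simp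
 have g: "0 < g" "g < 1" using r0 unfolding g_def by (auto simp: field_simps)
 have gr: "g * r \<le> 1" using r0 unfolding g_def by (auto simp: field_simps)
 have gr2: "0 \<le> g\<^sup>2 * r" "g\<^sup>2 * r \<le> 1"
 proof -
  have "g * (g * r) \<le> 1 * 1" by (intro mult_mono) (use g gr r0 in auto)
  then show "g\<^sup>2 * r \<le> 1" by (simp add: power2_eq_square mult.assoc)
 qed (use r0 g in auto)
 have gr3: "0 \<le> g^3 * r" "g^3 * r \<le> 1"
 proof -
  have "g * (g\<^sup>2 * r) \<le> 1 * 1" by (intro mult_mono) (use g gr2 r0 in auto)
  then show "g^3 * r \<le> 1" by (simp add: power2_eq_square power3_eq_cube mult.assoc)
 qed (use r0 g in auto)
 have e1: "y powr (q - 1) * E = 1" unfolding E_def using xy by (simp add: powr_add[symmetric])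
 have e2: "y powr (q - 1) * x * y powr (- q) = r * Y"
  unfolding r_def Y_def using xy by (simp add: powr_add[symmetric] mult_ac)
 have e3: "y powr q * E\<^sup>2 = Z" unfolding E_def Z_def power2_eq_square using xy by (simp add: powr_add[symmetric])
 have e4: "y powr q * E * x * y powr (- q) = r" unfolding E_def r_def using xy by (simp add: powr_minus)
 have e5: "y powr q * (x * y powr (- q))\<^sup>2 = r\<^sup>2 * Y" unfolding r_def Y_def power2_eq_square
  using xy by (simp add: powr_add[symmetric] mult_ac)
 have e6: "y powr q * y powr (- q) = 1" using xy by (simp add: powr_minus)
 have e7: "y powr q * x * y powr (- q - 1) = r * Y" unfolding r_def Y_def
  using xy by (simp add: powr_add[symmetric] mult_ac)
 have "2 * (q * b * y powr (q - 1)) * (- (g\<^sup>2 * r1))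
   = - 2 * q * g\<^sup>2 * (a * b * (y powr (q - 1) * E) + (1 - q) * b\<^sup>2 * (y powr (q - 1) * x * y powr (- q)))"
  unfolding r1_def by (simp add: algebra_simps power2_eq_square)
 also have "\<dots> = - 2 * q * g\<^sup>2 * (a * b) + 2 * q * (q - 1) * (g\<^sup>2 * r) * b\<^sup>2 * Y"
  unfolding e1 e2 by (simp add: algebra_simps)
 finally have t1: "2 * (q * b * y powr (q - 1)) * (- (g\<^sup>2 * r1)) =
   - 2 * q * g\<^sup>2 * (a * b) + 2 * q * (q - 1) * (g\<^sup>2 * r) * b\<^sup>2 * Y" .
 have "y powr q * r1\<^sup>2 = a\<^sup>2 * (y powr q * E\<^sup>2) + 2 * (1 - q) * a * b * (y powr q * E * x * y powr (- q))
   + (1 - q)\<^sup>2 * b\<^sup>2 * (y powr q * (x * y powr (- q))\<^sup>2)"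
  unfolding r1_def by (simp add: algebra_simps power2_eq_square)
 then have t2: "y powr q * r1\<^sup>2 = a\<^sup>2 * Z + 2 * (1 - q) * a * b * r + (1 - q)\<^sup>2 * b\<^sup>2 * (r\<^sup>2 * Y)"
  unfolding e3 e4 e5 .
 have "y powr q * r2 = 2 * (1 - q) * a * b * (y powr q * y powr (- q))
   + (1 - q) * (- q) * b\<^sup>2 * (y powr q * x * y powr (- q - 1))"
  unfolding r2_def by (simp add: algebra_simps)
 then have t3: "y powr q * r2 = 2 * (1 - q) * a * b - q * (1 - q) * b\<^sup>2 * (r * Y)"
  unfolding e6 e7 by simp
 have ab: "- (c * \<bar>a * b\<bar>) \<le> c * d * (a * b)" if "0 \<le> c" "\<bar>d\<bar> \<le> 1" for c d :: real
 proof -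
  have "\<bar>c * d * (a * b)\<bar> = c * (\<bar>d\<bar> * \<bar>a * b\<bar>)" using that by (simp add: abs_mult)
  also have "\<dots> \<le> c * (1 * \<bar>a * b\<bar>)" by (intro mult_left_mono mult_right_mono) (use that in auto)
  finally show ?thesis by linarith
 qed
 have "y powr q * (2 * g^3 * r1\<^sup>2 - g\<^sup>2 * r2) = 2 * g^3 * (y powr q * r1\<^sup>2) - g\<^sup>2 * (y powr q * r2)"
  by (simp add: algebra_simps)
 also have "\<dots> = 2 * g^3 * a\<^sup>2 * Z + 4 * (q - 1) * (- (g^3 * r)) * (a * b) + 2 * g^3 * ((1 - q)\<^sup>2 * b\<^sup>2 * (r\<^sup>2 * Y))
   + 2 * (q - 1) * g\<^sup>2 * (a * b) - q * (q - 1) * (g\<^sup>2 * r) * b\<^sup>2 * Y"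
  unfolding t2 t3 by (simp add: algebra_simps)
 finally have t4: "y powr q * (2 * g^3 * r1\<^sup>2 - g\<^sup>2 * r2) =
   2 * g^3 * a\<^sup>2 * Z + 4 * (q - 1) * (- (g^3 * r)) * (a * b) + 2 * g^3 * ((1 - q)\<^sup>2 * b\<^sup>2 * (r\<^sup>2 * Y))
   + 2 * (q - 1) * g\<^sup>2 * (a * b) - q * (q - 1) * (g\<^sup>2 * r) * b\<^sup>2 * Y" .
 have g2: "\<bar>g\<^sup>2\<bar> \<le> 1" using g by (simp add: power_le_one)
 have s1: "- 2 * q * g\<^sup>2 * (a * b) \<ge> - (2 * q * \<bar>a * b\<bar>)"
  using ab[of "2 * q" "- g\<^sup>2"] g2 q12 by simp
 have s2: "4 * (q - 1) * (- (g^3 * r)) * (a * b) \<ge> - (4 * (q - 1) * \<bar>a * b\<bar>)"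
  using ab[of "4 * (q - 1)" "- (g^3 * r)"] gr3 q12 by simp
 have s3: "2 * (q - 1) * g\<^sup>2 * (a * b) \<ge> - (2 * (q - 1) * \<bar>a * b\<bar>)"
  using ab[of "2 * (q - 1)" "g\<^sup>2"] g2 q12 by simp
 have s4: "0 \<le> 2 * g^3 * ((1 - q)\<^sup>2 * b\<^sup>2 * (r\<^sup>2 * Y))" using g YZpos by auto
 have s5: "0 \<le> q * (q - 1) * b\<^sup>2 * Y * g" using g YZpos q12 by auto
 have s6: "0 \<le> 2 * q * (q - 1) * (g\<^sup>2 * r) * b\<^sup>2 * Y" using g YZpos q12 r0 by auto
 have s7: "q * (q - 1) * (g\<^sup>2 * r) * b\<^sup>2 * Y \<le> q * (q - 1) * b\<^sup>2 * Y"
  using mult_left_mono[OF gr2(2), of "q * (q - 1) * b\<^sup>2 * Y"] YZpos q12 by (simp add: mult_ac)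
 have s8: "q * (q - 1) * b\<^sup>2 * Y \<le> 2 * (b\<^sup>2 * Y)"
 proof -
  have "q * (q - 1) \<le> 2 * 1" by (intro mult_mono) (use q12 in auto)
  from mult_right_mono[OF this, of "b\<^sup>2 * Y"] show ?thesis using YZpos by (simp add: mult_ac)
 qed
 \<comment> \<open>For \<open>r \<le> 1\<close> the convexity in \<open>a\<close> comes from the
   quotient, as \<open>g\<close> is at least 1/2. Otherwise \<open>x\<close> exceeds
   \<open>y powr (q - 1)\<close>, and \<open>x powr (p - 2)\<close> dominates \<open>Z\<close>
   because \<open>(q - 1) * (p - 2) = 2 - q\<close>.\<close>
 have s9: "p * (p - 1) * a\<^sup>2 * x powr (p - 2) + 2 * g^3 * a\<^sup>2 * Z \<ge> a\<^sup>2 * Z / 4"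
 proof (cases "r \<le> 1")
  case True
  then have "g \<ge> 1/2" unfolding g_def using r0 by (auto simp: field_simps)
  then have "g^3 \<ge> (1/2)^3" by (intro power_mono) auto
  then have "2 * g^3 \<ge> 1/4" by (simp add: power3_eq_cube)
  from mult_right_mono[OF this, of "a\<^sup>2 * Z"] YZpos
  have "2 * g^3 * a\<^sup>2 * Z \<ge> a\<^sup>2 * Z / 4" by (simp add: mult_ac)
  moreover have "p * (p - 1) * a\<^sup>2 * x powr (p - 2) \<ge> 0" using p by auto
  ultimately show ?thesis by linarith
 next
  case False
  then have "x * y powr (1 - q) \<ge> 1" unfolding r_def by simp
  then have "x * y powr (1 - q) * y powr (q - 1) \<ge> 1 * y powr (q - 1)" by (intro mult_right_mono) auto
  then have "x \<ge> y powr (q - 1)" using xy by (simp add: mult.assoc powr_add[symmetric])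
  then have "x powr (p - 2) \<ge> (y powr (q - 1)) powr (p - 2)" by (intro powr_mono2) (use p xy in auto)
  moreover have "(q - 1) * (p - 2) = 2 - q" using p q by (simp add: field_simps)
  ultimately have xz: "x powr (p - 2) \<ge> Z" unfolding Z_def by (simp add: powr_powr)
  have "p * (p - 1) \<ge> 2 * 1" by (intro mult_mono) (use p in auto)
  then have "p * (p - 1) * (a\<^sup>2 * x powr (p - 2)) \<ge> 1 * (a\<^sup>2 * x powr (p - 2))" by (intro mult_right_mono) auto
  moreover have "a\<^sup>2 * x powr (p - 2) \<ge> a\<^sup>2 * Z" using xz by (intro mult_left_mono) auto
  moreover have "a\<^sup>2 * Z \<ge> a\<^sup>2 * Z / 4" using YZpos by simp
  moreover have "2 * g^3 * a\<^sup>2 * Z \<ge> 0" using g YZpos by auto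
  ultimately show ?thesis unfolding mult.assoc by linarith
 qed
 \<comment> \<open>146 is 144 + 2: the 2 absorbs the negative term bounded in \<open>s7\<close> and
   \<open>s8\<close>, the 144 is spent in \<open>s11\<close>. There 12 is 10 for the mixed terms,
   counted in \<open>s12\<close>, plus the 2 of the claim.\<close>
 have s10: "M * q * (q - 1) * b\<^sup>2 * Y = 146 * (b\<^sup>2 * Y)" proof -
  have "M * (q * (q - 1)) = 146" using qq0 by (metis M less_irrefl nonzero_divide_eq_eq)
  then show ?thesis by (metis mult.assoc)
 qed
 have s11: "a\<^sup>2 * Z / 4 + 144 * (b\<^sup>2 * Y) \<ge> 12 * \<bar>a * b\<bar>"
 proof -
  define s where "s = sqrt Z"
  have s: "s > 0" "s\<^sup>2 = Z" using YZpos unfolding s_def by auto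
  have Y: "Y = 1 / s\<^sup>2" using YZ YZpos s by (simp add: nonzero_eq_divide_eq)
  have "0 \<le> (\<bar>a\<bar> * s / 2 - 12 * \<bar>b\<bar> / s)\<^sup>2" by simp
  also have "\<dots> = a\<^sup>2 * s\<^sup>2 / 4 - 12 * \<bar>a * b\<bar> + 144 * (b\<^sup>2 / s\<^sup>2)"
   using s(1) by (simp add: power2_diff power_mult_distrib power_divide abs_mult)
  finally show ?thesis unfolding Y using s by simp
 qed
 have s12: "2 * q * \<bar>a * b\<bar> + 4 * (q - 1) * \<bar>a * b\<bar> + 2 * (q - 1) * \<bar>a * b\<bar> \<le> 10 * \<bar>a * b\<bar>"
 proof -
  have "2 * q + 4 * (q - 1) + 2 * (q - 1) \<le> 10" using q12 by simp
  from mult_right_mono[OF this, of "\<bar>a * b\<bar>"] show ?thesis by (simp add: algebra_simps)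
 qed
 \<comment> \<open>What remains is linear once every nonlinear expression is replaced by a
   variable.\<close>
 have key: "2 * N \<le> T1 + T2 + (T3 + (m1 + T4) + (T5 + m2 + T6 + m3 - T7))"
  if "Q \<le> T1 + T5" "T2 = 146 * W" "0 \<le> T3" "- n1 \<le> m1" "0 \<le> T4" "- n2 \<le> m2" "0 \<le> T6" "- n3 \<le> m3"
   "T7 \<le> V" "V \<le> 2 * W" "12 * N \<le> Q + 144 * W" "n1 + n2 + n3 \<le> 10 * N"
  for N T1 T2 T3 T4 T5 T6 T7 m1 m2 m3 n1 n2 n3 V W Q :: real
  using that by linarith
 show ?thesis
  unfolding t1 t4 Y_def[symmetric] by (rule key[OF s9 s10 s5 s1 s6 s2 s4 s3 s7 s8 s11 s12])
qed

text \<open>The bilinear perturbation adds \<open>2 * z * (a * b)\<close> to the second derivative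
  along the line, which the Hessian bound absorbs as long as
  \<open>\<bar>z\<bar> \<le> 1\<close>.\<close>

lemma bellman_convex_line:
 fixes p q x0 y0 a b z :: real
 assumes p: "2 < p" and q: "q = p / (p - 1)" and M: "M = 146 / (q * (q - 1))"
  and z: "\<bar>z\<bar> \<le> 1"
 shows "convex_on {t. 0 < x0 + t * a \<and> 0 < y0 + t * b}
   (\<lambda>t. bellman p q M (x0 + t * a) (y0 + t * b) + z * ((x0 + t * a) * (y0 + t * b)))"
proof -
 let ?S = "{t. 0 < x0 + t * a \<and> 0 < y0 + t * b}"
 define x where "x = (\<lambda>t. x0 + t * a)"
 define y where "y = (\<lambda>t. y0 + t * b)"
 define E where "E = (\<lambda>t. y t powr (1 - q))"
 define r where "r = (\<lambda>t. x t * y t powr (1 - q))"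
 define r1 where "r1 = (\<lambda>t. a * E t + (1 - q) * x t * b * y t powr (- q))"
 define r2 where "r2 = (\<lambda>t. 2 * (1 - q) * a * b * y t powr (- q) + (1 - q) * (- q) * x t * b\<^sup>2 * y t powr (- q - 1))"
 define g where "g = (\<lambda>t. inverse (1 + r t))"
 have dx: "(x has_real_derivative a) (at t)" for t unfolding x_def by (auto intro!: derivative_eq_intros)
 have dy: "((\<lambda>t. y t powr s) has_real_derivative s * b * y t powr (s - 1)) (at t)" if "t \<in> ?S" for t s
  unfolding y_def by (rule has_derivative_powr_line) (use that in auto)
 have dxp: "((\<lambda>t. x t powr s) has_real_derivative s * a * x t powr (s - 1)) (at t)" if "t \<in> ?S" for t s
  unfolding x_def by (rule has_derivative_powr_line) (use that in auto)
 have dr: "(r has_real_derivative r1 t) (at t)" if "t \<in> ?S" for t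
  unfolding r_def r1_def E_def
  by (rule DERIV_mult[OF dx dy[OF that], THEN DERIV_cong]) (simp add: algebra_simps)
 have dr1: "(r1 has_real_derivative r2 t) (at t)" if "t \<in> ?S" for t
 proof -
  have "((\<lambda>t. a * y t powr (1 - q) + (1 - q) * b * (x t * y t powr (- q))) has_real_derivative
    a * ((1 - q) * b * y t powr (1 - q - 1)) + (1 - q) * b * (a * y t powr (- q) + (- q * b * y t powr (- q - 1)) * x t)) (at t)"
   by (intro DERIV_add DERIV_cmult DERIV_mult dx dy that)
  moreover have "(\<lambda>t. a * y t powr (1 - q) + (1 - q) * b * (x t * y t powr (- q))) = r1"
   by (simp add: fun_eq_iff r1_def E_def)
  moreover have "a * ((1 - q) * b * y t powr (1 - q - 1)) + (1 - q) * b * (a * y t powr (- q) + (- q * b * y t powr (- q - 1)) * x t) = r2 t"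
   by (simp add: r2_def algebra_simps power2_eq_square)
  ultimately show ?thesis by metis
 qed
 have rpos: "1 + r t > 0" if "t \<in> ?S" for t
  unfolding r_def x_def y_def using that by (intro add_pos_nonneg) auto
 have dg: "(g has_real_derivative - (g t)\<^sup>2 * r1 t) (at t)" if "t \<in> ?S" for t
 proof -
  have "((\<lambda>t. 1 + r t) has_real_derivative r1 t) (at t)" using dr[OF that] by (auto intro!: derivative_eq_intros)
  from DERIV_inverse_fun[OF this] rpos[OF that] show ?thesis unfolding g_def
   by (simp add: power2_eq_square mult_ac)
 qed
 define f where "f = (\<lambda>t. x t powr p + M * y t powr q + y t powr q * g t + z * (x t * y t))"
 define f1 where "f1 = (\<lambda>t. p * a * x t powr (p - 1) + M * (q * b * y t powr (q - 1))
   + (q * b * y t powr (q - 1) * g t + (- (g t)\<^sup>2 * r1 t) * y t powr q) + z * (a * y t + b * x t))"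
 define f2 where "f2 = (\<lambda>t. p * a * ((p - 1) * a * x t powr (p - 1 - 1)) + M * (q * b * ((q - 1) * b * y t powr (q - 1 - 1)))
   + ((q * b * ((q - 1) * b * y t powr (q - 1 - 1))) * g t + (- (g t)\<^sup>2 * r1 t) * (q * b * y t powr (q - 1))
   + ((- (2 * g t * (- (g t)\<^sup>2 * r1 t)) * r1 t - (g t)\<^sup>2 * r2 t) * y t powr q + (q * b * y t powr (q - 1)) * (- (g t)\<^sup>2 * r1 t)))
   + z * (a * b + b * a))"
 have dy1: "(y has_real_derivative b) (at t)" for t unfolding y_def by (auto intro!: derivative_eq_intros)
 have df: "(f has_real_derivative f1 t) (at t)" if "t \<in> ?S" for t
  unfolding f_def f1_def by (intro DERIV_add DERIV_cmult DERIV_mult dx dy dxp dg dy1 that)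
 have df1: "(f1 has_real_derivative f2 t) (at t)" if "t \<in> ?S" for t
 proof -
  have "((\<lambda>t. - (g t)\<^sup>2 * r1 t) has_real_derivative - (2 * g t * (- (g t)\<^sup>2 * r1 t)) * r1 t - (g t)\<^sup>2 * r2 t) (at t)"
   by (rule DERIV_mult[OF DERIV_minus[OF DERIV_power[OF dg[OF that], of 2]] dr1[OF that], THEN DERIV_cong])
    (simp add: algebra_simps)
  then show ?thesis
   unfolding f1_def f2_def by (intro DERIV_add DERIV_cmult DERIV_mult dx dy dxp dg dy1 that)
 qed
 have f2: "f2 t \<ge> 0" if t: "t \<in> ?S" for t
 proof -
  have pos: "0 < x t" "0 < y t" using that by (auto simp: x_def y_def)
  have "f2 t = p * (p - 1) * a\<^sup>2 * x t powr (p - 2) + M * q * (q - 1) * b\<^sup>2 * y t powr (q - 2)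
   + (q * (q - 1) * b\<^sup>2 * y t powr (q - 2) * g t + 2 * (q * b * y t powr (q - 1)) * (- ((g t)\<^sup>2 * r1 t))
    + y t powr q * (2 * (g t)^3 * (r1 t)\<^sup>2 - (g t)\<^sup>2 * r2 t)) + 2 * z * (a * b)"
   unfolding f2_def by (simp add: algebra_simps power2_eq_square power3_eq_cube)
  moreover have "\<bar>2 * z * (a * b)\<bar> \<le> 2 * \<bar>a * b\<bar>"
   using mult_right_mono[OF z, of "2 * \<bar>a * b\<bar>"] by (simp add: abs_mult)
  ultimately show ?thesis
   using bellman_hessian_bound[OF p q M pos, where a=a and b=b]
   unfolding g_def r1_def r2_def r_def E_def by linarith
 qed
 have cS: "convex ?S"
 proof (rule convexI)
  fix s t u v :: real
  assume st: "s \<in> ?S" "t \<in> ?S" and uv: "0 \<le> u" "0 \<le> v" "u + v = 1"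
  have pos: "0 < u * c + v * d" if "0 < c" "0 < d" for c d
   using uv that by (cases "u = 0") (auto intro: add_pos_nonneg)
  have "c + (u * s + v * t) * d = u * (c + s * d) + v * (c + t * d)" for c d
  proof -
   have "u * (c + s * d) + v * (c + t * d) = (u + v) * c + (u * s + v * t) * d" by (simp add: algebra_simps)
   then show ?thesis using uv by simp
  qed
  then show "u *\<^sub>R s + v *\<^sub>R t \<in> ?S" using st by (simp add: pos)
 qed
 have "convex_on ?S f" by (rule f''_ge0_imp_convex[OF cS df df1 f2])
 then show ?thesis
  unfolding f_def bellman_def x_def y_def g_def r_def by (simp add: divide_inverse)
qed

text \<open>Boundary points of the quadrant are approached diagonally from inside. At
  \<open>y = 0\<close> the convention \<open>0 powr s = 0\<close> gives the quotient the value 0,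
  and this is also its limit, since it is dominated by \<open>e powr q\<close>.\<close>

lemma bellman_tendsto_at_right:
 fixes p q M x y :: real
 assumes "0 < p" "1 < q" "0 \<le> x" "0 \<le> y"
 shows "((\<lambda>e. bellman p q M (x + e) (y + e)) \<longlongrightarrow> bellman p q M x y) (at_right 0)"
proof -
 have pw: "((\<lambda>e. (z + e) powr s) \<longlongrightarrow> z powr s) (at_right 0)" if "0 \<le> z" "0 < s" for z s :: real
 proof -
  have "((\<lambda>e. z + e) \<longlongrightarrow> z + 0) (at_right 0)" by (intro tendsto_intros)
  moreover have "\<forall>\<^sub>F e in at_right 0. 0 \<le> z + e"
   using that by (auto simp: eventually_at_right_field intro!: exI[of _ 1])
  ultimately show ?thesis using that by (intro tendsto_powr2) (auto intro!: tendsto_const)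
 qed
 have "((\<lambda>e. (y + e) powr q / (1 + (x + e) * (y + e) powr (1 - q))) \<longlongrightarrow> y powr q / (1 + x * y powr (1 - q))) (at_right 0)"
 proof (cases "y = 0")
  case False
  then have y: "y > 0" using assms by simp
  have "((\<lambda>e. (y + e) powr (1 - q)) \<longlongrightarrow> (y + 0) powr (1 - q)) (at_right 0)"
   using y by (intro tendsto_intros) auto
  moreover have "((\<lambda>e. x + e) \<longlongrightarrow> x + 0) (at_right 0)" by (intro tendsto_intros)
  moreover have "1 + x * y powr (1 - q) > 0" using y assms by (intro add_pos_nonneg) auto
  ultimately show ?thesis using pw[of y q] assms y by (intro tendsto_divide tendsto_add tendsto_mult tendsto_const) auto
 next
  case True
  have ev: "\<forall>\<^sub>F e in at_right (0::real). e > 0" by (simp add: eventually_at_right_less)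
  have "((\<lambda>e. e powr q / (1 + (x + e) * e powr (1 - q))) \<longlongrightarrow> 0) (at_right 0)"
  proof (rule tendsto_sandwich[OF _ _ tendsto_const])
   show "((\<lambda>e. (0 + e) powr q) \<longlongrightarrow> 0) (at_right 0)" using pw[of 0 q] assms by simp
   show "\<forall>\<^sub>F e in at_right 0. 0 \<le> e powr q / (1 + (x + e) * e powr (1 - q))"
    using ev by eventually_elim (use assms in auto)
   show "\<forall>\<^sub>F e in at_right 0. e powr q / (1 + (x + e) * e powr (1 - q)) \<le> (0 + e) powr q"
   proof (use ev in eventually_elim)
    case (elim e)
    have "0 \<le> (x + e) * e powr (1 - q)" using elim assms by simp
    then have "e powr q / (1 + (x + e) * e powr (1 - q)) \<le> e powr q / 1"
     by (intro divide_left_mono) auto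
    then show ?case by simp
   qed
  qed
  then show ?thesis using True by simp
 qed
 then show ?thesis unfolding bellman_def using assms
  by (intro tendsto_add tendsto_mult tendsto_const pw) auto
qed

lemma bellman_convex_quadrant:
 fixes p q M s x1 y1 x2 y2 t :: real
 assumes p: "2 < p" and q: "q = p / (p - 1)" and M: "M = 146 / (q * (q - 1))" and s: "\<bar>s\<bar> \<le> 1"
  and pos: "0 \<le> x1" "0 \<le> y1" "0 \<le> x2" "0 \<le> y2" and t: "0 \<le> t" "t \<le> 1"
 defines "f \<equiv> \<lambda>x y. bellman p q M x y + s * (x * y)"
 shows "f ((1 - t) * x1 + t * x2) ((1 - t) * y1 + t * y2) \<le> (1 - t) * f x1 y1 + t * f x2 y2"
proof -
 have q1: "1 < q" using p unfolding q by (simp add: divide_simps)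
 have interior: "f ((1 - t) * x1 + t * x2) ((1 - t) * y1 + t * y2) \<le> (1 - t) * f x1 y1 + t * f x2 y2"
  if "0 < x1" "0 < y1" "0 < x2" "0 < y2" for x1 y1 x2 y2
  using convex_onD[OF bellman_convex_line[OF p q M s, of x1 "x2 - x1" y1 "y2 - y1"], of t 0 1] that t
  unfolding f_def by (simp add: algebra_simps)
 have lim: "((\<lambda>e. f (x + e) (y + e)) \<longlongrightarrow> f x y) (at_right 0)" if "0 \<le> x" "0 \<le> y" for x y
 proof -
  have "((\<lambda>e. s * ((x + e) * (y + e))) \<longlongrightarrow> s * ((x + 0) * (y + 0))) (at_right 0)" by (intro tendsto_intros)
  then show ?thesis unfolding f_def using bellman_tendsto_at_right[of p q x y M] that p q1
   by (intro tendsto_add) auto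
 qed
 have "((\<lambda>e. f ((1 - t) * x1 + t * x2 + e) ((1 - t) * y1 + t * y2 + e)) \<longlongrightarrow> f ((1 - t) * x1 + t * x2) ((1 - t) * y1 + t * y2)) (at_right 0)"
  by (intro lim) (use pos t in auto)
 moreover have "((\<lambda>e. (1 - t) * f (x1 + e) (y1 + e) + t * f (x2 + e) (y2 + e)) \<longlongrightarrow> (1 - t) * f x1 y1 + t * f x2 y2) (at_right 0)"
  by (intro tendsto_intros lim pos)
 moreover have "\<forall>\<^sub>F e in at_right 0. f ((1 - t) * x1 + t * x2 + e) ((1 - t) * y1 + t * y2 + e)
   \<le> (1 - t) * f (x1 + e) (y1 + e) + t * f (x2 + e) (y2 + e)"
 proof (use eventually_at_right_less[of 0] in eventually_elim)
  case (elim e)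
  then show ?case using interior[of "x1 + e" "y1 + e" "x2 + e" "y2 + e"] pos
   by (simp add: algebra_simps)
 qed
 ultimately show ?thesis by (intro tendsto_le) auto
qed

definition bellman_function :: "real => real => real => (real => real => real) => bool" where
 "bellman_function p q C B \<longleftrightarrow>
   borel_fun (\<lambda>z. B (fst z) (snd z)) \<and>
   (\<forall>x\<ge>0. \<forall>y\<ge>0. 0 \<le> B x y \<and> B x y \<le> C * (x powr p + y powr q)) \<and>
   (\<forall>s\<in>{-1, 1}. \<forall>x1\<ge>0. \<forall>y1\<ge>0. \<forall>x2\<ge>0. \<forall>y2\<ge>0. \<forall>t\<in>{0..1}.
    B ((1 - t) * x1 + t * x2) ((1 - t) * y1 + t * y2)
     + s * (((1 - t) * x1 + t * x2) * ((1 - t) * y1 + t * y2))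
    \<le> (1 - t) * (B x1 y1 + s * (x1 * y1)) + t * (B x2 y2 + s * (x2 * y2)))"

lemma bellman_function_swap:
 assumes "bellman_function p q C B"
 shows "bellman_function q p C (\<lambda>x y. B y x)"
proof -
 have "borel_fun (\<lambda>z::real\<times>real. B (fst (snd z, fst z)) (snd (snd z, fst z)))"
  by (rule measurable_compose[of "\<lambda>z. (snd z, fst z)" borel borel "\<lambda>z. B (fst z) (snd z)"])
   (use assms in \<open>auto simp: bellman_function_def intro!: borel_measurable_continuous_onI continuous_intros\<close>)
 moreover have "B (((1 - t) * y1 + t * y2)) ((1 - t) * x1 + t * x2)
     + s * (((1 - t) * x1 + t * x2) * ((1 - t) * y1 + t * y2))
    \<le> (1 - t) * (B y1 x1 + s * (x1 * y1)) + t * (B y2 x2 + s * (x2 * y2))"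
  if "s \<in> {-1, 1}" "0 \<le> x1" "0 \<le> y1" "0 \<le> x2" "0 \<le> y2" "t \<in> {0..1}" for s x1 y1 x2 y2 t :: real
  using assms[unfolded bellman_function_def, THEN conjunct2, THEN conjunct2, rule_format, of s y1 x1 y2 x2 t] that
  by (simp only: mult.commute[of "(1 - t) * x1 + t * x2"] mult.commute[of x1 y1] mult.commute[of x2 y2])
 moreover have "0 \<le> B y x \<and> B y x \<le> C * (x powr q + y powr p)" if "0 \<le> x" "0 \<le> y" for x y
  using assms[unfolded bellman_function_def, THEN conjunct2, THEN conjunct1, rule_format, of y x] that
  by (simp add: add.commute)
 ultimately show ?thesis unfolding bellman_function_def by simp
qed

text \<open>The construction works for \<open>p > 2\<close>. Conjugate exponents lie on opposite
  sides of 2, so \<open>p < 2\<close> follows by exchanging the two variables; at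
  \<open>p = 2\<close> a quadratic form does.\<close>

lemma bellman_function_exists:
 fixes p q :: real
 assumes p: "1 < p" and q: "q = p / (p - 1)"
 shows "\<exists>C B. 0 < C \<and> bellman_function p q C B"
proof -
 have gt2: "\<exists>C B. 0 < C \<and> bellman_function p q C B" if p: "2 < p" and q: "q = p / (p - 1)" for p q :: real
 proof -
  define M where "M = 146 / (q * (q - 1))"
  have q1: "1 < q" using p unfolding q by (simp add: divide_simps)
  have M: "M > 0" unfolding M_def using q1 by simp
  have "borel_fun (\<lambda>z. bellman p q M (fst z) (snd z))"
   unfolding bellman_def borel_prod[symmetric] by measurable
  moreover have "0 \<le> bellman p q M x y \<and> bellman p q M x y \<le> (M + 1) * (x powr p + y powr q)"
   if "0 \<le> x" "0 \<le> y" for x y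
  proof -
   have "0 \<le> x * y powr (1 - q)" using that by simp
   then have "y powr q / (1 + x * y powr (1 - q)) \<le> y powr q / 1" by (intro divide_left_mono) auto
   moreover have "0 \<le> M * x powr p" using M by simp
   moreover have "0 \<le> M * x powr p" "0 \<le> M * y powr q" "0 \<le> x powr p" "0 \<le> y powr q"
    "0 \<le> y powr q / (1 + x * y powr (1 - q))" using M that by auto
   ultimately show ?thesis unfolding bellman_def by (simp add: ring_distribs)
  qed
  ultimately have "bellman_function p q (M + 1) (bellman p q M)"
   unfolding bellman_function_def
  proof (intro conjI ballI allI impI)
   fix s x1 y1 x2 y2 t :: real
   assume s: "s \<in> {-1, 1}" and *: "t \<in> {0..1}" "0 \<le> x1" "0 \<le> y1" "0 \<le> x2" "0 \<le> y2"
   have "\<bar>s\<bar> \<le> 1" using s by auto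
   from bellman_convex_quadrant[OF p q M_def this, of x1 y1 x2 y2 t] *
   show "bellman p q M ((1 - t) * x1 + t * x2) ((1 - t) * y1 + t * y2)
     + s * (((1 - t) * x1 + t * x2) * ((1 - t) * y1 + t * y2))
    \<le> (1 - t) * (bellman p q M x1 y1 + s * (x1 * y1)) + t * (bellman p q M x2 y2 + s * (x2 * y2))"
    by auto
  qed auto
  then show ?thesis using M by (intro exI[of _ "M + 1"] exI[of _ "bellman p q M"]) auto
 qed
 consider "2 < p" | "p = 2" | "p < 2" by linarith
 then show ?thesis
 proof cases
  case 1
  then show ?thesis using gt2 q by blast
 next
  case 2
  have q2: "q = 2" using 2 q by simp
  have "bellman_function p q 1 (\<lambda>x y. x\<^sup>2 + y\<^sup>2)"
   unfolding bellman_function_def borel_prod[symmetric]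
  proof (intro conjI ballI allI impI)
   fix s x1 y1 x2 y2 t :: real
   assume s: "s \<in> {-1, 1}" and t: "t \<in> {0..1}"
   define a b where "a = x1 - x2" and "b = y1 - y2"
   have "((1 - t) * x1 + t * x2)\<^sup>2 + ((1 - t) * y1 + t * y2)\<^sup>2
     + s * (((1 - t) * x1 + t * x2) * ((1 - t) * y1 + t * y2))
    = (1 - t) * (x1\<^sup>2 + y1\<^sup>2 + s * (x1 * y1)) + t * (x2\<^sup>2 + y2\<^sup>2 + s * (x2 * y2))
      - t * (1 - t) * (a\<^sup>2 + b\<^sup>2 + s * (a * b))"
    unfolding a_def b_def by (simp add: algebra_simps power2_eq_square)
   moreover have "a\<^sup>2 + b\<^sup>2 + s * (a * b) \<ge> 0"
   proof -
    have "a\<^sup>2 + b\<^sup>2 + s * (a * b) = (a + s * b)\<^sup>2 / 2 + (a\<^sup>2 + b\<^sup>2) / 2"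
     using s by (auto simp: power2_eq_square field_simps)
    then show ?thesis by simp
   qed
   then have "0 \<le> t * (1 - t) * (a\<^sup>2 + b\<^sup>2 + s * (a * b))" using t by auto
   ultimately show "((1 - t) * x1 + t * x2)\<^sup>2 + ((1 - t) * y1 + t * y2)\<^sup>2
     + s * (((1 - t) * x1 + t * x2) * ((1 - t) * y1 + t * y2))
    \<le> (1 - t) * (x1\<^sup>2 + y1\<^sup>2 + s * (x1 * y1)) + t * (x2\<^sup>2 + y2\<^sup>2 + s * (x2 * y2))" by linarith
  qed (auto simp: 2 q2)
  then show ?thesis by (intro exI[of _ 1]) auto
 next
  case 3
  have "2 < q" "p = q / (q - 1)" unfolding q using 3 p by (auto simp: field_simps)
  then show ?thesis using gt2 bellman_function_swap by blast
 qed
qed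

text \<open>The mean of the two products exceeds the product of the means by
  \<open>(x1 - x2) * (y1 - y2) / 4\<close>; the sign \<open>s\<close> is taken so that this
  difference becomes a gain.\<close>

lemma bellman_function_midpoint:
 assumes B: "bellman_function p q C B" and pos: "0 \<le> x1" "0 \<le> y1" "0 \<le> x2" "0 \<le> y2"
 shows "B ((x1 + x2) / 2) ((y1 + y2) / 2) \<le> (B x1 y1 + B x2 y2) / 2 - \<bar>x1 - x2\<bar> * \<bar>y1 - y2\<bar> / 4"
proof -
 have *: "B ((x1 + x2) / 2) ((y1 + y2) / 2) + s * ((x1 + x2) / 2 * ((y1 + y2) / 2))
   \<le> (B x1 y1 + s * (x1 * y1)) / 2 + (B x2 y2 + s * (x2 * y2)) / 2" if "s \<in> {-1, 1}" for s
  using B[unfolded bellman_function_def, THEN conjunct2, THEN conjunct2, rule_format, OF that pos, of "1/2"]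
  by (simp add: add_divide_distrib)
 have "\<bar>x1 - x2\<bar> * \<bar>y1 - y2\<bar> = \<bar>x1 * y1 + x2 * y2 - x1 * y2 - x2 * y1\<bar>"
  by (simp add: abs_mult[symmetric] algebra_simps)
 then show ?thesis using *[of 1] *[of "-1"] by (simp add: field_simps abs_if)
qed

lemma bellman_function_convex:
 assumes B: "bellman_function p q C B"
 shows "convex_on ({0..} \<times> {0..}) (\<lambda>z. B (fst z) (snd z))"
proof (rule convex_onI)
 show "convex ({0::real..} \<times> {0::real..})" by (intro convex_Times convex_real_interval)
 fix t :: real and z w :: "real \<times> real"
 assume t: "0 < t" "t < 1" and z: "z \<in> {0..} \<times> {0..}" "w \<in> {0..} \<times> {0..}"
 define X Y where "X = (1 - t) * fst z + t * fst w" and "Y = (1 - t) * snd z + t * snd w"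
 have "B X Y + s * (X * Y) \<le> (1 - t) * (B (fst z) (snd z) + s * (fst z * snd z)) + t * (B (fst w) (snd w) + s * (fst w * snd w))"
  if "s \<in> {-1, 1}" for s
  unfolding X_def Y_def
  by (rule B[unfolded bellman_function_def, THEN conjunct2, THEN conjunct2, rule_format, OF that]) (use t z in auto)
 from this[of 1] this[of "-1"]
 show "B (fst ((1 - t) *\<^sub>R z + t *\<^sub>R w)) (snd ((1 - t) *\<^sub>R z + t *\<^sub>R w))
   \<le> (1 - t) * B (fst z) (snd z) + t * B (fst w) (snd w)"
  unfolding X_def Y_def by (simp add: algebra_simps)
qed

section \<open>Bounded Borel functions of bounded support\<close>

definition bdd_cpt :: "('a::euclidean_space => real) => bool" where
 "bdd_cpt f \<longleftrightarrow> borel_fun f \<and> (\<exists>M. \<forall>x. \<bar>f x\<bar> \<le> M) \<and> (\<exists>R. \<forall>x. R < norm x --> f x = 0)"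

lemma bdd_cptI:
 assumes "borel_fun f" "\<And>x. \<bar>f x\<bar> \<le> M" "\<And>x. R < norm x ==> f x = 0"
 shows "bdd_cpt f"
 using assms unfolding bdd_cpt_def by blast

lemma bdd_cptE:
 assumes "bdd_cpt f"
 obtains M R where "borel_fun f" "\<And>x. \<bar>f x\<bar> \<le> M" "\<And>x. R < norm x ==> f x = 0" "0 \<le> M" "0 \<le> R"
proof -
 obtain M R where *: "borel_fun f" "\<forall>x. \<bar>f x\<bar> \<le> M" "\<forall>x. R < norm x --> f x = 0"
  using assms unfolding bdd_cpt_def by blast
 have "0 \<le> M" using *(2) by (meson abs_ge_zero order_trans)
 moreover have "f x = 0" if "\<bar>R\<bar> < norm x" for x using * that by auto
 ultimately show thesis using that[of M "\<bar>R\<bar>"] * by auto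
qed

lemma bdd_cpt_measurable [measurable_dest]: "bdd_cpt f ==> borel_fun f"
 unfolding bdd_cpt_def by blast

lemma bdd_cpt_integrable:
 assumes "bdd_cpt f" shows "integrable lborel f"
proof -
 obtain M R where *: "borel_fun f" "\<And>x. \<bar>f x\<bar> \<le> M" "\<And>x. R < norm x ==> f x = 0" "0 \<le> M" "0 \<le> R"
  using bdd_cptE[OF assms] by blast
 have "integrable lborel (\<lambda>x. M * indicator (cball 0 R) x :: real)"
  by (intro integrable_mult_right integrable_real_indicator emeasure_lborel_cball_finite) simp
 then show ?thesis
  by (rule Bochner_Integration.integrable_bound) (use * in \<open>auto simp: indicator_def\<close>)
qed

text \<open>The closure properties of the class reduce to composition with a locally bounded Borel
  function of two variables that vanishes at the origin. Inside this class every integral exists,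
  which keeps the discrete argument free of integrability questions.\<close>

lemma bdd_cpt_comp2:
 assumes F: "(\<lambda>z. F (fst z) (snd z)) \<in> borel_measurable (borel :: (real \<times> real) measure)"
  and bd: "\<And>M. \<exists>C. \<forall>a b. \<bar>a\<bar> \<le> M \<and> \<bar>b\<bar> \<le> M --> \<bar>F a b\<bar> \<le> C" and F0: "F 0 0 = 0"
  and f: "bdd_cpt f" and g: "bdd_cpt g"
 shows "bdd_cpt (\<lambda>x. F (f x) (g x))"
proof -
 obtain M R where f': "borel_fun f" "\<And>x. \<bar>f x\<bar> \<le> M" "\<And>x. R < norm x ==> f x = 0"
  using bdd_cptE[OF f] by metis
 obtain M' R' where g': "borel_fun g" "\<And>x. \<bar>g x\<bar> \<le> M'" "\<And>x. R' < norm x ==> g x = 0"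
  using bdd_cptE[OF g] by metis
 obtain C where C: "\<And>a b. \<bar>a\<bar> \<le> max M M' \<and> \<bar>b\<bar> \<le> max M M' ==> \<bar>F a b\<bar> \<le> C" using bd by metis
 have "(\<lambda>x. (f x, g x)) \<in> borel \<rightarrow>\<^sub>M borel" using f'(1) g'(1) by (rule borel_measurable_Pair)
 from measurable_compose[OF this F] have "borel_fun (\<lambda>x. F (f x) (g x))" by simp
 then show ?thesis
  by (rule bdd_cptI[where M=C and R="max R R'"])
   (use f' g' F0 in \<open>auto intro!: C simp: le_max_iff_disj\<close>)
qed

lemma bdd_cpt_add: "bdd_cpt f ==> bdd_cpt g ==> bdd_cpt (\<lambda>x. f x + g x)"
proof (rule bdd_cpt_comp2[where F="(+)"])
 show "\<exists>C. \<forall>a b. \<bar>a\<bar> \<le> M \<and> \<bar>b\<bar> \<le> M --> \<bar>a + b\<bar> \<le> C" for M :: real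
  by (rule exI[of _ "2 * M"]) auto
qed (auto simp: borel_prod[symmetric])

lemma bdd_cpt_mult: "bdd_cpt f ==> bdd_cpt g ==> bdd_cpt (\<lambda>x. f x * g x)"
proof (rule bdd_cpt_comp2[where F="(*)"])
 show "\<exists>C. \<forall>a b. \<bar>a\<bar> \<le> M \<and> \<bar>b\<bar> \<le> M --> \<bar>a * b\<bar> \<le> C" for M :: real
  by (rule exI[of _ "M * M"]) (auto simp: abs_mult intro!: mult_mono)
qed (auto simp: borel_prod[symmetric])

lemma bdd_cpt_cmult: "bdd_cpt f ==> bdd_cpt (\<lambda>x. c * f x)"
proof (rule bdd_cpt_comp2[where F="\<lambda>a b. c * a" and g=f])
 show "\<exists>C. \<forall>a b. \<bar>a\<bar> \<le> M \<and> \<bar>b\<bar> \<le> M --> \<bar>c * a\<bar> \<le> C" for M :: real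
  by (rule exI[of _ "\<bar>c\<bar> * M"]) (auto simp: abs_mult intro!: mult_mono)
qed (auto simp: borel_prod[symmetric])

lemma bdd_cpt_divide: "bdd_cpt f ==> bdd_cpt (\<lambda>x. f x / c)"
 using bdd_cpt_cmult[of f "1/c"] by simp

lemma bdd_cpt_diff: "bdd_cpt f ==> bdd_cpt g ==> bdd_cpt (\<lambda>x. f x - g x)"
 using bdd_cpt_add[of f "\<lambda>x. -1 * g x"] bdd_cpt_cmult[of g "-1"] by simp

lemma bdd_cpt_zero: "bdd_cpt (\<lambda>x. 0)"
 unfolding bdd_cpt_def by auto

lemma bdd_cpt_sum: "(\<And>i. i \<in> I ==> bdd_cpt (f i)) ==> bdd_cpt (\<lambda>x. \<Sum>i\<in>I. f i x)"
 by (induction I rule: infinite_finite_induct) (auto intro: bdd_cpt_zero bdd_cpt_add)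

lemma bdd_cpt_abs: "bdd_cpt f ==> bdd_cpt (\<lambda>x. \<bar>f x\<bar>)"
 unfolding bdd_cpt_def by auto

lemma bdd_cpt_shift: assumes "bdd_cpt f" shows "bdd_cpt (\<lambda>x. f (x + v))"
proof -
 obtain M R where *: "borel_fun f" "\<And>x. \<bar>f x\<bar> \<le> M" "\<And>x. R < norm x ==> f x = 0"
  using bdd_cptE[OF assms] by metis
 show ?thesis
 proof (rule bdd_cptI)
  show "borel_fun (\<lambda>x. f (x + v))" using *(1) by measurable
  show "f (x + v) = 0" if "R + norm v < norm x" for x
   using norm_diff_ineq[of x v] that by (intro *) auto
 qed (rule *(2))
qed

lemma bdd_cpt_shift_minus: "bdd_cpt f ==> bdd_cpt (\<lambda>x. f (x - v))"
 using bdd_cpt_shift[of f "-v"] by simp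

lemma bdd_cpt_max0: "bdd_cpt f ==> bdd_cpt (\<lambda>x. max 0 (f x))"
proof (rule bdd_cpt_comp2[where F="\<lambda>a b. max 0 a" and g=f])
 show "\<exists>C. \<forall>a b. \<bar>a\<bar> \<le> M \<and> \<bar>b\<bar> \<le> M --> \<bar>max 0 a\<bar> \<le> C" for M :: real
  by (rule exI[of _ M]) auto
qed (auto simp: borel_prod[symmetric])

lemma bdd_cpt_powr: "bdd_cpt f ==> 0 < p ==> bdd_cpt (\<lambda>x. \<bar>f x\<bar> powr p)"
proof (rule bdd_cpt_comp2[where F="\<lambda>a b. \<bar>a\<bar> powr p" and g=f])
 show "\<exists>C. \<forall>a b. \<bar>a\<bar> \<le> M \<and> \<bar>b\<bar> \<le> M --> \<bar>\<bar>a\<bar> powr p\<bar> \<le> C" if "0 < p" for M :: real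
  by (rule exI[of _ "M powr p"]) (use that in \<open>auto intro!: powr_mono2\<close>)
qed (auto simp: borel_prod[symmetric])

lemmas bdd_cpt_intros = bdd_cpt_cmult bdd_cpt_divide bdd_cpt_add bdd_cpt_diff bdd_cpt_sum
 bdd_cpt_mult bdd_cpt_abs bdd_cpt_max0 bdd_cpt_powr
lemmas bdd_cpt_shifts = bdd_cpt_shift bdd_cpt_shift_minus

lemma lborel_integral_shift:
 fixes f :: "'a::euclidean_space => 'b::{banach, second_countable_topology}"
 assumes [measurable]: "borel_fun f"
 shows "(LBINT x. f (x + v)) = (LBINT x. f x)"
proof -
 have "(LBINT x. f x) = (\<integral>x. f x \<partial>(distr lborel borel ((+) v)))"
  by (simp add: lborel_distr_plus)
 also have "\<dots> = (LBINT x. f (v + x))" by (rule integral_distr) auto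
 finally show ?thesis by (simp add: add.commute)
qed

section \<open>Differences, averages and the discrete Laplacian\<close>

definition dif :: "'a::ab_group_add => ('a => real) => 'a => real" where
 "dif v f x = f (x + v) - f x"

text \<open>The weight 2 at the centre makes this a mean of midpoints, of \<open>f x\<close> with
  \<open>f (x + e i)\<close> and of \<open>f x\<close> with \<open>f (x - e i)\<close>; the midpoint
  inequality of the Bellman function applies to exactly this form.\<close>

definition avg :: "'i set => ('i => 'a::ab_group_add) => ('a => real) => 'a => real" where
 "avg I e f x = (\<Sum>i\<in>I. (2 * f x + f (x + e i) + f (x - e i)) / 4) / card I"

definition lap :: "'i set => ('i => 'a::ab_group_add) => ('a => real) => 'a => real" where
 "lap I e f x = (\<Sum>i\<in>I. f (x + e i) - 2 * f x + f (x - e i))"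

lemma bdd_cpt_dif: "bdd_cpt f ==> bdd_cpt (dif v f)"
 unfolding dif_def by (intro bdd_cpt_intros) (auto intro: bdd_cpt_shifts)

lemma bdd_cpt_avg: "bdd_cpt f ==> bdd_cpt (avg I e f)"
 unfolding avg_def by (intro bdd_cpt_intros) (auto intro: bdd_cpt_shifts)

lemma bdd_cpt_lap: "bdd_cpt f ==> bdd_cpt (lap I e f)"
 unfolding lap_def by (intro bdd_cpt_intros) (auto intro: bdd_cpt_shifts)

lemma bdd_cpt_avg_pow: "bdd_cpt f ==> bdd_cpt ((avg I e ^^ k) f)"
 by (induction k) (auto intro: bdd_cpt_avg)

lemma avg_add: "avg I e (\<lambda>x. f x + g x) = (\<lambda>x. avg I e f x + avg I e g x)"
proof (rule ext)
 fix x
 have "(\<Sum>i\<in>I. (2 * (f x + g x) + (f (x + e i) + g (x + e i)) + (f (x - e i) + g (x - e i))) / 4)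
  = (\<Sum>i\<in>I. (2 * f x + f (x + e i) + f (x - e i)) / 4) + (\<Sum>i\<in>I. (2 * g x + g (x + e i) + g (x - e i)) / 4)"
  unfolding sum.distrib[symmetric] by (intro sum.cong refl) (simp add: field_simps)
 then show "avg I e (\<lambda>x. f x + g x) x = avg I e f x + avg I e g x"
  unfolding avg_def by (simp add: add_divide_distrib)
qed

lemma avg_cmult: "avg I e (\<lambda>x. c * f x) = (\<lambda>x. c * avg I e f x)"
proof (rule ext)
 fix x
 have "(\<Sum>i\<in>I. (2 * (c * f x) + c * f (x + e i) + c * f (x - e i)) / 4)
  = c * (\<Sum>i\<in>I. (2 * f x + f (x + e i) + f (x - e i)) / 4)"
  unfolding sum_distrib_left by (intro sum.cong refl) (simp add: field_simps)
 then show "avg I e (\<lambda>x. c * f x) x = c * avg I e f x"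
  unfolding avg_def by simp
qed

lemma avg_diff: "avg I e (\<lambda>x. f x - g x) = (\<lambda>x. avg I e f x - avg I e g x)"
 using avg_add[of I e f "\<lambda>x. -1 * g x"] unfolding avg_cmult by simp

lemma avg_shift: "avg I e (\<lambda>x. f (x + v)) = (\<lambda>x. avg I e f (x + v))"
 unfolding avg_def by (simp only: diff_add_eq add.assoc add.commute[of "e _" v])

lemma avg_dif: "avg I e (dif v f) = dif v (avg I e f)"
proof -
 have "avg I e (dif v f) = avg I e (\<lambda>x. f (x + v) - f x)" unfolding dif_def ..
 also have "\<dots> = dif v (avg I e f)" unfolding avg_diff avg_shift dif_def ..
 finally show ?thesis .
qed

lemma avg_pow_dif: "(avg I e ^^ k) (dif v f) = dif v ((avg I e ^^ k) f)"
 by (induction k) (auto simp: avg_dif)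

lemma avg_pow_add: "(avg I e ^^ k) (\<lambda>x. f x + g x) = (\<lambda>x. (avg I e ^^ k) f x + (avg I e ^^ k) g x)"
 by (induction k) (auto simp: avg_add)

lemma avg_pow_cmult: "(avg I e ^^ k) (\<lambda>x. c * f x) = (\<lambda>x. c * (avg I e ^^ k) f x)"
 by (induction k) (auto simp: avg_cmult)

lemma avg_pow_diff: "(avg I e ^^ k) (\<lambda>x. f x - g x) = (\<lambda>x. (avg I e ^^ k) f x - (avg I e ^^ k) g x)"
 by (induction k) (auto simp: avg_diff)

lemma avg_nonneg: "(\<And>x. 0 \<le> f x) ==> 0 \<le> avg I e f x"
 unfolding avg_def by (intro divide_nonneg_nonneg sum_nonneg) auto

lemma avg_pow_nonneg: "(\<And>x. 0 \<le> f x) ==> 0 \<le> (avg I e ^^ k) f x"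
 by (induction k arbitrary: x) (auto intro: avg_nonneg)

lemma avg_eq_lap:
 assumes "finite I" "I \<noteq> {}"
 shows "avg I e f x = f x + lap I e f x / (4 * card I)"
proof -
 have "(\<Sum>i\<in>I. (2 * f x + f (x + e i) + f (x - e i)) / 4) = (\<Sum>i\<in>I. f x + (f (x + e i) - 2 * f x + f (x - e i)) / 4)"
  by (intro sum.cong) (auto simp: field_simps)
 also have "\<dots> = card I * f x + lap I e f x / 4"
  unfolding lap_def by (subst sum.distrib) (simp add: sum_divide_distrib)
 finally show ?thesis unfolding avg_def using assms by (simp add: add_divide_distrib card_gt_0_iff)
qed

lemma integral_shift_mult:
 assumes "bdd_cpt f" "bdd_cpt g"
 shows "(LBINT x. f (x + v) * g x) = (LBINT x. f x * g (x - v))"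
 using lborel_integral_shift[of "\<lambda>x. f x * g (x - v)" v] assms[THEN bdd_cpt_measurable] by simp

lemma integral_avg_mult:
 fixes f g :: "'a::euclidean_space => real"
 assumes f: "bdd_cpt f" and g: "bdd_cpt g"
 shows "(LBINT x. avg I e f x * g x) = (LBINT x. f x * avg I e g x)"
proof -
 have *: "(LBINT x. avg I e f x * g x) =
   (\<Sum>i\<in>I. (2 * (LBINT x. f x * g x) + (LBINT x. f (x + e i) * g x) + (LBINT x. f (x + (- e i)) * g x)) / 4) / card I"
  if f: "bdd_cpt f" and g: "bdd_cpt g" for f g :: "'a => real"
 proof -
  have "(LBINT x. avg I e f x * g x) = (LBINT x. (\<Sum>i\<in>I. (2 * (f x * g x) + f (x + e i) * g x + f (x - e i) * g x) / 4) / card I)"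
  proof (rule Bochner_Integration.integral_cong[OF refl])
   fix x
   have "(\<Sum>i\<in>I. (2 * f x + f (x + e i) + f (x - e i)) / 4) * g x
     = (\<Sum>i\<in>I. (2 * (f x * g x) + f (x + e i) * g x + f (x - e i) * g x) / 4)"
    unfolding sum_distrib_right by (intro sum.cong refl) (simp add: field_simps)
   then show "avg I e f x * g x = (\<Sum>i\<in>I. (2 * (f x * g x) + f (x + e i) * g x + f (x - e i) * g x) / 4) / card I"
    unfolding avg_def by simp
  qed
  also have "\<dots> = (\<Sum>i\<in>I. (2 * (LBINT x. f x * g x) + (LBINT x. f (x + e i) * g x) + (LBINT x. f (x - e i) * g x)) / 4) / card I"
   by (simp add: Bochner_Integration.integral_sum Bochner_Integration.integral_add bdd_cpt_integrable bdd_cpt_intros f g f[THEN bdd_cpt_shift] g[THEN bdd_cpt_shift] f[THEN bdd_cpt_shift_minus] g[THEN bdd_cpt_shift_minus])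
  finally show ?thesis by simp
 qed
 show ?thesis
  unfolding *[OF f g] mult.commute[of "f _" "avg I e g _"] *[OF g f] integral_shift_mult[OF f g]
  by (simp add: mult.commute add_ac)
qed

lemma integral_avg_pow_mult:
 assumes f: "bdd_cpt f" and g: "bdd_cpt g"
 shows "(LBINT x. (avg I e ^^ k) f x * g x) = (LBINT x. f x * (avg I e ^^ k) g x)"
 using g
proof (induction k arbitrary: g)
 case (Suc k)
 have "(LBINT x. avg I e ((avg I e ^^ k) f) x * g x) = (LBINT x. (avg I e ^^ k) f x * avg I e g x)"
  by (intro integral_avg_mult bdd_cpt_avg_pow f Suc.prems)
 also have "\<dots> = (LBINT x. f x * (avg I e ^^ k) (avg I e g) x)"
  by (intro Suc.IH bdd_cpt_avg Suc.prems)
 finally show ?case by (simp add: funpow_swap1)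
qed simp

lemma integral_second_difference_mult:
 assumes f: "bdd_cpt f" and g: "bdd_cpt g"
 shows "(LBINT x. (f (x + v) - 2 * f x + f (x - v)) * g x) = - (LBINT x. dif v f x * dif v g x)"
proof -
 have "(LBINT x. dif v f x * dif v g x) = (LBINT x. f (x + v) * g (x + v)) - (LBINT x. f (x + v) * g x)
   - (LBINT x. f x * g (x + v)) + (LBINT x. f x * g x)"
  unfolding dif_def by (simp add: ring_distribs bdd_cpt_integrable bdd_cpt_intros f g f[THEN bdd_cpt_shift] g[THEN bdd_cpt_shift] f[THEN bdd_cpt_shift_minus] g[THEN bdd_cpt_shift_minus])
 also have "(LBINT x. f (x + v) * g (x + v)) = (LBINT x. f x * g x)"
  using lborel_integral_shift[of "\<lambda>x. f x * g x" v] f g by simp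
 also have "(LBINT x. f x * g (x + v)) = (LBINT x. f (x - v) * g x)"
  using integral_shift_mult[OF g f, of v] by (simp add: mult.commute)
 finally show ?thesis by (simp add: ring_distribs mult.assoc bdd_cpt_integrable bdd_cpt_intros f g f[THEN bdd_cpt_shift] g[THEN bdd_cpt_shift] f[THEN bdd_cpt_shift_minus] g[THEN bdd_cpt_shift_minus])
qed

lemma convex_on_powr_nonneg:
 fixes p :: real
 assumes p: "1 < p"
 shows "convex_on {0..} (\<lambda>x. x powr p)"
proof (rule convex_onI)
 fix t x y :: real
 assume t: "0 < t" "t < 1" and xy: "x \<in> {0..}" "y \<in> {0..}"
 have scale: "(s * z) powr p \<le> s * z powr p" if "0 < s" "s < 1" "0 \<le> z" for s z :: real
 proof -
  have "s powr p \<le> s powr 1" using that p by (intro powr_mono') auto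
  then show ?thesis using that by (simp add: powr_mult mult_right_mono)
 qed
 consider "x = 0" | "y = 0" | "0 < x" "0 < y" using xy by force
 then show "((1 - t) *\<^sub>R x + t *\<^sub>R y) powr p \<le> (1 - t) * x powr p + t * y powr p"
 proof cases
  case 3
  then show ?thesis using convex_onD[OF powr_convex, of p t x y] p t by auto
 qed (use scale[of t y] scale[of "1 - t" x] t xy p in auto)
qed simp

section \<open>The Bellman function under repeated averaging\<close>

lemma bellman_function_bounds:
 assumes "bellman_function p q C B" "0 \<le> x" "0 \<le> y"
 shows "0 \<le> B x y" "B x y \<le> C * (x powr p + y powr q)"
 using assms unfolding bellman_function_def by auto

lemma bdd_cpt_bellman:
 assumes B: "bellman_function p q C B" and pq: "0 < p" "0 < q" and C: "0 < (C::real)"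
  and f: "bdd_cpt f" "\<And>x. 0 \<le> f x" and g: "bdd_cpt g" "\<And>x. 0 \<le> g x"
 shows "bdd_cpt (\<lambda>x. B (f x) (g x))"
proof -
 have dom: "bdd_cpt (\<lambda>x. C * (\<bar>f x\<bar> powr p + \<bar>g x\<bar> powr q))"
  by (intro bdd_cpt_intros f g pq)
 obtain M R where *: "\<And>x. \<bar>C * (\<bar>f x\<bar> powr p + \<bar>g x\<bar> powr q)\<bar> \<le> M"
  "\<And>x. R < norm x ==> C * (\<bar>f x\<bar> powr p + \<bar>g x\<bar> powr q) = 0"
  using bdd_cptE[OF dom] by metis
 have le: "0 \<le> B (f x) (g x)" "B (f x) (g x) \<le> C * (\<bar>f x\<bar> powr p + \<bar>g x\<bar> powr q)" for x
  using bellman_function_bounds[OF B f(2) g(2), of x x] f(2) g(2) by auto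
 have "(\<lambda>x. (f x, g x)) \<in> borel \<rightarrow>\<^sub>M borel"
  by (intro borel_measurable_Pair bdd_cpt_measurable f g)
 from measurable_compose[OF this, of "\<lambda>z. B (fst z) (snd z)"] B
 have "borel_fun (\<lambda>x. B (f x) (g x))" by (simp add: bellman_function_def)
 then show ?thesis
 proof (rule bdd_cptI)
  show "\<bar>B (f x) (g x)\<bar> \<le> M" for x using le[of x] *(1)[of x] by linarith
  show "B (f x) (g x) = 0" if "R < norm x" for x using le[of x] *(2)[OF that] by linarith
 qed
qed

text \<open>Jensen's inequality over the \<open>2 * card I\<close> midpoints, then the midpoint
  inequality at each of them. Only the gain on the side of \<open>x + e i\<close> is kept: 1/4 from
  the midpoint, 1/2 from the two sides and \<open>1 / card I\<close> from the mean give the factor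
  \<open>8 * card I\<close>.\<close>

lemma bellman_step:
 fixes u v :: "'a::euclidean_space => real"
 assumes I: "finite I" "I \<noteq> {}" and B: "bellman_function p q C B" and pq: "0 < p" "0 < q" and C: "0 < (C::real)"
  and u: "bdd_cpt u" "\<And>x. 0 \<le> u x" and v: "bdd_cpt v" "\<And>x. 0 \<le> v x"
 shows "(LBINT x. B (avg I e u x) (avg I e v x)) + (\<Sum>i\<in>I. LBINT x. \<bar>dif (e i) u x\<bar> * \<bar>dif (e i) v x\<bar>) / (8 * card I)
   \<le> (LBINT x. B (u x) (v x))"
proof -
 define m where "m = real (card I)"
 have m: "m > 0" unfolding m_def using I by (simp add: card_gt_0_iff)
 define b where "b = (\<lambda>x. B (u x) (v x))"
 have b: "bdd_cpt b" unfolding b_def by (rule bdd_cpt_bellman[OF B pq C u v])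
 have pt: "B (avg I e u x) (avg I e v x) \<le>
   (\<Sum>i\<in>I. (2 * b x + b (x + e i) + b (x - e i)) / 4 - \<bar>dif (e i) u x\<bar> * \<bar>dif (e i) v x\<bar> / 8) / m" for x
 proof -
  define y where "y = (\<lambda>(i, s::bool). if s then ((u x + u (x + e i)) / 2, (v x + v (x + e i)) / 2)
    else ((u x + u (x - e i)) / 2, (v x + v (x - e i)) / 2))"
  let ?J = "I \<times> (UNIV::bool set)"
  have sumJ: "(\<Sum>z\<in>?J. F z) = (\<Sum>i\<in>I. F (i, True) + F (i, False))" for F :: "_ \<times> bool => real"
  proof -
   have "(\<Sum>z\<in>?J. F z) = (\<Sum>i\<in>I. \<Sum>s\<in>UNIV. F (i, s))" by (simp add: sum.cartesian_product)
   then show ?thesis by (simp add: UNIV_bool add.commute)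
  qed
  have "(\<Sum>z\<in>?J. (1 / (2 * m)) *\<^sub>R y z) = (avg I e u x, avg I e v x)"
  proof (rule prod_eqI)
   show "fst (\<Sum>z\<in>?J. (1 / (2 * m)) *\<^sub>R y z) = fst (avg I e u x, avg I e v x)"
    unfolding fst_sum sumJ avg_def m_def[symmetric] y_def fst_conv sum_divide_distrib using m
    by (intro sum.cong) (auto simp: field_simps)
   show "snd (\<Sum>z\<in>?J. (1 / (2 * m)) *\<^sub>R y z) = snd (avg I e u x, avg I e v x)"
    unfolding snd_sum sumJ avg_def m_def[symmetric] y_def snd_conv sum_divide_distrib using m
    by (intro sum.cong) (auto simp: field_simps)
  qed
  moreover have "(\<lambda>z. B (fst z) (snd z)) (\<Sum>z\<in>?J. (1 / (2 * m)) *\<^sub>R y z) \<le> (\<Sum>z\<in>?J. (1 / (2 * m)) * (\<lambda>z. B (fst z) (snd z)) (y z))"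
  proof (rule convex_on_sum[OF _ _ bellman_function_convex[OF B]])
   show "(\<Sum>z\<in>?J. 1 / (2 * m)) = 1" using m by (simp add: card_cartesian_product m_def)
  qed (use I m u(2) v(2) in \<open>auto simp: y_def split: if_splits\<close>)
  ultimately have "B (avg I e u x) (avg I e v x) \<le> (\<Sum>z\<in>?J. (1 / (2 * m)) * (\<lambda>z. B (fst z) (snd z)) (y z))" by simp
  also have "\<dots> = (\<Sum>i\<in>I. (B ((u x + u (x + e i)) / 2) ((v x + v (x + e i)) / 2)
     + B ((u x + u (x - e i)) / 2) ((v x + v (x - e i)) / 2)) / 2) / m"
   unfolding sumJ sum_divide_distrib y_def using m by (intro sum.cong) (auto simp: field_simps)
  also have "\<dots> \<le> (\<Sum>i\<in>I. (2 * b x + b (x + e i) + b (x - e i)) / 4 - \<bar>dif (e i) u x\<bar> * \<bar>dif (e i) v x\<bar> / 8) / m"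
  proof (intro divide_right_mono sum_mono)
   fix i
   have 1: "B ((u x + u (x + e i)) / 2) ((v x + v (x + e i)) / 2)
     \<le> (b x + b (x + e i)) / 2 - \<bar>dif (e i) u x\<bar> * \<bar>dif (e i) v x\<bar> / 4"
    unfolding b_def dif_def using bellman_function_midpoint[OF B, of "u x" "v x" "u (x + e i)" "v (x + e i)"] u(2) v(2)
    by (simp add: abs_minus_commute)
   have "0 \<le> \<bar>u x - u (x - e i)\<bar> * \<bar>v x - v (x - e i)\<bar> / 4" by simp
   then have 2: "B ((u x + u (x - e i)) / 2) ((v x + v (x - e i)) / 2) \<le> (b x + b (x - e i)) / 2"
    unfolding b_def using bellman_function_midpoint[OF B u(2)[of x] v(2)[of x] u(2)[of "x - e i"] v(2)[of "x - e i"]]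
    by linarith
   from 1 2 show "(B ((u x + u (x + e i)) / 2) ((v x + v (x + e i)) / 2)
     + B ((u x + u (x - e i)) / 2) ((v x + v (x - e i)) / 2)) / 2
    \<le> (2 * b x + b (x + e i) + b (x - e i)) / 4 - \<bar>dif (e i) u x\<bar> * \<bar>dif (e i) v x\<bar> / 8"
    by (simp add: field_simps)
  qed (use m in auto)
  finally show ?thesis .
 qed
 have Bi: "bdd_cpt (\<lambda>x. B (avg I e u x) (avg I e v x))"
  by (intro bdd_cpt_bellman[OF B pq C] bdd_cpt_avg avg_nonneg u v)
 have "(LBINT x. B (avg I e u x) (avg I e v x)) \<le>
   (LBINT x. (\<Sum>i\<in>I. (2 * b x + b (x + e i) + b (x - e i)) / 4 - \<bar>dif (e i) u x\<bar> * \<bar>dif (e i) v x\<bar> / 8) / m)"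
  by (intro integral_mono pt bdd_cpt_integrable Bi bdd_cpt_intros b b[THEN bdd_cpt_shift] b[THEN bdd_cpt_shift_minus] bdd_cpt_dif u v)
 also have "\<dots> = (\<Sum>i\<in>I. (2 * (LBINT x. b x) + (LBINT x. b (x + e i)) + (LBINT x. b (x + (- e i)))) / 4
    - (LBINT x. \<bar>dif (e i) u x\<bar> * \<bar>dif (e i) v x\<bar>) / 8) / m"
  by (simp add: bdd_cpt_integrable bdd_cpt_intros b b[THEN bdd_cpt_shift] b[THEN bdd_cpt_shift_minus] bdd_cpt_dif u v)
 also have "\<dots> = (LBINT x. b x) - (\<Sum>i\<in>I. LBINT x. \<bar>dif (e i) u x\<bar> * \<bar>dif (e i) v x\<bar>) / (8 * m)"
  unfolding lborel_integral_shift[OF bdd_cpt_measurable[OF b]] using m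
  by (simp add: sum_subtractf m_def[symmetric] sum_divide_distrib[symmetric] diff_divide_distrib)
 finally show ?thesis unfolding b_def m_def by simp
qed

text \<open>The losses of \<open>bellman_step\<close> telescope, and since \<open>B\<close> stays
  nonnegative their total is bounded by the initial value for every \<open>N\<close>.\<close>

lemma bellman_iterate:
 fixes u v :: "'a::euclidean_space => real"
 assumes I: "finite I" "I \<noteq> {}" and B: "bellman_function p q C B" and pq: "0 < p" "0 < q" and C: "0 < (C::real)"
  and u: "bdd_cpt u" "\<And>x. 0 \<le> u x" and v: "bdd_cpt v" "\<And>x. 0 \<le> v x" and i: "i \<in> I"
 shows "(\<Sum>k<N. LBINT x. \<bar>dif (e i) ((avg I e ^^ k) u) x\<bar> * \<bar>dif (e i) ((avg I e ^^ k) v) x\<bar>)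
   \<le> 8 * real (card I) * C * ((LBINT x. \<bar>u x\<bar> powr p) + (LBINT x. \<bar>v x\<bar> powr q))"
proof -
 define m where "m = real (card I)"
 have m: "m > 0" unfolding m_def using I by (simp add: card_gt_0_iff)
 define D where "D = (\<lambda>k. \<Sum>i\<in>I. LBINT x. \<bar>dif (e i) ((avg I e ^^ k) u) x\<bar> * \<bar>dif (e i) ((avg I e ^^ k) v) x\<bar>)"
 have "(LBINT x. B ((avg I e ^^ N) u x) ((avg I e ^^ N) v x)) + (\<Sum>k<N. D k) / (8 * m) \<le> (LBINT x. B (u x) (v x))"
 proof (induction N)
  case (Suc N)
  have "(LBINT x. B ((avg I e ^^ Suc N) u x) ((avg I e ^^ Suc N) v x)) + D N / (8 * m)
    \<le> (LBINT x. B ((avg I e ^^ N) u x) ((avg I e ^^ N) v x))"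
   unfolding D_def m_def using bellman_step[OF I B pq C, of "(avg I e ^^ N) u" "(avg I e ^^ N) v" e]
   by (simp add: bdd_cpt_avg_pow avg_pow_nonneg u v)
  with Suc show ?case by (simp add: add_divide_distrib)
 qed simp
 moreover have "0 \<le> (LBINT x. B ((avg I e ^^ N) u x) ((avg I e ^^ N) v x))"
  by (intro Bochner_Integration.integral_nonneg bellman_function_bounds[OF B] avg_pow_nonneg u v)
 moreover have "(LBINT x. B (u x) (v x)) \<le> (LBINT x. C * (\<bar>u x\<bar> powr p + \<bar>v x\<bar> powr q))"
  using bellman_function_bounds(2)[OF B u(2) v(2)] u v
  by (intro integral_mono bdd_cpt_integrable bdd_cpt_bellman[OF B pq C] bdd_cpt_intros pq) auto
 moreover have "(LBINT x. C * (\<bar>u x\<bar> powr p + \<bar>v x\<bar> powr q)) = C * ((LBINT x. \<bar>u x\<bar> powr p) + (LBINT x. \<bar>v x\<bar> powr q))"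
 proof -
  have "integrable lborel (\<lambda>x. \<bar>u x\<bar> powr p)" "integrable lborel (\<lambda>x. \<bar>v x\<bar> powr q)"
   by (intro bdd_cpt_integrable bdd_cpt_intros u v pq)+
  then show ?thesis by simp
 qed
 ultimately have "(\<Sum>k<N. D k) / (8 * m) \<le> C * ((LBINT x. \<bar>u x\<bar> powr p) + (LBINT x. \<bar>v x\<bar> powr q))" by linarith
 then have "(\<Sum>k<N. D k) \<le> 8 * m * C * ((LBINT x. \<bar>u x\<bar> powr p) + (LBINT x. \<bar>v x\<bar> powr q))"
  using m by (simp add: field_simps)
 moreover have "(\<Sum>k<N. LBINT x. \<bar>dif (e i) ((avg I e ^^ k) u) x\<bar> * \<bar>dif (e i) ((avg I e ^^ k) v) x\<bar>) \<le> (\<Sum>k<N. D k)"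
  unfolding D_def by (intro sum_mono member_le_sum[OF i]) (auto intro!: Bochner_Integration.integral_nonneg I)
 ultimately show ?thesis unfolding m_def by linarith
qed

text \<open>The Bellman function lives on a quadrant, so \<open>f\<close> and \<open>g\<close> are
  split into positive and negative parts; the four resulting pairings turn the constant 8 into
  32.\<close>

lemma bellman_iterate_signed:
 fixes f g :: "'a::euclidean_space => real"
 assumes I: "finite I" "I \<noteq> {}" and B: "bellman_function p q C B" and pq: "0 < p" "0 < q" and C: "0 < (C::real)"
  and f: "bdd_cpt f" and g: "bdd_cpt g" and i: "i \<in> I"
 shows "(\<Sum>k<N. LBINT x. \<bar>dif (e i) ((avg I e ^^ k) f) x\<bar> * \<bar>dif (e i) ((avg I e ^^ k) g) x\<bar>)
   \<le> 32 * real (card I) * C * ((LBINT x. \<bar>f x\<bar> powr p) + (LBINT x. \<bar>g x\<bar> powr q))"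
proof -
 define h where "h = (\<lambda>(s::real) (f::'a => real) x. max 0 (s * f x))"
 have h: "bdd_cpt (h s f)" "0 \<le> h s f x" if "bdd_cpt f" for s x and f :: "'a => real"
  unfolding h_def by (auto intro!: bdd_cpt_intros that)
 have dec: "f = (\<lambda>x. h 1 f x - h (-1) f x)" for f unfolding h_def by (auto simp: fun_eq_iff max_def)
 define G where "G = (\<lambda>k f x. dif (e i) ((avg I e ^^ k) f) x)"
 have Gb: "bdd_cpt (G k f)" if "bdd_cpt f" for k f unfolding G_def by (intro bdd_cpt_dif bdd_cpt_avg_pow that)
 have Gdec: "\<bar>G k f x\<bar> \<le> \<bar>G k (h 1 f) x\<bar> + \<bar>G k (h (-1) f) x\<bar>" for k f x
 proof -
  have "G k f x = G k (h 1 f) x - G k (h (-1) f) x"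
   unfolding G_def by (subst dec[of f]) (simp add: avg_pow_diff dif_def)
  then show ?thesis by linarith
 qed
 define Q where "Q = (\<lambda>f g. \<Sum>k<N. LBINT x. \<bar>G k f x\<bar> * \<bar>G k g x\<bar>)"
 define R where "R = 8 * real (card I) * C * ((LBINT x. \<bar>f x\<bar> powr p) + (LBINT x. \<bar>g x\<bar> powr q))"
 have powh: "(LBINT x. \<bar>h s f x\<bar> powr p) \<le> (LBINT x. \<bar>f x\<bar> powr p)"
  if "bdd_cpt f" "\<bar>s\<bar> = 1" "0 < p" for s p and f :: "'a => real"
 proof (intro integral_mono bdd_cpt_integrable bdd_cpt_intros h that powr_mono2)
  fix x
  have "\<bar>s * f x\<bar> = \<bar>f x\<bar>" using that by (simp add: abs_mult)
  then show "\<bar>h s f x\<bar> \<le> \<bar>f x\<bar>" unfolding h_def by linarith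
 qed (use that in auto)
 have Qh: "Q (h s f) (h t g) \<le> R" if "\<bar>s\<bar> = 1" "\<bar>t\<bar> = 1" for s t
 proof -
  have "Q (h s f) (h t g) \<le> 8 * real (card I) * C * ((LBINT x. \<bar>h s f x\<bar> powr p) + (LBINT x. \<bar>h t g x\<bar> powr q))"
   unfolding Q_def G_def by (intro bellman_iterate[OF I B pq C] h f g i)
  also have "\<dots> \<le> R" unfolding R_def
   by (intro mult_left_mono add_mono powh) (use f g that pq C in auto)
  finally show ?thesis .
 qed
 have "Q f g \<le> Q (h 1 f) (h 1 g) + Q (h 1 f) (h (-1) g) + Q (h (-1) f) (h 1 g) + Q (h (-1) f) (h (-1) g)"
  unfolding Q_def sum.distrib[symmetric]
 proof (rule sum_mono)
  fix k
  have "(LBINT x. \<bar>G k f x\<bar> * \<bar>G k g x\<bar>) \<le> (LBINT x. \<bar>G k (h 1 f) x\<bar> * \<bar>G k (h 1 g) x\<bar> + \<bar>G k (h 1 f) x\<bar> * \<bar>G k (h (- 1) g) x\<bar>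
     + \<bar>G k (h (- 1) f) x\<bar> * \<bar>G k (h 1 g) x\<bar> + \<bar>G k (h (- 1) f) x\<bar> * \<bar>G k (h (- 1) g) x\<bar>)"
  proof (intro integral_mono bdd_cpt_integrable bdd_cpt_intros Gb h f g)
   fix x
   have "\<bar>G k f x\<bar> * \<bar>G k g x\<bar> \<le> (\<bar>G k (h 1 f) x\<bar> + \<bar>G k (h (-1) f) x\<bar>) * (\<bar>G k (h 1 g) x\<bar> + \<bar>G k (h (-1) g) x\<bar>)"
    by (intro mult_mono Gdec) auto
   then show "\<bar>G k f x\<bar> * \<bar>G k g x\<bar> \<le> \<bar>G k (h 1 f) x\<bar> * \<bar>G k (h 1 g) x\<bar> + \<bar>G k (h 1 f) x\<bar> * \<bar>G k (h (- 1) g) x\<bar>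
     + \<bar>G k (h (- 1) f) x\<bar> * \<bar>G k (h 1 g) x\<bar> + \<bar>G k (h (- 1) f) x\<bar> * \<bar>G k (h (- 1) g) x\<bar>"
    by (simp add: ring_distribs)
  qed
  also have "\<dots> = (LBINT x. \<bar>G k (h 1 f) x\<bar> * \<bar>G k (h 1 g) x\<bar>) + (LBINT x. \<bar>G k (h 1 f) x\<bar> * \<bar>G k (h (-1) g) x\<bar>)
   + (LBINT x. \<bar>G k (h (-1) f) x\<bar> * \<bar>G k (h 1 g) x\<bar>) + (LBINT x. \<bar>G k (h (-1) f) x\<bar> * \<bar>G k (h (-1) g) x\<bar>)"
   by (simp add: bdd_cpt_integrable bdd_cpt_intros Gb h f g)
  finally show "(LBINT x. \<bar>G k f x\<bar> * \<bar>G k g x\<bar>) \<le> \<dots>" .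
 qed
 also have "\<dots> \<le> 4 * R" using Qh[of 1 1] Qh[of 1 "-1"] Qh[of "-1" 1] Qh[of "-1" "-1"] by simp
 finally show ?thesis unfolding Q_def G_def R_def by (simp add: mult_ac)
qed

text \<open>An average of translations is a contraction: Jensen's inequality over \<open>I\<close>
  and over the three points of each summand, then translation invariance of the integral.\<close>

lemma integral_avg_powr_le:
 fixes f :: "'a::euclidean_space => real"
 assumes I: "finite I" "I \<noteq> {}" and p: "1 < p" and f: "bdd_cpt f"
 shows "(LBINT x. \<bar>avg I e f x\<bar> powr p) \<le> (LBINT x. \<bar>f x\<bar> powr p)"
proof -
 define m where "m = real (card I)"
 have m: "m > 0" unfolding m_def using I by (simp add: card_gt_0_iff)
 have cp: "convex_on {0..} (\<lambda>x::real. x powr p)" using p by (rule convex_on_powr_nonneg)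
 define b where "b = (\<lambda>x. \<bar>f x\<bar> powr p)"
 have b: "bdd_cpt b" unfolding b_def using p by (intro bdd_cpt_intros f) auto
 have pt: "\<bar>avg I e f x\<bar> powr p \<le> avg I e b x" for x
 proof -
  have "\<bar>avg I e f x\<bar> \<le> (\<Sum>i\<in>I. \<bar>(2 * f x + f (x + e i) + f (x - e i)) / 4\<bar>) / m"
   unfolding avg_def m_def[symmetric] abs_divide[of _ m] abs_of_pos[OF m] using m
   by (intro divide_right_mono sum_abs) auto
  moreover have "(\<Sum>i\<in>I. \<bar>(2 * f x + f (x + e i) + f (x - e i)) / 4\<bar>) / m
   = (\<Sum>i\<in>I. (1 / m) *\<^sub>R \<bar>(2 * f x + f (x + e i) + f (x - e i)) / 4\<bar>)"
   unfolding sum_divide_distrib by (intro sum.cong refl) simp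
  ultimately have "\<bar>avg I e f x\<bar> powr p \<le> (\<Sum>i\<in>I. (1 / m) *\<^sub>R \<bar>(2 * f x + f (x + e i) + f (x - e i)) / 4\<bar>) powr p"
   using p by (intro powr_mono2) simp_all
  also have "\<dots> \<le> (\<Sum>i\<in>I. (1 / m) * (\<bar>(2 * f x + f (x + e i) + f (x - e i)) / 4\<bar> powr p))"
   by (rule convex_on_sum[OF _ _ cp]) (use I m in \<open>auto simp: m_def\<close>)
  also have "\<dots> \<le> (\<Sum>i\<in>I. (1 / m) * ((2 * b x + b (x + e i) + b (x - e i)) / 4))"
  proof (intro sum_mono mult_left_mono)
   fix i
   define w where "w = (\<lambda>j::nat. if j = 0 then \<bar>f x\<bar> else if j = 1 then \<bar>f (x + e i)\<bar> else \<bar>f (x - e i)\<bar>)"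
   define c where "c = (\<lambda>j::nat. if j = 0 then 1/2 else 1/4::real)"
   have "(\<Sum>j\<in>{0,1,2}. c j *\<^sub>R w j) powr p \<le> (\<Sum>j\<in>{0,1,2}. c j * (w j powr p))"
    by (rule convex_on_sum[OF _ _ cp]) (auto simp: c_def w_def)
   then have "((2 * \<bar>f x\<bar> + \<bar>f (x + e i)\<bar> + \<bar>f (x - e i)\<bar>) / 4) powr p \<le> (2 * b x + b (x + e i) + b (x - e i)) / 4"
    by (simp add: c_def w_def b_def add_divide_distrib add.assoc)
   moreover have "\<bar>(2 * f x + f (x + e i) + f (x - e i)) / 4\<bar> powr p \<le> ((2 * \<bar>f x\<bar> + \<bar>f (x + e i)\<bar> + \<bar>f (x - e i)\<bar>) / 4) powr p"
    using p by (intro powr_mono2) auto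
   ultimately show "\<bar>(2 * f x + f (x + e i) + f (x - e i)) / 4\<bar> powr p \<le> (2 * b x + b (x + e i) + b (x - e i)) / 4"
    by linarith
  qed (use m in auto)
  also have "\<dots> = avg I e b x" unfolding avg_def m_def by (simp add: sum_divide_distrib mult.commute)
  finally show ?thesis .
 qed
 have "(LBINT x. \<bar>avg I e f x\<bar> powr p) \<le> (LBINT x. avg I e b x)"
  using p by (intro integral_mono pt bdd_cpt_integrable bdd_cpt_intros bdd_cpt_avg f b) auto
 also have "\<dots> = (\<Sum>i\<in>I. (2 * (LBINT x. b x) + (LBINT x. b (x + e i)) + (LBINT x. b (x + (- e i)))) / 4) / m"
  unfolding avg_def m_def[symmetric] by (simp add: bdd_cpt_integrable bdd_cpt_intros b b[THEN bdd_cpt_shift] b[THEN bdd_cpt_shift_minus])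
 also have "\<dots> = (LBINT x. b x)"
  unfolding lborel_integral_shift[OF bdd_cpt_measurable[OF b]] using m by (simp add: m_def[symmetric])
 finally show ?thesis unfolding b_def .
qed

lemma avg_pow_lap:
 assumes I: "finite I" "I \<noteq> {}"
 shows "(avg I e ^^ N) f x = f x + (\<Sum>k<N. (avg I e ^^ k) (lap I e f) x) / (4 * card I)"
proof (induction N)
 case (Suc N)
 have "avg I e f = (\<lambda>x. f x + (1 / (4 * card I)) * lap I e f x)"
  by (rule ext) (simp add: avg_eq_lap[OF I])
 then have "(avg I e ^^ Suc N) f x = (avg I e ^^ N) (\<lambda>x. f x + (1 / (4 * card I)) * lap I e f x) x"
  by (simp only: funpow_Suc_right o_apply)
 also have "\<dots> = (avg I e ^^ N) f x + (avg I e ^^ N) (lap I e f) x / (4 * card I)"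
  unfolding avg_pow_add avg_pow_cmult by simp
 finally show ?case using Suc by (simp add: add_divide_distrib)
qed simp

text \<open>The average is self-adjoint and commutes with differences, so an even power can be
  shared equally between \<open>f\<close> and \<open>g\<close>. The symmetric expression is the one
  summed by the Bellman estimate.\<close>

lemma integral_dif_avg_pow:
 assumes f: "bdd_cpt f" and g: "bdd_cpt g"
 shows "(LBINT x. dif v ((avg I e ^^ (l + l)) f) x * dif v g x)
  = (LBINT x. dif v ((avg I e ^^ l) f) x * dif v ((avg I e ^^ l) g) x)"
 unfolding avg_pow_dif[symmetric] funpow_add o_apply
 by (intro integral_avg_pow_mult bdd_cpt_avg_pow bdd_cpt_dif f g)

lemma abs_integral_le_half_sum:
 fixes f g :: "'a::euclidean_space => real"
 assumes m: "f \<in> borel_measurable lborel" "g \<in> borel_measurable lborel"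
  and i: "integrable lborel (\<lambda>x. (f x)\<^sup>2)" "integrable lborel (\<lambda>x. (g x)\<^sup>2)" and s: "0 < s"
 shows "\<bar>LBINT x. f x * g x\<bar> \<le> s * (LBINT x. (f x)\<^sup>2) + (LBINT x. (g x)\<^sup>2) / s"
proof -
 have b: "\<bar>f x * g x\<bar> \<le> s * (f x)\<^sup>2 + (g x)\<^sup>2 / s" for x
 proof -
  have "0 \<le> (s * \<bar>f x\<bar> - \<bar>g x\<bar>)\<^sup>2 / s" using s by simp
  also have "\<dots> = s * (f x)\<^sup>2 + (g x)\<^sup>2 / s - 2 * \<bar>f x * g x\<bar>"
   using s by (simp add: power2_diff power_mult_distrib field_simps abs_mult power2_eq_square)
  finally show ?thesis using abs_ge_zero[of "f x * g x"] by linarith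
 qed
 have I: "integrable lborel (\<lambda>x. s * (f x)\<^sup>2 + (g x)\<^sup>2 / s)" using i by simp
 have J: "integrable lborel (\<lambda>x. f x * g x)"
  by (rule Bochner_Integration.integrable_bound[OF I]) (use m order_trans[OF b abs_ge_self] in \<open>auto intro!: AE_I2\<close>)
 have "\<bar>LBINT x. f x * g x\<bar> \<le> (LBINT x. \<bar>f x * g x\<bar>)" by (rule integral_abs_bound)
 also have "\<dots> \<le> (LBINT x. s * (f x)\<^sup>2 + (g x)\<^sup>2 / s)"
  by (rule integral_mono[OF integrable_abs[OF J] I b])
 also have "\<dots> = s * (LBINT x. (f x)\<^sup>2) + (LBINT x. (g x)\<^sup>2) / s" using i by simp
 finally show ?thesis .
qed

lemma integral_abs_mult_le:
 assumes f: "bdd_cpt f" and g: "bdd_cpt g" and t: "0 < t"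
 shows "\<bar>LBINT x. f x * g x\<bar> \<le> t * (LBINT x. \<bar>f x\<bar> * \<bar>f x\<bar>) + (LBINT x. \<bar>g x\<bar> * \<bar>g x\<bar>) / t"
 using abs_integral_le_half_sum[of f g t] t bdd_cpt_measurable[OF f] bdd_cpt_measurable[OF g]
  bdd_cpt_integrable[OF bdd_cpt_mult[OF f f]] bdd_cpt_integrable[OF bdd_cpt_mult[OF g g]]
 by (simp add: power2_eq_square)

text \<open>The Bellman estimate with both exponents 2 and both functions equal makes these
  integrals summable.\<close>

lemma dif_avg_pow_L2_tendsto_0:
 fixes f :: "'a::euclidean_space => real"
 assumes I: "finite I" "I \<noteq> {}" and f: "bdd_cpt f" and i: "i \<in> I"
 shows "(\<lambda>k. LBINT x. \<bar>dif (e i) ((avg I e ^^ k) f) x\<bar> * \<bar>dif (e i) ((avg I e ^^ k) f) x\<bar>) \<longlonglongrightarrow> 0"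
proof -
 obtain C B where C: "0 < C" and B: "bellman_function 2 2 C B"
  using bellman_function_exists[of 2 2] by auto
 have "summable (\<lambda>k. LBINT x. \<bar>dif (e i) ((avg I e ^^ k) f) x\<bar> * \<bar>dif (e i) ((avg I e ^^ k) f) x\<bar>)"
  by (rule summableI_nonneg_bounded[OF _ bellman_iterate_signed[OF I B _ _ C f f i]]) auto
 then show ?thesis by (rule summable_LIMSEQ_zero)
qed

text \<open>The average differs from the identity by \<open>lap / (4 * card I)\<close>, so the
  pairing of \<open>v\<close> with \<open>g\<close> telescopes into pairings of the iterates applied
  to \<open>lap I e v\<close>. Even iterates form a Bellman sum; odd ones are even iterates of the
  averaged function, whose \<open>p\<close>-integral is no larger. The factor \<open>card I\<close>
  cancels, leaving \<open>16 = 2 * 32 / 4\<close>.\<close>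

lemma second_difference_pairing:
 fixes v g :: "'a::euclidean_space => real"
 assumes I: "finite I" "I \<noteq> {}" and p: "1 < p" "0 < q" and B: "bellman_function p q C B" and C: "0 < C"
  and v: "bdd_cpt v" and g: "bdd_cpt g" and i: "i \<in> I"
 shows "\<bar>LBINT x. (v (x + e i) - 2 * v x + v (x - e i)) * g x\<bar>
   \<le> 16 * C * ((LBINT x. \<bar>lap I e v x\<bar> powr p) + (LBINT x. \<bar>g x\<bar> powr q))"
proof -
 define m where "m = real (card I)"
 have m: "m > 0" unfolding m_def using I by (simp add: card_gt_0_iff)
 define f where "f = lap I e v"
 have f: "bdd_cpt f" unfolding f_def by (intro bdd_cpt_lap v)
 define A where "A = avg I e"
 define a where "a = (\<lambda>k f. LBINT x. dif (e i) ((A ^^ k) f) x * dif (e i) g x)"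
 define F where "F = (LBINT x. \<bar>f x\<bar> powr p)"
 define G where "G = (LBINT x. \<bar>g x\<bar> powr q)"
 have pq: "0 < p" "0 < q" using p by auto
 have even_part: "\<bar>\<Sum>l<N. a (l + l) h\<bar> \<le> 32 * m * C * ((LBINT x. \<bar>h x\<bar> powr p) + G)"
  if h: "bdd_cpt h" for h N
 proof -
  have "\<bar>\<Sum>l<N. a (l + l) h\<bar> \<le> (\<Sum>l<N. LBINT x. \<bar>dif (e i) ((A ^^ l) h) x\<bar> * \<bar>dif (e i) ((A ^^ l) g) x\<bar>)"
  proof (rule order_trans[OF sum_abs], rule sum_mono)
   fix l
   show "\<bar>a (l + l) h\<bar> \<le> (LBINT x. \<bar>dif (e i) ((A ^^ l) h) x\<bar> * \<bar>dif (e i) ((A ^^ l) g) x\<bar>)"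
    unfolding a_def A_def integral_dif_avg_pow[OF h g]
    using integral_abs_bound[of lborel "\<lambda>x. dif (e i) ((avg I e ^^ l) h) x * dif (e i) ((avg I e ^^ l) g) x"]
    by (simp add: abs_mult)
  qed
  also have "\<dots> \<le> 32 * m * C * ((LBINT x. \<bar>h x\<bar> powr p) + G)"
   unfolding A_def m_def G_def by (rule bellman_iterate_signed[OF I B pq C h g i])
  finally show ?thesis .
 qed
 have split: "(\<Sum>k<2 * N. a k f) = (\<Sum>l<N. a (l + l) f) + (\<Sum>l<N. a (l + l) (A f))" for N
 proof (induction N)
  case (Suc N)
  have "a (2 * N + 1) f = a (N + N) (A f)" unfolding a_def
   by (simp only: mult_2[symmetric] add_0_right add_Suc_right One_nat_def funpow_Suc_right o_apply)
  then show ?case using Suc by (simp add: mult_2)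
 qed simp
 have "(LBINT x. \<bar>A f x\<bar> powr p) \<le> F"
  unfolding A_def F_def by (rule integral_avg_powr_le[OF I p(1) f])
 then have "32 * m * C * ((LBINT x. \<bar>A f x\<bar> powr p) + G) \<le> 32 * m * C * (F + G)"
  using m C by (intro mult_left_mono add_right_mono) auto
 then have sum_le: "\<bar>\<Sum>k<2 * N. a k f\<bar> \<le> 2 * (32 * m * C * (F + G))" for N
  unfolding split using even_part[OF f, of N] even_part[of "A f" N]
  unfolding F_def[symmetric] using bdd_cpt_avg[OF f] A_def by fastforce
 have tele: "a (2 * N) v = a 0 v + (\<Sum>k<2 * N. a k f) / (4 * m)" for N
 proof -
  have "dif (e i) ((A ^^ (2 * N)) v) x = dif (e i) v x + (\<Sum>k<2 * N. dif (e i) ((A ^^ k) f) x) / (4 * m)" for x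
   unfolding A_def dif_def avg_pow_lap[OF I, of _ e v] m_def f_def by (simp add: sum_subtractf diff_divide_distrib)
  then have "a (2 * N) v = (LBINT x. dif (e i) v x * dif (e i) g x + (\<Sum>k<2 * N. dif (e i) ((A ^^ k) f) x * dif (e i) g x) / (4 * m))"
   unfolding a_def by (simp add: ring_distribs sum_distrib_right)
  also have "\<dots> = (LBINT x. dif (e i) v x * dif (e i) g x) + (LBINT x. (\<Sum>k<2 * N. dif (e i) ((A ^^ k) f) x * dif (e i) g x) / (4 * m))"
   unfolding A_def
   by (intro Bochner_Integration.integral_add bdd_cpt_integrable bdd_cpt_intros bdd_cpt_dif bdd_cpt_avg_pow f v g)
  also have "(LBINT x. (\<Sum>k<2 * N. dif (e i) ((A ^^ k) f) x * dif (e i) g x) / (4 * m)) = (\<Sum>k<2 * N. a k f) / (4 * m)"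
  proof -
   have "integrable lborel (\<lambda>x. dif (e i) ((A ^^ k) f) x * dif (e i) g x)" for k
    unfolding A_def by (intro bdd_cpt_integrable bdd_cpt_intros bdd_cpt_dif bdd_cpt_avg_pow f v g)
   then show ?thesis unfolding a_def by simp
  qed
  finally show ?thesis unfolding a_def by simp
 qed
 define d where "d = (\<lambda>k. LBINT x. \<bar>dif (e i) ((A ^^ k) v) x\<bar> * \<bar>dif (e i) ((A ^^ k) v) x\<bar>)"
 have d0: "(\<lambda>N. d (2 * N)) \<longlonglongrightarrow> 0"
  using dif_avg_pow_L2_tendsto_0[OF I v i, of e] unfolding d_def A_def
  by (rule LIMSEQ_subseq_LIMSEQ[unfolded o_def]) (auto simp: strict_mono_def)
 define r where "r = (LBINT x. \<bar>dif (e i) g x\<bar> * \<bar>dif (e i) g x\<bar>)"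
 \<comment> \<open>Of the remainder only the factor \<open>d (2 * N)\<close> tends to 0, so the
   product is split with a free weight: \<open>N\<close> goes to infinity first, \<open>t\<close>
   afterwards.\<close>
 have bound: "\<bar>a 0 v\<bar> \<le> 16 * C * (F + G) + (t * d (2 * N) + r / t)" if "0 < t" for t N
 proof -
  have "\<bar>a (2 * N) v\<bar> \<le> t * d (2 * N) + r / t"
   unfolding a_def d_def r_def A_def by (intro integral_abs_mult_le bdd_cpt_dif bdd_cpt_avg_pow v g that)
  moreover have "\<bar>(\<Sum>k<2 * N. a k f) / (4 * m)\<bar> \<le> 16 * C * (F + G)"
   using divide_right_mono[OF sum_le[of N], of "4 * m"] m by simp
  ultimately show ?thesis using tele[of N] by linarith
 qed
 have bound': "\<bar>a 0 v\<bar> \<le> 16 * C * (F + G) + r / t" if t: "0 < t" for t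
 proof (rule LIMSEQ_le_const)
  show "(\<lambda>N. 16 * C * (F + G) + (t * d (2 * N) + r / t)) \<longlonglongrightarrow> 16 * C * (F + G) + r / t"
   by (rule tendsto_eq_intros d0 refl | simp)+
 qed (use bound[OF t] in auto)
 have "\<bar>a 0 v\<bar> \<le> 16 * C * (F + G)"
 proof (rule tendsto_lowerbound[rotated])
  show "\<forall>\<^sub>F t in at_top. \<bar>a 0 v\<bar> \<le> 16 * C * (F + G) + r / t"
   using eventually_gt_at_top[of "0::real"] by eventually_elim (rule bound')
  have "((\<lambda>t::real. 16 * C * (F + G) + r / t) \<longlongrightarrow> 16 * C * (F + G) + 0) at_top"
   by (intro tendsto_add tendsto_const tendsto_divide_0[OF tendsto_const] filterlim_at_top_imp_at_infinity filterlim_ident)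
  then show "((\<lambda>t::real. 16 * C * (F + G) + r / t) \<longlongrightarrow> 16 * C * (F + G)) at_top" by simp
 qed simp
 then show ?thesis
  unfolding integral_second_difference_mult[OF v g] F_def G_def f_def a_def by simp
qed

text \<open>Duality: the pairing is tested with a multiple of
  \<open>sgn (w x) * \<bar>w x\<bar> powr (p - 1)\<close>. That \<open>K\<close> is uniform in the
  directions \<open>e\<close> is what permits the step size to shrink later.\<close>

lemma second_difference_bound:
 fixes p :: real
 assumes p: "1 < p"
 shows "\<exists>K>0. \<forall>(I::'i set) (e :: 'i => 'a::euclidean_space) i f. finite I --> i \<in> I --> bdd_cpt f -->
   (LBINT x. \<bar>f (x + e i) - 2 * f x + f (x - e i)\<bar> powr p) \<le> K * (LBINT x. \<bar>lap I e f x\<bar> powr p)"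
proof -
 define q where "q = p / (p - 1)"
 have q: "1 < q" unfolding q_def using p by (simp add: divide_simps)
 obtain C B where C: "0 < C" and B: "bellman_function p q C B"
  using bellman_function_exists[OF p q_def] by auto
 \<comment> \<open>Scaling the test function by \<open>s\<close> multiplies the left side by
   \<open>s\<close> and the last term by \<open>s powr q\<close>. This value makes
   \<open>s powr q\<close> equal to \<open>s / (32 * C)\<close>, so half of the left side absorbs
   that term.\<close>
 define s where "s = (1 / (32 * C)) powr (1 / (q - 1))"
 have s: "s > 0" unfolding s_def using C by simp
 have "s powr (q - 1) = 1 / (32 * C)" unfolding s_def using C q by (simp add: powr_powr)
 then have "s * s powr (q - 1) = s / (32 * C)" by simp
 then have sq: "s powr q = s / (32 * C)" using s by (simp add: powr_mult_base)
 have main: "(LBINT x. \<bar>f (x + e i) - 2 * f x + f (x - e i)\<bar> powr p) \<le> 32 * C / s * (LBINT x. \<bar>lap I e f x\<bar> powr p)"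
  if I: "finite I" and i: "i \<in> I" and f: "bdd_cpt f" for I and e :: "'i => 'a" and i f
 proof -
  define w where "w = (\<lambda>x. f (x + e i) - 2 * f x + f (x - e i))"
  have w: "bdd_cpt w" unfolding w_def
   by (intro bdd_cpt_intros f f[THEN bdd_cpt_shift] f[THEN bdd_cpt_shift_minus])
  define g where "g = (\<lambda>x. s * (sgn (w x) * \<bar>w x\<bar> powr (p - 1)))"
  have g: "bdd_cpt g"
  proof -
   have "bdd_cpt (\<lambda>x. sgn (w x) * \<bar>w x\<bar> powr (p - 1))"
   proof (rule bdd_cpt_comp2[where F="\<lambda>a b. sgn a * \<bar>a\<bar> powr (p - 1)", OF _ _ _ w w])
    show "\<exists>C. \<forall>a b. \<bar>a\<bar> \<le> M \<and> \<bar>b\<bar> \<le> M --> \<bar>sgn a * \<bar>a\<bar> powr (p - 1)\<bar> \<le> C" for M :: real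
     by (rule exI[of _ "M powr (p - 1)"]) (use p in \<open>auto simp: abs_mult sgn_if intro!: powr_mono2\<close>)
   qed (auto simp: borel_prod[symmetric])
   then show ?thesis unfolding g_def by (rule bdd_cpt_cmult)
  qed
  define W where "W = (LBINT x. \<bar>w x\<bar> powr p)"
  define F where "F = (LBINT x. \<bar>lap I e f x\<bar> powr p)"
  have "(p - 1) * q = p" unfolding q_def using p by simp
  then have gq: "\<bar>g x\<bar> powr q = s powr q * \<bar>w x\<bar> powr p" for x
   unfolding g_def using s by (cases "w x = 0") (auto simp: abs_mult powr_mult powr_powr sgn_if)
  have wg: "w x * g x = s * \<bar>w x\<bar> powr p" for x
  proof -
   have "\<bar>w x\<bar> * \<bar>w x\<bar> powr (p - 1) = \<bar>w x\<bar> powr p" by (simp add: powr_mult_base)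
   moreover have "w x * sgn (w x) = \<bar>w x\<bar>" by (simp add: abs_sgn)
   ultimately show ?thesis unfolding g_def by (metis mult.assoc mult.left_commute)
  qed
  have "\<bar>LBINT x. w x * g x\<bar> \<le> 16 * C * (F + (LBINT x. \<bar>g x\<bar> powr q))"
   unfolding w_def F_def using second_difference_pairing[OF I _ p _ B C f g i] i q by auto
  then have "s * W \<le> 16 * C * (F + s powr q * W)"
   unfolding gq wg W_def by simp
  then have "s * W \<le> 32 * C * F" unfolding sq using C by (simp add: field_simps)
  then have "W \<le> 32 * C / s * F" using s by (simp add: field_simps)
  then show ?thesis unfolding W_def w_def F_def .
 qed
 show ?thesis
  by (rule exI[of _ "32 * C / s"]) (use main C s in auto)
qed

section \<open>From second differences to second derivatives\<close>

definition has_dd :: "('a::real_vector => real) => 'a => ('a => real) => bool" where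
 "has_dd f v g \<longleftrightarrow> (\<forall>x t. ((\<lambda>t. f (x + t *\<^sub>R v)) has_real_derivative g (x + t *\<^sub>R v)) (at t))"

lemma has_ddD: "has_dd f v g ==> ((\<lambda>t. f (x + t *\<^sub>R v)) has_real_derivative g (x + t *\<^sub>R v)) (at t)"
 unfolding has_dd_def by blast

text \<open>Maclaurin's formula of order 2 for the even function
  \<open>w (x + t *\<^sub>R v) + w (x - t *\<^sub>R v)\<close> of \<open>t\<close>, whose first
  derivative vanishes at 0.\<close>

lemma second_difference_mean_value:
 fixes w w1 w2 :: "'a::real_vector => real"
 assumes dd: "has_dd w v w1" "has_dd w1 v w2"
  and h: "0 < h"
 shows "\<exists>z. 0 < z \<and> z < h \<and> w (x + h *\<^sub>R v) - 2 * w x + w (x - h *\<^sub>R v) = h\<^sup>2 * ((w2 (x + z *\<^sub>R v) + w2 (x - z *\<^sub>R v)) / 2)"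
proof -
 have neg: "((\<lambda>t. f (x - t *\<^sub>R v)) has_real_derivative - f' (x - t *\<^sub>R v)) (at t)"
  if "has_dd f v f'" for f f' t
  using DERIV_chain2[where f="\<lambda>t. f (x + t *\<^sub>R v)" and g=uminus and x=t and Db="-1", OF has_ddD[OF that, of x "-t"] DERIV_minus[OF DERIV_ident]]
  by simp
 define D where "D = (\<lambda>(m::nat) t. if m = 0 then w (x + t *\<^sub>R v) + w (x - t *\<^sub>R v)
   else if m = 1 then w1 (x + t *\<^sub>R v) - w1 (x - t *\<^sub>R v) else w2 (x + t *\<^sub>R v) + w2 (x - t *\<^sub>R v))"
 have "\<exists>t>0. t < h \<and> D 0 h = (\<Sum>m<2. D m 0 / fact m * h ^ m) + D 2 t / fact 2 * h ^ 2"
 proof (rule Maclaurin[OF h])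
  have "((\<lambda>t. w (x + t *\<^sub>R v) + w (x - t *\<^sub>R v)) has_real_derivative w1 (x + t *\<^sub>R v) - w1 (x - t *\<^sub>R v)) (at t)" for t
   using DERIV_add[OF has_ddD[OF dd(1), of x t] neg[OF dd(1), of t]] by simp
  moreover have "((\<lambda>t. w1 (x + t *\<^sub>R v) - w1 (x - t *\<^sub>R v)) has_real_derivative w2 (x + t *\<^sub>R v) + w2 (x - t *\<^sub>R v)) (at t)" for t
   using DERIV_diff[OF has_ddD[OF dd(2), of x t] neg[OF dd(2), of t]] by simp
  ultimately show "\<forall>m t. m < 2 \<and> 0 \<le> t \<and> t \<le> h --> (D m has_real_derivative D (Suc m) t) (at t)"
   unfolding D_def by (auto simp: less_2_cases_iff)
 qed auto
 then obtain t where t: "0 < t" "t < h" "D 0 h = (\<Sum>m<2. D m 0 / fact m * h ^ m) + D 2 t / fact 2 * h ^ 2" by blast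
 then show ?thesis
  by (intro exI[of _ t]) (simp add: D_def numeral_2_eq_2 algebra_simps)
qed

definition twice_dd :: "'i set => ('i => 'a::euclidean_space) => real => ('a => real) => ('i => 'a => real) => ('i => 'a => real) => bool" where
 "twice_dd I e R f f1 f2 \<longleftrightarrow> finite I \<and> continuous_on UNIV f \<and> (\<forall>x. R < norm x --> f x = 0) \<and>
   (\<forall>i\<in>I. has_dd f (e i) (f1 i) \<and> has_dd (f1 i) (e i) (f2 i) \<and> continuous_on UNIV (f2 i) \<and> (\<forall>x. R < norm x --> f2 i x = 0))"

text \<open>With the directions \<open>h n *\<^sub>R e j\<close> the difference estimate carries the
  factor \<open>((h n)\<^sup>2) powr p\<close> on both sides; it cancels, and dominated convergence
  applies to the quotients that remain.\<close>

lemma second_derivative_bound: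
 fixes p :: real
 assumes p: "1 < p"
 shows "\<exists>K>0. \<forall>(I::'i set) (e :: 'i => 'a::euclidean_space) i v v1 v2 R. i \<in> I --> twice_dd I e R v v1 v2 -->
   (LBINT x. \<bar>v2 i x\<bar> powr p) \<le> K * (LBINT x. \<bar>\<Sum>j\<in>I. v2 j x\<bar> powr p)"
proof -
 obtain K where K: "K > 0" and bd: "\<And>(I::'i set) (e :: 'i => 'a) i v. finite I ==> i \<in> I ==> bdd_cpt v ==>
   (LBINT x. \<bar>v (x + e i) - 2 * v x + v (x - e i)\<bar> powr p) \<le> K * (LBINT x. \<bar>lap I e v x\<bar> powr p)"
  using second_difference_bound[OF p, where ?'i='i and ?'a='a] by blast
 have "(LBINT x. \<bar>v2 i x\<bar> powr p) \<le> K * (LBINT x. \<bar>\<Sum>j\<in>I. v2 j x\<bar> powr p)"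
  if i: "i \<in> I" and dd: "twice_dd I e R v v1 v2"
  for I :: "'i set" and e :: "'i => 'a" and i v v1 v2 R
 proof -
  have I: "finite I" and c: "continuous_on UNIV v" and s: "\<And>x. R < norm x ==> v x = 0"
   and d: "\<And>i. i \<in> I ==> has_dd v (e i) (v1 i)" "\<And>i. i \<in> I ==> has_dd (v1 i) (e i) (v2 i)"
   and c2: "\<And>i. i \<in> I ==> continuous_on UNIV (v2 i)" and s2: "\<And>i x. i \<in> I ==> R < norm x ==> v2 i x = 0"
   using dd unfolding twice_dd_def by auto
  have nice: "bdd_cpt f" if f: "continuous_on UNIV f" "\<And>x. R < norm x ==> f x = 0" for f :: "'a => real"
  proof -
   have "compact (f ` cball 0 R)" by (intro compact_continuous_image continuous_on_subset[OF f(1)]) auto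
   then obtain M where M: "\<And>x. x \<in> cball 0 R ==> \<bar>f x\<bar> \<le> M"
    using compact_imp_bounded bounded_iff by (metis imageI real_norm_def)
   show ?thesis
   proof (rule bdd_cptI[where M="max M 0"])
    show "\<bar>f x\<bar> \<le> max M 0" for x using M[of x] f(2)[of x] by (cases "R < norm x") auto
   qed (use f in \<open>auto intro: borel_measurable_continuous_onI\<close>)
  qed
  have v: "bdd_cpt v" by (rule nice[OF c s])
  have v2: "bdd_cpt (v2 j)" if "j \<in> I" for j by (rule nice[OF c2 s2]) (use that in auto)
  define M where "M = (\<lambda>j. SOME M. \<forall>x. \<bar>v2 j x\<bar> \<le> M)"
  have M: "\<bar>v2 j x\<bar> \<le> M j" if "j \<in> I" for j x
  proof -
   have "\<forall>x. \<bar>v2 j x\<bar> \<le> M j"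
    unfolding M_def by (rule someI_ex) (use v2[OF that] in \<open>auto simp: bdd_cpt_def\<close>)
   then show ?thesis ..
  qed
  define h where "h = (\<lambda>n::nat. inverse (real (Suc n)))"
  have h: "0 < h n" "h n \<le> 1" for n unfolding h_def by (auto simp: inverse_le_1_iff)
  have h0: "h \<longlonglongrightarrow> 0" unfolding h_def by (rule LIMSEQ_inverse_real_of_nat)
  define w where "w = (\<lambda>j n x. (v (x + h n *\<^sub>R e j) - 2 * v x + v (x - h n *\<^sub>R e j)) / (h n)\<^sup>2)"
  have w: "\<exists>z. 0 < z \<and> z < h n \<and> w j n x = (v2 j (x + z *\<^sub>R e j) + v2 j (x - z *\<^sub>R e j)) / 2" if "j \<in> I" for j n x
   using second_difference_mean_value[OF d[OF that] h(1)[of n], of x] h(1)[of n]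
   unfolding w_def by (metis less_irrefl nonzero_mult_div_cancel_left power_eq_0_iff)
  have wlim: "(\<lambda>n. w j n x) \<longlonglongrightarrow> v2 j x" if j: "j \<in> I" for j x
  proof -
   obtain z where z: "\<And>n. 0 < z n \<and> z n < h n \<and> w j n x = (v2 j (x + z n *\<^sub>R e j) + v2 j (x - z n *\<^sub>R e j)) / 2"
    proof -
    have "\<forall>n. \<exists>z. 0 < z \<and> z < h n \<and> w j n x = (v2 j (x + z *\<^sub>R e j) + v2 j (x - z *\<^sub>R e j)) / 2"
     using w[OF j] by blast
    from choice[OF this] show thesis using that by blast
   qed
   have z0: "z \<longlonglongrightarrow> 0"
    by (rule tendsto_sandwich[OF _ _ tendsto_const h0]) (intro always_eventually allI less_imp_le conjunct1[OF z] conjunct1[OF conjunct2[OF z]])+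
   have ct: "isCont (v2 j) x" using c2[OF j] by (simp add: continuous_on_eq_continuous_at)
   have "(\<lambda>n. x + z n *\<^sub>R e j) \<longlonglongrightarrow> x + 0 *\<^sub>R e j" "(\<lambda>n. x - z n *\<^sub>R e j) \<longlonglongrightarrow> x - 0 *\<^sub>R e j"
    by (intro tendsto_intros z0)+
   then have "(\<lambda>n. x + z n *\<^sub>R e j) \<longlonglongrightarrow> x" "(\<lambda>n. x - z n *\<^sub>R e j) \<longlonglongrightarrow> x" by simp_all
   then have "(\<lambda>n. (v2 j (x + z n *\<^sub>R e j) + v2 j (x - z n *\<^sub>R e j)) / 2) \<longlonglongrightarrow> (v2 j x + v2 j x) / 2"
    by (intro tendsto_divide tendsto_add tendsto_const isCont_tendsto_compose[OF ct]) auto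
   moreover have "(\<lambda>n. w j n x) = (\<lambda>n. (v2 j (x + z n *\<^sub>R e j) + v2 j (x - z n *\<^sub>R e j)) / 2)"
    using z by blast
   ultimately show ?thesis by simp
  qed
  have wM: "\<bar>w j n x\<bar> \<le> M j" if j: "j \<in> I" for j n x
  proof -
   obtain z where "w j n x = (v2 j (x + z *\<^sub>R e j) + v2 j (x - z *\<^sub>R e j)) / 2" using w[OF j, of n x] by blast
   then show ?thesis using M[OF j, of "x + z *\<^sub>R e j"] M[OF j, of "x - z *\<^sub>R e j"] by (simp add: abs_le_iff)
  qed
  define R' where "R' = R + (\<Sum>j\<in>I. norm (e j))"
  have w0: "w j n x = 0" if j: "j \<in> I" and x: "R' < norm x" for j n x
  proof -
   have "norm (h n *\<^sub>R e j) \<le> 1 * norm (e j)" using h[of n] by (simp add: mult_right_mono mult_left_le_one_le)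
   also have "\<dots> \<le> (\<Sum>j\<in>I. norm (e j))" using member_le_sum[OF j, of "\<lambda>j. norm (e j)"] I by simp
   finally have "norm (h n *\<^sub>R e j) \<le> (\<Sum>j\<in>I. norm (e j))" .
   moreover have "norm x - norm (h n *\<^sub>R e j) \<le> norm (x + h n *\<^sub>R e j)" by (rule norm_diff_ineq)
   moreover have "norm x - norm (h n *\<^sub>R e j) \<le> norm (x - h n *\<^sub>R e j)" by (rule norm_triangle_ineq2)
   moreover have "0 \<le> norm (h n *\<^sub>R e j)" by simp
   ultimately have "R < norm (x + h n *\<^sub>R e j)" "R < norm (x - h n *\<^sub>R e j)" "R < norm x"
    using x unfolding R'_def by linarith+
   then show ?thesis unfolding w_def by (simp add: s)
  qed
  have wn: "bdd_cpt (w j n)" for j n unfolding w_def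
   by (intro bdd_cpt_intros v v[THEN bdd_cpt_shift] v[THEN bdd_cpt_shift_minus])
  have lim: "(\<lambda>n. LBINT x. \<bar>f n x\<bar> powr p) \<longlonglongrightarrow> (LBINT x. \<bar>g x\<bar> powr p)"
   if f: "\<And>n. bdd_cpt (f n)" and g: "bdd_cpt g" and fg: "\<And>x. (\<lambda>n. f n x) \<longlonglongrightarrow> g x"
    and fM: "\<And>n x. \<bar>f n x\<bar> \<le> N" and f0: "\<And>n x. R' < norm x ==> f n x = 0" for f and g :: "'a => real" and N
  proof (rule integral_dominated_convergence[where w="\<lambda>x. N powr p * indicator (cball 0 R') x"])
   show "integrable lborel (\<lambda>x. N powr p * indicator (cball 0 R') x :: real)"
    by (intro integrable_mult_right integrable_real_indicator emeasure_lborel_cball_finite) simp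
   show "AE x in lborel. (\<lambda>n. \<bar>f n x\<bar> powr p) \<longlonglongrightarrow> \<bar>g x\<bar> powr p"
    using p by (intro AE_I2 tendsto_powr2 tendsto_rabs fg tendsto_const) auto
   show "AE x in lborel. norm (\<bar>f n x\<bar> powr p) \<le> N powr p * indicator (cball 0 R') x" for n
    using p f0[of _ n] fM by (intro AE_I2) (auto simp: indicator_def intro!: powr_mono2)
  qed (use bdd_cpt_measurable[OF bdd_cpt_powr[OF f]] bdd_cpt_measurable[OF bdd_cpt_powr[OF g]] p in auto)
  have L1: "(\<lambda>n. LBINT x. \<bar>w i n x\<bar> powr p) \<longlonglongrightarrow> (LBINT x. \<bar>v2 i x\<bar> powr p)"
   by (rule lim[OF wn v2[OF i] wlim[OF i] wM[OF i] w0[OF i]])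
  have L2: "(\<lambda>n. LBINT x. \<bar>\<Sum>j\<in>I. w j n x\<bar> powr p) \<longlonglongrightarrow> (LBINT x. \<bar>\<Sum>j\<in>I. v2 j x\<bar> powr p)"
  proof (rule lim)
   show "\<bar>\<Sum>j\<in>I. w j n x\<bar> \<le> (\<Sum>j\<in>I. M j)" for n x
    by (rule order_trans[OF sum_abs]) (intro sum_mono wM)
   show "(\<Sum>j\<in>I. w j n x) = 0" if "R' < norm x" for n x using w0[OF _ that] by simp
  qed (auto intro!: tendsto_sum wlim bdd_cpt_sum wn v2)
  have le: "(LBINT x. \<bar>w i n x\<bar> powr p) \<le> K * (LBINT x. \<bar>\<Sum>j\<in>I. w j n x\<bar> powr p)" for n
  proof -
   have scale: "\<bar>y\<bar> powr p = ((h n)\<^sup>2) powr p * \<bar>y / (h n)\<^sup>2\<bar> powr p" for y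
    using h(1)[of n] by (subst powr_mult[symmetric]) (auto simp: abs_divide)
   have e1: "(LBINT x. \<bar>v (x + h n *\<^sub>R e i) - 2 * v x + v (x - h n *\<^sub>R e i)\<bar> powr p)
     = ((h n)\<^sup>2) powr p * (LBINT x. \<bar>w i n x\<bar> powr p)"
    unfolding w_def integral_mult_right_zero[symmetric]
    by (intro Bochner_Integration.integral_cong refl scale)
   have e2: "(LBINT x. \<bar>lap I (\<lambda>j. h n *\<^sub>R e j) v x\<bar> powr p)
     = ((h n)\<^sup>2) powr p * (LBINT x. \<bar>\<Sum>j\<in>I. w j n x\<bar> powr p)"
    unfolding w_def integral_mult_right_zero[symmetric] lap_def sum_divide_distrib[symmetric]
    by (intro Bochner_Integration.integral_cong refl scale)
   have "(LBINT x. \<bar>v (x + h n *\<^sub>R e i) - 2 * v x + v (x - h n *\<^sub>R e i)\<bar> powr p)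
    \<le> K * (LBINT x. \<bar>lap I (\<lambda>j. h n *\<^sub>R e j) v x\<bar> powr p)"
    by (rule bd[OF I i v])
   then have "((h n)\<^sup>2) powr p * (LBINT x. \<bar>w i n x\<bar> powr p) \<le> ((h n)\<^sup>2) powr p * (K * (LBINT x. \<bar>\<Sum>j\<in>I. w j n x\<bar> powr p))"
    unfolding e1 e2 by (simp add: mult_ac)
   moreover have "((h n)\<^sup>2) powr p > 0" using h(1)[of n] by simp
   ultimately show ?thesis by (simp only: mult_le_cancel_left_pos)
  qed
  show ?thesis by (rule LIMSEQ_le[OF L1 tendsto_mult_left[OF L2]]) (use le in auto)
 qed
 then show ?thesis using K by blast
qed

section \<open>Lebesgue spaces and convolution\<close>

text \<open>The \<open>p\<close>-th power of the norm is used until the very end, to avoid roots of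
  extended reals; each triangle inequality then costs a factor \<open>2 powr p\<close>.\<close>

definition In :: "real => ('a::euclidean_space => real) => ennreal" where
 "In p f = (\<integral>\<^sup>+x. ennreal (\<bar>f x\<bar> powr p) \<partial>lborel)"

definition Lspace :: "real => ('a::euclidean_space => real) => bool" where
 "Lspace p f \<longleftrightarrow> borel_fun f \<and> In p f < \<infinity>"

lemma Lspace_measurable [measurable_dest]: "Lspace p f ==> borel_fun f"
 unfolding Lspace_def by blast

lemma powr_abs_add_le:
 fixes a b p :: real assumes "0 < p"
 shows "\<bar>a + b\<bar> powr p \<le> 2 powr p * (\<bar>a\<bar> powr p + \<bar>b\<bar> powr p)"
proof -
 have "\<bar>a + b\<bar> powr p \<le> (2 * max \<bar>a\<bar> \<bar>b\<bar>) powr p" using assms by (intro powr_mono2) auto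
 also have "\<dots> = 2 powr p * (max \<bar>a\<bar> \<bar>b\<bar> powr p)" by (simp add: powr_mult)
 also have "\<dots> \<le> 2 powr p * (\<bar>a\<bar> powr p + \<bar>b\<bar> powr p)"
  by (intro mult_left_mono) (auto simp: max_def)
 finally show ?thesis .
qed

lemma In_add:
 assumes "0 < p" and [measurable]: "borel_fun f" "borel_fun g"
 shows "In p (\<lambda>x. f x + g x) \<le> ennreal (2 powr p) * (In p f + In p g)"
proof -
 have "In p (\<lambda>x. f x + g x) \<le> (\<integral>\<^sup>+x. ennreal (2 powr p) * (ennreal (\<bar>f x\<bar> powr p) + ennreal (\<bar>g x\<bar> powr p)) \<partial>lborel)"
  unfolding In_def using powr_abs_add_le[OF assms(1)]
  by (intro nn_integral_mono) (simp add: ennreal_mult'[symmetric] ennreal_plus[symmetric] del: ennreal_plus)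
 then show ?thesis unfolding In_def by (simp add: nn_integral_cmult nn_integral_add)
qed

lemma In_cmult:
 assumes [measurable]: "borel_fun f"
 shows "In p (\<lambda>x. c * f x) = ennreal (\<bar>c\<bar> powr p) * In p f"
 unfolding In_def by (subst nn_integral_cmult[symmetric]) (auto simp: abs_mult powr_mult ennreal_mult')

lemma In_uminus: "In p (\<lambda>x. - f x) = In p f"
 unfolding In_def by simp

lemma In_diff:
 assumes "0 < p" and [measurable]: "borel_fun f" "borel_fun g"
 shows "In p (\<lambda>x. f x - g x) \<le> ennreal (2 powr p) * (In p f + In p g)"
 using In_add[of p f "\<lambda>x. - g x"] assms by (simp add: In_uminus)

lemma In_cong_AE: "AE x in lborel. f x = g x ==> In p f = In p g"
 unfolding In_def by (intro nn_integral_cong_AE) auto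

lemma In_mono_AE:
 assumes "0 \<le> p" "AE x in lborel. \<bar>f x\<bar> \<le> \<bar>g x\<bar>"
 shows "In p f \<le> In p g"
 unfolding In_def using assms(2)
 by (intro nn_integral_mono_AE) (auto elim!: eventually_mono intro!: powr_mono2 assms(1))

lemma In_sum:
 assumes p: "0 < p" and "finite I" and m: "\<And>i. i \<in> I ==> borel_fun (f i)"
 shows "In p (\<lambda>x. \<Sum>i\<in>I. f i x) \<le> ennreal ((2 powr p) ^ card I) * (\<Sum>i\<in>I. In p (f i))"
 using assms(2) m
proof (induction I rule: finite_induct)
 case empty
 then show ?case using p by (simp add: In_def)
next
 case (insert i I)
 have 1: "1 \<le> (2 powr p) ^ card I" using p by (intro one_le_power) (auto intro: ge_one_powr_ge_zero)
 have m: "borel_fun (\<lambda>x. \<Sum>i\<in>I. f i x)" using insert by auto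
 have "In p (\<lambda>x. \<Sum>j\<in>insert i I. f j x) \<le> ennreal (2 powr p) * (In p (f i) + In p (\<lambda>x. \<Sum>j\<in>I. f j x))"
  using insert by (simp add: In_add[OF p] m)
 also have "\<dots> \<le> ennreal (2 powr p) * (ennreal ((2 powr p) ^ card I) * In p (f i) + ennreal ((2 powr p) ^ card I) * (\<Sum>i\<in>I. In p (f i)))"
 proof (intro mult_left_mono add_mono)
  have "1 * In p (f i) \<le> ennreal ((2 powr p) ^ card I) * In p (f i)"
   using 1 by (intro mult_right_mono) (auto simp: ennreal_1[symmetric] simp del: ennreal_1)
  then show "In p (f i) \<le> ennreal ((2 powr p) ^ card I) * In p (f i)" by simp
 qed (use insert in auto)
 also have "\<dots> = ennreal ((2 powr p) ^ card (insert i I)) * (\<Sum>i\<in>insert i I. In p (f i))"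
  using insert by (simp add: ring_distribs ennreal_mult mult.assoc)
 finally show ?case .
qed

lemma Lspace_add: "0 < p ==> Lspace p f ==> Lspace p g ==> Lspace p (\<lambda>x. f x + g x)"
 using In_add[of p f g] unfolding Lspace_def
 by (auto intro!: le_less_trans[OF In_add] simp: ennreal_mult_less_top)

lemma Lspace_cmult: "Lspace p f ==> Lspace p (\<lambda>x. c * f x)"
 unfolding Lspace_def by (auto simp: In_cmult ennreal_mult_less_top)

lemma Lspace_diff: "0 < p ==> Lspace p f ==> Lspace p g ==> Lspace p (\<lambda>x. f x - g x)"
 using Lspace_add[of p f "\<lambda>x. -1 * g x"] Lspace_cmult[of p g "-1"] by simp

lemma Lspace_zero: "0 < p ==> Lspace p (\<lambda>x. 0)"
 unfolding Lspace_def In_def by simp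

lemma Lspace_sum: "0 < p ==> (\<And>i. i \<in> I ==> Lspace p (f i)) ==> Lspace p (\<lambda>x. \<Sum>i\<in>I. f i x)"
 by (induction I rule: infinite_finite_induct) (auto intro: Lspace_add Lspace_zero)

lemma In_eq_integral: "bdd_cpt f ==> 0 < p ==> In p f = ennreal (LBINT x. \<bar>f x\<bar> powr p)"
 unfolding In_def by (intro nn_integral_eq_integral bdd_cpt_integrable bdd_cpt_powr) auto

lemma bdd_cpt_Lspace: "bdd_cpt f ==> 0 < p ==> Lspace p f"
 unfolding Lspace_def by (auto simp: In_eq_integral bdd_cpt_measurable)

text \<open>Fatou's lemma in the form that transfers bounds to a limit: the bounds may depend on
  \<open>n\<close>, provided that they converge.\<close>

lemma In_liminf:
 assumes [measurable]: "\<And>n. borel_fun (f n)" and p: "0 < p"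
  and lim: "AE x in lborel. (\<lambda>n. f n x) \<longlonglongrightarrow> g x" and bd: "\<And>n. In p (f n) \<le> b n" "b \<longlonglongrightarrow> c"
 shows "In p g \<le> c"
proof -
 have "In p g = (\<integral>\<^sup>+x. liminf (\<lambda>n. ennreal (\<bar>f n x\<bar> powr p)) \<partial>lborel)"
  unfolding In_def
 proof (intro nn_integral_cong_AE)
  show "AE x in lborel. ennreal (\<bar>g x\<bar> powr p) = liminf (\<lambda>n. ennreal (\<bar>f n x\<bar> powr p))"
   using lim
  proof eventually_elim
   case (elim x)
   have "(\<lambda>n. ennreal (\<bar>f n x\<bar> powr p)) \<longlonglongrightarrow> ennreal (\<bar>g x\<bar> powr p)"
    using p by (intro tendsto_ennrealI tendsto_powr2 tendsto_rabs elim tendsto_const) auto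
   then show ?case by (rule lim_imp_Liminf[OF sequentially_bot, symmetric])
  qed
 qed
 also have "\<dots> \<le> liminf (\<lambda>n. In p (f n))"
  unfolding In_def by (rule nn_integral_liminf) simp
 also have "\<dots> \<le> liminf b" by (intro Liminf_mono always_eventually allI bd(1))
 also have "\<dots> = c" by (rule lim_imp_Liminf[OF sequentially_bot bd(2)])
 finally show ?thesis .
qed

text \<open>Either \<open>\<bar>y\<bar> \<le> t\<close>, or
  \<open>\<bar>y\<bar> powr (1 - p) \<le> t powr (1 - p)\<close>. With \<open>t\<close> tuned in
  each application, this replaces Hoelder's inequality throughout.\<close>

lemma abs_le_powr_split:
 fixes y t p :: real
 assumes p: "1 \<le> p" and t: "0 < t"
 shows "\<bar>y\<bar> \<le> t + t powr (1 - p) * \<bar>y\<bar> powr p"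
proof (cases "\<bar>y\<bar> \<le> t")
 case True
 then show ?thesis using t by (intro order_trans[OF True]) simp
next
 case False
 then have "t powr (p - 1) \<le> \<bar>y\<bar> powr (p - 1)" using p t by (intro powr_mono2) auto
 then have "t powr (1 - p) * t powr (p - 1) * \<bar>y\<bar> \<le> t powr (1 - p) * \<bar>y\<bar> powr (p - 1) * \<bar>y\<bar>"
  by (intro mult_right_mono mult_left_mono) auto
 moreover have "t powr (1 - p) * t powr (p - 1) = 1" using t by (simp add: powr_add[symmetric])
 moreover have "\<bar>y\<bar> powr (p - 1) * \<bar>y\<bar> = \<bar>y\<bar> powr p" by (simp add: powr_mult_base mult.commute)
 ultimately show ?thesis using t by (simp add: mult.assoc)
qed

text \<open>A strictly positive integrable weight turns the Cauchy property in the
  \<open>p\<close>-th mean into the one in the first mean, where an a.e. convergent subsequence is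
  available. Fatou's lemma then shows that its limit is also the limit in the original
  sense.\<close>

lemma Lspace_complete:
 fixes f :: "nat => 'a::euclidean_space => real"
 assumes p: "1 \<le> p" and f: "\<And>n. Lspace p (f n)"
  and cauchy: "\<And>e. 0 < e ==> \<exists>N. \<forall>n\<ge>N. \<forall>m\<ge>N. In p (\<lambda>x. f n x - f m x) < ennreal e"
 obtains g r where "Lspace p g" "(\<lambda>n. In p (\<lambda>x. f n x - g x)) \<longlonglongrightarrow> 0"
  "strict_mono r" "AE x in lborel. (\<lambda>n. f (r n) x) \<longlonglongrightarrow> g x"
proof -
 have [measurable]: "borel_fun (f n)" for n using f by (rule Lspace_measurable)
 have p0: "0 < p" using p by simp
 obtain h :: "'a => ennreal" where h: "h \<in> borel_measurable lborel" "integral\<^sup>N lborel h \<noteq> \<infinity>" "\<And>x. 0 < h x \<and> h x < \<infinity>"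
  using sigma_finite_measure.Ex_finite_integrable_function[OF lborel.sigma_finite_measure_axioms] by auto
 define w where "w = (\<lambda>x. enn2real (min (h x) 1))"
 have [measurable]: "borel_fun w" unfolding w_def using h(1) by measurable
 have wx: "0 < w x" "w x \<le> 1" for x
  unfolding w_def using h(3)[of x] by (auto simp: enn2real_positive_iff min_less_iff_disj intro!: enn2real_leI)
 have wint: "integrable lborel w"
 proof (rule integrableI_nonneg)
  have "(\<integral>\<^sup>+x. ennreal (w x) \<partial>lborel) \<le> integral\<^sup>N lborel h"
  proof (intro nn_integral_mono)
   fix x
   have "min (h x) 1 < top" by (simp add: min_less_iff_disj)
   then show "ennreal (w x) \<le> h x" unfolding w_def by simp
  qed
  then show "(\<integral>\<^sup>+x. ennreal (w x) \<partial>lborel) < \<infinity>" using h(2) by (auto simp: less_top top.not_eq_extremum)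
 qed (use wx in \<open>auto intro: less_imp_le\<close>)
 define W where "W = (LBINT x. w x) + 1"
 have "0 \<le> (LBINT x. w x)" by (intro Bochner_Integration.integral_nonneg less_imp_le wx)
 then have W: "0 < W" "(LBINT x. w x) \<le> W" unfolding W_def by auto
 have key: "integrable lborel (\<lambda>x. g x * w x) \<and>
   (LBINT x. \<bar>g x * w x\<bar>) \<le> t * W + t powr (1 - p) * enn2real (In p g)"
  if t: "0 < t" and g: "Lspace p g" for t g
 proof -
  have [measurable]: "borel_fun g" using g by (rule Lspace_measurable)
  have gp: "integrable lborel (\<lambda>x. \<bar>g x\<bar> powr p)"
   by (rule integrableI_nonneg) (use g in \<open>auto simp: Lspace_def In_def\<close>)
  have gI: "(LBINT x. \<bar>g x\<bar> powr p) = enn2real (In p g)"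
   unfolding In_def by (subst integral_eq_nn_integral) auto
  have bd: "\<bar>g x * w x\<bar> \<le> t * w x + t powr (1 - p) * \<bar>g x\<bar> powr p" for x
  proof -
   have "\<bar>g x\<bar> * w x \<le> (t + t powr (1 - p) * \<bar>g x\<bar> powr p) * w x"
    using abs_le_powr_split[OF p t, of "g x"] wx[of x] by (intro mult_right_mono) auto
   also have "\<dots> = t * w x + (t powr (1 - p) * \<bar>g x\<bar> powr p) * w x" by (simp add: algebra_simps)
   also have "\<dots> \<le> t * w x + (t powr (1 - p) * \<bar>g x\<bar> powr p) * 1"
    using wx[of x] by (intro add_left_mono mult_left_mono) auto
   finally show ?thesis using wx[of x] by (simp add: abs_mult)
  qed
  have int: "integrable lborel (\<lambda>x. t * w x + t powr (1 - p) * \<bar>g x\<bar> powr p)"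
   using wint gp by simp
  have 1: "integrable lborel (\<lambda>x. g x * w x)"
   by (rule Bochner_Integration.integrable_bound[OF int]) (use bd in \<open>auto intro!: AE_I2 order_trans[OF bd]\<close>)
  have "(LBINT x. \<bar>g x * w x\<bar>) \<le> (LBINT x. t * w x + t powr (1 - p) * \<bar>g x\<bar> powr p)"
   using 1 int bd by (intro integral_mono) auto
  also have "\<dots> = t * (LBINT x. w x) + t powr (1 - p) * enn2real (In p g)"
   using wint gp gI by simp
  also have "\<dots> \<le> t * W + t powr (1 - p) * enn2real (In p g)" using W t by simp
  finally show ?thesis using 1 by simp
 qed
 obtain r where r: "strict_mono r" "AE x in lborel. Cauchy (\<lambda>i. f (r i) x * w x)"
 proof (rule cauchy_L1_AE_cauchy_subseq)
  show "integrable lborel (\<lambda>x. f n x * w x)" for n using key[OF zero_less_one f[of n]] by blast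
  fix e :: real assume e: "0 < e"
  \<comment> \<open>This makes the first term of \<open>key\<close> equal to \<open>e / 2\<close>;
    the next choice, of \<open>d\<close>, makes the second at most \<open>e / 4\<close>.\<close>
  define t where "t = e / (2 * W)"
  have t: "0 < t" unfolding t_def using e W by simp
  define d where "d = e / (4 * t powr (1 - p))"
  have d: "0 < d" unfolding d_def using e t by simp
  obtain N where N: "\<And>n m. n \<ge> N ==> m \<ge> N ==> In p (\<lambda>x. f n x - f m x) < ennreal d" using cauchy[OF d] by blast
  have "(LBINT x. norm (f n x * w x - f m x * w x)) < e" if "n \<ge> N" "m \<ge> N" for n m
  proof -
   have "enn2real (In p (\<lambda>x. f n x - f m x)) \<le> d" using N[OF that] d by (intro enn2real_leI) auto
   then have "t powr (1 - p) * enn2real (In p (\<lambda>x. f n x - f m x)) \<le> t powr (1 - p) * d"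
    by (intro mult_left_mono) auto
   also have "\<dots> = e / 4" unfolding d_def using t by simp
   finally have "t * W + t powr (1 - p) * enn2real (In p (\<lambda>x. f n x - f m x)) \<le> e / 2 + e / 4"
    unfolding t_def using W by simp
   then show ?thesis using key[OF t Lspace_diff[OF p0 f[of n] f[of m]]] e by (simp add: left_diff_distrib)
  qed
  then show "\<exists>N. \<forall>i\<ge>N. \<forall>j\<ge>N. (LBINT x. norm (f i x * w x - f j x * w x)) < e" by blast
 qed
 define g where "g = (\<lambda>x. lim (\<lambda>n. f (r n) x))"
 have [measurable]: "borel_fun g" unfolding g_def by measurable
 have conv: "AE x in lborel. (\<lambda>n. f (r n) x) \<longlonglongrightarrow> g x"
  using r(2)
 proof eventually_elim
  case (elim x)
  then obtain l where "(\<lambda>i. f (r i) x * w x) \<longlonglongrightarrow> l" using Cauchy_convergent convergent_def by blast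
  then have "(\<lambda>i. f (r i) x * w x / w x) \<longlonglongrightarrow> l / w x" using wx[of x] by (intro tendsto_intros) auto
  then have "(\<lambda>i. f (r i) x) \<longlonglongrightarrow> l / w x" using wx[of x] by simp
  then show ?case unfolding g_def by (metis limI)
 qed
 have small: "In p (\<lambda>x. f n x - g x) \<le> ennreal e"
  if N: "\<And>n m. n \<ge> N ==> m \<ge> N ==> In p (\<lambda>x. f n x - f m x) < ennreal e" and n: "n \<ge> N" for n N e
 proof (rule In_liminf[where f="\<lambda>k x. f n x - f (r (k + N)) x" and b="\<lambda>_. ennreal e"])
  show "AE x in lborel. (\<lambda>k. f n x - f (r (k + N)) x) \<longlonglongrightarrow> f n x - g x"
   using conv by eventually_elim (intro tendsto_intros LIMSEQ_ignore_initial_segment)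
  have "r (k + N) \<ge> N" for k using seq_suble[OF r(1), of "k + N"] by linarith
  then show "In p (\<lambda>x. f n x - f (r (k + N)) x) \<le> ennreal e" for k
   using N[OF n] by (auto intro: less_imp_le)
 qed (use p0 in auto)
 have lim: "(\<lambda>n. In p (\<lambda>x. f n x - g x)) \<longlonglongrightarrow> 0"
 proof (rule order_tendstoI)
  fix a :: ennreal assume "0 < a"
  then obtain e where e: "0 < e" "ennreal e < a"
   by (metis ennreal_zero_neq_top ennreal_less_top dense enn2real_positive_iff ennreal_enn2real order_less_trans less_top)
  obtain N where "\<And>n m. n \<ge> N ==> m \<ge> N ==> In p (\<lambda>x. f n x - f m x) < ennreal e" using cauchy[OF e(1)] by blast
  from small[OF this] e(2) show "\<forall>\<^sub>F n in sequentially. In p (\<lambda>x. f n x - g x) < a"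
   unfolding eventually_sequentially by (meson order_le_less_trans)
 qed simp
 have "Lspace p g"
 proof -
  obtain N where N: "In p (\<lambda>x. f N x - g x) \<le> ennreal 1"
   using small cauchy[OF zero_less_one] by blast
  have "In p g = In p (\<lambda>x. f N x - (f N x - g x))" by simp
  also have "\<dots> \<le> ennreal (2 powr p) * (In p (f N) + In p (\<lambda>x. f N x - g x))" by (intro In_diff p0) auto
  also have "\<dots> < \<infinity>" using f[of N] N by (auto simp: Lspace_def ennreal_mult_less_top intro: le_less_trans)
  finally show ?thesis unfolding Lspace_def by simp
 qed
 then show thesis using that lim r(1) conv by blast
qed

section \<open>Truncation and density of continuous functions\<close>

definition trunc :: "nat => ('a::euclidean_space => real) => 'a => real" where
 "trunc n f x = (if norm x \<le> real n \<and> \<bar>f x\<bar> \<le> real n then f x else 0)"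

lemma trunc_measurable [measurable]:
 fixes f :: "'a::euclidean_space => real"
 assumes [measurable]: "borel_fun f"
 shows "borel_fun (trunc n f)"
 unfolding trunc_def[abs_def] by measurable

lemma bdd_cpt_trunc: "borel_fun f ==> bdd_cpt (trunc n f)"
 by (rule bdd_cptI[where M="real n" and R="real n"]) (auto simp: trunc_def)

lemma trunc_eventually_eq: "\<forall>\<^sub>F n in sequentially. trunc n f x = f x"
proof -
 obtain N :: nat where N: "max (norm x) \<bar>f x\<bar> \<le> real N" using real_arch_simple by blast
 show ?thesis
  by (rule eventually_sequentiallyI[of N]) (use N in \<open>auto simp: trunc_def\<close>)
qed

lemma abs_trunc_le: "\<bar>trunc n f x\<bar> \<le> \<bar>f x\<bar>"
 unfolding trunc_def by auto

lemma In_tendsto_0: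
 assumes [measurable]: "\<And>n. borel_fun (u n)" "borel_fun g" and p: "0 < p"
  and g: "In p g < \<infinity>" and bd: "\<And>n. AE x in lborel. \<bar>u n x\<bar> \<le> \<bar>g x\<bar>" and lim: "AE x in lborel. (\<lambda>n. u n x) \<longlonglongrightarrow> 0"
 shows "(\<lambda>n. In p (u n)) \<longlonglongrightarrow> 0"
proof -
 have "(\<lambda>n. \<integral>\<^sup>+x. ennreal (\<bar>u n x\<bar> powr p) \<partial>lborel) \<longlonglongrightarrow> (\<integral>\<^sup>+x. ennreal (\<bar>0::real\<bar> powr p) \<partial>(lborel::'a measure))"
 proof (rule nn_integral_dominated_convergence[where w="\<lambda>x. ennreal (\<bar>g x\<bar> powr p)"])
  show "AE x in lborel. ennreal (\<bar>u n x\<bar> powr p) \<le> ennreal (\<bar>g x\<bar> powr p)" for n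
   using bd[of n] by eventually_elim (use p in \<open>auto intro!: powr_mono2\<close>)
  show "AE x in lborel. (\<lambda>n. ennreal (\<bar>u n x\<bar> powr p)) \<longlonglongrightarrow> ennreal (\<bar>0::real\<bar> powr p)"
   using lim by eventually_elim (intro tendsto_ennrealI tendsto_powr2 tendsto_rabs tendsto_const, use p in auto)
 qed (use g in \<open>auto simp: In_def\<close>)
 then show ?thesis using p unfolding In_def by simp
qed

lemma In_trunc_tendsto:
 assumes p: "0 < p" and f: "Lspace p f"
 shows "(\<lambda>n. In p (\<lambda>x. f x - trunc n f x)) \<longlonglongrightarrow> 0"
proof (rule In_tendsto_0[where g=f])
 have [measurable]: "borel_fun f" using f by (rule Lspace_measurable)
 show "AE x in lborel. \<bar>f x - trunc n f x\<bar> \<le> \<bar>f x\<bar>" for n by (auto simp: trunc_def)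
 show "AE x in lborel. (\<lambda>n. f x - trunc n f x) \<longlonglongrightarrow> 0"
 proof (rule AE_I2)
  fix x
  show "(\<lambda>n. f x - trunc n f x) \<longlonglongrightarrow> 0"
   by (rule tendsto_eventually, rule eventually_mono[OF trunc_eventually_eq[of f x]]) simp
 qed
 show "borel_fun (\<lambda>x. f x - trunc n f x)" for n by measurable
 show "borel_fun f" by fact
qed (use p f in \<open>auto simp: Lspace_def\<close>)

text \<open>A measurable function is an a.e. limit of continuous ones. Clamping these to the bounds
  of \<open>f\<close> and cutting them off beyond radius \<open>R + 1\<close> provides the
  dominating function and leaves the limit unchanged.\<close>

lemma continuous_approximation_bdd_cpt:
 fixes f :: "'a::euclidean_space => real"
 assumes p: "0 < p" and f: "bdd_cpt f"
 obtains g where "\<And>n. continuous_on UNIV (g n)" "\<And>n. bdd_cpt (g n)" "(\<lambda>n. In p (\<lambda>x. f x - g n x)) \<longlonglongrightarrow> 0"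
proof -
 obtain M R where fm: "borel_fun f" "\<And>x. \<bar>f x\<bar> \<le> M" "\<And>x. R < norm x ==> f x = 0" "0 \<le> M" "0 \<le> R"
  using bdd_cptE[OF f] by blast
 have "f \<in> borel_measurable lebesgue" by (rule measurable_completion) (simp add: fm(1))
 then have "f \<in> borel_measurable (lebesgue_on UNIV)" by simp
 then have "f measurable_on UNIV" using lebesgue_measurable_imp_measurable_on[of f UNIV] by simp
 then have "\<exists>N g. negligible N \<and> (\<forall>n. continuous_on UNIV (g n)) \<and> (\<forall>x. x \<notin> N --> (\<lambda>n. g n x) \<longlonglongrightarrow> f x)"
  unfolding measurable_on_def by simp
 then obtain N g where N: "negligible N" and g: "\<And>n. continuous_on UNIV (g n)"
  and lim: "\<And>x. x \<notin> N ==> (\<lambda>n. g n x) \<longlonglongrightarrow> f x"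
  by blast
 define c where "c = (\<lambda>x::'a. max 0 (min 1 (R + 1 - norm x)))"
 define h where "h = (\<lambda>n x. c x * max (-M) (min M (g n x)))"
 have hc: "continuous_on UNIV (h n)" for n
  unfolding h_def c_def by (intro continuous_intros g)
 have c01: "0 \<le> c x" "c x \<le> 1" for x unfolding c_def by auto
 have hM: "\<bar>h n x\<bar> \<le> M" for n x
 proof -
  have "c x * \<bar>max (-M) (min M (g n x))\<bar> \<le> 1 * M" using c01[of x] fm(4) by (intro mult_mono) auto
  then show ?thesis unfolding h_def using c01[of x] by (simp add: abs_mult)
 qed
 have h0: "h n x = 0" if "R + 1 < norm x" for n x unfolding h_def c_def using that by simp
 have hb: "bdd_cpt (h n)" for n
  by (rule bdd_cptI[OF borel_measurable_continuous_onI[OF hc] hM h0])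
 have "(\<lambda>n. In p (\<lambda>x. f x - h n x)) \<longlonglongrightarrow> 0"
 proof (rule In_tendsto_0[where g="\<lambda>x. 2 * M * indicator (cball 0 (R + 1)) x"])
  show "AE x in lborel. \<bar>f x - h n x\<bar> \<le> \<bar>2 * M * indicator (cball 0 (R + 1)) x\<bar>" for n
  proof (rule AE_I2)
   fix x
   have "\<bar>f x - h n x\<bar> \<le> M + M" using fm(2)[of x] hM[of n x] by linarith
   then show "\<bar>f x - h n x\<bar> \<le> \<bar>2 * M * indicator (cball 0 (R + 1)) x\<bar>"
    using fm(3)[of x] h0[of x n] fm(4) by (cases "norm x \<le> R + 1") auto
  qed
  have "bdd_cpt (\<lambda>x. 2 * M * indicator (cball 0 (R + 1)) x :: real)"
   by (rule bdd_cptI[where M="2 * M" and R="R + 1"]) (use fm(4) in \<open>auto simp: indicator_def\<close>)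
  from bdd_cpt_Lspace[OF this p] show "In p (\<lambda>x. 2 * M * indicator (cball 0 (R + 1)) x) < \<infinity>"
   unfolding Lspace_def by auto
  have sub: "{x. \<not> (\<lambda>n. f x - h n x) \<longlonglongrightarrow> 0} \<subseteq> N"
  proof (rule subsetI, rule ccontr)
   fix x assume x: "x \<in> {x. \<not> (\<lambda>n. f x - h n x) \<longlonglongrightarrow> 0}" "x \<notin> N"
   have "(\<lambda>n. h n x) \<longlonglongrightarrow> c x * max (-M) (min M (f x))"
    unfolding h_def by (intro tendsto_intros lim x)
   moreover have "c x * max (-M) (min M (f x)) = f x"
   proof (cases "R < norm x")
    case False
    then have "c x = 1" unfolding c_def by simp
    moreover have "max (-M) (min M (f x)) = f x" using fm(2)[of x] by (auto simp: abs_le_iff)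
    ultimately show ?thesis by simp
   qed (use fm(3)[of x] fm(4) in auto)
   ultimately have "(\<lambda>n. f x - h n x) \<longlonglongrightarrow> f x - f x" by (intro tendsto_intros) simp
   with x show False by simp
  qed
  have "AE x in lebesgue. (\<lambda>n. f x - h n x) \<longlonglongrightarrow> 0"
   by (rule AE_I'[of N]) (use N sub in \<open>auto simp: negligible_iff_null_sets\<close>)
  then show "AE x in lborel. (\<lambda>n. f x - h n x) \<longlonglongrightarrow> 0" by (simp add: AE_completion_iff)
  show "borel_fun (\<lambda>x. f x - h n x)" for n
   using fm(1) bdd_cpt_measurable[OF hb[of n]] by measurable
  show "borel_fun (\<lambda>x. 2 * M * indicator (cball 0 (R + 1)) x :: real)"
   by (intro borel_measurable_times borel_measurable_indicator) auto
 qed (use p in auto)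
 then show thesis by (rule that[OF hc hb])
qed

lemma Lspace_continuous_approximation:
 fixes f :: "'a::euclidean_space => real"
 assumes p: "0 < p" and f: "Lspace p f" and e: "0 < e"
 obtains g where "continuous_on UNIV g" "bdd_cpt g" "In p (\<lambda>x. f x - g x) < e"
proof -
 have [measurable]: "borel_fun f" using f by (rule Lspace_measurable)
 have two: "(\<lambda>n. ennreal (2 powr p) * (a n + b n)) \<longlonglongrightarrow> 0" if "a \<longlonglongrightarrow> 0" "b \<longlonglongrightarrow> 0" for a b :: "nat => ennreal"
  using ennreal_tendsto_cmult[OF _ tendsto_add[OF that], of "ennreal (2 powr p)"] by simp
 define h where "h = (\<lambda>n. trunc n f)"
 have h: "bdd_cpt (h n)" for n unfolding h_def by (intro bdd_cpt_trunc) auto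
 have ex: "\<exists>g. continuous_on UNIV g \<and> bdd_cpt g \<and> In p (\<lambda>x. h n x - g x) < ennreal (1 / Suc n)" for n
 proof -
  obtain g where g: "\<And>k. continuous_on UNIV (g k)" "\<And>k. bdd_cpt (g k)" "(\<lambda>k. In p (\<lambda>x. h n x - g k x)) \<longlonglongrightarrow> 0"
   using continuous_approximation_bdd_cpt[OF p h[of n]] by blast
  have "\<forall>\<^sub>F k in sequentially. In p (\<lambda>x. h n x - g k x) < ennreal (1 / Suc n)"
   by (rule order_tendstoD(2)[OF g(3)]) simp
  from eventually_happens'[OF sequentially_bot this] obtain k where "In p (\<lambda>x. h n x - g k x) < ennreal (1 / Suc n)" ..
  then show ?thesis using g(1)[of k] g(2)[of k] by (intro exI[of _ "g k"] conjI)
 qed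
 from choice[OF allI[OF ex]] obtain g where
  *: "\<forall>n. continuous_on UNIV (g n) \<and> bdd_cpt (g n) \<and> In p (\<lambda>x. h n x - g n x) < ennreal (1 / Suc n)" ..
 have g: "continuous_on UNIV (g n)" "bdd_cpt (g n)" "In p (\<lambda>x. h n x - g n x) < ennreal (1 / Suc n)" for n
  using *[rule_format, of n] by simp_all
 have [measurable]: "borel_fun (g n)" "borel_fun (h n)" for n
  using g(2) h by (auto dest: bdd_cpt_measurable)
 have hg: "(\<lambda>n. In p (\<lambda>x. h n x - g n x)) \<longlonglongrightarrow> 0"
 proof (rule tendsto_sandwich[OF _ _ tendsto_const])
  have "(\<lambda>n. 1 / real (Suc n)) \<longlonglongrightarrow> 0" using LIMSEQ_inverse_real_of_nat by (simp add: inverse_eq_divide)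
  then have "(\<lambda>n. ennreal (1 / real (Suc n))) \<longlonglongrightarrow> ennreal 0" by (rule tendsto_ennrealI)
  then show "(\<lambda>n. ennreal (1 / real (Suc n))) \<longlonglongrightarrow> 0" by simp
 qed (use g(3) in \<open>auto intro: less_imp_le always_eventually\<close>)
 have "(\<lambda>n. In p (\<lambda>x. f x - g n x)) \<longlonglongrightarrow> 0"
 proof (rule tendsto_sandwich[OF _ _ tendsto_const two[OF In_trunc_tendsto[OF p f] hg]])
  have "In p (\<lambda>x. f x - g n x) \<le> ennreal (2 powr p) * (In p (\<lambda>x. f x - h n x) + In p (\<lambda>x. h n x - g n x))" for n
   using In_add[OF p, of "\<lambda>x. f x - h n x" "\<lambda>x. h n x - g n x"] by simp
  then show "\<forall>\<^sub>F n in sequentially. In p (\<lambda>x. f x - g n x) \<le> ennreal (2 powr p) * (In p (\<lambda>x. f x - trunc n f x) + In p (\<lambda>x. h n x - g n x))"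
   unfolding h_def by auto
 qed auto
 from eventually_happens'[OF sequentially_bot order_tendstoD(2)[OF this e]]
 obtain n where n: "In p (\<lambda>x. f x - g n x) < e" ..
 show thesis by (rule that[OF g(1,2) n])
qed

section \<open>Local integrability, convolution and Young's inequality\<close>

definition loc_int :: "('a::euclidean_space => real) => bool" where
 "loc_int f \<longleftrightarrow> borel_fun f \<and> (\<forall>R. integrable lborel (\<lambda>x. indicator (cball 0 R) x * f x))"

lemma loc_int_measurable [measurable_dest]: "loc_int f ==> borel_fun f"
 unfolding loc_int_def by blast

lemma Lspace_loc_int:
 assumes p: "1 \<le> p" and f: "Lspace p f"
 shows "loc_int f"
proof -
 have [measurable]: "borel_fun f" using f by (rule Lspace_measurable)
 have fp: "integrable lborel (\<lambda>x. \<bar>f x\<bar> powr p)"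
  by (rule integrableI_nonneg) (use f in \<open>auto simp: Lspace_def In_def\<close>)
 have "integrable lborel (\<lambda>x. indicator (cball 0 R) x * f x)" for R
 proof (rule Bochner_Integration.integrable_bound)
  show "integrable lborel (\<lambda>x. indicator (cball 0 R) x + \<bar>f x\<bar> powr p)"
   by (intro Bochner_Integration.integrable_add fp integrable_real_indicator emeasure_lborel_cball_finite) simp
  show "AE x in lborel. norm (indicator (cball 0 R) x * f x) \<le> norm (indicator (cball 0 R) x + \<bar>f x\<bar> powr p)"
  proof (rule AE_I2)
   fix x
   show "norm (indicator (cball 0 R) x * f x) \<le> norm (indicator (cball 0 R) x + \<bar>f x\<bar> powr p)"
    using abs_le_powr_split[OF p, of 1 "f x"] by (cases "x \<in> cball 0 R") auto
  qed
  show "(\<lambda>x. indicator (cball 0 R) x * f x) \<in> borel_measurable lborel"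
   by (intro borel_measurable_times borel_measurable_indicator) auto
 qed
 then show ?thesis unfolding loc_int_def by simp
qed

lemma bdd_cpt_loc_int: "bdd_cpt f ==> loc_int f"
 by (rule Lspace_loc_int[of 1]) (auto intro: bdd_cpt_Lspace)

lemma loc_int_bounded:
 assumes "borel_fun f" "\<And>x. \<bar>f x\<bar> \<le> M"
 shows "loc_int f"
proof -
 have "bdd_cpt (\<lambda>x. indicator (cball 0 R) x * f x)" for R
  by (rule bdd_cptI[where M="\<bar>M\<bar>" and R=R])
   (use assms in \<open>auto simp: indicator_def intro: order_trans[OF _ abs_ge_self]\<close>)
 then show ?thesis unfolding loc_int_def using assms(1) by (auto intro: bdd_cpt_integrable)
qed

lemma integrable_bdd_cpt_mult:
 assumes k: "bdd_cpt k" and f: "loc_int f"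
 shows "integrable lborel (\<lambda>x. k x * f x)"
proof -
 obtain M R where km: "borel_fun k" "\<And>x. \<bar>k x\<bar> \<le> M" "\<And>x. R < norm x ==> k x = 0"
  using bdd_cptE[OF k] by metis
 have "integrable lborel (\<lambda>x. M * (indicator (cball 0 R) x * f x))"
  by (rule integrable_mult_right) (use f in \<open>simp add: loc_int_def\<close>)
 then show ?thesis
 proof (rule Bochner_Integration.integrable_bound)
  show "AE x in lborel. norm (k x * f x) \<le> norm (M * (indicator (cball 0 R) x * f x))"
  proof (rule AE_I2)
   fix x
   have "\<bar>k x\<bar> * \<bar>f x\<bar> \<le> \<bar>M\<bar> * \<bar>f x\<bar>" using km(2)[of x] by (intro mult_right_mono) auto
   then show "norm (k x * f x) \<le> norm (M * (indicator (cball 0 R) x * f x))"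
    using km(3)[of x] by (cases "norm x \<le> R") (auto simp: abs_mult)
  qed
 qed (simp add: km(1) loc_int_measurable[OF f] borel_measurable_times)
qed

lemma loc_int_add: "loc_int f ==> loc_int g ==> loc_int (\<lambda>x. f x + g x)"
 unfolding loc_int_def by (auto simp: ring_distribs)

lemma loc_int_cmult: "loc_int f ==> loc_int (\<lambda>x. c * f x)"
 unfolding loc_int_def by (auto simp: mult.left_commute)

lemma loc_int_abs: "loc_int f ==> loc_int (\<lambda>x. \<bar>f x\<bar>)"
proof -
 assume f: "loc_int f"
 have "integrable lborel (\<lambda>x. indicator (cball 0 R) x * \<bar>f x\<bar>)" for R
 proof -
  have "integrable lborel (\<lambda>x. \<bar>indicator (cball 0 R) x * f x\<bar>)"
   by (rule integrable_abs) (use f in \<open>simp add: loc_int_def\<close>)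
  then show ?thesis by (simp add: abs_mult)
 qed
 then show ?thesis using f unfolding loc_int_def by auto
qed

lemma lborel_distr_uminus_euclidean: "distr lborel borel (uminus :: 'a => 'a) = (lborel :: 'a::euclidean_space measure)"
 using lborel_affine[of "-1" "0::'a"] by (simp add: density_1)

lemma lborel_integral_reflect:
 fixes f :: "'a::euclidean_space => 'b::{banach, second_countable_topology}"
 assumes [measurable]: "borel_fun f"
 shows "(LBINT x. f (c - x)) = (LBINT x. f x)"
proof -
 have "(LBINT x. f x) = (LBINT x. f (c + x))"
  using lborel_integral_shift[of f c] by (simp add: add.commute)
 also have "\<dots> = (\<integral>x. f (c + x) \<partial>(distr lborel borel uminus))"
  by (simp only: lborel_distr_uminus_euclidean)
 also have "\<dots> = (LBINT x. f (c + (- x)))" by (rule integral_distr) auto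
 finally show ?thesis by simp
qed

lemma bdd_cpt_reflect:
 fixes k :: "'a::euclidean_space => real"
 assumes "bdd_cpt k"
 shows "bdd_cpt (\<lambda>y. k (x - y))"
proof -
 obtain M R where km: "borel_fun k" "\<And>x. \<bar>k x\<bar> \<le> M" "\<And>x. R < norm x ==> k x = 0"
  using bdd_cptE[OF assms] by metis
 show ?thesis
 proof (rule bdd_cptI)
  show "borel_fun (\<lambda>y. k (x - y))" using km(1) by measurable
  show "k (x - y) = 0" if "R + norm x < norm y" for y
   using norm_triangle_ineq2[of y x] that by (intro km(3)) (simp add: norm_minus_commute)
 qed (rule km(2))
qed

definition conv :: "('a::euclidean_space => real) => ('a => real) => 'a => real" where
 "conv k f x = (LBINT y. k (x - y) * f y)"

lemma conv_integrable: "bdd_cpt k ==> loc_int f ==> integrable lborel (\<lambda>y. k (x - y) * f y)"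
 by (intro integrable_bdd_cpt_mult bdd_cpt_reflect)

lemma conv_measurable [measurable]:
 fixes k f :: "'a::euclidean_space => real"
 assumes [measurable]: "borel_fun k" "borel_fun f"
 shows "borel_fun (conv k f)"
 unfolding conv_def[abs_def] by measurable

lemma conv_add_right: "bdd_cpt k ==> loc_int f ==> loc_int g ==> conv k (\<lambda>x. f x + g x) = (\<lambda>x. conv k f x + conv k g x)"
 unfolding conv_def by (simp add: ring_distribs conv_integrable)

lemma conv_diff_right: "bdd_cpt k ==> loc_int f ==> loc_int g ==> conv k (\<lambda>x. f x - g x) = (\<lambda>x. conv k f x - conv k g x)"
 unfolding conv_def by (simp add: right_diff_distrib conv_integrable)

lemma conv_sum_right:
 "bdd_cpt k ==> (\<And>i. i \<in> I ==> loc_int (f i)) ==> conv k (\<lambda>x. \<Sum>i\<in>I. f i x) = (\<lambda>x. \<Sum>i\<in>I. conv k (f i) x)"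
 unfolding conv_def by (simp add: sum_distrib_left conv_integrable)

lemma conv_add_left: "bdd_cpt k ==> bdd_cpt k' ==> loc_int f ==> conv (\<lambda>x. k x + k' x) f = (\<lambda>x. conv k f x + conv k' f x)"
 unfolding conv_def by (simp add: ring_distribs conv_integrable)

lemma conv_cmult_left: "conv (\<lambda>x. c * k x) f = (\<lambda>x. c * conv k f x)"
 unfolding conv_def by (simp add: mult.assoc)

lemma conv_diff_left: "bdd_cpt k ==> bdd_cpt k' ==> loc_int f ==> conv (\<lambda>x. k x - k' x) f = (\<lambda>x. conv k f x - conv k' f x)"
 unfolding conv_def by (simp add: left_diff_distrib conv_integrable)

lemma conv_sum_left:
 "(\<And>i. i \<in> I ==> bdd_cpt (k i)) ==> loc_int f ==> conv (\<lambda>x. \<Sum>i\<in>I. k i x) f = (\<lambda>x. \<Sum>i\<in>I. conv (k i) f x)"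
 unfolding conv_def by (simp add: sum_distrib_right conv_integrable)

lemma conv_commute:
 assumes [measurable]: "borel_fun k" "borel_fun f"
 shows "conv k f x = (LBINT y. k y * f (x - y))"
 unfolding conv_def using lborel_integral_reflect[of "\<lambda>y. k y * f (x - y)" x] by simp

lemma bdd_cpt_conv:
 assumes k: "bdd_cpt k" and f: "bdd_cpt f"
 shows "bdd_cpt (conv k f)"
proof -
 obtain M R where km: "borel_fun k" "\<And>x. \<bar>k x\<bar> \<le> M" "\<And>x. R < norm x ==> k x = 0" "0 \<le> M" "0 \<le> R"
  using bdd_cptE[OF k] by blast
 obtain M' R' where fm: "borel_fun f" "\<And>x. \<bar>f x\<bar> \<le> M'" "\<And>x. R' < norm x ==> f x = 0"
  using bdd_cptE[OF f] by metis
 show ?thesis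
 proof (rule bdd_cptI)
  show "borel_fun (conv k f)" using km(1) fm(1) by (rule conv_measurable)
  show "\<bar>conv k f x\<bar> \<le> (LBINT y. M * \<bar>f y\<bar>)" for x
  proof -
   have "\<bar>conv k f x\<bar> \<le> (LBINT y. \<bar>k (x - y) * f y\<bar>)" unfolding conv_def by (rule integral_abs_bound)
   also have "\<dots> \<le> (LBINT y. M * \<bar>f y\<bar>)"
    by (intro integral_mono integrable_abs conv_integrable[OF k bdd_cpt_loc_int[OF f]] integrable_mult_right bdd_cpt_integrable[OF f])
     (auto simp: abs_mult intro!: mult_right_mono km)
   finally show ?thesis .
  qed
  show "conv k f x = 0" if x: "R + R' < norm x" for x
  proof -
   have "k (x - y) * f y = 0" for y
   proof (cases "R < norm (x - y)")
    case False
    then have "R' < norm y" using x norm_triangle_ineq2[of x y] by linarith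
    then show ?thesis using fm(3) by simp
   qed (use km(3) in simp)
   then have "(\<lambda>y. k (x - y) * f y) = (\<lambda>y. 0)" by (rule ext)
   then show ?thesis unfolding conv_def by (simp only: integral_zero)
  qed
 qed
qed

text \<open>The bound \<open>abs_le_powr_split\<close> is integrated against the kernel, with
  \<open>t\<close> balancing the two terms; the missing sharpness is the factor
  \<open>2 powr p\<close>. If the convolution on the right vanishes there is no balancing value, and
  \<open>t\<close> is sent to 0 instead.\<close>

lemma Young_pointwise:
 fixes k f :: "'a::euclidean_space => real"
 assumes p: "1 \<le> p" and k: "bdd_cpt k" and f: "Lspace p f" and A: "0 < A" "(LBINT x. \<bar>k x\<bar>) \<le> A"
 shows "\<bar>conv k f x\<bar> powr p \<le> 2 powr p * A powr (p - 1) * conv (\<lambda>x. \<bar>k x\<bar>) (\<lambda>x. \<bar>f x\<bar> powr p) x"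
proof -
 have [measurable]: "borel_fun f" using f by (rule Lspace_measurable)
 have fp: "integrable lborel (\<lambda>x. \<bar>f x\<bar> powr p)"
  by (rule integrableI_nonneg) (use f in \<open>auto simp: Lspace_def In_def\<close>)
 have li: "loc_int f" by (rule Lspace_loc_int[OF p f])
 define c where "c = conv (\<lambda>x. \<bar>k x\<bar>) (\<lambda>x. \<bar>f x\<bar> powr p) x"
 have lip: "loc_int (\<lambda>x. \<bar>f x\<bar> powr p)"
  by (rule Lspace_loc_int[of 1]) (use fp in \<open>auto simp: Lspace_def In_def nn_integral_eq_integral\<close>)
 have c0: "0 \<le> c" unfolding c_def conv_def by (intro Bochner_Integration.integral_nonneg) auto
 have bound: "\<bar>conv k f x\<bar> \<le> t * A + t powr (1 - p) * c" if t: "0 < t" for t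
 proof -
  have i0: "integrable lborel (\<lambda>y. k (x - y))" by (intro bdd_cpt_integrable bdd_cpt_reflect k)
  have i1: "integrable lborel (\<lambda>y. \<bar>k (x - y)\<bar>)" by (rule integrable_abs[OF i0])
  have i2: "integrable lborel (\<lambda>y. \<bar>k (x - y)\<bar> * \<bar>f y\<bar> powr p)"
   by (rule conv_integrable[OF bdd_cpt_abs[OF k] lip])
  have "\<bar>conv k f x\<bar> \<le> (LBINT y. \<bar>k (x - y) * f y\<bar>)" unfolding conv_def by (rule integral_abs_bound)
  also have "\<dots> \<le> (LBINT y. t * \<bar>k (x - y)\<bar> + t powr (1 - p) * (\<bar>k (x - y)\<bar> * \<bar>f y\<bar> powr p))"
  proof (intro integral_mono integrable_abs conv_integrable[OF k li] Bochner_Integration.integrable_add integrable_mult_right i0 i1 i2)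
   fix y
   have "\<bar>k (x - y)\<bar> * \<bar>f y\<bar> \<le> \<bar>k (x - y)\<bar> * (t + t powr (1 - p) * \<bar>f y\<bar> powr p)"
    by (intro mult_left_mono abs_le_powr_split p t) auto
   then show "\<bar>k (x - y) * f y\<bar> \<le> t * \<bar>k (x - y)\<bar> + t powr (1 - p) * (\<bar>k (x - y)\<bar> * \<bar>f y\<bar> powr p)"
    by (simp add: abs_mult algebra_simps)
  qed
  also have "\<dots> = t * (LBINT y. \<bar>k (x - y)\<bar>) + t powr (1 - p) * c"
   unfolding c_def conv_def using i1 i2 by simp
  also have "(LBINT y. \<bar>k (x - y)\<bar>) = (LBINT y. \<bar>k y\<bar>)"
   using lborel_integral_reflect[of "\<lambda>y. \<bar>k y\<bar>" x] bdd_cpt_measurable[OF k] by simp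
  finally show ?thesis using A(2) t mult_left_mono[of "(LBINT y. \<bar>k y\<bar>)" A t] by linarith
 qed
 have "\<bar>conv k f x\<bar> powr p \<le> 2 powr p * A powr (p - 1) * c"
 proof (cases "c = 0")
  case True
  have "\<bar>conv k f x\<bar> \<le> 0 + e" if "0 < e" for e
   using bound[of "e / A"] that A True by simp
  then have "\<bar>conv k f x\<bar> \<le> 0" by (rule field_le_epsilon)
  then show ?thesis using True p by simp
 next
  case False
  then have c: "0 < c" using c0 by simp
  define t where "t = (c / A) powr (1 / p)"
  have t: "0 < t" unfolding t_def using c A by simp
  have tp: "t powr p = c / A" unfolding t_def using c A p by (simp add: powr_powr)
  have "t powr (1 - p) * c = t * (c / t powr p)" using t by (simp add: powr_diff)
  also have "\<dots> = t * A" unfolding tp using c A by simp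
  finally have "\<bar>conv k f x\<bar> \<le> 2 * t * A" using bound[OF t] by (simp add: mult_ac)
  then have "\<bar>conv k f x\<bar> powr p \<le> (2 * t * A) powr p" using p by (intro powr_mono2) auto
  also have "\<dots> = 2 powr p * (c / A) * A powr p" using t A by (simp add: powr_mult tp)
  also have "\<dots> = 2 powr p * A powr (p - 1) * c" using A by (simp add: powr_diff)
  finally show ?thesis .
 qed
 then show ?thesis unfolding c_def .
qed

text \<open>Tonelli's theorem applied to the pointwise bound: the mass of the kernel contributes one
  more factor \<open>A\<close> to \<open>A powr (p - 1)\<close>.\<close>

lemma In_conv_le:
 fixes k f :: "'a::euclidean_space => real"
 assumes p: "1 \<le> p" and k: "bdd_cpt k" and f: "Lspace p f" and A: "0 < A" "(LBINT x. \<bar>k x\<bar>) \<le> A"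
 shows "In p (conv k f) \<le> ennreal (2 powr p * A powr p) * In p f"
proof -
 have [measurable]: "borel_fun f" "borel_fun k"
  using f k by (auto dest: Lspace_measurable bdd_cpt_measurable)
 have fp: "integrable lborel (\<lambda>x. \<bar>f x\<bar> powr p)"
  by (rule integrableI_nonneg) (use f in \<open>auto simp: Lspace_def In_def\<close>)
 have lip: "loc_int (\<lambda>x. \<bar>f x\<bar> powr p)"
  by (rule Lspace_loc_int[of 1]) (use fp in \<open>auto simp: Lspace_def In_def nn_integral_eq_integral\<close>)
 have "In p (conv k f) \<le> (\<integral>\<^sup>+x. ennreal (2 powr p * A powr (p - 1)) * ennreal (conv (\<lambda>x. \<bar>k x\<bar>) (\<lambda>x. \<bar>f x\<bar> powr p) x) \<partial>lborel)"
  unfolding In_def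
 proof (rule nn_integral_mono)
  fix x
  show "ennreal (\<bar>conv k f x\<bar> powr p) \<le> ennreal (2 powr p * A powr (p - 1)) * ennreal (conv (\<lambda>x. \<bar>k x\<bar>) (\<lambda>x. \<bar>f x\<bar> powr p) x)"
   using Young_pointwise[OF p k f A, of x] by (subst ennreal_mult'[symmetric]) (auto intro: ennreal_leI)
 qed
 also have "\<dots> = ennreal (2 powr p * A powr (p - 1)) * (\<integral>\<^sup>+x. ennreal (conv (\<lambda>x. \<bar>k x\<bar>) (\<lambda>x. \<bar>f x\<bar> powr p) x) \<partial>lborel)"
  by (rule nn_integral_cmult) measurable
 also have "(\<integral>\<^sup>+x. ennreal (conv (\<lambda>x. \<bar>k x\<bar>) (\<lambda>x. \<bar>f x\<bar> powr p) x) \<partial>lborel)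
   = (\<integral>\<^sup>+x. (\<integral>\<^sup>+y. ennreal (\<bar>k (x - y)\<bar>) * ennreal (\<bar>f y\<bar> powr p) \<partial>lborel) \<partial>lborel)"
 proof (rule nn_integral_cong)
  fix x
  show "ennreal (conv (\<lambda>x. \<bar>k x\<bar>) (\<lambda>x. \<bar>f x\<bar> powr p) x) = (\<integral>\<^sup>+y. ennreal (\<bar>k (x - y)\<bar>) * ennreal (\<bar>f y\<bar> powr p) \<partial>lborel)"
   unfolding conv_def
   by (subst nn_integral_eq_integral[symmetric]) (auto simp: ennreal_mult' intro!: conv_integrable bdd_cpt_abs k lip)
 qed
 also have "\<dots> = (\<integral>\<^sup>+y. (\<integral>\<^sup>+x. ennreal (\<bar>k (x - y)\<bar>) * ennreal (\<bar>f y\<bar> powr p) \<partial>lborel) \<partial>lborel)"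
  by (rule lborel_pair.Fubini') measurable
 also have "\<dots> = (\<integral>\<^sup>+y. ennreal (LBINT x. \<bar>k x\<bar>) * ennreal (\<bar>f y\<bar> powr p) \<partial>lborel)"
 proof (rule nn_integral_cong)
  fix y
  have "(\<integral>\<^sup>+x. ennreal (\<bar>k (x - y)\<bar>) * ennreal (\<bar>f y\<bar> powr p) \<partial>lborel) = (\<integral>\<^sup>+x. ennreal (\<bar>k (x - y)\<bar>) \<partial>lborel) * ennreal (\<bar>f y\<bar> powr p)"
   by (rule nn_integral_multc) measurable
  also have "(\<integral>\<^sup>+x. ennreal (\<bar>k (x - y)\<bar>) \<partial>lborel) = ennreal (LBINT x. \<bar>k (x - y)\<bar>)"
   by (intro nn_integral_eq_integral integrable_abs bdd_cpt_integrable bdd_cpt_shift_minus k) auto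
  also have "(LBINT x. \<bar>k (x - y)\<bar>) = (LBINT x. \<bar>k x\<bar>)"
   using lborel_integral_shift[of "\<lambda>x. \<bar>k x\<bar>" "-y"] by simp
  finally show "(\<integral>\<^sup>+x. ennreal (\<bar>k (x - y)\<bar>) * ennreal (\<bar>f y\<bar> powr p) \<partial>lborel) = ennreal (LBINT x. \<bar>k x\<bar>) * ennreal (\<bar>f y\<bar> powr p)" .
 qed
 also have "\<dots> = ennreal (LBINT x. \<bar>k x\<bar>) * In p f"
  unfolding In_def by (rule nn_integral_cmult) measurable
 also have "ennreal (2 powr p * A powr (p - 1)) * (ennreal (LBINT x. \<bar>k x\<bar>) * In p f) \<le> ennreal (2 powr p * A powr (p - 1)) * (ennreal A * In p f)"
  by (intro mult_left_mono mult_right_mono ennreal_leI A) auto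
 also have "\<dots> = ennreal (2 powr p * A powr p) * In p f"
 proof -
  have "A powr (p - 1) * A = A powr p" using A by (simp add: powr_mult_base mult.commute)
  then have e: "2 powr p * A powr (p - 1) * A = 2 powr p * A powr p" by (simp add: mult.assoc)
  show ?thesis using A by (simp add: mult.assoc[symmetric] ennreal_mult'[symmetric] e)
 qed
 finally show ?thesis .
qed

lemma Lspace_conv:
 assumes p: "1 \<le> p" and k: "bdd_cpt k" and f: "Lspace p f"
 shows "Lspace p (conv k f)"
proof -
 define A where "A = \<bar>LBINT x. \<bar>k x\<bar>\<bar> + 1"
 have "0 < A" "(LBINT x. \<bar>k x\<bar>) \<le> A" unfolding A_def by linarith+
 from In_conv_le[OF p k f this] show ?thesis
  using f bdd_cpt_measurable[OF k] unfolding Lspace_def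
  by (auto intro: le_less_trans simp: ennreal_mult_less_top)
qed

text \<open>Both \<open>w\<close> and \<open>k\<close> have bounded support, so only the values of
  \<open>f\<close> on one ball enter; this justifies Fubini's theorem for an \<open>f\<close> that
  is merely locally integrable.\<close>

lemma conv_adjoint:
 fixes k f w :: "'a::euclidean_space => real"
 assumes k: "bdd_cpt k" and f: "loc_int f" and w: "bdd_cpt w"
 shows "(LBINT x. w x * conv k f x) = (LBINT y. (LBINT x. w x * k (x - y)) * f y)"
proof -
 have [measurable]: "borel_fun k" "borel_fun f" "borel_fun w"
  using k f w by (auto dest: bdd_cpt_measurable loc_int_measurable)
 obtain M R where km: "\<And>x. \<bar>k x\<bar> \<le> M" "\<And>x. R < norm x ==> k x = 0" "0 \<le> M" "0 \<le> R"
  using bdd_cptE[OF k] by metis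
 obtain M' R' where pm: "\<And>x. \<bar>w x\<bar> \<le> M'" "\<And>x. R' < norm x ==> w x = 0" "0 \<le> M'" "0 \<le> R'"
  using bdd_cptE[OF w] by metis
 define F where "F = (\<lambda>x y. w x * (k (x - y) * f y))"
 have Fm: "(\<lambda>(x, y). F x y) \<in> borel_measurable (lborel \<Otimes>\<^sub>M lborel)"
  unfolding F_def by measurable
 have Fx: "(LBINT y. F x y) = w x * conv k f x" for x unfolding F_def conv_def by simp
 define L where "L = (LBINT y. indicator (cball 0 (R + R')) y * \<bar>f y\<bar>)"
 have iL: "integrable lborel (\<lambda>y. indicator (cball 0 (R + R')) y * \<bar>f y\<bar>)"
  using loc_int_abs[OF f] unfolding loc_int_def by blast
 have Fint: "integrable (lborel \<Otimes>\<^sub>M lborel) (\<lambda>(x, y). F x y)"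
 proof (rule lborel_pair.Fubini_integrable[OF Fm])
  show "AE x in lborel. integrable lborel (\<lambda>y. case (x, y) of (x, y) => F x y)"
   unfolding F_def by (auto intro!: AE_I2 integrable_mult_right conv_integrable k f)
  show "integrable lborel (\<lambda>x. LBINT y. norm (case (x, y) of (x, y) => F x y))"
  proof (rule Bochner_Integration.integrable_bound)
   show "integrable lborel (\<lambda>x. M * L * \<bar>w x\<bar>)"
    by (intro integrable_mult_right integrable_abs bdd_cpt_integrable w)
   show "(\<lambda>x. LBINT y. norm (case (x, y) of (x, y) => F x y)) \<in> borel_measurable lborel"
    unfolding F_def by measurable
   show "AE x in lborel. norm (LBINT y. norm (case (x, y) of (x, y) => F x y)) \<le> norm (M * L * \<bar>w x\<bar>)"
   proof (rule AE_I2)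
    fix x
    have "(LBINT y. norm (F x y)) \<le> (LBINT y. (\<bar>w x\<bar> * M) * (indicator (cball 0 (R + R')) y * \<bar>f y\<bar>))"
    proof (rule integral_mono)
     show "integrable lborel (\<lambda>y. norm (F x y))"
      unfolding F_def by (intro integrable_norm integrable_mult_right conv_integrable k f)
     fix y
     show "norm (F x y) \<le> (\<bar>w x\<bar> * M) * (indicator (cball 0 (R + R')) y * \<bar>f y\<bar>)"
     proof (cases "R' < norm x \<or> R < norm (x - y)")
      case True
      then have "F x y = 0" unfolding F_def using km(2) pm(2) by auto
      then show ?thesis using km(3) by simp
     next
      case False
      then have "norm y \<le> R + R'" using norm_triangle_ineq2[of y x] by (simp add: norm_minus_commute)
      moreover have "\<bar>k (x - y)\<bar> * \<bar>f y\<bar> \<le> M * \<bar>f y\<bar>" by (intro mult_right_mono km) auto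
      then have "\<bar>w x\<bar> * (\<bar>k (x - y)\<bar> * \<bar>f y\<bar>) \<le> \<bar>w x\<bar> * (M * \<bar>f y\<bar>)" by (intro mult_left_mono) auto
      ultimately show ?thesis unfolding F_def by (simp add: abs_mult mult.assoc)
     qed
    qed (intro integrable_mult_right iL)
    also have "\<dots> = M * L * \<bar>w x\<bar>" unfolding L_def by simp
    finally show "norm (LBINT y. norm (case (x, y) of (x, y) => F x y)) \<le> norm (M * L * \<bar>w x\<bar>)" by simp
   qed
  qed
 qed
 have "(LBINT x. w x * conv k f x) = (LBINT x. (LBINT y. F x y))" by (simp add: Fx)
 also have "\<dots> = (LBINT y. (LBINT x. F x y))"
  by (rule lborel_pair.Fubini_integral[OF Fint, symmetric])
 also have "\<dots> = (LBINT y. (LBINT x. w x * k (x - y)) * f y)"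
  unfolding F_def mult.assoc[symmetric] by simp
 finally show ?thesis .
qed

section \<open>Directional derivatives of convolutions\<close>

lemma has_dd_add: "has_dd f v f' ==> has_dd g v g' ==> has_dd (\<lambda>x. f x + g x) v (\<lambda>x. f' x + g' x)"
 unfolding has_dd_def by (auto intro: DERIV_add)

lemma has_dd_diff: "has_dd f v f' ==> has_dd g v g' ==> has_dd (\<lambda>x. f x - g x) v (\<lambda>x. f' x - g' x)"
 unfolding has_dd_def by (auto intro: DERIV_diff)

lemma has_dd_mult: "has_dd f v f' ==> has_dd g v g' ==> has_dd (\<lambda>x. f x * g x) v (\<lambda>x. f' x * g x + g' x * f x)"
 unfolding has_dd_def by (auto intro: DERIV_mult)

lemma has_dd_unique: "has_dd f v g ==> has_dd f v g' ==> g = g'"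
proof
 fix x assume "has_dd f v g" "has_dd f v g'"
 from this[THEN has_ddD, of x 0] show "g x = g' x" by (auto intro: DERIV_unique)
qed

lemma has_dd_difference_quotient:
 fixes k :: "'a::real_vector => real"
 assumes d: "has_dd k v k'" and M: "\<And>x. \<bar>k' x\<bar> \<le> M" and h: "h \<noteq> 0"
 shows "\<bar>(k (x + h *\<^sub>R v) - k x) / h\<bar> \<le> M"
proof -
 have "\<exists>z. k (x + h *\<^sub>R v) - k x = h * k' (x + z *\<^sub>R v)"
 proof (cases "0 < h")
  case True
  from MVT2[OF True, of "\<lambda>t. k (x + t *\<^sub>R v)" "\<lambda>t. k' (x + t *\<^sub>R v)"] has_ddD[OF d]
  obtain z where "k (x + h *\<^sub>R v) - k (x + 0 *\<^sub>R v) = (h - 0) * k' (x + z *\<^sub>R v)" by blast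
  then show ?thesis by (intro exI[of _ z]) simp
 next
  case False
  then have "h < 0" using h by simp
  from MVT2[OF this, of "\<lambda>t. k (x + t *\<^sub>R v)" "\<lambda>t. k' (x + t *\<^sub>R v)"] has_ddD[OF d]
  obtain z where "k (x + 0 *\<^sub>R v) - k (x + h *\<^sub>R v) = (0 - h) * k' (x + z *\<^sub>R v)" by blast
  then show ?thesis by (intro exI[of _ z]) (simp add: algebra_simps)
 qed
 then obtain z where "k (x + h *\<^sub>R v) - k x = h * k' (x + z *\<^sub>R v)" by blast
 then have "(k (x + h *\<^sub>R v) - k x) / h = k' (x + z *\<^sub>R v)" using h by simp
 then show ?thesis using M by simp
qed

text \<open>The derivative falls on the kernel, so local integrability of \<open>f\<close> is
  enough. The difference quotients of the kernel are bounded by the mean value theorem and have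
  supports in a common ball.\<close>

lemma has_dd_conv:
 fixes k f :: "'a::euclidean_space => real"
 assumes d: "has_dd k v k'" and k: "bdd_cpt k" and k': "bdd_cpt k'" and f: "loc_int f"
 shows "has_dd (conv k f) v (conv k' f)"
 unfolding has_dd_def
proof (intro allI)
 fix x :: 'a and t :: real
 have [measurable]: "borel_fun k" "borel_fun k'" "borel_fun f"
  using k k' f by (auto dest: bdd_cpt_measurable loc_int_measurable)
 obtain M R where km: "\<And>x. \<bar>k x\<bar> \<le> M" "\<And>x. R < norm x ==> k x = 0" using bdd_cptE[OF k] by metis
 obtain M' where km': "\<And>x. \<bar>k' x\<bar> \<le> M'" "0 \<le> M'" using bdd_cptE[OF k'] by metis
 define F where "F = (\<lambda>t. conv k f (x + t *\<^sub>R v))"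
 define z where "z = x + t *\<^sub>R v"
 have "((\<lambda>s. (F s - F t) / (s - t)) \<longlongrightarrow> conv k' f z) (at t within {t - 1<..<t + 1})"
  unfolding tendsto_at_iff_sequentially
 proof (intro allI impI)
  fix X :: "nat => real"
  assume X: "\<forall>i. X i \<in> {t - 1<..<t + 1} - {t}" and Xt: "X \<longlonglongrightarrow> t"
  \<comment> \<open>The window of radius 1 around \<open>t\<close> keeps
    \<open>\<bar>h i\<bar>\<close> at most 1, so that one ball contains the supports of all
    quotients.\<close>
  define h where "h = (\<lambda>i. X i - t)"
  have h: "h i \<noteq> 0" "\<bar>h i\<bar> \<le> 1" for i using X[rule_format, of i] unfolding h_def by auto
  define Q where "Q = (\<lambda>i y. (k ((z - y) + h i *\<^sub>R v) - k (z - y)) / h i)"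
  have ex: "(F (X i) - F t) / (X i - t) = (LBINT y. Q i y * f y)" for i
  proof -
   have 1: "x + X i *\<^sub>R v - y = (z - y) + h i *\<^sub>R v" for y unfolding z_def h_def by (simp add: algebra_simps)
   have "F (X i) - F t = (LBINT y. k (x + X i *\<^sub>R v - y) * f y - k (z - y) * f y)"
    unfolding F_def conv_def z_def[symmetric]
    by (rule Bochner_Integration.integral_diff[symmetric]) (intro conv_integrable k f)+
   also have "\<dots> = (LBINT y. h i * (Q i y * f y))"
    unfolding 1 Q_def using h(1)[of i] by (intro Bochner_Integration.integral_cong refl) (simp add: left_diff_distrib)
   also have "\<dots> = h i * (LBINT y. Q i y * f y)" by simp
   finally show ?thesis unfolding h_def[symmetric] using h(1)[of i] by (simp add: h_def)
  qed
  have "(\<lambda>i. LBINT y. Q i y * f y) \<longlonglongrightarrow> (LBINT y. k' (z - y) * f y)"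
  proof (rule integral_dominated_convergence[where w="\<lambda>y. M' * (indicator (cball 0 (norm z + R + norm v)) y * \<bar>f y\<bar>)"])
   show "integrable lborel (\<lambda>y. M' * (indicator (cball 0 (norm z + R + norm v)) y * \<bar>f y\<bar>))"
    by (rule integrable_mult_right) (use loc_int_abs[OF f] in \<open>simp add: loc_int_def\<close>)
   show "AE y in lborel. (\<lambda>i. Q i y * f y) \<longlonglongrightarrow> k' (z - y) * f y"
   proof (rule AE_I2)
    fix y
    have "((\<lambda>t. k ((z - y) + t *\<^sub>R v)) has_real_derivative k' ((z - y) + 0 *\<^sub>R v)) (at 0)"
     by (rule has_ddD[OF d])
    then have "((\<lambda>s. (k ((z - y) + s *\<^sub>R v) - k (z - y)) / s) \<longlongrightarrow> k' (z - y)) (at 0)"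
     by (simp add: has_field_derivative_iff)
    moreover have "filterlim h (at 0) sequentially"
    proof (rule filterlim_atI)
     have "(\<lambda>i. X i - t) \<longlonglongrightarrow> t - t" by (intro tendsto_intros Xt)
     then show "h \<longlonglongrightarrow> 0" unfolding h_def by simp
    qed (use h(1) in simp)
    ultimately have "(\<lambda>i. Q i y) \<longlonglongrightarrow> k' (z - y)"
     unfolding Q_def by (rule filterlim_compose)
    then show "(\<lambda>i. Q i y * f y) \<longlonglongrightarrow> k' (z - y) * f y" by (intro tendsto_intros)
   qed
   show "AE y in lborel. norm (Q i y * f y) \<le> M' * (indicator (cball 0 (norm z + R + norm v)) y * \<bar>f y\<bar>)" for i
   proof (rule AE_I2)
    fix y
    show "norm (Q i y * f y) \<le> M' * (indicator (cball 0 (norm z + R + norm v)) y * \<bar>f y\<bar>)"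
    proof (cases "norm y \<le> norm z + R + norm v")
     case True
     have "\<bar>Q i y\<bar> \<le> M'" unfolding Q_def by (rule has_dd_difference_quotient[OF d km'(1) h(1)])
     then have "\<bar>Q i y\<bar> * \<bar>f y\<bar> \<le> M' * \<bar>f y\<bar>" by (rule mult_right_mono) simp
     then show ?thesis using True by (simp add: abs_mult)
    next
     case False
     have hv: "norm (h i *\<^sub>R v) \<le> norm v" using h(2)[of i] by (simp add: mult_left_le_one_le)
     have "norm y \<le> norm z + norm (z - y)" by (metis norm_minus_commute norm_triangle_sub)
     moreover have "norm (z - y) - norm (h i *\<^sub>R v) \<le> norm ((z - y) + h i *\<^sub>R v)" by (rule norm_diff_ineq)
     ultimately have "R < norm ((z - y) + h i *\<^sub>R v)" "R < norm (z - y)" using False hv norm_ge_zero[of v] by linarith+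
     then have "Q i y = 0" unfolding Q_def using km(2) by simp
     then show ?thesis using km'(2) by simp
    qed
   qed
   show "(\<lambda>y. Q i y * f y) \<in> borel_measurable lborel" for i unfolding Q_def by measurable
  qed measurable
  then show "((\<lambda>s. (F s - F t) / (s - t)) \<circ> X) \<longlonglongrightarrow> conv k' f z"
   unfolding o_def ex conv_def .
 qed
 then have "(F has_real_derivative conv k' f z) (at t within {t - 1<..<t + 1})"
  unfolding has_field_derivative_iff .
 then show "((\<lambda>t. conv k f (x + t *\<^sub>R v)) has_real_derivative conv k' f (x + t *\<^sub>R v)) (at t)"
  unfolding F_def z_def by (subst (asm) at_within_open) auto
qed

lemma continuous_conv:
 fixes k f :: "'a::euclidean_space => real"
 assumes c: "continuous_on UNIV k" and k: "bdd_cpt k" and f: "loc_int f"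
 shows "continuous_on UNIV (conv k f)"
 unfolding continuous_on_sequentially
proof (intro allI ballI impI)
 fix X :: "nat => 'a" and x
 assume *: "(\<forall>n. X n \<in> UNIV) \<and> X \<longlonglongrightarrow> x"
 then have X: "X \<longlonglongrightarrow> x" by simp
 have [measurable]: "borel_fun k" "borel_fun f"
  using k f by (auto dest: bdd_cpt_measurable loc_int_measurable)
 obtain M R where km: "\<And>x. \<bar>k x\<bar> \<le> M" "\<And>x. R < norm x ==> k x = 0" "0 \<le> M" using bdd_cptE[OF k] by metis
 from X have "Bseq X" by (intro convergent_imp_Bseq convergentI)
 then obtain B where B: "\<And>n. norm (X n) \<le> B" unfolding Bseq_def by auto
 have "(\<lambda>i. LBINT y. k (X i - y) * f y) \<longlonglongrightarrow> (LBINT y. k (x - y) * f y)"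
 proof (rule integral_dominated_convergence[where w="\<lambda>y. M * (indicator (cball 0 (B + R)) y * \<bar>f y\<bar>)"])
  show "integrable lborel (\<lambda>y. M * (indicator (cball 0 (B + R)) y * \<bar>f y\<bar>))"
   by (rule integrable_mult_right) (use loc_int_abs[OF f] in \<open>simp add: loc_int_def\<close>)
  show "AE y in lborel. (\<lambda>i. k (X i - y) * f y) \<longlonglongrightarrow> k (x - y) * f y"
  proof (rule AE_I2)
   fix y
   have "isCont k (x - y)" using c by (simp add: continuous_on_eq_continuous_at)
   then have "(\<lambda>i. k (X i - y)) \<longlonglongrightarrow> k (x - y)"
    by (rule isCont_tendsto_compose) (intro tendsto_intros X)
   then show "(\<lambda>i. k (X i - y) * f y) \<longlonglongrightarrow> k (x - y) * f y" by (intro tendsto_intros)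
  qed
  show "AE y in lborel. norm (k (X i - y) * f y) \<le> M * (indicator (cball 0 (B + R)) y * \<bar>f y\<bar>)" for i
  proof (rule AE_I2)
   fix y
   show "norm (k (X i - y) * f y) \<le> M * (indicator (cball 0 (B + R)) y * \<bar>f y\<bar>)"
   proof (cases "norm y \<le> B + R")
    case True
    have "\<bar>k (X i - y)\<bar> * \<bar>f y\<bar> \<le> M * \<bar>f y\<bar>" by (intro mult_right_mono km) simp
    then show ?thesis using True by (simp add: abs_mult)
   next
    case False
    have "norm y \<le> norm (X i) + norm (X i - y)" by (metis norm_minus_commute norm_triangle_sub)
    then have "R < norm (X i - y)" using False B[of i] by linarith
    then show ?thesis using km by simp
   qed
  qed
 qed measurable
 then show "(conv k f \<circ> X) \<longlonglongrightarrow> conv k f x" unfolding o_def conv_def .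
qed

lemma conv_support:
 fixes k f :: "'a::euclidean_space => real"
 assumes "\<And>x. R < norm x ==> k x = 0" "\<And>x. R' < norm x ==> f x = 0" "R + R' < norm x"
 shows "conv k f x = 0"
proof -
 have "k (x - y) * f y = 0" for y
 proof (cases "R < norm (x - y)")
  case False
  then have "R' < norm y" using assms(3) norm_triangle_ineq2[of x y] by linarith
  then show ?thesis using assms(2) by simp
 qed (use assms(1) in simp)
 then have "(\<lambda>y. k (x - y) * f y) = (\<lambda>y. 0)" by (rule ext)
 then show ?thesis unfolding conv_def by (simp only: integral_zero)
qed

section \<open>Calderon-Zygmund estimates for regular kernels\<close>

lemma continuous_bdd_cpt:
 fixes f :: "'a::euclidean_space => real"
 assumes f: "continuous_on UNIV f" and 0: "\<And>x. R < norm x ==> f x = 0"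
 shows "bdd_cpt f"
proof -
 have "compact (f ` cball 0 R)" by (intro compact_continuous_image continuous_on_subset[OF f]) auto
 then have "bounded (f ` cball 0 R)" by (rule compact_imp_bounded)
 then obtain M where M: "\<forall>y \<in> f ` cball 0 R. norm y \<le> M"
  unfolding bounded_iff by blast
 show ?thesis
 proof (rule bdd_cptI[where M="max M 0"])
  show "\<bar>f x\<bar> \<le> max M 0" for x using M 0[of x] by (cases "R < norm x") (auto simp: le_max_iff_disj)
 qed (use f 0 in \<open>auto intro: borel_measurable_continuous_onI\<close>)
qed

text \<open>A twice continuously differentiable kernel of compact support, with gradient
  \<open>D\<close> and Hessian \<open>H\<close> carried along as data, so that no derivative ever
  has to be extracted. Of the bilinearity of \<open>H\<close>, additivity, sign and symmetry are
  recorded, as used in polarization.\<close>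

definition kernel :: "('a::euclidean_space => real) => ('a => 'a => real) => ('a => 'a => 'a => real) => bool" where
 "kernel K D H \<longleftrightarrow> (\<forall>v. has_dd K v (D v)) \<and> (\<forall>v w. has_dd (D v) w (H v w)) \<and>
   continuous_on UNIV K \<and> (\<forall>v. continuous_on UNIV (D v)) \<and> (\<forall>v w. continuous_on UNIV (H v w)) \<and>
   (\<exists>R. \<forall>x. R < norm x --> K x = 0 \<and> (\<forall>v. D v x = 0) \<and> (\<forall>v w. H v w x = 0)) \<and>
   (\<forall>x v w. H v w x = H w v x) \<and> (\<forall>x u v w. H (u + v) w x = H u w x + H v w x) \<and>
   (\<forall>x v w. H (- v) w x = - H v w x)"

lemma kernel_support:
 assumes "kernel K D H"
 obtains R where "\<And>x. R < norm x ==> K x = 0" "\<And>x v. R < norm x ==> D v x = 0" "\<And>x v w. R < norm x ==> H v w x = 0"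
proof -
 from assms have "\<exists>R. \<forall>x. R < norm x --> K x = 0 \<and> (\<forall>v. D v x = 0) \<and> (\<forall>v w. H v w x = 0)"
  unfolding kernel_def by (elim conjE)
 then obtain R where R: "\<forall>x. R < norm x --> K x = 0 \<and> (\<forall>v. D v x = 0) \<and> (\<forall>v w. H v w x = 0)" ..
 show thesis by (rule that[of R]) (use R in simp_all)
qed

lemma kernelD:
 assumes K: "kernel K D H"
 shows "has_dd K v (D v)" "has_dd (D v) w (H v w)" "continuous_on UNIV K" "continuous_on UNIV (D v)" "continuous_on UNIV (H v w)"
  "bdd_cpt K" "bdd_cpt (D v)" "bdd_cpt (H v w)" "H v w x = H w v x" "H (u + v) w x = H u w x + H v w x"
  "H (- v) w x = - H v w x"
proof -
 show c: "continuous_on UNIV K" "continuous_on UNIV (D v)" "continuous_on UNIV (H v w)"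
  using K unfolding kernel_def by simp_all
 show "has_dd K v (D v)" "has_dd (D v) w (H v w)"
  using K unfolding kernel_def by simp_all
 have sym: "\<forall>x v w. H v w x = H w v x" using K unfolding kernel_def by (elim conjE)
 have add: "\<forall>x u v w. H (u + v) w x = H u w x + H v w x" using K unfolding kernel_def by (elim conjE)
 have neg: "\<forall>x v w. H (- v) w x = - H v w x" using K unfolding kernel_def by (elim conjE)
 show "H v w x = H w v x" by (rule sym[rule_format])
 show "H (u + v) w x = H u w x + H v w x" by (rule add[rule_format])
 show "H (- v) w x = - H v w x" by (rule neg[rule_format])
 obtain R where R: "\<And>x. R < norm x ==> K x = 0" "\<And>x v. R < norm x ==> D v x = 0" "\<And>x v w. R < norm x ==> H v w x = 0"
  using kernel_support[OF K] by metis
 show "bdd_cpt K" "bdd_cpt (D v)" "bdd_cpt (H v w)"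
  by (rule continuous_bdd_cpt[OF c(1) R(1)] continuous_bdd_cpt[OF c(2) R(2)] continuous_bdd_cpt[OF c(3) R(3)]; assumption)+
qed

lemma kernel_diff:
 assumes k: "kernel K D H" and k': "kernel K' D' H'"
 shows "kernel (\<lambda>x. K x - K' x) (\<lambda>v x. D v x - D' v x) (\<lambda>v w x. H v w x - H' v w x)"
proof -
 obtain R where R: "\<And>x. R < norm x ==> K x = 0" "\<And>x v. R < norm x ==> D v x = 0" "\<And>x v w. R < norm x ==> H v w x = 0"
  using kernel_support[OF k] by metis
 obtain R' where R': "\<And>x. R' < norm x ==> K' x = 0" "\<And>x v. R' < norm x ==> D' v x = 0" "\<And>x v w. R' < norm x ==> H' v w x = 0"
  using kernel_support[OF k'] by metis
 show ?thesis unfolding kernel_def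
 proof (intro conjI allI has_dd_diff continuous_on_diff kernelD[OF k] kernelD[OF k'])
  show "\<exists>R. \<forall>x. R < norm x --> K x - K' x = 0 \<and> (\<forall>v. D v x - D' v x = 0) \<and> (\<forall>v w. H v w x - H' v w x = 0)"
   by (rule exI[of _ "max R R'"]) (simp add: R R')
  show "H v w x - H' v w x = H w v x - H' w v x" for v w x
   using kernelD(9)[OF k, of v w x] kernelD(9)[OF k', of v w x] by simp
  show "H (u + v) w x - H' (u + v) w x = H u w x - H' u w x + (H v w x - H' v w x)" for u v w x
   using kernelD(10)[OF k, of u v w x] kernelD(10)[OF k', of u v w x] by simp
  show "H (- v) w x - H' (- v) w x = - (H v w x - H' v w x)" for v w x
   using kernelD(11)[OF k, of v w x] kernelD(11)[OF k', of v w x] by simp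
 qed
qed

definition klap :: "(real^'n => real^'n => real^'n => real) => real^'n => real" where
 "klap H x = (\<Sum>i\<in>UNIV. H (axis i 1) (axis i 1) x)"

lemma bdd_cpt_klap: "kernel K D H ==> bdd_cpt (klap H)"
 unfolding klap_def[abs_def] by (intro bdd_cpt_sum) (rule kernelD(8))

lemma kernel_polarization:
 assumes K: "kernel K D H"
 shows "H a a x * 2 + H b b x * 2 = H (a + b) (a + b) x + H (a - b) (a - b) x"
  "H a b x * 4 = H (a + b) (a + b) x - H (a - b) (a - b) x"
proof -
 have add: "H (u + v) w x = H u w x + H v w x" "H w (u + v) x = H w u x + H w v x" for u v w
  using kernelD(10)[OF K, of u v w x] kernelD(9)[OF K] by metis+
 have neg: "H (- v) w x = - H v w x" "H w (- v) x = - H w v x" for v w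
  using kernelD(11)[OF K, of v w x] kernelD(9)[OF K] by metis+
 have sub: "a - b = a + (- b)" by simp
 show "H a a x * 2 + H b b x * 2 = H (a + b) (a + b) x + H (a - b) (a - b) x"
  "H a b x * 4 = H (a + b) (a + b) x - H (a - b) (a - b) x"
  unfolding sub add neg kernelD(9)[OF K, of b a x] by simp_all
qed

text \<open>Over all directions \<open>axis i 1 + axis j 1\<close> and
  \<open>axis i 1 - axis j 1\<close> the pure second derivatives add up to \<open>4 * n\<close>
  times the Laplacian; the null directions that occur for \<open>i = j\<close> contribute 0. A mixed
  derivative is a quarter of the difference of two pure ones, each controlled by that sum.\<close>

lemma kernel_CZ_bdd_cpt:
 fixes p :: real
 assumes p: "1 < p"
 shows "\<exists>C>0. \<forall>K D (H :: real^'n::finite => real^'n => real^'n => real) i j f. kernel K D H --> bdd_cpt f -->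
   In p (conv (H (axis i 1) (axis j 1)) f) \<le> ennreal C * In p (conv (klap H) f)"
proof -
 define I where "I = (UNIV :: ('n \<times> 'n \<times> bool) set)"
 define e where "e = (\<lambda>(i::'n, j::'n, s). axis i 1 + (if s then axis j 1 else - axis j 1) :: real^'n)"
 obtain C where C: "C > 0" and bd: "\<And>(I::('n \<times> 'n \<times> bool) set) (e :: ('n \<times> 'n \<times> bool) => real^'n) i g g1 g2 R. i \<in> I ==> twice_dd I e R g g1 g2 ==>
   (LBINT x. \<bar>g2 i x\<bar> powr p) \<le> C * (LBINT x. \<bar>\<Sum>j\<in>I. g2 j x\<bar> powr p)"
  using second_derivative_bound[OF p, where ?'i="'n \<times> 'n \<times> bool" and ?'a="real^'n"] by blast
 define n where "n = real CARD('n)"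
 define B where "B = (2 powr p * (C + C) * (4 * n) powr p) * (1/4) powr p"
 have B: "B > 0" unfolding B_def n_def using C by simp
 have main: "In p (conv (H (axis i 1) (axis j 1)) f) \<le> ennreal B * In p (conv (klap H) f)"
  if K: "kernel K D H" and f: "bdd_cpt f" for K D and H :: "real^'n => real^'n => real^'n => real" and i j f
 proof -
  have li: "loc_int f" by (rule bdd_cpt_loc_int[OF f])
  obtain R where R: "\<And>x. R < norm x ==> K x = 0" "\<And>x v. R < norm x ==> D v x = 0" "\<And>x v w. R < norm x ==> H v w x = 0"
   using kernel_support[OF K] by metis
  obtain M' R' where R': "\<And>x. R' < norm x ==> f x = 0" using bdd_cptE[OF f] by metis
  have sum_e: "(\<Sum>i\<in>I. conv (H (e i) (e i)) f x) = 4 * n * conv (klap H) f x" for x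
  proof -
   have "(\<Sum>i\<in>I. conv (H (e i) (e i)) f x) = (\<Sum>i\<in>UNIV. \<Sum>j\<in>UNIV. \<Sum>s\<in>UNIV. conv (H (e (i, j, s)) (e (i, j, s))) f x)"
    unfolding I_def by (simp add: UNIV_Times_UNIV[symmetric] sum.cartesian_product del: UNIV_Times_UNIV)
   also have "\<dots> = (\<Sum>i\<in>UNIV. \<Sum>j\<in>UNIV. conv (\<lambda>y. H (axis i 1 + axis j 1) (axis i 1 + axis j 1) y + H (axis i 1 - axis j 1) (axis i 1 - axis j 1) y) f x)"
    unfolding e_def by (simp add: UNIV_bool conv_add_left[OF kernelD(8)[OF K] kernelD(8)[OF K] li] add.commute)
   also have "\<dots> = (\<Sum>i\<in>UNIV. \<Sum>j\<in>UNIV. conv (\<lambda>y. 2 * H (axis i 1) (axis i 1) y + 2 * H (axis j 1) (axis j 1) y) f x)"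
    by (simp only: kernel_polarization(1)[OF K, symmetric] mult.commute[of _ "2::real"])
   also have "\<dots> = (\<Sum>i\<in>UNIV. \<Sum>j\<in>UNIV. 2 * conv (H (axis i 1) (axis i 1)) f x + 2 * conv (H (axis j 1) (axis j 1)) f x)"
    by (simp only: conv_add_left[OF bdd_cpt_cmult[OF kernelD(8)[OF K]] bdd_cpt_cmult[OF kernelD(8)[OF K]] li] conv_cmult_left)
   also have "\<dots> = 4 * n * (\<Sum>i\<in>UNIV. conv (H (axis i 1) (axis i 1)) f x)"
    unfolding n_def by (simp add: sum.distrib sum_distrib_left[symmetric])
   also have "(\<Sum>i\<in>UNIV. conv (H (axis i 1) (axis i 1)) f x) = conv (klap H) f x"
    unfolding klap_def[abs_def] by (simp add: conv_sum_left[OF kernelD(8)[OF K] li])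
   finally show ?thesis .
  qed
  have pure: "In p (conv (H (e l) (e l)) f) \<le> ennreal (C * (4 * n) powr p) * In p (conv (klap H) f)" for l
  proof -
   have "(LBINT x. \<bar>conv (H (e l) (e l)) f x\<bar> powr p) \<le> C * (LBINT x. \<bar>\<Sum>j\<in>I. conv (H (e j) (e j)) f x\<bar> powr p)"
   proof (rule bd)
   show "twice_dd I e (R + R') (conv K f) (\<lambda>i. conv (D (e i)) f) (\<lambda>i. conv (H (e i) (e i)) f)"
    unfolding twice_dd_def
    by (intro ballI conjI allI impI has_dd_conv kernelD[OF K] li continuous_conv conv_support[OF R(3) R'] conv_support[OF R(1) R']) (simp add: I_def)
  qed (auto simp: I_def)
   also have "(LBINT x. \<bar>\<Sum>j\<in>I. conv (H (e j) (e j)) f x\<bar> powr p) = (4 * n) powr p * (LBINT x. \<bar>conv (klap H) f x\<bar> powr p)"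
    unfolding sum_e n_def by (simp add: abs_mult powr_mult)
   finally have "(LBINT x. \<bar>conv (H (e l) (e l)) f x\<bar> powr p) \<le> C * (4 * n) powr p * (LBINT x. \<bar>conv (klap H) f x\<bar> powr p)"
    by (simp add: mult.assoc)
   then show ?thesis
    using C p by (simp add: In_eq_integral bdd_cpt_conv kernelD(8)[OF K] bdd_cpt_klap[OF K] f ennreal_mult'[symmetric] ennreal_leI)
  qed
  define h where "h = (\<lambda>s. conv (H (e (i, j, s)) (e (i, j, s))) f)"
  have m: "borel_fun (h s)" for s
   unfolding h_def using bdd_cpt_conv[OF kernelD(8)[OF K] f] by (rule bdd_cpt_measurable)
  have hp: "In p (h s) \<le> ennreal (C * (4 * n) powr p) * In p (conv (klap H) f)" for s
   unfolding h_def by (rule pure)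
  have "conv (H (axis i 1) (axis j 1)) f = (\<lambda>x. (1/4) * (h True x - h False x))"
  proof
   fix x
   have "4 * conv (H (axis i 1) (axis j 1)) f x = conv (\<lambda>y. H (axis i 1) (axis j 1) y * 4) f x"
    by (simp only: conv_cmult_left mult.commute[of _ "4::real"])
   also have "\<dots> = h True x - h False x"
    unfolding kernel_polarization(2)[OF K] h_def e_def by (simp add: conv_diff_left[OF kernelD(8)[OF K] kernelD(8)[OF K] li])
   finally show "conv (H (axis i 1) (axis j 1)) f x = (1/4) * (h True x - h False x)"
    by simp
  qed
  then have "In p (conv (H (axis i 1) (axis j 1)) f) = ennreal ((1/4) powr p) * In p (\<lambda>x. h True x - h False x)"
   using In_cmult[of "\<lambda>x. h True x - h False x" p "1/4"] m by simp
  also have "\<dots> \<le> ennreal ((1/4) powr p) * (ennreal (2 powr p) * (ennreal (C * (4 * n) powr p) * In p (conv (klap H) f) + ennreal (C * (4 * n) powr p) * In p (conv (klap H) f)))"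
   using p by (intro mult_left_mono order_trans[OF In_diff] add_mono hp m) auto
  also have "\<dots> = ennreal B * In p (conv (klap H) f)"
  proof -
   define a where "a = C * (4 * n) powr p"
   have a: "0 \<le> a" unfolding a_def using C by simp
   have "ennreal a * X + ennreal a * X = ennreal (a + a) * X" for X
    by (simp only: distrib_right[symmetric] ennreal_plus[OF a a])
   then have "ennreal ((1/4) powr p) * (ennreal (2 powr p) * (ennreal a * X + ennreal a * X)) = ennreal ((1/4) powr p * (2 powr p * (a + a))) * X" for X
    using a by (simp add: ennreal_mult' mult.assoc)
   moreover have "(1/4) powr p * (2 powr p * (a + a)) = B" unfolding B_def a_def by (simp add: algebra_simps)
   ultimately show ?thesis unfolding a_def by simp
  qed
  finally show ?thesis .
 qed
 show ?thesis by (rule exI[of _ B], intro conjI allI impI B) (rule main)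
qed

lemma conv_trunc_tendsto:
 fixes k f :: "'a::euclidean_space => real"
 assumes k: "bdd_cpt k" and f: "loc_int f"
 shows "(\<lambda>n. conv k (trunc n f) x) \<longlonglongrightarrow> conv k f x"
 unfolding conv_def
proof (rule integral_dominated_convergence[where w="\<lambda>y. \<bar>k (x - y) * f y\<bar>"])
 have [measurable]: "borel_fun k" "borel_fun f"
  using k f by (auto dest: bdd_cpt_measurable loc_int_measurable)
 show "integrable lborel (\<lambda>y. \<bar>k (x - y) * f y\<bar>)" by (intro integrable_abs conv_integrable k f)
 show "AE y in lborel. (\<lambda>n. k (x - y) * trunc n f y) \<longlonglongrightarrow> k (x - y) * f y"
  by (intro AE_I2 tendsto_mult tendsto_const tendsto_eventually trunc_eventually_eq)
 show "AE y in lborel. norm (k (x - y) * trunc n f y) \<le> \<bar>k (x - y) * f y\<bar>" for n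
  by (intro AE_I2) (auto simp: abs_mult intro!: mult_left_mono abs_trunc_le)
 show "(\<lambda>y. k (x - y) * f y) \<in> borel_measurable lborel" by measurable
 show "(\<lambda>y. k (x - y) * trunc n f y) \<in> borel_measurable lborel" for n by measurable
qed

lemma tendsto_ennreal_affine:
 fixes c d a :: ennreal
 assumes "c < \<infinity>" "d < \<infinity>" "u \<longlonglongrightarrow> 0"
 shows "(\<lambda>n. c * (a + d * u n)) \<longlonglongrightarrow> c * a"
proof -
 have "(\<lambda>n. d * u n) \<longlonglongrightarrow> d * 0" using assms by (intro ennreal_tendsto_cmult) auto
 then have "(\<lambda>n. a + d * u n) \<longlonglongrightarrow> a + d * 0" by (intro tendsto_add tendsto_const)
 then have "(\<lambda>n. c * (a + d * u n)) \<longlonglongrightarrow> c * (a + d * 0)" using assms by (intro ennreal_tendsto_cmult) auto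
 then show ?thesis by simp
qed

text \<open>\<open>f\<close> is truncated: Fatou's lemma handles the left side, Young's inequality
  the right. The constant of the latter depends on the kernel, but it multiplies a null sequence
  only, so the final constant is the same for all kernels.\<close>

lemma kernel_CZ:
 fixes p :: real
 assumes p: "1 < p"
 shows "\<exists>C>0. \<forall>K D (H :: real^'n::finite => real^'n => real^'n => real) i j f. kernel K D H --> Lspace p f -->
   In p (conv (H (axis i 1) (axis j 1)) f) \<le> ennreal C * In p (conv (klap H) f)"
proof -
 obtain C where C: "C > 0" and bd: "\<And>K D (H :: real^'n => real^'n => real^'n => real) i j f. kernel K D H ==> bdd_cpt f ==>
   In p (conv (H (axis i 1) (axis j 1)) f) \<le> ennreal C * In p (conv (klap H) f)"
  using kernel_CZ_bdd_cpt[OF p, where ?'n='n] by blast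
 have p1: "1 \<le> p" "0 < p" using p by auto
 have main: "In p (conv (H (axis i 1) (axis j 1)) f) \<le> ennreal (C * 2 powr p) * In p (conv (klap H) f)"
  if K: "kernel K D H" and f: "Lspace p f" for K D and H :: "real^'n => real^'n => real^'n => real" and i j f
 proof -
  have [measurable]: "borel_fun f" using f by (rule Lspace_measurable)
  have li: "loc_int f" by (rule Lspace_loc_int[OF p1(1) f])
  have kl: "bdd_cpt (klap H)" by (rule bdd_cpt_klap[OF K])
  have [measurable]: "borel_fun (klap H)" using kl by (rule bdd_cpt_measurable)
  have tr: "bdd_cpt (trunc n f)" for n by (intro bdd_cpt_trunc) measurable
  define A where "A = \<bar>LBINT x. \<bar>klap H x\<bar>\<bar> + 1"
  have A: "0 < A" "(LBINT x. \<bar>klap H x\<bar>) \<le> A" unfolding A_def by linarith+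
  show ?thesis
  proof (rule In_liminf)
   show "AE x in lborel. (\<lambda>n. conv (H (axis i 1) (axis j 1)) (trunc n f) x) \<longlonglongrightarrow> conv (H (axis i 1) (axis j 1)) f x"
    by (intro AE_I2 conv_trunc_tendsto kernelD[OF K] li)
   show "borel_fun (conv (H (axis i 1) (axis j 1)) (trunc n f))" for n
    by (intro bdd_cpt_measurable[OF bdd_cpt_conv] kernelD[OF K] tr)
   show "(\<lambda>n. ennreal (C * 2 powr p) * (In p (conv (klap H) f) + ennreal (2 powr p * A powr p) * In p (\<lambda>x. f x - trunc n f x)))
     \<longlonglongrightarrow> ennreal (C * 2 powr p) * In p (conv (klap H) f)"
    by (intro tendsto_ennreal_affine In_trunc_tendsto p1 f) auto
   fix n
   have d: "conv (klap H) (trunc n f) = (\<lambda>x. conv (klap H) f x - conv (klap H) (\<lambda>x. f x - trunc n f x) x)"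
    unfolding conv_diff_right[OF kl li bdd_cpt_loc_int[OF tr]] by simp
   have fd: "Lspace p (\<lambda>x. f x - trunc n f x)" by (intro Lspace_diff p1 f bdd_cpt_Lspace tr)
   have "In p (conv (H (axis i 1) (axis j 1)) (trunc n f)) \<le> ennreal C * In p (conv (klap H) (trunc n f))"
    by (rule bd[OF K tr])
   also have "In p (conv (klap H) (trunc n f)) \<le> ennreal (2 powr p) * (In p (conv (klap H) f) + In p (conv (klap H) (\<lambda>x. f x - trunc n f x)))"
    unfolding d by (intro In_diff p1 conv_measurable) measurable
   also have "In p (conv (klap H) (\<lambda>x. f x - trunc n f x)) \<le> ennreal (2 powr p * A powr p) * In p (\<lambda>x. f x - trunc n f x)"
    by (rule In_conv_le[OF p1(1) kl fd A])
   finally show "In p (conv (H (axis i 1) (axis j 1)) (trunc n f)) \<le>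
     ennreal (C * 2 powr p) * (In p (conv (klap H) f) + ennreal (2 powr p * A powr p) * In p (\<lambda>x. f x - trunc n f x))"
    using C by (simp add: mult_left_mono add_left_mono ennreal_mult' mult.assoc)
  qed (use p1 in auto)
 qed
 show ?thesis by (rule exI[of _ "C * 2 powr p"], intro conjI allI impI) (use C in simp, rule main)
qed

section \<open>Dilations and approximate identities\<close>

definition dilate :: "real => ('a::euclidean_space => real) => 'a => real" where
 "dilate e a x = a ((1 / e) *\<^sub>R x) / e ^ DIM('a)"

lemma lborel_integral_scale:
 fixes f :: "'a::euclidean_space => real"
 assumes [measurable]: "borel_fun f" and c: "0 < c"
 shows "(LBINT x. f x) = c ^ DIM('a) * (LBINT x. f (c *\<^sub>R x))"
proof -
 have "(LBINT x. f x) = (\<integral>x. f x \<partial>(density (distr lborel borel (\<lambda>x. 0 + c *\<^sub>R x)) (\<lambda>_. ennreal (\<bar>c\<bar> ^ DIM('a)))))"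
  using lborel_affine[of c "0::'a"] c by simp
 also have "\<dots> = (\<integral>x. (c ^ DIM('a)) *\<^sub>R f x \<partial>(distr lborel borel (\<lambda>x. 0 + c *\<^sub>R x)))"
  using c by (subst integral_density) auto
 also have "\<dots> = (LBINT x. (c ^ DIM('a)) *\<^sub>R f (c *\<^sub>R x))"
  by (subst integral_distr) auto
 finally show ?thesis by simp
qed

lemma dilate_support:
 assumes "\<And>x. R < norm x ==> a x = 0" "0 < e" "e * R < norm x"
 shows "dilate e a x = 0"
proof -
 have "R < norm ((1 / e) *\<^sub>R x)" using assms(2,3) by (simp add: field_simps)
 then show ?thesis unfolding dilate_def using assms(1) by simp
qed

lemma bdd_cpt_dilate:
 fixes a :: "'a::euclidean_space => real"
 assumes a: "bdd_cpt a" and e: "0 < e"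
 shows "bdd_cpt (dilate e a)"
proof -
 obtain M R where am: "borel_fun a" "\<And>x. \<bar>a x\<bar> \<le> M" "\<And>x. R < norm x ==> a x = 0"
  using bdd_cptE[OF a] by metis
 show ?thesis
 proof (rule bdd_cptI)
  show "borel_fun (dilate e a)" unfolding dilate_def[abs_def] using am(1) by measurable
  show "\<bar>dilate e a x\<bar> \<le> M / e ^ DIM('a)" for x
   unfolding dilate_def using am(2) e by (simp add: abs_divide divide_right_mono)
  show "dilate e a x = 0" if "e * R < norm x" for x by (rule dilate_support[OF am(3) e that])
 qed
qed

lemma integral_abs_dilate:
 fixes a :: "'a::euclidean_space => real"
 assumes a: "bdd_cpt a" and e: "0 < e"
 shows "(LBINT x. \<bar>dilate e a x\<bar>) = (LBINT x. \<bar>a x\<bar>)"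
proof -
 have [measurable]: "borel_fun a" using a by (rule bdd_cpt_measurable)
 have "(LBINT x. \<bar>dilate e a x\<bar>) = e ^ DIM('a) * (LBINT x. \<bar>dilate e a (e *\<^sub>R x)\<bar>)"
  by (rule lborel_integral_scale[OF _ e]) (use bdd_cpt_dilate[OF a e] in \<open>auto dest: bdd_cpt_measurable\<close>)
 also have "\<dots> = (LBINT x. \<bar>a x\<bar>)" unfolding dilate_def using e by (simp add: abs_divide)
 finally show ?thesis .
qed

lemma conv_dilate:
 fixes a g :: "'a::euclidean_space => real"
 assumes a: "bdd_cpt a" and g: "borel_fun g" and e: "0 < e"
 shows "conv (dilate e a) g x = (LBINT z. a z * g (x - e *\<^sub>R z))"
proof -
 have [measurable]: "borel_fun a" "borel_fun g" "borel_fun (dilate e a)"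
  using a g bdd_cpt_dilate[OF a e] by (auto dest: bdd_cpt_measurable)
 have "conv (dilate e a) g x = (LBINT y. dilate e a y * g (x - y))" by (rule conv_commute) measurable
 also have "\<dots> = e ^ DIM('a) * (LBINT z. dilate e a (e *\<^sub>R z) * g (x - e *\<^sub>R z))"
  by (rule lborel_integral_scale[OF _ e]) measurable
 also have "\<dots> = (LBINT z. a z * g (x - e *\<^sub>R z))" unfolding dilate_def using e by simp
 finally show ?thesis .
qed

lemma conv_dilate_continuous_tendsto:
 fixes a g :: "'a::euclidean_space => real"
 assumes p: "0 < p" and a: "bdd_cpt a" and g: "continuous_on UNIV g" "bdd_cpt g"
  and e: "\<And>n. 0 < e n" "\<And>n. e n \<le> 1" "e \<longlonglongrightarrow> 0"
 shows "(\<lambda>n. In p (\<lambda>x. conv (dilate (e n) a) g x - (LBINT z. a z) * g x)) \<longlonglongrightarrow> 0"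
proof -
 have [measurable]: "borel_fun a" "borel_fun g"
  using a g by (auto dest: bdd_cpt_measurable)
 obtain M R where am: "\<And>x. R < norm x ==> a x = 0" "0 \<le> R" using bdd_cptE[OF a] by metis
 obtain N S where gm: "\<And>x. \<bar>g x\<bar> \<le> N" "\<And>x. S < norm x ==> g x = 0" "0 \<le> N" using bdd_cptE[OF g(2)] by metis
 define A where "A = (LBINT z. \<bar>a z\<bar>)"
 have A: "0 \<le> A" unfolding A_def by simp
 have aint: "integrable lborel (\<lambda>z. \<bar>a z\<bar>)" by (intro integrable_abs bdd_cpt_integrable a)
 show ?thesis
 proof (rule In_tendsto_0[where g="\<lambda>x. 2 * A * N * indicator (cball 0 (R + S)) x"])
  show "borel_fun (\<lambda>x. conv (dilate (e n) a) g x - (LBINT z. a z) * g x)" for n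
   using bdd_cpt_measurable[OF bdd_cpt_conv[OF bdd_cpt_dilate[OF a e(1)] g(2)]] by measurable
  show "(\<lambda>x. 2 * A * N * indicator (cball 0 (R + S)) x :: real) \<in> borel_measurable (borel :: 'a measure)"
   by (intro borel_measurable_times borel_measurable_indicator) auto
  have "bdd_cpt (\<lambda>x. 2 * A * N * indicator (cball 0 (R + S)) x :: real)"
   by (rule bdd_cptI[where M="2 * A * N" and R="R + S"]) (use A gm(3) in \<open>auto simp: indicator_def\<close>)
  from bdd_cpt_Lspace[OF this p]
  show "In p (\<lambda>x. 2 * A * N * indicator (cball 0 (R + S)) x :: real) < \<infinity>" unfolding Lspace_def by blast
  show "AE x in lborel. \<bar>conv (dilate (e n) a) g x - (LBINT z. a z) * g x\<bar> \<le> \<bar>2 * A * N * indicator (cball 0 (R + S)) x\<bar>" for n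
  proof (rule AE_I2)
   fix x
   show "\<bar>conv (dilate (e n) a) g x - (LBINT z. a z) * g x\<bar> \<le> \<bar>2 * A * N * indicator (cball 0 (R + S)) x\<bar>"
   proof (cases "norm x \<le> R + S")
    case True
    have "\<bar>conv (dilate (e n) a) g x\<bar> \<le> (LBINT z. \<bar>a z * g (x - e n *\<^sub>R z)\<bar>)"
     unfolding conv_dilate[OF a \<open>borel_fun g\<close> e(1)] by (rule integral_abs_bound)
    also have "\<dots> \<le> (LBINT z. \<bar>a z\<bar> * N)"
    proof (rule integral_mono_AE')
     show "integrable lborel (\<lambda>z. \<bar>a z\<bar> * N)" using aint by simp
     show "AE z in lborel. \<bar>a z * g (x - e n *\<^sub>R z)\<bar> \<le> \<bar>a z\<bar> * N"
      by (intro AE_I2) (auto simp: abs_mult intro!: mult_left_mono gm)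
    qed (use gm(3) in \<open>auto intro!: AE_I2\<close>)
    also have "\<dots> = A * N" unfolding A_def by simp
    finally have 1: "\<bar>conv (dilate (e n) a) g x\<bar> \<le> A * N" .
    have "\<bar>LBINT z. a z\<bar> \<le> A" unfolding A_def by (rule integral_abs_bound)
    then have "\<bar>(LBINT z. a z) * g x\<bar> \<le> A * N" unfolding abs_mult using A by (intro mult_mono gm) auto
    then show ?thesis using 1 True A gm(3) by simp
   next
    case False
    have "e n * R \<le> 1 * R" using e(2) am(2) by (intro mult_right_mono) auto
    then have lt: "e n * R + S < norm x" using False by simp
    have "conv (dilate (e n) a) g x = 0"
     by (rule conv_support[OF dilate_support[OF am(1) e(1)] gm(2) lt])
    moreover have "g x = 0" using False am(2) by (intro gm(2)) simp
    ultimately show ?thesis by simp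
   qed
  qed
  show "AE x in lborel. (\<lambda>n. conv (dilate (e n) a) g x - (LBINT z. a z) * g x) \<longlonglongrightarrow> 0"
  proof (rule AE_I2)
   fix x
   have "(\<lambda>n. LBINT z. a z * g (x - e n *\<^sub>R z)) \<longlonglongrightarrow> (LBINT z. a z * g x)"
   proof (rule integral_dominated_convergence[where w="\<lambda>z. \<bar>a z\<bar> * N"])
    show "integrable lborel (\<lambda>z. \<bar>a z\<bar> * N)" using aint by simp
    show "AE z in lborel. (\<lambda>n. a z * g (x - e n *\<^sub>R z)) \<longlonglongrightarrow> a z * g x"
    proof (rule AE_I2)
     fix z
     have "(\<lambda>n. x - e n *\<^sub>R z) \<longlonglongrightarrow> x - 0 *\<^sub>R z" by (intro tendsto_intros e)
     then have "(\<lambda>n. x - e n *\<^sub>R z) \<longlonglongrightarrow> x" by simp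
     moreover have "isCont g x" using g(1) by (simp add: continuous_on_eq_continuous_at)
     ultimately have "(\<lambda>n. g (x - e n *\<^sub>R z)) \<longlonglongrightarrow> g x" by (rule isCont_tendsto_compose[rotated])
     then show "(\<lambda>n. a z * g (x - e n *\<^sub>R z)) \<longlonglongrightarrow> a z * g x" by (intro tendsto_intros)
    qed
    show "AE z in lborel. norm (a z * g (x - e n *\<^sub>R z)) \<le> \<bar>a z\<bar> * N" for n
     by (intro AE_I2) (auto simp: abs_mult intro!: mult_left_mono gm)
   qed measurable
   then have "(\<lambda>n. conv (dilate (e n) a) g x) \<longlonglongrightarrow> (LBINT z. a z) * g x"
    by (simp add: conv_dilate[OF a \<open>borel_fun g\<close> e(1)])
   then have "(\<lambda>n. conv (dilate (e n) a) g x - (LBINT z. a z) * g x) \<longlonglongrightarrow> (LBINT z. a z) * g x - (LBINT z. a z) * g x"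
    by (intro tendsto_intros)
   then show "(\<lambda>n. conv (dilate (e n) a) g x - (LBINT z. a z) * g x) \<longlonglongrightarrow> 0" by simp
  qed
 qed (rule p)
qed

lemma ennreal_tendsto_0I:
 fixes u :: "nat => ennreal"
 assumes "\<And>d. 0 < d ==> \<exists>c. c \<longlonglongrightarrow> 0 \<and> (\<forall>n. u n \<le> ennreal M * (ennreal d + c n))" and M: "0 < M"
 shows "u \<longlonglongrightarrow> 0"
proof (rule order_tendstoI)
 fix a :: ennreal assume a: "0 < a"
 obtain e where e: "0 < e" "ennreal e < a"
  using a by (metis ennreal_zero_neq_top ennreal_less_top dense enn2real_positive_iff ennreal_enn2real order_less_trans less_top)
 define d where "d = e / (2 * M)"
 have d: "0 < d" unfolding d_def using e M by simp
 obtain c where c: "c \<longlonglongrightarrow> 0" "\<And>n. u n \<le> ennreal M * (ennreal d + c n)" using assms(1)[OF d] by blast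
 have "\<forall>\<^sub>F n in sequentially. c n < ennreal d" by (rule order_tendstoD(2)[OF c(1)]) (use d in simp)
 then show "\<forall>\<^sub>F n in sequentially. u n < a"
 proof eventually_elim
  case (elim n)
  have "u n \<le> ennreal M * (ennreal d + ennreal d)"
   using elim by (intro order_trans[OF c(2)] mult_left_mono add_left_mono) auto
  also have "\<dots> = ennreal (M * (d + d))" using M d by (simp only: ennreal_plus[symmetric] ennreal_mult'[symmetric] less_imp_le)
  also have "M * (d + d) = e" unfolding d_def using M by (simp add: field_simps)
  finally show ?case using e(2) by simp
 qed
qed simp

text \<open>The operators are bounded uniformly in \<open>n\<close>, so convergence on the dense
  class of continuous, compactly supported functions extends to all. It serves shrinking dilations,
  where \<open>a\<close> is the mass of the profile, and spreading ones, where \<open>a\<close> is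
  0.\<close>

lemma conv_tendsto_dense:
 fixes f :: "'a::euclidean_space => real"
 assumes p: "1 \<le> p" and f: "Lspace p f" and k: "\<And>n. bdd_cpt (k n)" "\<And>n. (LBINT x. \<bar>k n x\<bar>) \<le> A" and A: "0 < A"
  and base: "\<And>g. continuous_on UNIV g ==> bdd_cpt g ==> (\<lambda>n. In p (\<lambda>x. conv (k n) g x - a * g x)) \<longlonglongrightarrow> 0"
 shows "(\<lambda>n. In p (\<lambda>x. conv (k n) f x - a * f x)) \<longlonglongrightarrow> 0"
proof -
 have p0: "0 < p" using p by simp
 define M where "M = 2 powr p * (2 powr p * A powr p + 2 powr p * (\<bar>a\<bar> powr p + 1))"
 have M: "0 < M" unfolding M_def by (intro mult_pos_pos add_nonneg_pos) auto
 show ?thesis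
 proof (rule ennreal_tendsto_0I[OF _ M])
  fix d :: real assume d: "0 < d"
  obtain g where g: "continuous_on UNIV g" "bdd_cpt g" "In p (\<lambda>x. f x - g x) < ennreal d"
   using Lspace_continuous_approximation[OF p0 f, of "ennreal d"] d by auto
  note [measurable] = Lspace_measurable[OF f] bdd_cpt_measurable[OF g(2)] bdd_cpt_measurable[OF k(1)]
  have lg: "Lspace p g" by (rule bdd_cpt_Lspace[OF g(2) p0])
  have lfg: "Lspace p (\<lambda>x. f x - g x)" by (rule Lspace_diff[OF p0 f lg])
  define c where "c = (\<lambda>n. In p (\<lambda>x. conv (k n) g x - a * g x))"
  have "In p (\<lambda>x. conv (k n) f x - a * f x) \<le> ennreal M * (ennreal d + c n)" for n
  proof -
   let ?I = "In p (\<lambda>x. f x - g x)" and ?D = "ennreal d + c n"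
   have split: "conv (k n) f x - a * f x = conv (k n) (\<lambda>x. f x - g x) x + ((conv (k n) g x - a * g x) + (- a) * (f x - g x))" for x
    unfolding conv_diff_right[OF k(1) Lspace_loc_int[OF p f] Lspace_loc_int[OF p lg]] by (simp add: algebra_simps)
   have "In p (\<lambda>x. conv (k n) f x - a * f x) \<le> ennreal (2 powr p) * (In p (conv (k n) (\<lambda>x. f x - g x)) + In p (\<lambda>x. (conv (k n) g x - a * g x) + (- a) * (f x - g x)))"
    unfolding split by (intro In_add p0) measurable
   also have "\<dots> \<le> ennreal (2 powr p) * (ennreal (2 powr p * A powr p) * ?I + ennreal (2 powr p) * (c n + ennreal (\<bar>a\<bar> powr p) * ?I))"
   proof (intro mult_left_mono add_mono In_conv_le[OF p k(1) lfg A k(2)])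
    have "In p (\<lambda>x. (- a) * (f x - g x)) = ennreal (\<bar>- a\<bar> powr p) * ?I" by (rule In_cmult) measurable
    then show "In p (\<lambda>x. (conv (k n) g x - a * g x) + (- a) * (f x - g x)) \<le> ennreal (2 powr p) * (c n + ennreal (\<bar>a\<bar> powr p) * ?I)"
     using In_add[of p "\<lambda>x. conv (k n) g x - a * g x" "\<lambda>x. (- a) * (f x - g x)"] p0 unfolding c_def by simp
   qed auto
   also have "\<dots> \<le> ennreal (2 powr p) * (ennreal (2 powr p * A powr p) * ?D + ennreal (2 powr p) * (1 * ?D + ennreal (\<bar>a\<bar> powr p) * ?D))"
    using g(3) by (intro mult_left_mono add_mono) (auto intro: order_trans[OF less_imp_le] add_increasing2 add_increasing)
   also have "\<dots> = ennreal M * ?D"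
   proof -
    have "ennreal M = ennreal (2 powr p) * (ennreal (2 powr p * A powr p) + ennreal (2 powr p) * (ennreal (\<bar>a\<bar> powr p) + 1))"
     unfolding M_def by (simp add: ennreal_mult')
    then show ?thesis by (simp add: algebra_simps)
   qed
   finally show ?thesis .
  qed
  then show "\<exists>c. c \<longlonglongrightarrow> 0 \<and> (\<forall>n. In p (\<lambda>x. conv (k n) f x - a * f x) \<le> ennreal M * (ennreal d + c n))"
   using base[OF g(1,2)] unfolding c_def by blast
 qed
qed

lemma integral_abs_dilate_le:
 assumes "bdd_cpt a" "0 < e"
 shows "(LBINT x. \<bar>dilate e a x\<bar>) \<le> (LBINT z. \<bar>a z\<bar>) + 1"
 unfolding integral_abs_dilate[OF assms] by simp

lemma conv_dilate_tendsto:
 fixes a f :: "'a::euclidean_space => real"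
 assumes p: "1 \<le> p" and a: "bdd_cpt a" and f: "Lspace p f"
  and e: "\<And>n. 0 < e n" "\<And>n. e n \<le> 1" "e \<longlonglongrightarrow> 0"
 shows "(\<lambda>n. In p (\<lambda>x. conv (dilate (e n) a) f x - (LBINT z. a z) * f x)) \<longlonglongrightarrow> 0"
proof (rule conv_tendsto_dense[OF p f bdd_cpt_dilate[OF a e(1)] integral_abs_dilate_le[OF a e(1)]])
 show "(\<lambda>n. In p (\<lambda>x. conv (dilate (e n) a) g x - (LBINT z. a z) * g x)) \<longlonglongrightarrow> 0" if "continuous_on UNIV g" "bdd_cpt g" for g
  by (rule conv_dilate_continuous_tendsto[OF _ a that e]) (use p in simp)
qed (simp add: add_nonneg_pos)

lemma In_dilate:
 fixes a :: "'a::euclidean_space => real" and p r :: real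
 assumes a: "bdd_cpt a" and p: "0 < p" and r: "0 < r"
 shows "In p (dilate r a) = ennreal (r powr (real DIM('a) * (1 - p)) * (LBINT x. \<bar>a x\<bar> powr p))"
proof -
 note [measurable] = bdd_cpt_measurable[OF bdd_cpt_dilate[OF a r]]
 have "(LBINT x. \<bar>dilate r a x\<bar> powr p) = r ^ DIM('a) * (LBINT x. \<bar>dilate r a (r *\<^sub>R x)\<bar> powr p)"
  by (rule lborel_integral_scale[OF _ r]) measurable
 also have "(\<lambda>x. \<bar>dilate r a (r *\<^sub>R x)\<bar> powr p) = (\<lambda>x. (1 / r ^ DIM('a)) powr p * \<bar>a x\<bar> powr p)"
  unfolding dilate_def using r by (simp add: fun_eq_iff abs_divide powr_divide)
 also have "r ^ DIM('a) * (LBINT x. (1 / r ^ DIM('a)) powr p * \<bar>a x\<bar> powr p) = r ^ DIM('a) * (1 / r ^ DIM('a)) powr p * (LBINT x. \<bar>a x\<bar> powr p)"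
  by simp
 also have "r ^ DIM('a) * (1 / r ^ DIM('a)) powr p = r powr (real DIM('a) * (1 - p))"
  using r by (simp add: powr_realpow[symmetric] powr_divide powr_powr powr_diff[symmetric] algebra_simps)
 finally show ?thesis unfolding In_eq_integral[OF bdd_cpt_dilate[OF a r] p] by simp
qed

text \<open>On the dense class the roles in Young's inequality are exchanged: the mass is that of
  \<open>g\<close>, and the \<open>p\<close>-integral of the spread profile decays like
  \<open>r n powr (DIM('a) * (1 - p))\<close>. This is where \<open>p > 1\<close> matters.\<close>

lemma conv_dilate_tendsto_0:
 fixes a f :: "'a::euclidean_space => real"
 assumes p: "1 < p" and a: "bdd_cpt a" and f: "Lspace p f"
  and r: "\<And>n. 1 \<le> r n" "filterlim r at_top sequentially"
 shows "(\<lambda>n. In p (conv (dilate (r n) a) f)) \<longlonglongrightarrow> 0"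
proof -
 have p1: "0 < p" "1 \<le> p" using p by auto
 have r0: "0 < r n" for n using r(1)[of n] by linarith
 note bd = bdd_cpt_dilate[OF a r0]
 have "(\<lambda>n. In p (\<lambda>x. conv (dilate (r n) a) f x - 0 * f x)) \<longlonglongrightarrow> 0"
 proof (rule conv_tendsto_dense[OF p1(2) f bd integral_abs_dilate_le[OF a r0]])
  fix g :: "'a => real" assume g: "bdd_cpt g"
  define L where "L = (LBINT y. \<bar>g y\<bar>) + 1"
  have L: "0 < L" "(LBINT y. \<bar>g y\<bar>) \<le> L" unfolding L_def by (simp_all add: add_nonneg_pos)
  define I where "I = (LBINT x. \<bar>a x\<bar> powr p)"
  have B: "In p (\<lambda>x. conv (dilate (r n) a) g x - 0 * g x) \<le> ennreal (2 powr p * L powr p * I * r n powr (real DIM('a) * (1 - p)))" for n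
  proof -
   have "conv (dilate (r n) a) g = conv g (dilate (r n) a)"
    using conv_commute[OF bdd_cpt_measurable[OF bd] bdd_cpt_measurable[OF g]] unfolding conv_def by (simp add: mult.commute)
   then have "In p (\<lambda>x. conv (dilate (r n) a) g x - 0 * g x) \<le> ennreal (2 powr p * L powr p) * In p (dilate (r n) a)"
    using In_conv_le[OF p1(2) g bdd_cpt_Lspace[OF bd p1(1)] L] by simp
   then show ?thesis unfolding In_dilate[OF a p1(1) r0] I_def by (simp add: ennreal_mult'[symmetric] ac_simps)
  qed
  have "(\<lambda>n. r n powr (real DIM('a) * (1 - p))) \<longlonglongrightarrow> 0"
   by (rule tendsto_neg_powr[OF _ r(2)]) (use p in \<open>simp add: mult_pos_neg\<close>)
  from tendsto_ennrealI[OF tendsto_mult_right_zero[OF this]]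
  have L: "(\<lambda>n. ennreal (2 powr p * L powr p * I * r n powr (real DIM('a) * (1 - p)))) \<longlonglongrightarrow> 0" by simp
  show "(\<lambda>n. In p (\<lambda>x. conv (dilate (r n) a) g x - 0 * g x)) \<longlonglongrightarrow> 0"
   by (rule tendsto_sandwich[OF always_eventually always_eventually tendsto_const L]) (use B in simp_all)
 qed (simp add: add_nonneg_pos)
 then show ?thesis by simp
qed

section \<open>Truncated Newtonian kernels\<close>

text \<open>The profile of \<open>1 / norm x\<close> in the variable
  \<open>s = x \<bullet> x\<close>. Up to \<open>s = 1\<close> it is replaced by its second order
  Taylor polynomial at 1, so that the two pieces match to second order; \<open>k1\<close> and
  \<open>k2\<close> are the derivatives.\<close>

definition k0 :: "real => real" where "k0 s = (if s \<le> 1 then (15 - 10 * s + 3 * s\<^sup>2) / 8 else s powr (-1/2))"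
definition k1 :: "real => real" where "k1 s = (if s \<le> 1 then (- 10 + 6 * s) / 8 else - (1/2) * s powr (-3/2))"
definition k2 :: "real => real" where "k2 s = (if s \<le> 1 then 3/4 else (3/4) * s powr (-5/2))"

lemma DERIV_If_le:
 fixes f g :: "real => real"
 assumes f: "\<And>s. (f has_real_derivative f' s) (at s)" and g: "\<And>s. 0 < s ==> (g has_real_derivative g' s) (at s)"
  and c: "0 < c" and eq: "f c = g c" "f' c = g' c"
 shows "((\<lambda>s. if s \<le> c then f s else g s) has_real_derivative (if s \<le> c then f' s else g' s)) (at s)"
proof -
 let ?h = "\<lambda>s. if s \<le> c then f s else g s"
 consider "s < c" | "s > c" | "s = c" by linarith
 then show ?thesis
 proof cases
  case 1
  then have "\<forall>\<^sub>F x in nhds s. ?h x = f x"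
   by (intro eventually_nhds[THEN iffD2] exI[of _ "{..<c}"]) auto
  from DERIV_cong_ev[OF refl this refl] show ?thesis using f[of s] 1 by simp
 next
  case 2
  then have "\<forall>\<^sub>F x in nhds s. ?h x = g x"
   by (intro eventually_nhds[THEN iffD2] exI[of _ "{c<..}"]) auto
  from DERIV_cong_ev[OF refl this refl] show ?thesis using g[of s] 2 c by simp
 next
  case 3
  have "((\<lambda>y. (?h y - ?h c) / (y - c)) \<longlongrightarrow> f' c) (at c)"
  proof (rule filterlim_split_at)
   have "((\<lambda>y. (f y - f c) / (y - c)) \<longlongrightarrow> f' c) (at_left c)"
    using f[of c] unfolding has_field_derivative_iff by (rule filterlim_mono) (auto simp: at_le)
   then show "((\<lambda>y. (?h y - ?h c) / (y - c)) \<longlongrightarrow> f' c) (at_left c)"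
    by (rule Lim_transform_eventually) (auto simp: eventually_at_filter)
   have "((\<lambda>y. (g y - g c) / (y - c)) \<longlongrightarrow> g' c) (at_right c)"
    using g[OF c] unfolding has_field_derivative_iff by (rule filterlim_mono) (auto simp: at_le)
   then show "((\<lambda>y. (?h y - ?h c) / (y - c)) \<longlongrightarrow> f' c) (at_right c)"
    unfolding eq by (rule Lim_transform_eventually) (auto simp: eventually_at_filter eq)
  qed
  then show ?thesis unfolding 3 has_field_derivative_iff by simp
 qed
qed

lemma DERIV_k0: "(k0 has_real_derivative k1 s) (at s)"
proof -
 have "((\<lambda>s. (15 - 10 * s + 3 * s\<^sup>2) / 8) has_real_derivative (- 10 + 6 * s) / 8) (at s)" for s :: real
  by (auto intro!: derivative_eq_intros)
 moreover have "((\<lambda>s. s powr (-1/2)) has_real_derivative - (1/2) * s powr (-3/2)) (at s)" if "0 < s" for s :: real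
  using has_real_derivative_powr[OF that, of "-1/2"] by simp
 ultimately show ?thesis
  unfolding k0_def[abs_def] k1_def by (rule DERIV_If_le) auto
qed

lemma DERIV_k1: "(k1 has_real_derivative k2 s) (at s)"
proof -
 have "((\<lambda>s. (- 10 + 6 * s) / 8) has_real_derivative 3/4) (at s)" for s :: real
  by (auto intro!: derivative_eq_intros)
 moreover have "((\<lambda>s. - (1/2) * s powr (-3/2)) has_real_derivative (3/4) * s powr (-5/2)) (at s)" if "0 < s" for s :: real
  using DERIV_cmult[OF has_real_derivative_powr[OF that, of "-3/2"], of "-1/2"] by simp
 ultimately show ?thesis
  unfolding k1_def[abs_def] k2_def by (rule DERIV_If_le) auto
qed

lemma continuous_k: "continuous_on UNIV k0" "continuous_on UNIV k1" "continuous_on UNIV k2"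
proof -
 show "continuous_on UNIV k0" "continuous_on UNIV k1"
  using DERIV_k0 DERIV_k1 by (auto intro: DERIV_continuous_on)
 have "continuous_on ({..1} \<union> {1..}) (\<lambda>s::real. if s \<le> 1 then 3/4 else (3/4) * s powr (-5/2))"
  by (rule continuous_on_If) (auto intro!: continuous_intros)
 moreover have "{..1} \<union> {1..} = (UNIV :: real set)" by auto
 ultimately show "continuous_on UNIV k2" unfolding k2_def[abs_def] by simp
qed

text \<open>For a function of \<open>s = x \<bullet> x\<close> in three dimensions the Laplacian is
  \<open>4 * s\<close> times the second plus 6 times the first derivative. It vanishes beyond 1,
  where the profile is harmonic, and is affine in \<open>s\<close> inside.\<close>

lemma k_laplacian: "4 * s * k2 s + 6 * k1 s = - (15/2) * max 0 (1 - s)"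
proof (cases "s \<le> 1")
 case False
 then have "s powr (-3/2) = s * s powr (-5/2)" using powr_mult_base[of s "-5/2"] by simp
 then show ?thesis using False unfolding k1_def k2_def by simp
qed (simp add: k1_def k2_def field_simps)

definition kap :: "real => 'a::euclidean_space => real" where
 "kap e x = k0 ((x \<bullet> x) / e\<^sup>2) / e"
definition kapD :: "real => 'a::euclidean_space => 'a => real" where
 "kapD e v x = k1 ((x \<bullet> x) / e\<^sup>2) * (2 * (x \<bullet> v)) / e ^ 3"
definition kapH :: "real => 'a::euclidean_space => 'a => 'a => real" where
 "kapH e v w x = k2 ((x \<bullet> x) / e\<^sup>2) * (4 * (x \<bullet> v) * (x \<bullet> w)) / e ^ 5 + k1 ((x \<bullet> x) / e\<^sup>2) * (2 * (w \<bullet> v)) / e ^ 3"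

lemma DERIV_inner_line: "((\<lambda>t. ((x + t *\<^sub>R w) \<bullet> (x + t *\<^sub>R w)) / c) has_real_derivative 2 * ((x + t *\<^sub>R w) \<bullet> w) / c) (at t)"
proof -
 have "((\<lambda>t. x \<bullet> x + 2 * t * (x \<bullet> w) + t\<^sup>2 * (w \<bullet> w)) has_real_derivative 2 * (x \<bullet> w) + 2 * t * (w \<bullet> w)) (at t)"
  by (auto intro!: derivative_eq_intros)
 from DERIV_cdivide[OF this, of c] show ?thesis by (simp add: algebra_simps power2_eq_square inner_commute)
qed

lemma has_dd_kap: "has_dd (kap e) v (kapD e v)"
 unfolding has_dd_def
proof (intro allI)
 fix x :: 'a and t :: real
 show "((\<lambda>t. kap e (x + t *\<^sub>R v)) has_real_derivative kapD e v (x + t *\<^sub>R v)) (at t)"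
  using DERIV_cdivide[OF DERIV_chain2[OF DERIV_k0 DERIV_inner_line[of x v "e\<^sup>2" t]], of e]
  unfolding kap_def kapD_def by (simp add: power3_eq_cube power2_eq_square)
qed

lemma has_dd_kapD: "has_dd (kapD e v) w (kapH e v w)"
 unfolding has_dd_def
proof (intro allI)
 fix x :: 'a and t :: real
 let ?y = "x + t *\<^sub>R w"
 have lin: "((\<lambda>t. 2 * ((x + t *\<^sub>R w) \<bullet> v)) has_real_derivative 2 * (w \<bullet> v)) (at t)"
 proof -
  have "((\<lambda>t. 2 * (x \<bullet> v + t * (w \<bullet> v))) has_real_derivative 2 * (w \<bullet> v)) (at t)"
   by (auto intro!: derivative_eq_intros)
  then show ?thesis by (simp add: inner_add_left)
 qed
 have "((\<lambda>t. k1 (((x + t *\<^sub>R w) \<bullet> (x + t *\<^sub>R w)) / e\<^sup>2) * (2 * ((x + t *\<^sub>R w) \<bullet> v)) / e ^ 3) has_real_derivative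
   (k2 ((?y \<bullet> ?y) / e\<^sup>2) * (2 * (?y \<bullet> w) / e\<^sup>2) * (2 * (?y \<bullet> v)) + 2 * (w \<bullet> v) * k1 ((?y \<bullet> ?y) / e\<^sup>2)) / e ^ 3) (at t)"
  by (rule DERIV_cdivide[OF DERIV_mult[OF DERIV_chain2[OF DERIV_k1 DERIV_inner_line[of x w "e\<^sup>2" t]] lin]])
 moreover have "(k2 ((?y \<bullet> ?y) / e\<^sup>2) * (2 * (?y \<bullet> w) / e\<^sup>2) * (2 * (?y \<bullet> v)) + 2 * (w \<bullet> v) * k1 ((?y \<bullet> ?y) / e\<^sup>2)) / e ^ 3 = kapH e v w ?y"
 proof -
  have "e ^ 5 = e\<^sup>2 * e ^ 3" by (simp add: power_add[symmetric])
  then show ?thesis unfolding kapH_def add_divide_distrib by (simp add: mult_ac)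
 qed
 ultimately show "((\<lambda>t. kapD e v (x + t *\<^sub>R w)) has_real_derivative kapH e v w (x + t *\<^sub>R w)) (at t)"
  unfolding kapD_def by simp
qed

lemma continuous_kap:
 "continuous_on UNIV (kap e)" "continuous_on UNIV (kapD e v)" "continuous_on UNIV (kapH e v w)"
proof -
 have c: "continuous_on UNIV (\<lambda>x. k ((x \<bullet> x) / e\<^sup>2))" if "continuous_on UNIV k" for k :: "real => real"
  by (rule continuous_on_compose2[OF that]) (auto intro!: continuous_intros simp: divide_inverse)
 show "continuous_on UNIV (kap e)" "continuous_on UNIV (kapD e v)" "continuous_on UNIV (kapH e v w)"
  unfolding kap_def[abs_def] kapD_def[abs_def] kapH_def[abs_def] divide_inverse[of _ e] divide_inverse[of _ "e ^ 3"] divide_inverse[of _ "e ^ 5"]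
  by (intro continuous_intros c[OF continuous_k(1)] c[OF continuous_k(2)] c[OF continuous_k(3)])+
qed

text \<open>Outside the ball of radius \<open>e\<close> the profile is the Newtonian one, so it no longer depends on \<open>e\<close>.\<close>

lemma kap_outside:
 fixes x :: "'a::euclidean_space"
 assumes e: "0 < e" and x: "e < norm x"
 shows "kap e x = (x \<bullet> x) powr (-1/2)" "kapD e v x = - ((x \<bullet> v) * (x \<bullet> x) powr (-3/2))"
  "kapH e v w x = 3 * (x \<bullet> v) * (x \<bullet> w) * (x \<bullet> x) powr (-5/2) - (w \<bullet> v) * (x \<bullet> x) powr (-3/2)"
proof -
 have "e\<^sup>2 < (norm x)\<^sup>2" using e x by (intro power_strict_mono) auto
 then have s: "1 < (x \<bullet> x) / e\<^sup>2" using e by (simp add: power2_norm_eq_inner)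
 have pw: "((x \<bullet> x) / e\<^sup>2) powr c = (x \<bullet> x) powr c * e powr (- 2 * c)" for c
 proof -
  have "(e\<^sup>2) powr c = (e powr 2) powr c" using e by simp
  also have "\<dots> = e powr (2 * c)" by (rule powr_powr)
  finally have "(e\<^sup>2) powr c = e powr (2 * c)" .
  moreover have "((x \<bullet> x) / e\<^sup>2) powr c = (x \<bullet> x) powr c / (e\<^sup>2) powr c" by (rule powr_divide)
  ultimately show ?thesis by (simp add: powr_minus divide_inverse)
 qed
 have e1: "e powr 1 = e" "e powr 3 = e ^ 3" "e powr 5 = e ^ 5" using e by simp_all
 show "kap e x = (x \<bullet> x) powr (-1/2)"
  unfolding kap_def k0_def using s e by (simp add: pw e1)
 show "kapD e v x = - ((x \<bullet> v) * (x \<bullet> x) powr (-3/2))"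
  unfolding kapD_def k1_def using s e by (simp add: pw e1)
 show "kapH e v w x = 3 * (x \<bullet> v) * (x \<bullet> w) * (x \<bullet> x) powr (-5/2) - (w \<bullet> v) * (x \<bullet> x) powr (-3/2)"
  unfolding kapH_def k1_def k2_def using s e by (simp add: pw e1)
qed

text \<open>Neither term has compact support, but both agree with the Newtonian kernel outside the
  larger of the two balls.\<close>

lemma kernel_kap_diff:
 assumes e: "0 < e" and r: "0 < r"
 shows "kernel (\<lambda>x::'a::euclidean_space. kap e x - kap r x) (\<lambda>v x. kapD e v x - kapD r v x) (\<lambda>v w x. kapH e v w x - kapH r v w x)"
 unfolding kernel_def
proof (intro conjI allI has_dd_diff has_dd_kap has_dd_kapD continuous_on_diff continuous_kap)
 show "\<exists>R. \<forall>x::'a. R < norm x --> kap e x - kap r x = 0 \<and> (\<forall>v. kapD e v x - kapD r v x = 0) \<and> (\<forall>v w. kapH e v w x - kapH r v w x = 0)"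
  by (rule exI[of _ "max e r"]) (simp add: kap_outside e r)
qed (simp_all add: kapH_def algebra_simps inner_commute add_divide_distrib diff_divide_distrib)

text \<open>Minus the Laplacian of \<open>kap 1\<close>, read off from \<open>k_laplacian\<close>;
  its dilations form an approximate identity up to the factor \<open>alpha\<close>.\<close>

definition bump_a :: "real^3 => real" where
 "bump_a x = (15/2) * max 0 (1 - x \<bullet> x)"

lemma bdd_cpt_bump_a: "bdd_cpt bump_a"
proof (rule continuous_bdd_cpt)
 show "continuous_on UNIV bump_a" unfolding bump_a_def[abs_def] by (intro continuous_intros)
 fix x :: "real^3" assume "1 < norm x"
 then have "1\<^sup>2 < (norm x)\<^sup>2" by (intro power_strict_mono) auto
 then show "bump_a x = 0" unfolding bump_a_def by (simp add: power2_norm_eq_inner)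
qed

text \<open>The value is \<open>4 * pi\<close>, the usual constant of the Newtonian kernel in three
  dimensions; it is kept symbolic.\<close>

definition alpha :: real where "alpha = (LBINT x. bump_a x)"

lemma alpha_pos: "0 < alpha"
proof -
 have "0 < measure lborel (cball (0::real^3) (1/2))" by (simp add: content_cball)
 also have "measure lborel (cball (0::real^3) (1/2)) = (LBINT x. indicator (cball (0::real^3) (1/2)) x)" by simp
 also have "\<dots> \<le> (LBINT x. bump_a x)"
 proof (rule integral_mono)
  show "integrable lborel (indicator (cball (0::real^3) (1/2)) :: real^3 => real)"
   by (intro integrable_real_indicator emeasure_lborel_cball_finite) simp
  fix x :: "real^3"
  show "indicator (cball 0 (1/2)) x \<le> bump_a x"
  proof (cases "norm x \<le> 1/2")
   case True
   then have "(norm x)\<^sup>2 \<le> (1/2)\<^sup>2" by (intro power_mono) auto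
   then have "x \<bullet> x \<le> 1/4" by (simp add: power2_norm_eq_inner power_divide)
   then show ?thesis unfolding bump_a_def by (simp add: max_def indicator_def)
  qed (simp add: bump_a_def)
 qed (intro bdd_cpt_integrable bdd_cpt_bump_a)
 finally show ?thesis unfolding alpha_def .
qed

lemma kapH_laplacian:
 assumes e: "0 < e"
 shows "(\<Sum>i\<in>UNIV. kapH e (axis i 1) (axis i 1) x) = - dilate e bump_a (x :: real^3)"
proof -
 define s where "s = (x \<bullet> x) / e\<^sup>2"
 have xx: "x \<bullet> x = (\<Sum>i\<in>UNIV. x $ i * x $ i)" by (simp add: inner_vec_def)
 have aa: "axis i 1 \<bullet> (axis i 1 :: real^3) = 1" for i by (simp add: inner_axis_axis)
 have "(\<Sum>i\<in>UNIV. kapH e (axis i 1) (axis i 1) x) = k2 s * 4 * (\<Sum>i\<in>UNIV. x $ i * x $ i) / e ^ 5 + 3 * (k1 s * 2 / e ^ 3)"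
  unfolding kapH_def s_def[symmetric] aa
  by (simp add: inner_axis sum.distrib sum_distrib_left sum_divide_distrib mult_ac)
 also have "\<dots> = (4 * s * k2 s + 6 * k1 s) / e ^ 3"
 proof -
  have "e ^ 5 = e\<^sup>2 * e ^ 3" by (simp add: power_add[symmetric])
  then show ?thesis unfolding xx[symmetric] s_def using e by (simp add: add_divide_distrib mult_ac)
 qed
 also have "\<dots> = - dilate e bump_a x"
 proof -
  have "((1 / e) *\<^sub>R x) \<bullet> ((1 / e) *\<^sub>R x) = s" unfolding s_def by (simp add: power2_eq_square)
  then show ?thesis unfolding k_laplacian dilate_def bump_a_def by simp
 qed
 finally show ?thesis .
qed

text \<open>The Newtonian kernel regularised at scale \<open>(1/2) ^ n\<close> and cut off at scale
  \<open>2 ^ n\<close>. Its Laplacian is a spreading bump minus a concentrating one, so that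
  convolution with it tends to \<open>- alpha\<close> times the identity.\<close>

definition Ker :: "nat => real^3 => real" where
 "Ker n x = kap ((1/2) ^ n) x - kap (2 ^ n) x"
definition KerD :: "nat => real^3 => real^3 => real" where
 "KerD n v x = kapD ((1/2) ^ n) v x - kapD (2 ^ n) v x"
definition KerH :: "nat => real^3 => real^3 => real^3 => real" where
 "KerH n v w x = kapH ((1/2) ^ n) v w x - kapH (2 ^ n) v w x"

lemma kernel_Ker: "kernel (Ker n) (KerD n) (KerH n)"
 unfolding Ker_def[abs_def] KerD_def[abs_def] KerH_def[abs_def]
 by (rule kernel_kap_diff) auto

lemma klap_KerH: "klap (KerH n) x = dilate (2 ^ n) bump_a x - dilate ((1/2) ^ n) bump_a x"
 unfolding klap_def KerH_def sum_subtractf by (simp add: kapH_laplacian)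

lemma integral_abs_bump_a: "(LBINT x. \<bar>dilate e bump_a x\<bar>) \<le> alpha" if "0 < e"
proof -
 have "\<bar>bump_a x\<bar> = bump_a x" for x unfolding bump_a_def by simp
 then show ?thesis unfolding integral_abs_dilate[OF bdd_cpt_bump_a that] alpha_def by simp
qed

lemma conv_klap_KerH:
 assumes f: "loc_int f"
 shows "conv (klap (KerH n)) f = (\<lambda>x. conv (dilate (2 ^ n) bump_a) f x - conv (dilate ((1/2) ^ n) bump_a) f x)"
proof -
 have "klap (KerH n) = (\<lambda>x. dilate (2 ^ n) bump_a x - dilate ((1/2) ^ n) bump_a x)"
  using klap_KerH by (rule ext)
 then show ?thesis
  using conv_diff_left[OF bdd_cpt_dilate[OF bdd_cpt_bump_a, of "2 ^ n"] bdd_cpt_dilate[OF bdd_cpt_bump_a, of "(1/2) ^ n"] f] by simp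
qed

section \<open>Second order Riesz transforms as limits\<close>

definition approx_err :: "real => (real^3 => real) => nat => ennreal" where
 "approx_err p f n = In p (conv (dilate (2 ^ n) bump_a) f) + In p (\<lambda>x. conv (dilate ((1/2) ^ n) bump_a) f x - alpha * f x)"

lemma approx_err_tendsto:
 assumes p: "1 < p" and f: "Lspace p f"
 shows "approx_err p f \<longlonglongrightarrow> 0"
proof -
 have "(\<lambda>n. In p (conv (dilate (2 ^ n) bump_a) f)) \<longlonglongrightarrow> 0"
 proof (rule conv_dilate_tendsto_0[OF p bdd_cpt_bump_a f])
  show "filterlim (\<lambda>n. 2 ^ n :: real) at_top sequentially"
  proof -
   have "filterlim (\<lambda>n. norm (2 ^ n :: real)) at_top sequentially"
    using filterlim_realpow_sequentially_gt1[of "2::real"] by (intro filterlim_at_infinity_imp_norm_at_top) auto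
   then show ?thesis by (simp add: norm_power)
  qed
 qed simp
 moreover have "(\<lambda>n. In p (\<lambda>x. conv (dilate ((1/2) ^ n) bump_a) f x - alpha * f x)) \<longlonglongrightarrow> 0"
  unfolding alpha_def
  by (rule conv_dilate_tendsto[OF _ bdd_cpt_bump_a f])
   (use p in \<open>auto simp: power_le_one intro: LIMSEQ_realpow_zero\<close>)
 ultimately have "(\<lambda>n. In p (conv (dilate (2 ^ n) bump_a) f) + In p (\<lambda>x. conv (dilate ((1/2) ^ n) bump_a) f x - alpha * f x)) \<longlonglongrightarrow> 0 + 0"
  by (rule tendsto_add)
 then show ?thesis unfolding approx_err_def[abs_def] by simp
qed

lemma conv_klap_KerH_tendsto:
 assumes p: "1 < p" and f: "Lspace p f"
 shows "(\<lambda>n. In p (\<lambda>x. conv (klap (KerH n)) f x + alpha * f x)) \<longlonglongrightarrow> 0"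
proof -
 have p1: "0 < p" "1 \<le> p" using p by auto
 have [measurable]: "borel_fun f" using f by (rule Lspace_measurable)
 have [measurable]: "borel_fun (dilate e bump_a)" if "0 < e" for e
  using bdd_cpt_dilate[OF bdd_cpt_bump_a that] by (rule bdd_cpt_measurable)
 have m: "borel_fun (conv (dilate (2 ^ n) bump_a) f)" "borel_fun (conv (dilate ((1/2) ^ n) bump_a) f)" for n
  by (intro conv_measurable; simp)+
 have lim: "(\<lambda>n. ennreal (2 powr p) * (0 + 1 * approx_err p f n)) \<longlonglongrightarrow> ennreal (2 powr p) * 0"
  by (rule tendsto_ennreal_affine[OF _ _ approx_err_tendsto[OF p f]]) auto
 show ?thesis
 proof (rule tendsto_sandwich[OF _ _ tendsto_const lim[simplified]])
  show "\<forall>\<^sub>F n in sequentially. In p (\<lambda>x. conv (klap (KerH n)) f x + alpha * f x) \<le> ennreal (2 powr p) * approx_err p f n"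
  proof (rule always_eventually, rule allI)
   fix n
   have "(\<lambda>x. conv (klap (KerH n)) f x + alpha * f x) = (\<lambda>x. conv (dilate (2 ^ n) bump_a) f x - (conv (dilate ((1/2) ^ n) bump_a) f x - alpha * f x))"
    unfolding conv_klap_KerH[OF Lspace_loc_int[OF p1(2) f]] by auto
   then show "In p (\<lambda>x. conv (klap (KerH n)) f x + alpha * f x) \<le> ennreal (2 powr p) * approx_err p f n"
    unfolding approx_err_def using m by (simp only:) (intro In_diff p1; measurable)
  qed
 qed simp
qed

text \<open>The constant of \<open>kernel_CZ\<close> does not depend on the kernel, and
  \<open>klap (KerH n)\<close> is a difference of two bumps of mass \<open>alpha\<close>, so nothing
  depends on \<open>n\<close>.\<close>

lemma riesz_bound_ex:
 assumes p: "1 < p"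
 shows "\<exists>C>0. \<forall>f n i j. Lspace p f --> In p (conv (KerH n (axis i 1) (axis j 1)) f) \<le> ennreal C * In p f"
proof -
 have p1: "0 < p" "1 \<le> p" using p by auto
 obtain C where C: "C > 0" and CZ: "\<And>K D (H :: real^3 => real^3 => real^3 => real) i j f. kernel K D H ==> Lspace p f ==>
   In p (conv (H (axis i 1) (axis j 1)) f) \<le> ennreal C * In p (conv (klap H) f)"
  using kernel_CZ[OF p, where ?'n=3] by blast
 define a where "a = 2 powr p * alpha powr p"
 have a: "0 \<le> a" unfolding a_def by simp
 define B where "B = C * (2 powr p * (a + a))"
 have "In p (conv (KerH n (axis i 1) (axis j 1)) f) \<le> ennreal (B + 1) * In p f" if f: "Lspace p f" for f n i j
 proof -
  have [measurable]: "borel_fun f" using f by (rule Lspace_measurable)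
  have e: "0 < (2::real) ^ n" "0 < (1/2::real) ^ n" by auto
  have m: "borel_fun (conv (dilate e bump_a) f)" if "0 < e" for e
   using bdd_cpt_measurable[OF bdd_cpt_dilate[OF bdd_cpt_bump_a that]] by (rule conv_measurable) measurable
  have Y: "In p (conv (dilate e bump_a) f) \<le> ennreal a * In p f" if "0 < e" for e
   unfolding a_def by (rule In_conv_le[OF p1(2) bdd_cpt_dilate[OF bdd_cpt_bump_a that] f alpha_pos integral_abs_bump_a[OF that]])
  have "In p (conv (KerH n (axis i 1) (axis j 1)) f) \<le> ennreal C * In p (conv (klap (KerH n)) f)"
   by (rule CZ[OF kernel_Ker f])
  also have "\<dots> \<le> ennreal C * (ennreal (2 powr p) * (ennreal a * In p f + ennreal a * In p f))"
   unfolding conv_klap_KerH[OF Lspace_loc_int[OF p1(2) f]]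
   by (intro mult_left_mono order_trans[OF In_diff] add_mono Y e p1 m) auto
  also have "\<dots> = ennreal B * In p f"
   unfolding B_def using a C by (simp only: distrib_right[symmetric] ennreal_plus[OF a a, symmetric]) (simp add: ennreal_mult' mult.assoc)
  also have "\<dots> \<le> ennreal (B + 1) * In p f" by (intro mult_right_mono ennreal_leI) auto
  finally show ?thesis .
 qed
 moreover have "0 < B + 1" unfolding B_def using a C by (intro add_nonneg_pos mult_nonneg_nonneg) auto
 ultimately show ?thesis by blast
qed

text \<open>The difference of two truncated kernels is again a kernel. The Calderon-Zygmund estimate
  for it reduces the Cauchy property of the second derivatives to that of the Laplacians, which
  converge to \<open>- alpha * f\<close>.\<close>

lemma riesz_limit:
 assumes p: "1 < p" and f: "Lspace p f"
 obtains g r where "Lspace p g" "(\<lambda>n. In p (\<lambda>x. conv (KerH n (axis i 1) (axis j 1)) f x - g x)) \<longlonglongrightarrow> 0"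
  "strict_mono r" "AE x in lborel. (\<lambda>n. conv (KerH (r n) (axis i 1) (axis j 1)) f x) \<longlonglongrightarrow> g x"
proof -
 have p1: "0 < p" "1 \<le> p" using p by auto
 have [measurable]: "borel_fun f" using f by (rule Lspace_measurable)
 have li: "loc_int f" by (rule Lspace_loc_int[OF p1(2) f])
 obtain C where C: "C > 0" and CZ: "\<And>K D (H :: real^3 => real^3 => real^3 => real) i j f. kernel K D H ==> Lspace p f ==>
   In p (conv (H (axis i 1) (axis j 1)) f) \<le> ennreal C * In p (conv (klap H) f)"
  using kernel_CZ[OF p, where ?'n=3] by blast
 define u where "u = (\<lambda>n x. conv (klap (KerH n)) f x + alpha * f x)"
 have u0: "(\<lambda>n. In p (u n)) \<longlonglongrightarrow> 0" unfolding u_def by (rule conv_klap_KerH_tendsto[OF p f])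
 have kb: "bdd_cpt (klap (KerH n))" for n by (rule bdd_cpt_klap[OF kernel_Ker])
 have um: "borel_fun (u n)" for n
  unfolding u_def using conv_measurable[OF bdd_cpt_measurable[OF kb[of n]], of f] by measurable
 have diff: "In p (\<lambda>x. conv (KerH n (axis i 1) (axis j 1)) f x - conv (KerH m (axis i 1) (axis j 1)) f x)
   \<le> ennreal C * (ennreal (2 powr p) * (In p (u n) + In p (u m)))" for n m
 proof -
  define H where "H = (\<lambda>v w x. KerH n v w x - KerH m v w x)"
  have K: "kernel (\<lambda>x. Ker n x - Ker m x) (\<lambda>v x. KerD n v x - KerD m v x) H"
   unfolding H_def by (rule kernel_diff[OF kernel_Ker kernel_Ker])
  have k: "bdd_cpt (KerH n v w)" for n v w by (rule kernelD(8)[OF kernel_Ker])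
  have "In p (\<lambda>x. conv (KerH n (axis i 1) (axis j 1)) f x - conv (KerH m (axis i 1) (axis j 1)) f x) = In p (conv (H (axis i 1) (axis j 1)) f)"
   unfolding H_def conv_diff_left[OF k k li] ..
  also have "\<dots> \<le> ennreal C * In p (conv (klap H) f)" by (rule CZ[OF K f])
  also have "conv (klap H) f = (\<lambda>x. u n x - u m x)"
  proof -
   have "klap H = (\<lambda>x. klap (KerH n) x - klap (KerH m) x)"
    unfolding klap_def[abs_def] H_def by (simp add: sum_subtractf)
   then show ?thesis unfolding u_def using conv_diff_left[OF kb kb li, of n m] by simp
  qed
  also have "In p (\<lambda>x. u n x - u m x) \<le> ennreal (2 powr p) * (In p (u n) + In p (u m))"
   by (rule In_diff[OF p1(1) um um])
  finally show ?thesis by (simp add: mult_left_mono)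
 qed
 show thesis
 proof (rule Lspace_complete[OF p1(2)])
  show "Lspace p (conv (KerH n (axis i 1) (axis j 1)) f)" for n
   by (rule Lspace_conv[OF p1(2) kernelD(8)[OF kernel_Ker] f])
  fix e :: real assume e: "0 < e"
  define d where "d = e / (4 * C * 2 powr p)"
  have d: "0 < d" unfolding d_def using e C by simp
  have "\<forall>\<^sub>F n in sequentially. In p (u n) < ennreal d" by (rule order_tendstoD(2)[OF u0]) (use d in simp)
  then obtain N where N: "\<And>n. n \<ge> N ==> In p (u n) < ennreal d" unfolding eventually_sequentially by auto
  have "In p (\<lambda>x. conv (KerH n (axis i 1) (axis j 1)) f x - conv (KerH m (axis i 1) (axis j 1)) f x) < ennreal e"
   if "n \<ge> N" "m \<ge> N" for n m
  proof -
   have "In p (\<lambda>x. conv (KerH n (axis i 1) (axis j 1)) f x - conv (KerH m (axis i 1) (axis j 1)) f x) \<le> ennreal C * (ennreal (2 powr p) * (ennreal d + ennreal d))"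
    using N[OF that(1)] N[OF that(2)] by (intro order_trans[OF diff] mult_left_mono add_mono) auto
   also have "\<dots> = ennreal (C * (2 powr p * (d + d)))"
    using d C by (simp only: ennreal_plus[OF less_imp_le[OF d] less_imp_le[OF d], symmetric]) (simp add: ennreal_mult'[symmetric])
   also have "C * (2 powr p * (d + d)) = e / 2" unfolding d_def using C by (simp add: field_simps)
   also have "ennreal (e / 2) < ennreal e" using e by (intro ennreal_lessI) auto
   finally show ?thesis .
  qed
  then show "\<exists>N. \<forall>n\<ge>N. \<forall>m\<ge>N. In p (\<lambda>x. conv (KerH n (axis i 1) (axis j 1)) f x - conv (KerH m (axis i 1) (axis j 1)) f x) < ennreal e"
   by (intro exI[of _ N] allI impI)
 qed (rule that)
qed

text \<open>Formally \<open>- alpha\<close> times the derivative \<open>i j\<close> of the inverse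
  Laplacian of \<open>f\<close>. The a.e. convergent subsequence belongs to the choice because only
  a pointwise limit can inherit bounds in an exponent different from \<open>p\<close>.\<close>

definition riesz :: "real => 3 => 3 => (real^3 => real) => real^3 => real" where
 "riesz p i j f = (SOME g. Lspace p g \<and> (\<lambda>n. In p (\<lambda>x. conv (KerH n (axis i 1) (axis j 1)) f x - g x)) \<longlonglongrightarrow> 0 \<and>
   (\<exists>r. strict_mono r \<and> (AE x in lborel. (\<lambda>n. conv (KerH (r n) (axis i 1) (axis j 1)) f x) \<longlonglongrightarrow> g x)))"

lemma riesz:
 assumes p: "1 < p" and f: "Lspace p f"
 shows "Lspace p (riesz p i j f)"
  "(\<lambda>n. In p (\<lambda>x. conv (KerH n (axis i 1) (axis j 1)) f x - riesz p i j f x)) \<longlonglongrightarrow> 0"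
  "\<exists>r. strict_mono r \<and> (AE x in lborel. (\<lambda>n. conv (KerH (r n) (axis i 1) (axis j 1)) f x) \<longlonglongrightarrow> riesz p i j f x)"
proof -
 have "\<exists>g. Lspace p g \<and> (\<lambda>n. In p (\<lambda>x. conv (KerH n (axis i 1) (axis j 1)) f x - g x)) \<longlonglongrightarrow> 0 \<and>
   (\<exists>r. strict_mono r \<and> (AE x in lborel. (\<lambda>n. conv (KerH (r n) (axis i 1) (axis j 1)) f x) \<longlonglongrightarrow> g x))"
  by (rule riesz_limit[OF p f, of i j], intro exI conjI)
 from someI_ex[OF this, folded riesz_def] show "Lspace p (riesz p i j f)"
  "(\<lambda>n. In p (\<lambda>x. conv (KerH n (axis i 1) (axis j 1)) f x - riesz p i j f x)) \<longlonglongrightarrow> 0"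
  "\<exists>r. strict_mono r \<and> (AE x in lborel. (\<lambda>n. conv (KerH (r n) (axis i 1) (axis j 1)) f x) \<longlonglongrightarrow> riesz p i j f x)"
  by blast+
qed

definition riesz_const :: "real => real" where
 "riesz_const p = (SOME C. 0 < C \<and> (\<forall>f n i j. Lspace p f --> In p (conv (KerH n (axis i 1) (axis j 1)) f) \<le> ennreal C * In p f))"

lemma riesz_const:
 assumes p: "1 < p"
 shows "0 < riesz_const p" "Lspace p f ==> In p (conv (KerH n (axis i 1) (axis j 1)) f) \<le> ennreal (riesz_const p) * In p f"
 using someI_ex[OF riesz_bound_ex[OF p], folded riesz_const_def] by blast+

text \<open>The limit is taken in one exponent, the bound holds in every other one.\<close>

lemma In_riesz_le:
 assumes p: "1 < p" and s: "1 < s" and f: "Lspace p f" and fs: "Lspace s f"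
 shows "In s (riesz p i j f) \<le> ennreal (riesz_const s) * In s f"
proof -
 obtain r where r: "AE x in lborel. (\<lambda>n. conv (KerH (r n) (axis i 1) (axis j 1)) f x) \<longlonglongrightarrow> riesz p i j f x"
  using riesz(3)[OF p f] by blast
 have "0 < s" using s by simp
 show ?thesis
 proof (rule In_liminf[OF _ \<open>0 < s\<close> r riesz_const(2)[OF s fs] tendsto_const])
  show "borel_fun (conv (KerH (r n) (axis i 1) (axis j 1)) f)" for n
   by (rule conv_measurable[OF bdd_cpt_measurable[OF kernelD(8)[OF kernel_Ker]] Lspace_measurable[OF f]])
 qed
qed

section \<open>Mollification and weak derivatives\<close>

text \<open>The index \<open>m\<close> closes the family under differentiation:
  \<open>DERIV_exp_flat\<close> expresses each derivative by members with larger index.\<close>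

definition exp_flat :: "nat => real => real" where
 "exp_flat m t = (if t \<le> 0 then 0 else inverse t ^ m * exp (- inverse t))"

lemma exp_flat_tendsto_at_right: "(exp_flat m \<longlongrightarrow> 0) (at_right 0)"
proof -
 have "((\<lambda>y::real. y ^ m / exp y) \<longlongrightarrow> 0) at_top" by (rule tendsto_power_div_exp_0)
 then have "((\<lambda>t::real. inverse t ^ m / exp (inverse t)) \<longlongrightarrow> 0) (at_right 0)"
  by (rule filterlim_compose[OF _ filterlim_inverse_at_top_right])
 then show ?thesis
 proof (rule Lim_transform_eventually)
  show "\<forall>\<^sub>F t in at_right 0. inverse t ^ m / exp (inverse t) = exp_flat m t"
   using eventually_at_right_less[of 0] by eventually_elim (simp add: exp_flat_def exp_minus divide_inverse)
 qed
qed

lemma DERIV_exp_flat: "(exp_flat m has_real_derivative exp_flat (m + 2) t - m * exp_flat (m + 1) t) (at t)"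
proof -
 consider "t < 0" | "t > 0" | "t = 0" by linarith
 then show ?thesis
 proof cases
  case 1
  have ev: "\<forall>\<^sub>F x in nhds t. exp_flat m x = 0"
   using 1 by (intro eventually_nhds[THEN iffD2] exI[of _ "{..<0}"]) (auto simp: exp_flat_def)
  have "(exp_flat m has_real_derivative 0) (at t)"
   by (rule DERIV_cong_ev[OF refl ev refl, THEN iffD2]) simp
  moreover have "exp_flat (m + 2) t - m * exp_flat (m + 1) t = 0" using 1 by (simp add: exp_flat_def)
  ultimately show ?thesis by simp
 next
  case 2
  have ev: "\<forall>\<^sub>F x in nhds t. exp_flat m x = inverse x ^ m * exp (- inverse x)"
   using 2 by (intro eventually_nhds[THEN iffD2] exI[of _ "{0<..}"]) (auto simp: exp_flat_def)
  have "((\<lambda>x. inverse x ^ m * exp (- inverse x)) has_real_derivative exp_flat (m + 2) t - m * exp_flat (m + 1) t) (at t)"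
  proof -
   have e: "((\<lambda>x. exp (- inverse x)) has_real_derivative exp (- inverse t) * (inverse t * inverse t)) (at t)"
    using 2 by (auto intro!: derivative_eq_intros)
   have "((\<lambda>x. inverse x ^ m) has_real_derivative - (m * inverse t ^ (m + 1))) (at t)"
   proof (cases m)
    case (Suc k)
    show ?thesis
     unfolding Suc using DERIV_power_Suc[OF DERIV_inverse[of t UNIV], of k] 2 by (simp add: algebra_simps)
   qed simp
   from DERIV_mult[OF this e] show ?thesis
    by (rule DERIV_cong) (use 2 in \<open>simp add: exp_flat_def algebra_simps\<close>)
  qed
  with DERIV_cong_ev[OF refl ev refl] show ?thesis by blast
 next
  case 3
  have "((\<lambda>y. (exp_flat m y - exp_flat m 0) / (y - 0)) \<longlongrightarrow> 0) (at 0)"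
  proof (rule filterlim_split_at)
   show "((\<lambda>y. (exp_flat m y - exp_flat m 0) / (y - 0)) \<longlongrightarrow> 0) (at_left 0)"
    by (rule tendsto_eventually) (auto simp: exp_flat_def eventually_at_filter)
   show "((\<lambda>y. (exp_flat m y - exp_flat m 0) / (y - 0)) \<longlongrightarrow> 0) (at_right 0)"
    by (rule Lim_transform_eventually[OF exp_flat_tendsto_at_right[of "Suc m"]])
     (auto simp: exp_flat_def eventually_at_filter divide_inverse)
  qed
  then show ?thesis unfolding 3 has_field_derivative_iff by (simp add: exp_flat_def)
 qed
qed

text \<open>A class closed under directional derivatives, so that smoothness of every order follows
  from one first order computation per constructor. It is just large enough for the translated and
  dilated bumps.\<close>

inductive smooth_alg :: "('a::euclidean_space => real) => bool" where
 const: "smooth_alg (\<lambda>x. c)"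
| lin: "smooth_alg (\<lambda>x. x \<bullet> v)"
| flat: "smooth_alg (\<lambda>x. exp_flat m (1 - c * ((x - a) \<bullet> (x - a))))"
| add: "smooth_alg f ==> smooth_alg g ==> smooth_alg (\<lambda>x. f x + g x)"
| mult: "smooth_alg f ==> smooth_alg g ==> smooth_alg (\<lambda>x. f x * g x)"

lemma smooth_alg_derivative:
 assumes "smooth_alg f"
 shows "\<exists>D. (\<forall>x. (f has_derivative D x) (at x)) \<and> (\<forall>v. smooth_alg (\<lambda>x. D x v))"
 using assms
proof induction
 case (const c)
 show ?case by (rule exI[of _ "\<lambda>x v. 0"]) (auto intro: smooth_alg.const)
next
 case (lin v)
 show ?case by (rule exI[of _ "\<lambda>x w. w \<bullet> v"]) (auto intro: smooth_alg.const derivative_intros)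
next
 case (flat m c a)
 define D where "D = (\<lambda>x v. (exp_flat (m + 2) (1 - c * ((x - a) \<bullet> (x - a))) + (- real m) * exp_flat (m + 1) (1 - c * ((x - a) \<bullet> (x - a))))
   * ((- 2 * c) * (x \<bullet> v + (- (a \<bullet> v)))))"
 have "((\<lambda>x. exp_flat m (1 - c * ((x - a) \<bullet> (x - a)))) has_derivative D x) (at x)" for x
 proof -
  have 1: "((\<lambda>x. 1 - c * ((x - a) \<bullet> (x - a))) has_derivative (\<lambda>v. (- 2 * c) * (x \<bullet> v + (- (a \<bullet> v))))) (at x)"
   by (auto intro!: derivative_eq_intros simp: algebra_simps inner_commute)
  have 2: "(exp_flat m has_derivative (*) (exp_flat (m + 2) (1 - c * ((x - a) \<bullet> (x - a))) - m * exp_flat (m + 1) (1 - c * ((x - a) \<bullet> (x - a)))))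
    (at (1 - c * ((x - a) \<bullet> (x - a))))"
   using DERIV_exp_flat unfolding has_field_derivative_def .
  from diff_chain_at[OF 1 2] show ?thesis unfolding D_def o_def by simp
 qed
 moreover have "smooth_alg (\<lambda>x. D x v)" for v
  unfolding D_def by (intro smooth_alg.intros)
 ultimately show ?case by blast
next
 case (add f g)
 then obtain D E where *: "\<And>x. (f has_derivative D x) (at x)" "\<And>v. smooth_alg (\<lambda>x. D x v)"
  "\<And>x. (g has_derivative E x) (at x)" "\<And>v. smooth_alg (\<lambda>x. E x v)" by blast
 show ?case
  by (rule exI[of _ "\<lambda>x v. D x v + E x v"]) (auto intro!: smooth_alg.add has_derivative_add *)
next
 case (mult f g)
 then obtain D E where *: "\<And>x. (f has_derivative D x) (at x)" "\<And>v. smooth_alg (\<lambda>x. D x v)"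
  "\<And>x. (g has_derivative E x) (at x)" "\<And>v. smooth_alg (\<lambda>x. E x v)" by blast
 show ?case
  by (rule exI[of _ "\<lambda>x v. f x * E x v + D x v * g x"])
   (auto intro!: smooth_alg.add smooth_alg.mult has_derivative_mult * mult.hyps)
qed

lemma smooth_alg_Ck: "smooth_alg f ==> Ck k f"
proof (induction k arbitrary: f)
 case 0
 obtain D where "\<And>x. (f has_derivative D x) (at x)" using smooth_alg_derivative[OF 0] by blast
 then have "continuous_on UNIV f"
  by (intro continuous_at_imp_continuous_on) (auto intro: has_derivative_continuous)
 then show ?case by simp
next
 case (Suc k)
 obtain D where D: "\<And>x. (f has_derivative D x) (at x)" "\<And>v. smooth_alg (\<lambda>x. D x v)"
  using smooth_alg_derivative[OF Suc.prems] by blast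
 have "pd f v = (\<lambda>x. D x v)" for v
  unfolding pd_def by (rule ext) (simp add: frechet_derivative_at[OF D(1), symmetric])
 then show ?case using D Suc.IH by (auto simp: differentiable_def)
qed

lemma smooth_alg_smooth: "smooth_alg f ==> smooth f"
 unfolding smooth_def using smooth_alg_Ck by blast

definition bump :: "'a::euclidean_space => real" where
 "bump x = exp_flat 0 (1 - x \<bullet> x)"

definition bumpD :: "'a::euclidean_space => 'a => real" where
 "bumpD v x = exp_flat 2 (1 - x \<bullet> x) * (- 2 * (x \<bullet> v))"

lemma exp_flat_continuous: "continuous_on UNIV (exp_flat m)"
 by (intro continuous_at_imp_continuous_on ballI DERIV_isCont[OF DERIV_exp_flat])

lemma bump_support: "1 < norm x ==> bump x = 0" "1 < norm x ==> bumpD v x = 0"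
proof -
 assume "1 < norm x"
 then have "1\<^sup>2 < (norm x)\<^sup>2" by (intro power_strict_mono) auto
 then have "1 - x \<bullet> x \<le> 0" by (simp add: power2_norm_eq_inner)
 then show "bump x = 0" "bumpD v x = 0" unfolding bump_def bumpD_def exp_flat_def by auto
qed

lemma continuous_bump:
 fixes v :: "'a::euclidean_space"
 shows "continuous_on UNIV (bump :: 'a => real)" "continuous_on UNIV (bumpD v)"
proof -
 have c: "continuous_on UNIV (\<lambda>x::'a. exp_flat m (1 - x \<bullet> x))" for m
  by (rule continuous_on_compose2[OF exp_flat_continuous]) (auto intro!: continuous_intros)
 show "continuous_on UNIV (bump :: 'a => real)" unfolding bump_def[abs_def] by (rule c)
 show "continuous_on UNIV (bumpD v)" unfolding bumpD_def[abs_def] by (intro c continuous_intros)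
qed

lemma bdd_cpt_bump: "bdd_cpt bump" "bdd_cpt (bumpD v)"
 by (rule continuous_bdd_cpt[OF continuous_bump(1) bump_support(1)] continuous_bdd_cpt[OF continuous_bump(2) bump_support(2)]; assumption)+

lemma has_dd_bump: "has_dd bump v (bumpD v)"
 unfolding has_dd_def
proof (intro allI)
 fix x :: 'a and t :: real
 have "((\<lambda>t. 1 - ((x + t *\<^sub>R v) \<bullet> (x + t *\<^sub>R v)) / 1) has_real_derivative 0 - 2 * ((x + t *\<^sub>R v) \<bullet> v) / 1) (at t)"
  by (intro DERIV_diff DERIV_const DERIV_inner_line)
 then have "((\<lambda>t. 1 - (x + t *\<^sub>R v) \<bullet> (x + t *\<^sub>R v)) has_real_derivative - 2 * ((x + t *\<^sub>R v) \<bullet> v)) (at t)" by simp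
 from DERIV_chain2[OF DERIV_exp_flat[of 0] this]
 show "((\<lambda>t. bump (x + t *\<^sub>R v)) has_real_derivative bumpD v (x + t *\<^sub>R v)) (at t)"
  unfolding bump_def bumpD_def by (simp add: numeral_2_eq_2)
qed

lemma bump_nonneg: "0 \<le> bump x"
 unfolding bump_def exp_flat_def by simp

lemma bump_integral_pos: "0 < (\<integral>x. (bump x :: real) \<partial>(lborel :: 'a::euclidean_space measure))"
proof -
 have "0 < exp (-2::real) * measure lborel (cball (0::'a) (1/2))" by (simp add: content_cball)
 also have "\<dots> = (LBINT x. exp (-2) * indicator (cball (0::'a) (1/2)) x)" by simp
 also have "\<dots> \<le> (\<integral>x. bump x \<partial>(lborel::'a measure))"
 proof (rule integral_mono)
  show "integrable lborel (\<lambda>x. exp (-2) * indicator (cball (0::'a) (1/2)) x :: real)"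
   by (intro integrable_mult_right integrable_real_indicator emeasure_lborel_cball_finite) simp
  fix x :: 'a
  show "exp (-2) * indicator (cball 0 (1/2)) x \<le> bump x"
  proof (cases "norm x \<le> 1/2")
   case True
   then have "(norm x)\<^sup>2 \<le> (1/2)\<^sup>2" by (intro power_mono) auto
   then have *: "1/2 \<le> 1 - x \<bullet> x" by (simp add: power2_norm_eq_inner power_divide)
   then have "inverse (1 - x \<bullet> x) \<le> inverse (1/2)" by (intro le_imp_inverse_le) auto
   then have "exp (-2) \<le> exp (- inverse (1 - x \<bullet> x))" by simp
   then show ?thesis using True * unfolding bump_def exp_flat_def by simp
  next
   case False
   then show ?thesis using bump_nonneg[of x] by simp
  qed
 qed (intro bdd_cpt_integrable bdd_cpt_bump)
 finally show ?thesis .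
qed

text \<open>The mollifier centred at \<open>x\<close> is an admissible test function of
  \<open>y\<close>. The minus sign in its derivative comes from the argument
  \<open>x - y\<close>.\<close>

lemma dilate_bump_test_fun:
 fixes x :: "'a::euclidean_space"
 assumes e: "0 < e" and sub: "cball x e \<subseteq> S"
 shows "test_fun S (\<lambda>y. dilate e bump (x - y))" "pd (\<lambda>y. dilate e bump (x - y)) v y = - (dilate e (bumpD v) (x - y) / e)"
proof -
 have "(\<lambda>y. dilate e bump (x - y)) = (\<lambda>y. exp_flat 0 (1 - (1 / e\<^sup>2) * ((y - x) \<bullet> (y - x))) * (1 / e ^ DIM('a)))"
  unfolding dilate_def bump_def by (rule ext) (simp add: power2_eq_square inner_commute inner_diff_left inner_diff_right algebra_simps)
 moreover have "smooth_alg (\<lambda>y. exp_flat 0 (1 - (1 / e\<^sup>2) * ((y - x) \<bullet> (y - x))) * (1 / e ^ DIM('a)))"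
  by (intro smooth_alg.intros)
 ultimately have sa: "smooth_alg (\<lambda>y. dilate e bump (x - y))" by simp
 have "{y. dilate e bump (x - y) \<noteq> 0} \<subseteq> cball x e"
 proof
  fix y assume y: "y \<in> {y. dilate e bump (x - y) \<noteq> 0}"
  have "dilate e bump (x - y) = 0" if "e < norm (x - y)"
   by (intro dilate_support[of 1 bump e "x - y"] bump_support(1) e) (use that in simp_all)
  then show "y \<in> cball x e" using y by (auto simp: dist_norm not_le[symmetric])
 qed
 then have cl: "closure {y. dilate e bump (x - y) \<noteq> 0} \<subseteq> cball x e" by (rule closure_minimal) simp
 then have "compact (closure {y. dilate e bump (x - y) \<noteq> 0})"
  using bounded_subset[OF bounded_cball cl] by (simp add: compact_eq_bounded_closed)
 then show "test_fun S (\<lambda>y. dilate e bump (x - y))"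
  unfolding test_fun_def using smooth_alg_smooth[OF sa] cl sub by blast
 obtain D where D: "\<And>z. ((\<lambda>y. dilate e bump (x - y)) has_derivative D z) (at z)"
  using smooth_alg_derivative[OF sa] by blast
 have pd: "pd (\<lambda>y. dilate e bump (x - y)) v y = D y v"
  unfolding pd_def by (simp add: frechet_derivative_at[OF D, symmetric])
 have l: "((\<lambda>t. y + t *\<^sub>R v) has_derivative (\<lambda>t. t *\<^sub>R v)) (at 0)" by (auto intro!: derivative_eq_intros)
 have "((\<lambda>y. dilate e bump (x - y)) has_derivative D y) (at (y + 0 *\<^sub>R v))" using D by simp
 from diff_chain_at[OF l this] have "((\<lambda>t. dilate e bump (x - (y + t *\<^sub>R v))) has_derivative (\<lambda>t. D y (t *\<^sub>R v))) (at 0)"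
  unfolding o_def .
 moreover have "D y (t *\<^sub>R v) = t * D y v" for t
  using linear_scale[OF has_derivative_linear[OF D[of y]]] by simp
 ultimately have 1: "((\<lambda>t. dilate e bump (x - (y + t *\<^sub>R v))) has_real_derivative D y v) (at 0)"
  unfolding has_field_derivative_def by (simp add: mult_commute_abs)
 have "((\<lambda>s. bump ((1 / e) *\<^sub>R (x - y) + s *\<^sub>R v)) has_real_derivative bumpD v ((1 / e) *\<^sub>R (x - y) + (- (0 / e)) *\<^sub>R v)) (at (- (0 / e)))"
  by (rule has_ddD[OF has_dd_bump])
 moreover have "((\<lambda>t. - (t / e)) has_real_derivative - (1 / e)) (at 0)"
  by (intro DERIV_minus DERIV_cdivide DERIV_ident)
 ultimately have "((\<lambda>t. bump ((1 / e) *\<^sub>R (x - y) + (- (t / e)) *\<^sub>R v)) has_real_derivative bumpD v ((1 / e) *\<^sub>R (x - y) + (- (0 / e)) *\<^sub>R v) * - (1 / e)) (at 0)"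
  by (rule DERIV_chain2)
 from DERIV_cdivide[OF this, of "e ^ DIM('a)"]
 have 2: "((\<lambda>t. dilate e bump (x - (y + t *\<^sub>R v))) has_real_derivative - (dilate e (bumpD v) (x - y) / e)) (at 0)"
  unfolding dilate_def by (simp add: algebra_simps)
 show "pd (\<lambda>y. dilate e bump (x - y)) v y = - (dilate e (bumpD v) (x - y) / e)"
  unfolding pd by (rule DERIV_unique[OF 1 2])
qed

lemma has_dd_dilate_bump: "has_dd (dilate e bump) v (\<lambda>x. dilate e (bumpD v) x / e)"
 unfolding has_dd_def
proof (intro allI)
 fix x :: 'a and t :: real
 have "((\<lambda>s. bump ((1 / e) *\<^sub>R x + s *\<^sub>R v)) has_real_derivative bumpD v ((1 / e) *\<^sub>R x + (t / e) *\<^sub>R v)) (at (t / e))"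
  by (rule has_ddD[OF has_dd_bump])
 moreover have "((\<lambda>t. t / e) has_real_derivative 1 / e) (at t)" by (intro DERIV_cdivide DERIV_ident)
 ultimately have "((\<lambda>t. bump ((1 / e) *\<^sub>R x + (t / e) *\<^sub>R v)) has_real_derivative bumpD v ((1 / e) *\<^sub>R x + (t / e) *\<^sub>R v) * (1 / e)) (at t)"
  by (rule DERIV_chain2)
 from DERIV_cdivide[OF this, of "e ^ DIM('a)"]
 show "((\<lambda>t. dilate e bump (x + t *\<^sub>R v)) has_real_derivative dilate e (bumpD v) (x + t *\<^sub>R v) / e) (at t)"
  unfolding dilate_def by (simp add: scaleR_add_right mult.commute)
qed

text \<open>Difference quotients have integral 0 by translation invariance, and they converge to the
  derivative under a common bound.\<close>

lemma integral_has_dd_eq_0: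
 fixes F :: "'a::euclidean_space => real"
 assumes d: "has_dd F v F'" and F: "bdd_cpt F" and F': "bdd_cpt F'"
 shows "(LBINT x. F' x) = 0"
proof -
 have [measurable]: "borel_fun F" "borel_fun F'" using F F' by (auto dest: bdd_cpt_measurable)
 obtain M R where FR: "\<And>x. R < norm x ==> F x = 0" using bdd_cptE[OF F] by metis
 obtain M where M: "\<And>x. \<bar>F' x\<bar> \<le> M" "0 \<le> M" using bdd_cptE[OF F'] by metis
 define h where "h = (\<lambda>n::nat. inverse (real (Suc n)))"
 have h: "h n \<noteq> 0" "\<bar>h n\<bar> \<le> 1" for n unfolding h_def by (auto simp: inverse_le_1_iff)
 have h0: "h \<longlonglongrightarrow> 0" unfolding h_def by (rule LIMSEQ_inverse_real_of_nat)
 have hat: "filterlim h (at 0) sequentially" by (rule filterlim_atI[OF h0]) (use h in simp)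
 define Q where "Q = (\<lambda>n x. (F (x + h n *\<^sub>R v) - F x) / h n)"
 have "(\<lambda>n. LBINT x. Q n x) \<longlonglongrightarrow> (LBINT x. F' x)"
 proof (rule integral_dominated_convergence[where w="\<lambda>x. M * indicator (cball 0 (R + norm v)) x"])
  show "integrable lborel (\<lambda>x. M * indicator (cball 0 (R + norm v)) x :: real)"
   by (intro integrable_mult_right integrable_real_indicator emeasure_lborel_cball_finite) simp
  show "AE x in lborel. (\<lambda>n. Q n x) \<longlonglongrightarrow> F' x"
  proof (rule AE_I2)
   fix x
   have "((\<lambda>t. F (x + t *\<^sub>R v)) has_real_derivative F' (x + 0 *\<^sub>R v)) (at 0)" by (rule has_ddD[OF d])
   then have "((\<lambda>s. (F (x + s *\<^sub>R v) - F x) / s) \<longlongrightarrow> F' x) (at 0)" by (simp add: has_field_derivative_iff)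
   then show "(\<lambda>n. Q n x) \<longlonglongrightarrow> F' x" unfolding Q_def using hat by (rule filterlim_compose)
  qed
  show "AE x in lborel. norm (Q n x) \<le> M * indicator (cball 0 (R + norm v)) x" for n
  proof (rule AE_I2)
   fix x
   show "norm (Q n x) \<le> M * indicator (cball 0 (R + norm v)) x"
   proof (cases "norm x \<le> R + norm v")
    case True
    then show ?thesis unfolding Q_def using has_dd_difference_quotient[OF d M(1) h(1), of x n] by simp
   next
    case False
    have hv: "norm (h n *\<^sub>R v) \<le> norm v" using h(2)[of n] by (simp add: mult_left_le_one_le)
    have "norm x - norm (h n *\<^sub>R v) \<le> norm (x + h n *\<^sub>R v)" by (rule norm_diff_ineq)
    then have "R < norm (x + h n *\<^sub>R v)" "R < norm x" using False hv norm_ge_zero[of v] by linarith+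
    then show ?thesis unfolding Q_def using FR M(2) by simp
   qed
  qed
  show "Q n \<in> borel_measurable lborel" for n unfolding Q_def[abs_def] by measurable
 qed measurable
 moreover have "(LBINT x. Q n x) = 0" for n
 proof -
  have "(LBINT x. F (x + h n *\<^sub>R v) - F x) = 0"
   using lborel_integral_shift[of F "h n *\<^sub>R v"]
   by (subst Bochner_Integration.integral_diff) (auto intro: bdd_cpt_integrable bdd_cpt_shift F)
  then show ?thesis unfolding Q_def by simp
 qed
 ultimately show ?thesis by (simp add: LIMSEQ_const_iff)
qed

text \<open>Strong convergence implies weak convergence, again by \<open>abs_le_powr_split\<close>:
  \<open>t\<close> makes the first term small, after which \<open>n\<close> is taken large for the
  second.\<close>

lemma integral_mult_tendsto:
 fixes u :: "nat => 'a::euclidean_space => real"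
 assumes p: "1 \<le> p" and u: "\<And>n. Lspace p (u n)" and g: "Lspace p g" and lim: "(\<lambda>n. In p (\<lambda>x. u n x - g x)) \<longlonglongrightarrow> 0"
  and w: "bdd_cpt w"
 shows "(\<lambda>n. LBINT x. w x * u n x) \<longlonglongrightarrow> (LBINT x. w x * g x)"
proof -
 have p0: "0 < p" using p by simp
 obtain M R where pm: "\<And>x. \<bar>w x\<bar> \<le> M" "0 \<le> M" using bdd_cptE[OF w] by metis
 define L where "L = (LBINT x. \<bar>w x\<bar>)"
 have iL: "integrable lborel (\<lambda>x. \<bar>w x\<bar>)" by (intro integrable_abs bdd_cpt_integrable w)
 have L0: "0 \<le> L" unfolding L_def by simp
 define d where "d = (\<lambda>n. enn2real (In p (\<lambda>x. u n x - g x)))"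
 have du: "Lspace p (\<lambda>x. u n x - g x)" for n by (rule Lspace_diff[OF p0 u g])
 have d0: "d \<longlonglongrightarrow> 0" unfolding d_def by (rule tendsto_enn2real) (use lim in simp_all)
 have bound: "\<bar>(LBINT x. w x * u n x) - (LBINT x. w x * g x)\<bar> \<le> t * L + t powr (1 - p) * M * d n" if t: "0 < t" for t n
 proof -
  have ip: "integrable lborel (\<lambda>x. \<bar>u n x - g x\<bar> powr p)"
   by (rule integrableI_nonneg) (use du[of n] in \<open>auto simp: Lspace_def In_def\<close>)
  have dI: "(LBINT x. \<bar>u n x - g x\<bar> powr p) = d n"
   unfolding d_def In_def by (subst integral_eq_nn_integral) (use du[of n] in \<open>auto simp: Lspace_def\<close>)
  have ui: "integrable lborel (\<lambda>x. w x * u n x)" "integrable lborel (\<lambda>x. w x * g x)" "integrable lborel (\<lambda>x. w x * (u n x - g x))"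
   by (intro integrable_bdd_cpt_mult w Lspace_loc_int[OF p] u g du)+
  have "(LBINT x. w x * u n x) - (LBINT x. w x * g x) = (LBINT x. w x * (u n x - g x))"
   unfolding right_diff_distrib by (rule Bochner_Integration.integral_diff[symmetric, OF ui(1,2)])
  also have "\<bar>\<dots>\<bar> \<le> (LBINT x. \<bar>w x * (u n x - g x)\<bar>)" by (rule integral_abs_bound)
  also have "\<dots> \<le> (LBINT x. t * \<bar>w x\<bar> + t powr (1 - p) * M * \<bar>u n x - g x\<bar> powr p)"
  proof (intro integral_mono integrable_abs ui Bochner_Integration.integrable_add integrable_mult_right iL ip bdd_cpt_integrable[OF w])
   fix x
   have "\<bar>w x\<bar> * \<bar>u n x - g x\<bar> \<le> \<bar>w x\<bar> * (t + t powr (1 - p) * \<bar>u n x - g x\<bar> powr p)"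
    by (intro mult_left_mono abs_le_powr_split p t) auto
   also have "\<dots> = t * \<bar>w x\<bar> + \<bar>w x\<bar> * (t powr (1 - p) * \<bar>u n x - g x\<bar> powr p)" by (simp add: algebra_simps)
   also have "\<dots> \<le> t * \<bar>w x\<bar> + M * (t powr (1 - p) * \<bar>u n x - g x\<bar> powr p)"
    by (intro add_left_mono mult_right_mono pm) auto
   finally show "\<bar>w x * (u n x - g x)\<bar> \<le> t * \<bar>w x\<bar> + t powr (1 - p) * M * \<bar>u n x - g x\<bar> powr p"
    by (simp add: abs_mult mult_ac)
  qed
  also have "\<dots> = t * L + t powr (1 - p) * M * d n" unfolding L_def dI[symmetric] using iL ip by simp
  finally show ?thesis .
 qed
 show ?thesis
 proof (rule LIMSEQ_I)
  fix e :: real assume e: "0 < e"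
  define t where "t = e / (2 * (L + 1))"
  have t: "0 < t" unfolding t_def using e L0 by simp
  have "t * L \<le> e / 2" unfolding t_def using e L0 by (simp add: field_simps)
  moreover have "(\<lambda>n. t powr (1 - p) * M * d n) \<longlonglongrightarrow> t powr (1 - p) * M * 0" by (intro tendsto_intros d0)
  then have "\<forall>\<^sub>F n in sequentially. t powr (1 - p) * M * d n < e / 2" by (rule order_tendstoD) (use e in simp)
  then obtain N where "\<And>n. n \<ge> N ==> t powr (1 - p) * M * d n < e / 2" unfolding eventually_sequentially by auto
  ultimately have "norm ((LBINT x. w x * u n x) - (LBINT x. w x * g x)) < e" if "n \<ge> N" for n
   using bound[OF t, of n] that by fastforce
  then show "\<exists>no. \<forall>n\<ge>no. norm ((LBINT x. w x * u n x) - (LBINT x. w x * g x)) < e" by blast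
 qed
qed

section \<open>Weak derivatives tested with once differentiable functions\<close>

definition C1pair :: "'a::euclidean_space set => 'a => ('a => real) => ('a => real) => bool" where
 "C1pair S v w w' \<longleftrightarrow> has_dd w v w' \<and> continuous_on UNIV w \<and> continuous_on UNIV w' \<and>
   (\<exists>C. compact C \<and> C \<subseteq> S \<and> (\<forall>x. x \<notin> C --> w x = 0 \<and> w' x = 0))"

definition loc_int_on :: "'a::euclidean_space set => ('a => real) => bool" where
 "loc_int_on S f \<longleftrightarrow> borel_fun f \<and> (\<forall>C. compact C \<and> C \<subseteq> S --> integrable lborel (\<lambda>x. indicator C x * f x))"

text \<open>Test functions are \<open>C1pair\<close>s, differentiable in the direction
  \<open>v\<close> only, because multiplication by a piecewise polynomial cutoff, reflection and
  convolution stay within this class. Borel functions and \<open>lborel\<close> are used to stay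
  clear of completions.\<close>

definition wd :: "'a::euclidean_space set => 'a => ('a => real) => ('a => real) => bool" where
 "wd S v f g \<longleftrightarrow> loc_int_on S f \<and> loc_int_on S g \<and>
   (\<forall>w w'. C1pair S v w w' --> (LBINT x. w' x * f x) = - (LBINT x. w x * g x))"

lemma C1pair_bdd_cpt:
 assumes "C1pair S v w w'"
 shows "bdd_cpt w" "bdd_cpt w'"
proof -
 obtain C where C: "compact C" "\<And>x. x \<notin> C ==> w x = 0" "\<And>x. x \<notin> C ==> w' x = 0"
  and c: "continuous_on UNIV w" "continuous_on UNIV w'" using assms unfolding C1pair_def by auto
 obtain R where R: "\<And>x. x \<in> C ==> norm x \<le> R" using compact_imp_bounded[OF C(1)] unfolding bounded_iff by auto
 show "bdd_cpt w" by (rule continuous_bdd_cpt[OF c(1), of R]) (use C R in force)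
 show "bdd_cpt w'" by (rule continuous_bdd_cpt[OF c(2), of R]) (use C R in force)
qed

lemma loc_int_on_UNIV: "loc_int_on UNIV f \<longleftrightarrow> loc_int f"
proof
 assume "loc_int_on UNIV f"
 then show "loc_int f" unfolding loc_int_on_def loc_int_def by simp
next
 assume f: "loc_int f"
 have "integrable lborel (\<lambda>x. indicator C x * f x)" if C: "compact C" for C
 proof (rule integrable_bdd_cpt_mult[OF _ f])
  obtain R where R: "\<And>x. x \<in> C ==> norm x \<le> R" using compact_imp_bounded[OF C] unfolding bounded_iff by auto
  show "bdd_cpt (indicator C :: 'a => real)"
   by (rule bdd_cptI[where M=1 and R=R]) (use R borel_compact[OF C] in \<open>auto simp: indicator_def not_le[symmetric]\<close>)
 qed
 then show "loc_int_on UNIV f" using f unfolding loc_int_on_def loc_int_def by simp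
qed

lemma integrable_lebesgue_AE_borel:
 fixes f f' :: "'a::euclidean_space => real"
 assumes "AE x in lebesgue. f x = f' x" "borel_fun f'" "f \<in> borel_measurable lebesgue"
 shows "integrable lebesgue f \<longleftrightarrow> integrable lborel f'" "integral\<^sup>L lebesgue f = integral\<^sup>L lborel f'"
proof -
 have m: "f' \<in> borel_measurable lborel" using assms(2) by simp
 have m': "f' \<in> borel_measurable lebesgue" by (rule measurable_completion[OF m])
 have "integrable lebesgue f \<longleftrightarrow> integrable lebesgue f'" by (rule integrable_cong_AE[OF assms(3) m' assms(1)])
 then show "integrable lebesgue f \<longleftrightarrow> integrable lborel f'" using integrable_completion[OF m] by simp
 have "integral\<^sup>L lebesgue f = integral\<^sup>L lebesgue f'" by (rule integral_cong_AE[OF assms(3) m' assms(1)])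
 then show "integral\<^sup>L lebesgue f = integral\<^sup>L lborel f'" using integral_completion[OF m] by simp
qed

text \<open>The product rule, combined with the fact that the derivative of the product has integral
  0.\<close>

lemma has_dd_imp_wd:
 assumes d: "has_dd f v g" and c: "continuous_on UNIV f" "continuous_on UNIV g"
 shows "wd UNIV v f g"
proof -
 have li: "loc_int h" if h: "continuous_on UNIV h" for h :: "'a => real"
  unfolding loc_int_on_UNIV[symmetric] loc_int_on_def
 proof (intro conjI allI impI)
  show m: "borel_fun h" using borel_measurable_continuous_onI[OF h] .
  fix C :: "'a set" assume C: "compact C \<and> C \<subseteq> UNIV"
  have "integrable lborel (\<lambda>x. indicator C x *\<^sub>R h x)" by (rule borel_integrable_compact) (use C continuous_on_subset[OF h] in auto)
  then show "integrable lborel (\<lambda>x. indicator C x * h x)" by simp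
 qed
 show ?thesis unfolding wd_def loc_int_on_UNIV
 proof (intro conjI allI impI li c)
  fix k k' assume C: "C1pair UNIV v k k'"
  note C' = C1pair_bdd_cpt[OF C]
  have w: "has_dd k v k'" "continuous_on UNIV k" "continuous_on UNIV k'" using C unfolding C1pair_def by auto
  have b: "bdd_cpt (\<lambda>x. \<phi> x * h x)" if \<phi>: "bdd_cpt \<phi>" "continuous_on UNIV \<phi>" and h: "continuous_on UNIV h" for \<phi> h :: "'a => real"
  proof -
   obtain R where "\<And>x. R < norm x ==> \<phi> x = 0" using bdd_cptE[OF \<phi>(1)] by metis
   then show ?thesis by (intro continuous_bdd_cpt[of _ R] continuous_on_mult \<phi> h) simp
  qed
  note b1 = b[OF C'(1) w(2) c(1)] and b2 = b[OF C'(2) w(3) c(1)] and b3 = b[OF C'(1) w(2) c(2)]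
  have e: "has_dd (\<lambda>x. k x * f x) v (\<lambda>x. k' x * f x + k x * g x)" using has_dd_mult[OF w(1) d] by (simp add: algebra_simps)
  from integral_has_dd_eq_0[OF e b1 bdd_cpt_add[OF b2 b3]]
  show "(LBINT x. k' x * f x) = - (LBINT x. k x * g x)"
   using bdd_cpt_integrable[OF b2] bdd_cpt_integrable[OF b3] by simp
 qed
qed

lemma compact_neighbourhood:
 fixes C :: "'a::euclidean_space set"
 assumes "compact C" "open S" "C \<subseteq> S"
 obtains e C' where "0 < e" "e \<le> 1" "compact C'" "C' \<subseteq> S" "\<And>x. x \<in> C ==> cball x e \<subseteq> C'"
proof -
 obtain e where e: "e > 0" "(\<Union>x\<in>C. cball x e) \<subseteq> S"
  using compact_subset_open_imp_cball_epsilon_subset[OF assms] by blast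
 define d where "d = min e 1"
 define C' where "C' = (\<Union>x\<in>C. \<Union>y\<in>cball 0 d. {x + y})"
 have C'eq: "C' = (\<Union>x\<in>C. cball x d)"
 proof -
  have "(\<Union>y\<in>cball 0 d. {x + y}) = cball x d" for x :: 'a
  proof -
   have "z \<in> (\<Union>y\<in>cball 0 d. {x + y})" if "z \<in> cball x d" for z
    using that by (intro UN_I[of "z - x"]) (auto simp: dist_norm norm_minus_commute)
   then show ?thesis by (auto simp: dist_norm)
  qed
  then show ?thesis unfolding C'_def by simp
 qed
 show thesis
 proof (rule that[of d C'])
  show "compact C'" unfolding C'_def by (rule compact_sums'[OF assms(1) compact_cball])
  have "cball x d \<subseteq> cball x e" for x :: 'a unfolding d_def by (rule subset_cball) simp
  then show "C' \<subseteq> S" unfolding C'eq using e(2) by blast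
 qed (use e in \<open>auto simp: d_def C'eq\<close>)
qed

text \<open>A weak derivative may be tested with functions that are only continuously differentiable in
 the direction concerned: mollify the function, not the test function.\<close>

lemma has_weak_deriv_imp_wd:
 fixes f g f' g' :: "'a::euclidean_space => real"
 assumes S: "open S" and w: "has_weak_deriv S v f g"
  and b: "borel_fun f'" "borel_fun g'"
  and ae: "AE x in lebesgue. x \<in> S --> f x = f' x" "AE x in lebesgue. x \<in> S --> g x = g' x"
 shows "wd S v f' g'"
proof -
 note [measurable] = b
 have loc: "loc_int_on S h'" if h': "borel_fun h'" "AE x in lebesgue. x \<in> S --> h x = h' x"
  and int: "\<And>C. compact C ==> C \<subseteq> S ==> set_integrable lebesgue C h" for h h'
  unfolding loc_int_on_def
 proof (intro conjI allI impI h')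
  fix C assume C: "compact C \<and> C \<subseteq> S"
  then have i: "integrable lebesgue (\<lambda>x. indicator C x * h x)" using int[of C] unfolding set_integrable_def by simp
  have m: "borel_fun (\<lambda>x. indicator C x * h' x)"
   using h'(1) C borel_compact by (intro borel_measurable_times borel_measurable_indicator) auto
  have ae: "AE x in lebesgue. indicator C x * h x = indicator C x * h' x"
   using h'(2) by eventually_elim (use C in \<open>auto simp: indicator_def\<close>)
  show "integrable lborel (\<lambda>x. indicator C x * h' x)"
   using integrable_lebesgue_AE_borel(1)[OF ae m borel_measurable_integrable[OF i]] i by simp
 qed
 have lf: "loc_int_on S f'" and lg: "loc_int_on S g'"
  using w unfolding has_weak_deriv_def by (auto intro: loc[OF b(1) ae(1)] loc[OF b(2) ae(2)])
 have "(LBINT x. u' x * f' x) = - (LBINT x. u x * g' x)" if u: "C1pair S v u u'" for u u'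
 proof -
  obtain C where C: "compact C" "C \<subseteq> S" "\<And>x. x \<notin> C ==> u x = 0" "\<And>x. x \<notin> C ==> u' x = 0"
   and dd: "has_dd u v u'"
   using u unfolding C1pair_def by auto
  note bp = C1pair_bdd_cpt[OF u]
  obtain e C' where e: "0 < e" "e \<le> 1" and C': "compact C'" "C' \<subseteq> S" and sub: "\<And>x. x \<in> C ==> cball x e \<subseteq> C'"
   using compact_neighbourhood[OF C(1) S C(2)] by metis
  have CC': "C \<subseteq> C'" using sub e(1) by (metis centre_in_cball less_imp_le subset_eq)
  define F where "F = (\<lambda>x. indicator C' x * f' x)"
  define G where "G = (\<lambda>x. indicator C' x * g' x)"
  have L1: "Lspace 1 (\<lambda>x. indicator C' x * h x)" if h: "loc_int_on S h" for h :: "'a => real"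
  proof -
   have "integrable lborel (\<lambda>x. indicator C' x * h x)" using h C' unfolding loc_int_on_def by blast
   then have "borel_fun (\<lambda>x. indicator C' x * h x)" "(\<integral>\<^sup>+x. ennreal (norm (indicator C' x * h x)) \<partial>lborel) < \<infinity>"
    unfolding integrable_iff_bounded by auto
   then show ?thesis unfolding Lspace_def In_def by simp
  qed
  have F1: "Lspace 1 F" and G1: "Lspace 1 G" unfolding F_def G_def using L1 lf lg by auto
  have Fl: "loc_int F" and Gl: "loc_int G" using F1 G1 by (auto intro: Lspace_loc_int[of 1])
  define d where "d = (\<lambda>n. e * inverse (real (Suc n)))"
  have d: "0 < d n" "d n \<le> e" "d n \<le> 1" for n
  proof -
   have "inverse (real (Suc n)) \<le> 1" by (auto simp: inverse_le_1_iff)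
   then show "d n \<le> e" unfolding d_def using e(1) by (simp add: mult_left_le)
   then show "d n \<le> 1" using e(2) by simp
   show "0 < d n" unfolding d_def using e(1) by simp
  qed
  have d0: "d \<longlonglongrightarrow> 0" unfolding d_def using LIMSEQ_inverse_real_of_nat by (rule tendsto_mult_right_zero)
  define bd where "bd = (\<lambda>n. dilate (d n) (bump :: 'a => real))"
  define bd' where "bd' = (\<lambda>n x. dilate (d n) (bumpD v) x / d n)"
  have bb: "bdd_cpt (bd n)" "bdd_cpt (bd' n)" for n
   unfolding bd_def bd'_def by (intro bdd_cpt_divide bdd_cpt_dilate bdd_cpt_bump d)+
  have bdd: "has_dd (bd n) v (bd' n)" for n unfolding bd_def bd'_def by (rule has_dd_dilate_bump)
  \<comment> \<open>For \<open>x\<close> in \<open>C\<close> the mollifier centred at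
    \<open>x\<close> is supported in \<open>S\<close>, so it may be inserted into the hypothesis.
    The result says that on the support of \<open>u\<close> the classical derivative of the
    mollified \<open>F\<close> is the mollified \<open>G\<close>.\<close>
  have key: "conv (bd' n) F x = conv (bd n) G x" if x: "x \<in> C" for n x
  proof -
   let ?\<phi> = "\<lambda>y. dilate (d n) bump (x - y)"
   have "cball x (d n) \<subseteq> cball x e" by (rule subset_cball) (rule d)
   then have "cball x (d n) \<subseteq> S" and inC': "cball x (d n) \<subseteq> C'" using sub[OF x] C'(2) by blast+
   note tf = dilate_bump_test_fun[OF d(1) this(1)]
   have z: "dilate (d n) bump (x - y) = 0" "dilate (d n) (bumpD v) (x - y) = 0" if "y \<notin> C'" for y
   proof -
    have "y \<notin> cball x (d n)" using that inC' by blast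
    then have lt: "d n * 1 < norm (x - y)" by (simp add: dist_norm)
    show "dilate (d n) bump (x - y) = 0" "dilate (d n) (bumpD v) (x - y) = 0"
     by (intro dilate_support[of 1 _ "d n" "x - y"] bump_support d lt; assumption)+
   qed
   have eq: "(LINT y:S|lebesgue. pd ?\<phi> v y *\<^sub>R f y) = - (LINT y:S|lebesgue. ?\<phi> y *\<^sub>R g y)"
    using w tf(1) unfolding has_weak_deriv_def by blast
   have conv_eq: "(LINT y:S|lebesgue. k y *\<^sub>R h y) = (LBINT y. k y * (indicator C' y * h' y))"
    if k: "borel_fun k" "\<And>y. y \<notin> C' ==> k y = 0" and h': "borel_fun h'" "AE x in lebesgue. x \<in> S --> h x = h' x"
    for k h h' :: "'a => real"
   proof -
    have 1: "AE y in lebesgue. indicator S y *\<^sub>R (k y *\<^sub>R h y) = k y * (indicator C' y * h' y)"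
     using h'(2) by eventually_elim (use k(2) C' in \<open>auto simp: indicator_def\<close>)
    have 2: "borel_fun (\<lambda>y. k y * (indicator C' y * h' y))"
     using k(1) h'(1) C' borel_compact by (intro borel_measurable_times borel_measurable_indicator) auto
    have "(\<lambda>y. k y * (indicator C' y * h' y)) \<in> borel_measurable lebesgue" by (rule measurable_completion) (use 2 in simp)
    then have 3: "(\<lambda>y. indicator S y *\<^sub>R (k y *\<^sub>R h y)) \<in> borel_measurable lebesgue"
     by (rule borel_measurable_AE) (use 1 in eventually_elim, erule sym)
    show ?thesis unfolding set_lebesgue_integral_def using integrable_lebesgue_AE_borel(2)[OF 1 2 3] .
   qed
   have m: "borel_fun (\<lambda>y. bd n (x - y))" "borel_fun (\<lambda>y. - bd' n (x - y))"
    using bdd_cpt_reflect[OF bb(1)[of n], of x] bdd_cpt_cmult[OF bdd_cpt_reflect[OF bb(2)[of n], of x], of "-1"] by (auto dest: bdd_cpt_measurable)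
   have "(LBINT y. - bd' n (x - y) * F y) = - (LBINT y. bd n (x - y) * G y)"
   proof -
    have "pd ?\<phi> v = (\<lambda>y. - bd' n (x - y))" unfolding bd'_def by (rule ext) (rule tf(2))
    then have "(LBINT y. - bd' n (x - y) * F y) = (LINT y:S|lebesgue. pd ?\<phi> v y *\<^sub>R f y)"
     unfolding F_def by (simp only:) (rule conv_eq[symmetric, OF m(2) _ b(1) ae(1)], simp add: bd'_def z)
    also have "\<dots> = - (LBINT y. bd n (x - y) * G y)"
     unfolding eq G_def bd_def by (rule arg_cong[where f=uminus], rule conv_eq[OF m(1)[unfolded bd_def] _ b(2) ae(2)]) (simp add: z)
    finally show ?thesis .
   qed
   then show ?thesis unfolding conv_def by simp
  qed
  have ibp: "(LBINT x. u' x * conv (bd n) F x) = - (LBINT x. u x * conv (bd n) G x)" for n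
  proof -
   have cc: "continuous_on UNIV (conv (bd n) F)" "continuous_on UNIV (conv (bd' n) F)"
    unfolding bd_def bd'_def dilate_def[abs_def] divide_inverse
    by (intro continuous_conv Fl continuous_intros continuous_on_compose2[OF continuous_bump(1)] continuous_on_compose2[OF continuous_bump(2)] subset_UNIV
      bb[of n, unfolded bd_def bd'_def dilate_def[abs_def] divide_inverse])+
   have "C1pair UNIV v u u'" using u unfolding C1pair_def by auto
   then have "(LBINT x. u' x * conv (bd n) F x) = - (LBINT x. u x * conv (bd' n) F x)"
    using has_dd_imp_wd[OF has_dd_conv[OF bdd bb Fl] cc] unfolding wd_def by simp
   also have "(LBINT x. u x * conv (bd' n) F x) = (LBINT x. u x * conv (bd n) G x)"
   proof (rule Bochner_Integration.integral_cong[OF refl])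
    fix x
    show "u x * conv (bd' n) F x = u x * conv (bd n) G x"
     using key[of x n] C(3)[of x] by (cases "x \<in> C") auto
   qed
   finally show ?thesis .
  qed
  \<comment> \<open>\<open>bump\<close> is not normalised: its mass appears in both limits and is
    cancelled at the end.\<close>
  define B where "B = (\<integral>x. (bump x :: real) \<partial>(lborel :: 'a measure))"
  have B: "0 < B" unfolding B_def by (rule bump_integral_pos)
  have lim: "(\<lambda>n. LBINT x. t x * conv (bd n) H x) \<longlonglongrightarrow> B * (LBINT x. t x * H x)"
   if H: "Lspace 1 H" and t: "bdd_cpt t" for t H
  proof -
   have "(\<lambda>n. LBINT x. t x * conv (bd n) H x) \<longlonglongrightarrow> (LBINT x. t x * (B * H x))"
   proof (rule integral_mult_tendsto[OF order_refl _ Lspace_cmult[OF H] _ t])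
    show "Lspace 1 (conv (bd n) H)" for n by (rule Lspace_conv[OF order_refl bb(1) H])
    show "(\<lambda>n. In 1 (\<lambda>x. conv (bd n) H x - B * H x)) \<longlonglongrightarrow> 0"
     unfolding bd_def B_def by (rule conv_dilate_tendsto[OF order_refl bdd_cpt_bump(1) H d(1) d(3) d0])
   qed
   then show ?thesis by (simp add: mult.left_commute)
  qed
  have "(\<lambda>n. LBINT x. u' x * conv (bd n) F x) \<longlonglongrightarrow> B * (LBINT x. u' x * F x)" by (rule lim[OF F1 bp(2)])
  moreover have "(\<lambda>n. LBINT x. u' x * conv (bd n) F x) \<longlonglongrightarrow> - (B * (LBINT x. u x * G x))"
   unfolding ibp by (intro tendsto_minus lim G1 bp)
  ultimately have "B * (LBINT x. u' x * F x) = B * - (LBINT x. u x * G x)"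
   using LIMSEQ_unique by fastforce
  then have "(LBINT x. u' x * F x) = - (LBINT x. u x * G x)"
   by (simp only: mult_left_cancel[OF less_imp_neq[OF B, symmetric]])
  moreover have "u' x * F x = u' x * f' x" "u x * G x = u x * g' x" for x
   unfolding F_def G_def using C(3,4)[of x] CC' by (cases "x \<in> C"; auto simp: indicator_def)+
  ultimately show ?thesis by simp
 qed
 then show ?thesis unfolding wd_def using lf lg by blast
qed

lemma test_fun_C1pair:
 fixes g :: "'a::euclidean_space => real"
 assumes t: "test_fun S g"
 shows "C1pair S v g (pd g v)"
proof -
 have Ck: "Ck (Suc (Suc 0)) g" using t unfolding test_fun_def smooth_def by simp
 then have d: "g differentiable (at x)" for x by simp
 have D: "(g has_derivative frechet_derivative g (at x)) (at x)" for x
  using d by (simp add: frechet_derivative_works)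
 have c: "continuous_on UNIV g"
  by (intro continuous_at_imp_continuous_on ballI has_derivative_continuous[OF D])
 have "\<forall>x. pd g v differentiable (at x)" using Ck by simp
 then have c': "continuous_on UNIV (pd g v)"
  by (intro continuous_at_imp_continuous_on ballI differentiable_imp_continuous_within) auto
 have dd: "has_dd g v (pd g v)" unfolding has_dd_def
 proof (intro allI)
  fix x t
  have l: "((\<lambda>t. x + t *\<^sub>R v) has_derivative (\<lambda>s. s *\<^sub>R v)) (at t)" by (auto intro!: derivative_eq_intros)
  have "((\<lambda>t. g (x + t *\<^sub>R v)) has_derivative (\<lambda>s. frechet_derivative g (at (x + t *\<^sub>R v)) (s *\<^sub>R v))) (at t)"
   using diff_chain_at[OF l D] unfolding o_def .
  moreover have "frechet_derivative g (at (x + t *\<^sub>R v)) (s *\<^sub>R v) = s * pd g v (x + t *\<^sub>R v)" for s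
   unfolding pd_def using linear_scale[OF has_derivative_linear[OF D]] by simp
  ultimately show "((\<lambda>t. g (x + t *\<^sub>R v)) has_real_derivative pd g v (x + t *\<^sub>R v)) (at t)"
   unfolding has_field_derivative_def by (simp add: mult_commute_abs)
 qed
 define C where "C = closure {x. g x \<noteq> 0}"
 have C: "compact C" "C \<subseteq> S" using t unfolding test_fun_def C_def by auto
 have z: "g x = 0" if "x \<notin> C" for x using that closure_subset[of "{x. g x \<noteq> 0}"] unfolding C_def by auto
 have z': "pd g v x = 0" if "x \<notin> C" for x
 proof -
  have o: "open (- C)" unfolding C_def by (rule open_Compl[OF closed_closure])
  have "(g has_derivative (\<lambda>_. 0)) (at x)"
   by (rule has_derivative_transform_within_open[where f="\<lambda>_. 0" and s="- C"]) (use o that z in auto)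
  then show ?thesis unfolding pd_def by (simp add: frechet_derivative_at[symmetric])
 qed
 show ?thesis unfolding C1pair_def by (intro conjI dd c c' exI[of _ C] C allI impI z z')
qed

definition loc_set_integrable :: "'a::euclidean_space set => ('a => 'b::euclidean_space) => bool" where
 "loc_set_integrable S h \<longleftrightarrow> (\<forall>C. compact C \<and> C \<subseteq> S --> set_integrable lebesgue C h)"

lemma set_integral_inner:
 fixes w :: "'a::euclidean_space => real" and h :: "'a => 'b::euclidean_space"
 assumes h: "loc_set_integrable S h"
  and w: "continuous_on UNIV w" "\<exists>C. compact C \<and> C \<subseteq> S \<and> (\<forall>x. x \<notin> C --> w x = 0)"
 shows "(LINT x:S|lebesgue. w x *\<^sub>R h x) \<bullet> b = (LINT x:S|lebesgue. w x *\<^sub>R (h x \<bullet> b))"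
proof -
 obtain C where C: "compact C" "C \<subseteq> S" "\<And>x. x \<notin> C ==> w x = 0" using w(2) by blast
 have i: "integrable lebesgue (\<lambda>x. indicator C x *\<^sub>R h x)" using h C(1,2) unfolding loc_set_integrable_def set_integrable_def by auto
 have "bounded (w ` C)" by (intro compact_imp_bounded compact_continuous_image continuous_on_subset[OF w(1)] C) auto
 then obtain M where M: "\<And>x. x \<in> C ==> \<bar>w x\<bar> \<le> M" unfolding bounded_iff by auto
 have eq: "(\<lambda>x. indicator S x *\<^sub>R (w x *\<^sub>R h x)) = (\<lambda>x. w x *\<^sub>R (indicator C x *\<^sub>R h x))"
  using C(2,3) by (auto simp: fun_eq_iff indicator_def)
 have m: "w \<in> borel_measurable lebesgue"
  by (rule measurable_completion) (simp add: borel_measurable_continuous_onI[OF w(1)])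
 have "integrable lebesgue (\<lambda>x. w x *\<^sub>R (indicator C x *\<^sub>R h x))"
 proof (rule Bochner_Integration.integrable_bound)
  show "integrable lebesgue (\<lambda>x. \<bar>M\<bar> * norm (indicator C x *\<^sub>R h x))" by (intro integrable_mult_right integrable_norm i)
  show "AE x in lebesgue. norm (w x *\<^sub>R (indicator C x *\<^sub>R h x)) \<le> norm (\<bar>M\<bar> * norm (indicator C x *\<^sub>R h x))"
  proof (rule AE_I2)
   fix x
   have "x \<in> C ==> \<bar>w x\<bar> * norm (h x) \<le> \<bar>M\<bar> * norm (h x)"
    by (rule mult_right_mono[OF order_trans[OF M abs_ge_self]]) simp_all
   then show "norm (w x *\<^sub>R (indicator C x *\<^sub>R h x)) \<le> norm (\<bar>M\<bar> * norm (indicator C x *\<^sub>R h x))"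
    by (cases "x \<in> C") simp_all
  qed
 qed (intro borel_measurable_scaleR m borel_measurable_integrable[OF i])
 then have "integrable lebesgue (\<lambda>x. indicator S x *\<^sub>R (w x *\<^sub>R h x))" unfolding eq .
 then show ?thesis unfolding set_lebesgue_integral_def
  by (subst integral_inner_left[symmetric]) (simp_all add: mult.assoc)
qed

lemma has_weak_deriv_iff:
 "has_weak_deriv S v f g \<longleftrightarrow> loc_set_integrable S f \<and> loc_set_integrable S g \<and>
   (\<forall>h::'a::euclidean_space => real. test_fun S h -->
    (LINT x:S|lebesgue. pd h v x *\<^sub>R f x) = - (LINT x:S|lebesgue. h x *\<^sub>R g x))"
 unfolding has_weak_deriv_def loc_set_integrable_def by blast

lemma loc_set_integrable_inner:
 "loc_set_integrable S h ==> loc_set_integrable S (\<lambda>x. h x \<bullet> b)"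
 unfolding loc_set_integrable_def set_integrable_def
 using integrable_inner_left[of b lebesgue "\<lambda>x. indicator _ x *\<^sub>R h x"] by simp

lemma loc_set_integrable_componentwise:
 fixes h :: "'a::euclidean_space => 'b::euclidean_space"
 assumes "\<And>b. b \<in> Basis ==> loc_set_integrable S (\<lambda>x. h x \<bullet> b)"
 shows "loc_set_integrable S h"
 unfolding loc_set_integrable_def set_integrable_def
proof (intro allI impI)
 fix C assume C: "compact C \<and> C \<subseteq> S"
 have "integrable lebesgue (\<lambda>x. \<Sum>b\<in>Basis. (indicator C x *\<^sub>R (h x \<bullet> b)) *\<^sub>R b)"
  using assms C unfolding loc_set_integrable_def set_integrable_def
  by (intro Bochner_Integration.integrable_sum integrable_scaleR_left) blast
 moreover have "(\<Sum>b\<in>Basis. (indicator C x *\<^sub>R (h x \<bullet> b)) *\<^sub>R b) = indicator C x *\<^sub>R h x" for x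
  by (subst (2) euclidean_representation[of "h x", symmetric]) (simp add: scaleR_sum_right)
 ultimately show "integrable lebesgue (\<lambda>x. indicator C x *\<^sub>R h x)" by simp
qed

lemma has_weak_deriv_componentwise:
 fixes f g :: "'a::euclidean_space => 'b::euclidean_space"
 shows "has_weak_deriv S v f g \<longleftrightarrow> (\<forall>b\<in>Basis. has_weak_deriv S v (\<lambda>x. f x \<bullet> b) (\<lambda>x. g x \<bullet> b))"
proof -
 have t: "continuous_on UNIV w" "continuous_on UNIV (pd w v)" "\<exists>C. compact C \<and> C \<subseteq> S \<and> (\<forall>x. x \<notin> C --> w x = 0)"
  "\<exists>C. compact C \<and> C \<subseteq> S \<and> (\<forall>x. x \<notin> C --> pd w v x = 0)" if "test_fun S w" for w :: "'a => real"
  using test_fun_C1pair[OF that, of v] unfolding C1pair_def by blast+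
 have inner: "((LINT x:S|lebesgue. pd w v x *\<^sub>R f x) = - (LINT x:S|lebesgue. w x *\<^sub>R g x)) \<longleftrightarrow>
   (\<forall>b\<in>Basis. (LINT x:S|lebesgue. pd w v x *\<^sub>R (f x \<bullet> b)) = - (LINT x:S|lebesgue. w x *\<^sub>R (g x \<bullet> b)))"
  if "loc_set_integrable S f" "loc_set_integrable S g" "test_fun S w" for w :: "'a => real"
  unfolding euclidean_eq_iff[where 'a='b] inner_minus_left
   set_integral_inner[OF that(1) t(2,4)[OF that(3)]] set_integral_inner[OF that(2) t(1,3)[OF that(3)]] ..
 have li: "loc_set_integrable S h \<longleftrightarrow> (\<forall>b\<in>Basis. loc_set_integrable S (\<lambda>x. h x \<bullet> b))" for h :: "'a => 'b"
  by (rule iffI) (simp add: loc_set_integrable_inner, rule loc_set_integrable_componentwise, simp)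
 show ?thesis
 proof
  assume "has_weak_deriv S v f g"
  then show "\<forall>b\<in>Basis. has_weak_deriv S v (\<lambda>x. f x \<bullet> b) (\<lambda>x. g x \<bullet> b)"
   unfolding has_weak_deriv_iff using inner by (simp add: loc_set_integrable_inner)
 next
  assume r: "\<forall>b\<in>Basis. has_weak_deriv S v (\<lambda>x. f x \<bullet> b) (\<lambda>x. g x \<bullet> b)"
  then have "loc_set_integrable S f" "loc_set_integrable S g" unfolding has_weak_deriv_iff by (simp_all add: li)
  then show "has_weak_deriv S v f g" using r inner unfolding has_weak_deriv_iff by simp
 qed
qed

text \<open>The smooth test functions are among the \<open>C1pair\<close>s, and for Borel integrands
  the integrals over \<open>lebesgue\<close> and \<open>lborel\<close> coincide.\<close>

lemma wd_imp_has_weak_deriv: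
 fixes f g :: "'a::euclidean_space => real"
 assumes w: "wd S v f g"
 shows "has_weak_deriv S v f g"
proof -
 have loc: "loc_set_integrable S h" if h: "loc_int_on S h" for h
  unfolding loc_set_integrable_def set_integrable_def
 proof (intro allI impI)
  fix C assume "compact C \<and> C \<subseteq> S"
  then have "integrable lborel (\<lambda>x. indicator C x * h x)" using h unfolding loc_int_on_def by blast
  then have "integrable lebesgue (\<lambda>x. indicator C x * h x)"
   using integrable_completion borel_measurable_integrable by blast
  then show "integrable lebesgue (\<lambda>x. indicator C x *\<^sub>R h x)" by simp
 qed
 have "(LINT x:S|lebesgue. pd \<phi> v x *\<^sub>R f x) = - (LINT x:S|lebesgue. \<phi> x *\<^sub>R g x)" if t: "test_fun S \<phi>" for \<phi> :: "'a => real"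
 proof -
  note C1 = test_fun_C1pair[OF t, of v]
  have z: "x \<notin> S ==> \<phi> x = 0" "x \<notin> S ==> pd \<phi> v x = 0" for x using C1 unfolding C1pair_def by blast+
  have eq: "(LINT x:S|lebesgue. k x *\<^sub>R h x) = (LBINT x. k x * h x)"
   if k: "bdd_cpt k" "\<And>x. x \<notin> S ==> k x = 0" and h: "borel_fun h" for k h :: "'a => real"
  proof -
   have "(\<lambda>x. indicator S x *\<^sub>R (k x *\<^sub>R h x)) = (\<lambda>x. k x * h x)" using k(2) by (auto simp: fun_eq_iff indicator_def)
   moreover have "(\<lambda>x. k x * h x) \<in> borel_measurable lborel" using bdd_cpt_measurable[OF k(1)] h by measurable
   ultimately show ?thesis unfolding set_lebesgue_integral_def by (simp add: integral_completion)
  qed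
  have m: "borel_fun f" "borel_fun g" using w unfolding wd_def loc_int_on_def by auto
  show ?thesis
   by (subst eq[OF C1pair_bdd_cpt(2)[OF C1] z(2) m(1)], assumption, subst eq[OF C1pair_bdd_cpt(1)[OF C1] z(1) m(2)], assumption)
    (use w C1 in \<open>simp add: wd_def\<close>)
 qed
 then show ?thesis unfolding has_weak_deriv_iff using w loc unfolding wd_def by blast
qed

lemma loc_int_onD:
 assumes "loc_int_on S f" "bdd_cpt w" "\<exists>C. compact C \<and> C \<subseteq> S \<and> (\<forall>x. x \<notin> C --> w x = 0)"
 shows "integrable lborel (\<lambda>x. w x * f x)"
proof -
 obtain C where C: "compact C" "C \<subseteq> S" "\<And>x. x \<notin> C ==> w x = 0" using assms(3) by auto
 have i: "integrable lborel (\<lambda>x. indicator C x * f x)" using assms(1) C unfolding loc_int_on_def by auto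
 have [measurable]: "borel_fun f" "borel_fun w"
  using assms(1) bdd_cpt_measurable[OF assms(2)] unfolding loc_int_on_def by auto
 obtain M where M: "\<And>x. \<bar>w x\<bar> \<le> M" using bdd_cptE[OF assms(2)] by metis
 show ?thesis
 proof (rule Bochner_Integration.integrable_bound)
  show "integrable lborel (\<lambda>x. M * (indicator C x * f x))" by (rule integrable_mult_right[OF i])
  show "AE x in lborel. norm (w x * f x) \<le> norm (M * (indicator C x * f x))"
  proof (rule AE_I2)
   fix x
   have "\<bar>w x\<bar> * \<bar>f x\<bar> \<le> \<bar>M\<bar> * \<bar>f x\<bar>" by (rule mult_right_mono[OF order_trans[OF M abs_ge_self]]) simp
   then show "norm (w x * f x) \<le> norm (M * (indicator C x * f x))"
    using C(3)[of x] by (cases "x \<in> C") (simp_all add: abs_mult)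
  qed
 qed measurable
qed

lemma wdD:
 assumes "wd S v f g"
 shows "loc_int_on S f" "loc_int_on S g" "borel_fun f" "borel_fun g"
  "C1pair S v w w' ==> (LBINT x. w' x * f x) = - (LBINT x. w x * g x)"
  "C1pair S v w w' ==> integrable lborel (\<lambda>x. w' x * f x)"
  "C1pair S v w w' ==> integrable lborel (\<lambda>x. w x * g x)"
proof -
 show l: "loc_int_on S f" "loc_int_on S g" using assms unfolding wd_def by auto
 then show "borel_fun f" "borel_fun g" unfolding loc_int_on_def by auto
 assume c: "C1pair S v w w'"
 show "(LBINT x. w' x * f x) = - (LBINT x. w x * g x)" using assms c unfolding wd_def by auto
 obtain C where C: "compact C" "C \<subseteq> S" "\<And>x. x \<notin> C ==> w x = 0" "\<And>x. x \<notin> C ==> w' x = 0"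
  using c unfolding C1pair_def by auto
 show "integrable lborel (\<lambda>x. w' x * f x)" "integrable lborel (\<lambda>x. w x * g x)"
  by (rule loc_int_onD[OF l(1) C1pair_bdd_cpt(2)[OF c]] loc_int_onD[OF l(2) C1pair_bdd_cpt(1)[OF c]]; use C in auto)+
qed

lemma loc_int_on_lincomb:
 assumes "loc_int_on S f" "loc_int_on S g"
 shows "loc_int_on S (\<lambda>x. a * f x + b * g x)"
 unfolding loc_int_on_def
proof (intro conjI allI impI)
 show "borel_fun (\<lambda>x. a * f x + b * g x)" using assms unfolding loc_int_on_def by auto
 fix C assume "compact C \<and> C \<subseteq> S"
 then have "integrable lborel (\<lambda>x. indicator C x * f x)" "integrable lborel (\<lambda>x. indicator C x * g x)"
  using assms unfolding loc_int_on_def by auto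
 then have "integrable lborel (\<lambda>x. a * (indicator C x * f x) + b * (indicator C x * g x))" by auto
 then show "integrable lborel (\<lambda>x. indicator C x * (a * f x + b * g x))" by (simp add: algebra_simps)
qed

lemma wd_lincomb:
 assumes "wd S v f f'" "wd S v g g'"
 shows "wd S v (\<lambda>x. a * f x + b * g x) (\<lambda>x. a * f' x + b * g' x)"
 unfolding wd_def
proof (intro conjI allI impI loc_int_on_lincomb wdD(1)[OF assms(1)] wdD(1)[OF assms(2)] wdD(2)[OF assms(1)] wdD(2)[OF assms(2)])
 fix w w' assume c: "C1pair S v w w'"
 have e: "(\<lambda>x. \<phi> x * (a * h x + b * k x)) = (\<lambda>x. a * (\<phi> x * h x) + b * (\<phi> x * k x))" for \<phi> h k :: "'a => real"
  by (simp add: fun_eq_iff algebra_simps)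
 show "(LBINT x. w' x * (a * f x + b * g x)) = - (LBINT x. w x * (a * f' x + b * g' x))"
  unfolding e using wdD(5-7)[OF assms(1) c] wdD(5-7)[OF assms(2) c] by simp
qed

lemma wd_cmult: "wd S v f f' ==> wd S v (\<lambda>x. a * f x) (\<lambda>x. a * f' x)"
 using wd_lincomb[of S v f f' f f' a 0] by simp

lemma wd_add: "wd S v f f' ==> wd S v g g' ==> wd S v (\<lambda>x. f x + g x) (\<lambda>x. f' x + g' x)"
 using wd_lincomb[of S v f f' g g' 1 1] by simp

lemma wd_diff: "wd S v f f' ==> wd S v g g' ==> wd S v (\<lambda>x. f x - g x) (\<lambda>x. f' x - g' x)"
 using wd_lincomb[of S v f f' g g' 1 "-1"] by simp

lemma wd_sum:
 assumes "\<And>i. i \<in> I ==> wd S v (f i) (f' i)" "finite I" "I \<noteq> {}"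
 shows "wd S v (\<lambda>x. \<Sum>i\<in>I. f i x) (\<lambda>x. \<Sum>i\<in>I. f' i x)"
 using assms(2,3,1) by (induction I rule: finite_ne_induct) (simp_all add: wd_add)

lemma wd_mono:
 assumes w: "wd S v f g" and "S' \<subseteq> S"
 shows "wd S' v f g"
proof -
 have "C1pair S v k k'" if "C1pair S' v k k'" for k k'
  using that assms(2) unfolding C1pair_def by (meson order_trans)
 moreover have "loc_int_on S' h" if "loc_int_on S h" for h using that assms(2) unfolding loc_int_on_def by (meson order_trans)
 ultimately show ?thesis using w unfolding wd_def by simp
qed

lemma wd_cong_AE:
 fixes f g f' g' :: "'a::euclidean_space => real"
 assumes w: "wd S v f g" and m: "borel_fun f'" "borel_fun g'"
  and ae: "AE x in lborel. x \<in> S --> f x = f' x" "AE x in lborel. x \<in> S --> g x = g' x"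
 shows "wd S v f' g'"
proof -
 have loc: "loc_int_on S h'" if "loc_int_on S h" "AE x in lborel. x \<in> S --> h x = h' x" "borel_fun h'" for h h'
  unfolding loc_int_on_def
 proof (intro conjI allI impI that)
  fix C assume C: "compact C \<and> C \<subseteq> S"
  then have i: "integrable lborel (\<lambda>x. indicator C x * h x)" using that unfolding loc_int_on_def by auto
  have ae': "AE x in lborel. indicator C x * h x = indicator C x * h' x"
   using that(2) by eventually_elim (use C in \<open>auto simp: indicator_def\<close>)
  have "(\<lambda>x. indicator C x * h' x) \<in> borel_measurable lborel" using that(3) borel_compact[of C] C by auto
  from integrable_cong_AE_imp[OF i this ae'] show "integrable lborel (\<lambda>x. indicator C x * h' x)" .
 qed
 have I: "(LBINT x. k x * h x) = (LBINT x. k x * h' x)"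
  if "AE x in lborel. x \<in> S --> h x = h' x" "bdd_cpt k" "\<And>x. x \<notin> S ==> k x = 0"
   "borel_fun h" "borel_fun h'" for k h h' :: "'a => real"
 proof (rule integral_cong_AE)
  show "AE x in lborel. k x * h x = k x * h' x" using that(1) by eventually_elim (use that(3) in auto)
 qed (use that(4,5) bdd_cpt_measurable[OF that(2)] in auto)
 show ?thesis unfolding wd_def
 proof (intro conjI allI impI loc[OF wdD(1)[OF w] ae(1) m(1)] loc[OF wdD(2)[OF w] ae(2) m(2)])
  fix k k' assume c: "C1pair S v k k'"
  have z: "x \<notin> S ==> k x = 0" "x \<notin> S ==> k' x = 0" for x using c unfolding C1pair_def by auto
  show "(LBINT x. k' x * f' x) = - (LBINT x. k x * g' x)"
   using wdD(5)[OF w c] I[OF ae(1) C1pair_bdd_cpt(2)[OF c] z(2) wdD(3)[OF w] m(1)] I[OF ae(2) C1pair_bdd_cpt(1)[OF c] z(1) wdD(4)[OF w] m(2)]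
   by simp
 qed
qed

text \<open>Both sides of the defining identity are pairings with \<open>bdd_cpt\<close> functions,
  so weak convergence of the functions and of their derivatives is enough.\<close>

lemma wd_tendsto:
 assumes w: "\<And>n. wd UNIV v (f n) (g n)" and li: "loc_int F" "loc_int G"
  and lim: "\<And>h. bdd_cpt h ==> (\<lambda>n. LBINT x. h x * f n x) \<longlonglongrightarrow> (LBINT x. h x * F x)"
   "\<And>h. bdd_cpt h ==> (\<lambda>n. LBINT x. h x * g n x) \<longlonglongrightarrow> (LBINT x. h x * G x)"
 shows "wd UNIV v F G"
 unfolding wd_def loc_int_on_UNIV
proof (intro conjI allI impI li)
 fix h h' assume c: "C1pair UNIV v h h'"
 note a = lim(1)[OF C1pair_bdd_cpt(2)[OF c]] and b = tendsto_minus[OF lim(2)[OF C1pair_bdd_cpt(1)[OF c]]]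
 show "(LBINT x. h' x * F x) = - (LBINT x. h x * G x)"
  by (rule LIMSEQ_unique[OF a]) (use b wdD(5)[OF w c] in simp)
qed

lemma C1pair_conv_reflect:
 assumes k: "continuous_on UNIV k" "bdd_cpt k" and c: "C1pair UNIV v h h'"
 shows "C1pair UNIV v (\<lambda>y. LBINT x. h x * k (x - y)) (\<lambda>y. LBINT x. h' x * k (x - y))"
proof -
 note b = C1pair_bdd_cpt[OF c]
 define k' where "k' = (\<lambda>x. k (- x))"
 have k'b: "bdd_cpt k'" unfolding k'_def by (rule bdd_cpt_reflect[OF k(2), of 0, simplified])
 have [measurable]: "borel_fun h" "borel_fun h'" "borel_fun k'"
  using bdd_cpt_measurable[OF b(1)] bdd_cpt_measurable[OF b(2)] bdd_cpt_measurable[OF k'b] by auto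
 have e: "(\<lambda>y. LBINT x. f x * k (x - y)) = conv f k'" if [measurable]: "borel_fun f" for f
 proof
  fix y
  have "conv f k' y = (LBINT x. f x * k' (y - x))" by (rule conv_commute) measurable
  then show "(LBINT x. f x * k (x - y)) = conv f k' y" unfolding k'_def by simp
 qed
 have w: "has_dd h v h'" "continuous_on UNIV h" "continuous_on UNIV h'" using c unfolding C1pair_def by auto
 obtain R1 where R1: "\<And>x. R1 < norm x ==> k' x = 0" using bdd_cptE[OF k'b] by metis
 obtain R2 where R2: "\<And>x. R2 < norm x ==> h x = 0" using bdd_cptE[OF b(1)] by metis
 obtain R3 where R3: "\<And>x. R3 < norm x ==> h' x = 0" using bdd_cptE[OF b(2)] by metis
 define R where "R = max (R2 + R1) (R3 + R1)"
 have z: "conv h k' x = 0" "conv h' k' x = 0" if "x \<notin> cball 0 R" for x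
  by (rule conv_support[of R2 h R1 k'] conv_support[of R3 h' R1 k']; use R1 R2 R3 that in \<open>auto simp: R_def\<close>)+
 have li: "loc_int k'" by (rule bdd_cpt_loc_int[OF k'b])
 show ?thesis unfolding C1pair_def e[OF \<open>h \<in> _\<close>] e[OF \<open>h' \<in> _\<close>]
  by (intro conjI has_dd_conv continuous_conv w b li exI[of _ "cball 0 R"] allI impI z) auto
qed

text \<open>By \<open>conv_adjoint\<close> the convolution passes to the test pair, which the
  reflected kernel maps to another test pair.\<close>

lemma wd_conv:
 assumes k: "continuous_on UNIV k" "bdd_cpt k" and w: "wd UNIV v f g"
 shows "wd UNIV v (conv k f) (conv k g)"
proof -
 have li: "loc_int f" "loc_int g" using wdD(1,2)[OF w] unfolding loc_int_on_UNIV .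
 have lc: "loc_int (conv k h)" if "loc_int h" for h
  using wdD(1)[OF has_dd_imp_wd[of "conv k h" 0 "\<lambda>_. 0"]] continuous_conv[OF k that]
  unfolding loc_int_on_UNIV has_dd_def by simp
 show ?thesis unfolding wd_def loc_int_on_UNIV
 proof (intro conjI allI impI lc li)
  fix u u' assume c: "C1pair UNIV v u u'"
  show "(LBINT x. u' x * conv k f x) = - (LBINT x. u x * conv k g x)"
   unfolding conv_adjoint[OF k(2) li(1) C1pair_bdd_cpt(2)[OF c]] conv_adjoint[OF k(2) li(2) C1pair_bdd_cpt(1)[OF c]]
   by (rule wdD(5)[OF w C1pair_conv_reflect[OF k c]])
 qed
qed

text \<open>Two exponents are allowed since a function and its derivative may lie in different
  spaces: in the application the function is square integrable, while its derivative is only known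
  to another power.\<close>

lemma wd_riesz:
 assumes p: "1 < p" and q: "1 < q" and f: "Lspace p f" and g: "Lspace q g" and w: "wd UNIV v f g"
 shows "wd UNIV v (riesz p i j f) (riesz q i j g)"
proof (rule wd_tendsto)
 have k: "continuous_on UNIV (KerH n (axis i 1) (axis j 1))" "bdd_cpt (KerH n (axis i 1) (axis j 1))" for n
  using kernelD(5,8)[OF kernel_Ker] by auto
 show "wd UNIV v (conv (KerH n (axis i 1) (axis j 1)) f) (conv (KerH n (axis i 1) (axis j 1)) g)" for n by (rule wd_conv[OF k w])
 have p1: "1 \<le> p" "1 \<le> q" using p q by auto
 show "loc_int (riesz p i j f)" "loc_int (riesz q i j g)"
  using Lspace_loc_int[OF p1(1) riesz(1)[OF p f]] Lspace_loc_int[OF p1(2) riesz(1)[OF q g]] .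
 fix h :: "real^3 => real" assume b: "bdd_cpt h"
 show "(\<lambda>n. LBINT x. h x * conv (KerH n (axis i 1) (axis j 1)) f x) \<longlonglongrightarrow> (LBINT x. h x * riesz p i j f x)"
  by (rule integral_mult_tendsto[OF p1(1) Lspace_conv[OF p1(1) k(2) f] riesz(1,2)[OF p f] b])
 show "(\<lambda>n. LBINT x. h x * conv (KerH n (axis i 1) (axis j 1)) g x) \<longlonglongrightarrow> (LBINT x. h x * riesz q i j g x)"
  by (rule integral_mult_tendsto[OF p1(2) Lspace_conv[OF p1(2) k(2) g] riesz(1,2)[OF q g] b])
qed

section \<open>The gradient of the Newtonian potential\<close>

lemma kapD_rescale:
 assumes "0 < e"
 shows "kapD (e / 2) v x - kapD e v x = e * dilate e (\<lambda>y. kapD (1/2) v y - kapD 1 v y) (x :: real^3)"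
proof -
 have a: "(x \<bullet> x) / (e / 2)\<^sup>2 = (x \<bullet> x) / e\<^sup>2 / (1/2)\<^sup>2" and b: "((1/e) *\<^sub>R x) \<bullet> ((1/e) *\<^sub>R x) = (x \<bullet> x) / e\<^sup>2"
  by (simp_all add: power2_eq_square)
 show ?thesis unfolding dilate_def kapD_def a b
  using assms by (simp add: field_simps power3_eq_cube)
qed

text \<open>Passing from \<open>n\<close> to \<open>Suc n\<close> adds an inner dyadic shell at
  scale \<open>(1/2)^n\<close> and an outer one at scale \<open>2^Suc n\<close>, both dilations of
  one profile. Since \<open>dilate\<close> is homogeneous of degree -3 and the gradient kernel of
  degree -2, each shell carries its scale as a factor.\<close>

lemma KerD_Suc:
 "KerD (Suc n) v x - KerD n v x =
  (1/2)^n * dilate ((1/2)^n) (\<lambda>y. kapD (1/2) v y - kapD 1 v y) x + 2^Suc n * dilate (2^Suc n) (\<lambda>y. kapD (1/2) v y - kapD 1 v y) x"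
proof -
 have "(1/2::real) ^ Suc n = (1/2)^n / 2" "(2::real)^n = 2 ^ Suc n / 2" by simp_all
 then show ?thesis
  unfolding KerD_def using kapD_rescale[of "(1/2)^n" v x] kapD_rescale[of "2^Suc n" v x] by simp
qed

text \<open>Near scale \<open>0\<close> the boundedness of \<open>h\<close> is used, near scale \<open>\<infinity>\<close> its square integrability.\<close>

lemma conv_dilate_le:
 fixes a h :: "real^3 => real"
 assumes a: "bdd_cpt a" and h: "borel_fun h" "\<And>x. \<bar>h x\<bar> \<le> B" "integrable lborel (\<lambda>x. (h x)\<^sup>2)"
  and l: "0 < l"
 shows "l * \<bar>conv (dilate l a) h x\<bar> \<le> l * (B * (LBINT z. \<bar>a z\<bar>))"
  "l * \<bar>conv (dilate l a) h x\<bar> \<le> ((LBINT z. (a z)\<^sup>2) + (LBINT z. (h z)\<^sup>2)) / sqrt l"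
proof -
 have [measurable]: "borel_fun a" "borel_fun h" using h a by (auto dest: bdd_cpt_measurable)
 have eq: "conv (dilate l a) h x = (LBINT z. a z * h (x - l *\<^sub>R z))" by (rule conv_dilate[OF a h(1) l])
 have ia: "integrable lborel (\<lambda>z. \<bar>a z\<bar>)" by (intro integrable_abs bdd_cpt_integrable a)
 have B0: "0 \<le> B" using h(2)[of 0] by linarith
 have J: "integrable lborel (\<lambda>z. a z * h (x - l *\<^sub>R z))"
  by (rule Bochner_Integration.integrable_bound[OF integrable_mult_right[OF ia, of B]])
   (auto intro!: AE_I2 simp: abs_mult mult.commute[of B] B0 intro: mult_left_mono h(2))
 have "\<bar>conv (dilate l a) h x\<bar> \<le> (LBINT z. \<bar>a z * h (x - l *\<^sub>R z)\<bar>)" unfolding eq by (rule integral_abs_bound)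
 also have "\<dots> \<le> (LBINT z. B * \<bar>a z\<bar>)"
  by (rule integral_mono[OF integrable_abs[OF J] integrable_mult_right[OF ia]])
   (simp add: abs_mult mult.commute[of B] mult_left_mono h(2))
 finally show "l * \<bar>conv (dilate l a) h x\<bar> \<le> l * (B * (LBINT z. \<bar>a z\<bar>))" using l by simp
 have m2: "borel_fun (\<lambda>z. (h z)\<^sup>2)" by measurable
 have bi: "integrable lborel (\<lambda>z. (a z)\<^sup>2)"
  unfolding power2_eq_square by (intro bdd_cpt_integrable bdd_cpt_mult a)
 have sc: "(LBINT z. (h z)\<^sup>2) = l ^ 3 * (LBINT z. (h (x - l *\<^sub>R z))\<^sup>2)"
 proof -
  have "(LBINT z. (h z)\<^sup>2) = (LBINT z. (h (x - z))\<^sup>2)"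
   by (rule lborel_integral_reflect[symmetric, of "\<lambda>z. (h z)\<^sup>2"]) measurable
  also have "\<dots> = l ^ DIM(real^3) * (LBINT z. (h (x - l *\<^sub>R z))\<^sup>2)" by (rule lborel_integral_scale[OF _ l]) measurable
  finally show ?thesis by simp
 qed
 have i2: "integrable lborel (\<lambda>z. (h (x - l *\<^sub>R z))\<^sup>2)"
 proof -
  let ?T = "\<lambda>z. x + (- l) *\<^sub>R z"
  have "integrable (density (distr lborel borel ?T) (\<lambda>_. ennreal (\<bar>- l\<bar> ^ DIM(real^3)))) (\<lambda>z. (h z)\<^sup>2)"
   using h(3) lborel_affine[of "- l" x] l by simp
  then have "integrable (distr lborel borel ?T) (\<lambda>z. l ^ 3 *\<^sub>R (h z)\<^sup>2)"
   by (subst (asm) integrable_density) (use l in auto)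
  then have "integrable lborel (\<lambda>z. l ^ 3 *\<^sub>R (h (?T z))\<^sup>2)" by (subst (asm) integrable_distr_eq) auto
  then have "integrable lborel (\<lambda>z. (h (x + (- l) *\<^sub>R z))\<^sup>2)" using l by simp
  then show ?thesis by simp
 qed
 \<comment> \<open>\<open>s\<close> is \<open>l powr (3/2)\<close>, the scaling weight of the square
   norm in three dimensions; with the weight \<open>1 / s\<close> both terms are of equal order, and
   the factor \<open>l\<close> in front leaves \<open>1 / sqrt l\<close>.\<close>
 define s where "s = l * sqrt l"
 have s: "0 < s" "s * sqrt l = l ^ 2" "s * s = l ^ 3"
  unfolding s_def using l by (simp_all add: power2_eq_square power3_eq_cube)
 have "\<bar>conv (dilate l a) h x\<bar> \<le> (1/s) * (LBINT z. (a z)\<^sup>2) + (LBINT z. (h (x - l *\<^sub>R z))\<^sup>2) / (1/s)"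
  unfolding eq by (rule abs_integral_le_half_sum[OF _ _ bi i2]) (use s in auto)
 also have "(LBINT z. (h (x - l *\<^sub>R z))\<^sup>2) / (1/s) = (LBINT z. (h z)\<^sup>2) / s"
  unfolding sc s(3)[symmetric] using s(1) by (simp add: field_simps)
 finally have "l * \<bar>conv (dilate l a) h x\<bar> \<le> l * (((LBINT z. (a z)\<^sup>2) + (LBINT z. (h z)\<^sup>2)) / s)"
  using l by (simp add: add_divide_distrib)
 also have "\<dots> = ((LBINT z. (a z)\<^sup>2) + (LBINT z. (h z)\<^sup>2)) / sqrt l" unfolding s_def using l by simp
 finally show "l * \<bar>conv (dilate l a) h x\<bar> \<le> ((LBINT z. (a z)\<^sup>2) + (LBINT z. (h z)\<^sup>2)) / sqrt l" .
qed

text \<open>\<open>V\<close> is the derivative \<open>j\<close> of the Newtonian potential of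
  \<open>h\<close>. The shells make the truncated convolutions converge uniformly, although
  \<open>h\<close> need not decay, and the derivatives of the truncations converge to the Riesz
  transform, so \<open>wd_tendsto\<close> applies.\<close>

lemma riesz_potential:
 fixes h :: "real^3 => real"
 assumes h: "Lspace 2 h" "\<And>x. \<bar>h x\<bar> \<le> B" and i2: "integrable lborel (\<lambda>x. (h x)\<^sup>2)"
 obtains V where "\<And>i. wd UNIV (axis i 1) V (riesz 2 i j h)"
proof -
 have hm: "borel_fun h" by (rule Lspace_measurable[OF h(1)])
 have li: "loc_int h" by (rule Lspace_loc_int[OF _ h(1)]) simp
 let ?v = "axis j 1 :: real^3"
 define a where "a = (\<lambda>y::real^3. kapD (1/2) ?v y - kapD 1 ?v y)"
 have a: "bdd_cpt a" unfolding a_def by (rule kernelD(7)[OF kernel_kap_diff]) auto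
 have k: "continuous_on UNIV (KerD n v)" "bdd_cpt (KerD n v)" "bdd_cpt (KerH n v w)" "continuous_on UNIV (KerH n v w)" for n v w
  using kernelD[OF kernel_Ker] by auto
 define U where "U = (\<lambda>n. conv (KerD n ?v) h)"
 have Um: "borel_fun (U n)" for n
  unfolding U_def by (rule conv_measurable[OF bdd_cpt_measurable[OF k(2)] hm])
 define c where "c = B * (LBINT z. \<bar>a z\<bar>) + ((LBINT z. (a z)\<^sup>2) + (LBINT z. (h z)\<^sup>2))"
 \<comment> \<open>The inner shells decay like \<open>(1/2)^n\<close>, the outer ones like
   \<open>1 / sqrt (2^n)\<close>; this ratio covers both.\<close>
 define q where "q = 1 / sqrt (2::real)"
 have q: "0 < q" "q < 1" "1/2 \<le> q" unfolding q_def by (auto simp: real_less_rsqrt field_simps intro!: real_le_lsqrt)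
 have B0: "0 \<le> B" using h(2)[of 0] by linarith
 have step: "\<bar>U (Suc n) x - U n x\<bar> \<le> c * q ^ n" for n x
 proof -
  let ?s = "(1/2)^n :: real" and ?l = "2 ^ Suc n :: real"
  have d: "bdd_cpt (dilate ?s a)" "bdd_cpt (dilate ?l a)" by (intro bdd_cpt_dilate a; simp)+
  have "U (Suc n) x - U n x = conv (\<lambda>x. KerD (Suc n) ?v x - KerD n ?v x) h x"
   unfolding U_def conv_diff_left[OF k(2) k(2) li] ..
  also have "(\<lambda>x. KerD (Suc n) ?v x - KerD n ?v x) = (\<lambda>x. ?s * dilate ?s a x + ?l * dilate ?l a x)"
   unfolding KerD_Suc a_def ..
  also have "conv \<dots> h x = ?s * conv (dilate ?s a) h x + ?l * conv (dilate ?l a) h x"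
   by (simp only: conv_add_left[OF bdd_cpt_cmult[OF d(1)] bdd_cpt_cmult[OF d(2)] li] conv_cmult_left)
  finally have "\<bar>U (Suc n) x - U n x\<bar> \<le> ?s * \<bar>conv (dilate ?s a) h x\<bar> + ?l * \<bar>conv (dilate ?l a) h x\<bar>"
   using abs_triangle_ineq[of "?s * conv (dilate ?s a) h x" "?l * conv (dilate ?l a) h x"] by (simp add: abs_mult)
  also have "\<dots> \<le> ?s * (B * (LBINT z. \<bar>a z\<bar>)) + ((LBINT z. (a z)\<^sup>2) + (LBINT z. (h z)\<^sup>2)) / sqrt ?l"
   by (intro add_mono conv_dilate_le[OF a hm h(2) i2]) auto
  also have "\<dots> \<le> q ^ n * (B * (LBINT z. \<bar>a z\<bar>)) + ((LBINT z. (a z)\<^sup>2) + (LBINT z. (h z)\<^sup>2)) * q ^ n"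
  proof (intro add_mono mult_right_mono mult_nonneg_nonneg B0)
   show "?s \<le> q ^ n" using q by (intro power_mono) auto
   have "inverse (sqrt ?l) \<le> inverse (sqrt (2 ^ n))" by (intro le_imp_inverse_le) auto
   also have "inverse (sqrt (2 ^ n)) = q ^ n" unfolding q_def by (simp add: real_sqrt_power power_one_over inverse_eq_divide)
   finally have r: "inverse (sqrt ?l) \<le> q ^ n" .
   have "((LBINT z. (a z)\<^sup>2) + (LBINT z. (h z)\<^sup>2)) * inverse (sqrt ?l) \<le> ((LBINT z. (a z)\<^sup>2) + (LBINT z. (h z)\<^sup>2)) * q ^ n"
    by (intro mult_left_mono r add_nonneg_nonneg) auto
   then show "((LBINT z. (a z)\<^sup>2) + (LBINT z. (h z)\<^sup>2)) / sqrt ?l \<le> ((LBINT z. (a z)\<^sup>2) + (LBINT z. (h z)\<^sup>2)) * q ^ n"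
    by (simp add: divide_inverse)
  qed simp
  finally show ?thesis unfolding c_def by (simp add: algebra_simps)
 qed
 have "uniform_limit UNIV (\<lambda>n x. \<Sum>i<n. U (Suc i) x - U i x) (\<lambda>x. \<Sum>i. U (Suc i) x - U i x) sequentially"
  by (rule Weierstrass_m_test[where M="\<lambda>n. c * q ^ n"]) (use step q in \<open>auto intro!: summable_mult summable_geometric\<close>)
 then have ul: "uniform_limit UNIV (\<lambda>n x. U n x - U 0 x) (\<lambda>x. \<Sum>i. U (Suc i) x - U i x) sequentially"
  by (simp only: sum_lessThan_telescope[of "\<lambda>n. U n x" for x])
 define V where "V = (\<lambda>x. (\<Sum>i. U (Suc i) x - U i x) + U 0 x)"
 have near: "\<exists>N. \<forall>n\<ge>N. \<forall>x. \<bar>U n x - V x\<bar> < e" if "0 < e" for e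
 proof -
  have "\<forall>\<^sub>F n in sequentially. \<forall>x\<in>UNIV. dist (U n x - U 0 x) (\<Sum>i. U (Suc i) x - U i x) < e"
   using ul that unfolding uniform_limit_iff by blast
  then show ?thesis unfolding eventually_sequentially V_def dist_real_def by (simp add: algebra_simps)
 qed
 have pt: "(\<lambda>n. U n x) \<longlonglongrightarrow> V x" for x
  by (rule LIMSEQ_I) (use near in \<open>simp only: real_norm_def, meson\<close>)
 have Vm [measurable]: "borel_fun V" by (rule borel_measurable_LIMSEQ_real[OF pt Um])
 have U_li: "loc_int (U n)" for n
  unfolding U_def
  using wdD(1)[OF has_dd_imp_wd[OF has_dd_conv[OF kernelD(2)[OF kernel_Ker] k(2,3) li] continuous_conv[OF k(1,2) li] continuous_conv[OF k(4,3) li]]]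
  unfolding loc_int_on_UNIV by blast
 obtain N0 where N0: "\<And>x. \<bar>U N0 x - V x\<bar> < 1" using near[of 1] by auto
 have V_li: "loc_int V"
 proof -
  have "loc_int (\<lambda>x. V x - U N0 x)"
   by (rule loc_int_bounded[of _ 1]) (use Um[of N0] N0 in \<open>auto simp: abs_minus_commute intro: less_imp_le\<close>)
  from loc_int_add[OF this U_li[of N0]] show ?thesis by simp
 qed
 have "wd UNIV (axis i 1) V (riesz 2 i j h)" for i
 proof (rule wd_tendsto)
  have sym: "KerH n ?v (axis i 1) = KerH n (axis i 1) ?v" for n by (rule ext) (rule kernelD(9)[OF kernel_Ker])
  show "wd UNIV (axis i 1) (U n) (conv (KerH n (axis i 1) ?v) h)" for n
   unfolding U_def sym[symmetric]
   by (rule has_dd_imp_wd[OF has_dd_conv[OF kernelD(2)[OF kernel_Ker] k(2,3) li] continuous_conv[OF k(1,2) li] continuous_conv[OF k(4,3) li]])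
  show "loc_int V" by (rule V_li)
  show "loc_int (riesz 2 i j h)" by (rule Lspace_loc_int[OF _ riesz(1)]) (use h in auto)
  fix g :: "real^3 => real" assume b: "bdd_cpt g"
  show "(\<lambda>n. LBINT x. g x * conv (KerH n (axis i 1) ?v) h x) \<longlonglongrightarrow> (LBINT x. g x * riesz 2 i j h x)"
   by (rule integral_mult_tendsto[of 2, OF _ Lspace_conv[OF _ k(3) h(1)] riesz(1,2)[OF _ h(1)] b]) auto
  have i\<psi>: "integrable lborel (\<lambda>x. \<bar>g x\<bar>)" by (intro integrable_abs bdd_cpt_integrable b)
  define L where "L = (LBINT x. \<bar>g x\<bar>) + 1"
  have L: "0 < L" unfolding L_def by (simp add: add_nonneg_pos)
  show "(\<lambda>n. LBINT x. g x * U n x) \<longlonglongrightarrow> (LBINT x. g x * V x)"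
  proof (rule LIMSEQ_I)
   fix r :: real assume r: "0 < r"
   obtain N where N: "\<And>n x. n \<ge> N ==> \<bar>U n x - V x\<bar> < r / L" using near[of "r / L"] r L by auto
   have "norm ((LBINT x. g x * U n x) - (LBINT x. g x * V x)) < r" if n: "n \<ge> N" for n
   proof -
    have i1: "integrable lborel (\<lambda>x. g x * U n x)" "integrable lborel (\<lambda>x. g x * V x)"
     by (rule integrable_bdd_cpt_mult[OF b U_li] integrable_bdd_cpt_mult[OF b V_li])+
    then have e: "(LBINT x. g x * U n x) - (LBINT x. g x * V x) = (LBINT x. g x * (U n x - V x))"
     and i3: "integrable lborel (\<lambda>x. g x * (U n x - V x))" by (simp_all add: right_diff_distrib)
    have "\<bar>LBINT x. g x * (U n x - V x)\<bar> \<le> (LBINT x. \<bar>g x * (U n x - V x)\<bar>)" by (rule integral_abs_bound)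
    also have "\<dots> \<le> (LBINT x. \<bar>g x\<bar> * (r / L))"
     by (rule integral_mono[OF integrable_abs[OF i3] integrable_mult_left[OF i\<psi>]])
      (simp only: abs_mult, rule mult_left_mono[OF less_imp_le[OF N[OF n]]], simp)
    also have "\<dots> = (L - 1) * (r / L)" unfolding L_def by simp
    also have "\<dots> < r" using L r by (simp add: field_simps)
    finally show ?thesis unfolding e by simp
   qed
   then show "\<exists>N. \<forall>n\<ge>N. norm ((LBINT x. g x * U n x) - (LBINT x. g x * V x)) < r" by auto
  qed
 qed
 then show thesis by (rule that)
qed

section \<open>Commuting derivatives and the div-curl representation\<close>

lemma has_dd_reflect:
 assumes "has_dd k v k'"
 shows "has_dd (\<lambda>y. k (x - y)) v (\<lambda>y. - k' (x - y))"
 unfolding has_dd_def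
proof (intro allI)
 fix y t
 have "((\<lambda>s. k ((x - y) + s *\<^sub>R v)) has_real_derivative k' ((x - y) + (- t) *\<^sub>R v)) (at (- t))"
  by (rule has_ddD[OF assms])
 from DERIV_mirror[THEN iffD1, OF this]
 show "((\<lambda>t. k (x - (y + t *\<^sub>R v))) has_real_derivative - k' (x - (y + t *\<^sub>R v))) (at t)"
  by (simp add: algebra_simps)
qed

text \<open>For fixed \<open>x\<close> the kernel \<open>k (x - y)\<close> is a test function of
  \<open>y\<close>, so the derivative can be moved from the kernel to the function; the two minus
  signs cancel.\<close>

lemma conv_weak_derivative:
 assumes k: "has_dd k v k'" "continuous_on UNIV k" "continuous_on UNIV k'" "bdd_cpt k" "bdd_cpt k'" and w: "wd UNIV v f g"
 shows "conv k' f = conv k g"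
proof
 fix x
 obtain R1 where R1: "\<And>x. R1 < norm x ==> k x = 0" using bdd_cptE[OF k(4)] by metis
 obtain R2 where R2: "\<And>x. R2 < norm x ==> k' x = 0" using bdd_cptE[OF k(5)] by metis
 have "C1pair UNIV v (\<lambda>y. k (x - y)) (\<lambda>y. - k' (x - y))"
  unfolding C1pair_def
 proof (intro conjI)
  show "has_dd (\<lambda>y. k (x - y)) v (\<lambda>y. - k' (x - y))" by (rule has_dd_reflect[OF k(1)])
  have l: "continuous_on UNIV (\<lambda>y. x - y)" by (intro continuous_intros)
  show "continuous_on UNIV (\<lambda>y. k (x - y))" by (rule continuous_on_compose2[OF k(2) l]) simp
  show "continuous_on UNIV (\<lambda>y. - k' (x - y))" by (rule continuous_on_minus[OF continuous_on_compose2[OF k(3) l]]) simp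
  have "max R1 R2 < norm (x - y)" if "y \<notin> cball 0 (norm x + max R1 R2)" for y
   using that norm_triangle_ineq2[of y x] unfolding mem_cball_0 norm_minus_commute[of y x] by linarith
  then show "\<exists>C. compact C \<and> C \<subseteq> UNIV \<and> (\<forall>y. y \<notin> C --> k (x - y) = 0 \<and> - k' (x - y) = 0)"
   by (intro exI[of _ "cball 0 (norm x + max R1 R2)"]) (simp add: R1 R2)
 qed
 from wdD(5)[OF w this] show "conv k' f x = conv k g x" unfolding conv_def by simp
qed

text \<open>Mollified in one of the two directions, the derivatives commute.\<close>

lemma wd_commute:
 assumes w: "wd UNIV a w ga" "wd UNIV b w gb" "wd UNIV a gb S" and p: "1 \<le> p" "Lspace p ga" and q: "1 \<le> q" "Lspace q S"
 shows "wd UNIV b ga S"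
proof -
 define e where "e = (\<lambda>n. inverse (real (Suc n)))"
 have e: "0 < e n" "e n \<le> 1" for n unfolding e_def by (auto simp: inverse_le_1_iff)
 have e0: "e \<longlonglongrightarrow> 0" unfolding e_def by (rule LIMSEQ_inverse_real_of_nat)
 define B where "B = (\<integral>x. (bump x :: real) \<partial>(lborel :: 'a measure))"
 have B: "0 < B" unfolding B_def by (rule bump_integral_pos)
 have k: "continuous_on UNIV (dilate (e n) bump :: 'a => real)" "continuous_on UNIV (\<lambda>x. dilate (e n) (bumpD a) x / e n)"
  "bdd_cpt (dilate (e n) bump :: 'a => real)" "bdd_cpt (\<lambda>x. dilate (e n) (bumpD a) x / e n)" for n
 proof -
  have l: "continuous_on UNIV (\<lambda>x::'a. (1 / e n) *\<^sub>R x)" by (intro continuous_intros)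
  have "continuous_on UNIV (\<lambda>x::'a. bump ((1 / e n) *\<^sub>R x))"
   by (rule continuous_on_compose2[OF continuous_bump(1) l]) simp
  moreover have "continuous_on UNIV (\<lambda>x. bumpD a ((1 / e n) *\<^sub>R x))"
   by (rule continuous_on_compose2[OF continuous_bump(2) l]) simp
  ultimately show "continuous_on UNIV (dilate (e n) bump :: 'a => real)" "continuous_on UNIV (\<lambda>x. dilate (e n) (bumpD a) x / e n)"
   using e(1)[of n] unfolding dilate_def[abs_def] by (auto intro!: continuous_on_divide)
  show "bdd_cpt (dilate (e n) bump :: 'a => real)" "bdd_cpt (\<lambda>x. dilate (e n) (bumpD a) x / e n)"
   by (intro bdd_cpt_dilate bdd_cpt_divide bdd_cpt_bump e)+
 qed
 have "wd UNIV b (\<lambda>x. B * ga x) (\<lambda>x. B * S x)"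
 proof (rule wd_tendsto)
  \<comment> \<open>With the \<open>a\<close>-derivative placed on the bump, convolving
    \<open>w\<close> yields the mollified \<open>ga\<close> and convolving \<open>gb\<close> yields
    the mollified \<open>S\<close>, while \<open>gb\<close> is the \<open>b\<close>-derivative of
    \<open>w\<close>.\<close>
  show "wd UNIV b (conv (dilate (e n) bump) ga) (conv (dilate (e n) bump) S)" for n
   using wd_conv[OF k(2,4)[of n] w(2)] conv_weak_derivative[OF has_dd_dilate_bump k[of n] w(1)]
    conv_weak_derivative[OF has_dd_dilate_bump k[of n] w(3)] by simp
  show "loc_int (\<lambda>x. B * ga x)" "loc_int (\<lambda>x. B * S x)" by (rule loc_int_cmult[OF Lspace_loc_int[OF p]] loc_int_cmult[OF Lspace_loc_int[OF q]])+
  fix h :: "'a => real" assume b: "bdd_cpt h"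
  show "(\<lambda>n. LBINT x. h x * conv (dilate (e n) bump) ga x) \<longlonglongrightarrow> (LBINT x. h x * (B * ga x))"
   by (rule integral_mult_tendsto[OF p(1) Lspace_conv[OF p(1) k(3) p(2)] Lspace_cmult[OF p(2)] conv_dilate_tendsto[OF p(1) bdd_cpt_bump(1) p(2) e e0, folded B_def] b])
  show "(\<lambda>n. LBINT x. h x * conv (dilate (e n) bump) S x) \<longlonglongrightarrow> (LBINT x. h x * (B * S x))"
   by (rule integral_mult_tendsto[OF q(1) Lspace_conv[OF q(1) k(3) q(2)] Lspace_cmult[OF q(2)] conv_dilate_tendsto[OF q(1) bdd_cpt_bump(1) q(2) e e0, folded B_def] b])
 qed
 from wd_cmult[OF this, of "inverse B"] B show ?thesis by (simp add: mult.assoc[symmetric])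
qed

text \<open>Both sides are derivatives along \<open>v\<close> of one function: the kernel
  differentiated in the directions \<open>i\<close> and \<open>k\<close>, convolved with
  \<open>w\<close>. It expresses the symmetry of second derivatives without assuming that
  \<open>w\<close> has any.\<close>

lemma conv_KerH_swap:
 assumes gi: "wd UNIV (axis i 1) w gi" and gk: "wd UNIV (axis k 1) w gk"
 shows "conv (KerH n (axis k 1) v) gi = conv (KerH n (axis i 1) v) gk"
proof -
 note K = kernelD(2,4,5,7,8)[OF kernel_Ker]
 have li: "loc_int gi" "loc_int gk" using wdD(2)[OF gi] wdD(2)[OF gk] unfolding loc_int_on_UNIV .
 have "KerH n (axis i 1) (axis k 1) = KerH n (axis k 1) (axis i 1)" by (rule ext) (rule kernelD(9)[OF kernel_Ker])
 then have "conv (KerD n (axis k 1)) gi = conv (KerD n (axis i 1)) gk"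
  using conv_weak_derivative[OF K gi, of n "axis k 1"] conv_weak_derivative[OF K gk, of n "axis i 1"] by simp
 moreover have "has_dd (conv (KerD n (axis k 1)) gi) v (conv (KerH n (axis k 1) v) gi)"
  by (rule has_dd_conv[OF K(1) K(4,5) li(1)])
 moreover have "has_dd (conv (KerD n (axis i 1)) gk) v (conv (KerH n (axis i 1) v) gk)"
  by (rule has_dd_conv[OF K(1) K(4,5) li(2)])
 ultimately show ?thesis using has_dd_unique by metis
qed

definition In_lim :: "real => (nat => 'a::euclidean_space => real) => ('a => real) => bool" where
 "In_lim p X a \<longleftrightarrow> (\<forall>n. borel_fun (X n)) \<and> borel_fun a \<and> (\<lambda>n. In p (\<lambda>x. X n x - a x)) \<longlonglongrightarrow> 0"

lemma In_lim_add:
 assumes p: "0 < p" and X: "In_lim p X a" and Y: "In_lim p Y b"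
 shows "In_lim p (\<lambda>n x. X n x + Y n x) (\<lambda>x. a x + b x)"
proof -
 have m: "borel_fun (X n)" "borel_fun a" "borel_fun (Y n)" "borel_fun b" for n
  using X Y unfolding In_lim_def by auto
 have "(\<lambda>n. ennreal (2 powr p) * (In p (\<lambda>x. X n x - a x) + In p (\<lambda>x. Y n x - b x))) \<longlonglongrightarrow> ennreal (2 powr p) * (0 + 0)"
  using X Y unfolding In_lim_def by (intro ennreal_tendsto_cmult tendsto_add) auto
 then have L: "(\<lambda>n. ennreal (2 powr p) * (In p (\<lambda>x. X n x - a x) + In p (\<lambda>x. Y n x - b x))) \<longlonglongrightarrow> 0" by simp
 have bd: "In p (\<lambda>x. (X n x + Y n x) - (a x + b x)) \<le> ennreal (2 powr p) * (In p (\<lambda>x. X n x - a x) + In p (\<lambda>x. Y n x - b x))" for n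
  using In_add[OF p borel_measurable_diff[OF m(1,2)] borel_measurable_diff[OF m(3,4)], of n n] by (simp add: add_diff_add)
 have "(\<lambda>n. In p (\<lambda>x. (X n x + Y n x) - (a x + b x))) \<longlonglongrightarrow> 0"
  by (rule tendsto_sandwich[OF always_eventually always_eventually tendsto_const L]) (use bd in simp_all)
 then show ?thesis unfolding In_lim_def using m by simp
qed

lemma In_lim_sum:
 assumes p: "0 < p" and X: "\<And>i. i \<in> I ==> In_lim p (X i) (a i)" and I: "finite I" "I \<noteq> {}"
 shows "In_lim p (\<lambda>n x. \<Sum>i\<in>I. X i n x) (\<lambda>x. \<Sum>i\<in>I. a i x)"
 using I X by (induction I rule: finite_ne_induct) (simp_all add: In_lim_add[OF p])

lemma In_lim_unique:
 assumes p: "0 < p" and X: "In_lim p X a" and Y: "In_lim p X b"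
 shows "AE x in lborel. a x = b x"
proof -
 have m: "borel_fun (X n)" "borel_fun a" "borel_fun b" for n
  using X Y unfolding In_lim_def by auto
 have L: "(\<lambda>n. ennreal (2 powr p) * (In p (\<lambda>x. X n x - b x) + In p (\<lambda>x. X n x - a x))) \<longlonglongrightarrow> ennreal (2 powr p) * (0 + 0)"
  using X Y unfolding In_lim_def by (intro ennreal_tendsto_cmult tendsto_add) auto
 have bd: "In p (\<lambda>x. a x - b x) \<le> ennreal (2 powr p) * (In p (\<lambda>x. X n x - b x) + In p (\<lambda>x. X n x - a x))" for n
  using In_diff[OF p borel_measurable_diff[OF m(1,3)] borel_measurable_diff[OF m(1,2)], of n n] by simp
 have "In p (\<lambda>x. a x - b x) \<le> ennreal (2 powr p) * (0 + 0)"
  by (rule LIMSEQ_le_const[OF L]) (intro exI allI impI bd)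
 then have "(\<integral>\<^sup>+x. ennreal (\<bar>a x - b x\<bar> powr p) \<partial>lborel) = 0" unfolding In_def by simp
 then have "AE x in lborel. ennreal (\<bar>a x - b x\<bar> powr p) = 0"
  by (subst (asm) nn_integral_0_iff_AE) (use m in auto)
 then show ?thesis by eventually_elim simp
qed

lemma In_lim_riesz:
 assumes p: "1 < p" and f: "Lspace p f"
 shows "In_lim p (\<lambda>n. conv (KerH n (axis i 1) (axis j 1)) f) (riesz p i j f)"
  "In_lim p (\<lambda>n. conv (klap (KerH n)) f) (\<lambda>x. - alpha * f x)"
 using conv_measurable[OF bdd_cpt_measurable[OF kernelD(8)[OF kernel_Ker]] Lspace_measurable[OF f]]
  conv_measurable[OF bdd_cpt_measurable[OF bdd_cpt_klap[OF kernel_Ker]] Lspace_measurable[OF f]]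
  Lspace_measurable[OF f] Lspace_measurable[OF riesz(1)[OF p f]] riesz(2)[OF p f] conv_klap_KerH_tendsto[OF p f]
 unfolding In_lim_def by simp_all

lemma conv_klap_eq_sum:
 assumes "loc_int f"
 shows "conv (klap (KerH n)) f = (\<lambda>x. \<Sum>k\<in>UNIV. conv (KerH n (axis k 1) (axis k 1)) f x)"
 unfolding klap_def[abs_def] by (rule conv_sum_left[OF kernelD(8)[OF kernel_Ker] assms])

lemma riesz_trace:
 assumes p: "1 < p" and f: "Lspace p f"
 shows "AE x in lborel. (\<Sum>k\<in>UNIV. riesz p k k f x) = - alpha * f x"
proof (rule In_lim_unique)
 have li: "loc_int f" by (rule Lspace_loc_int[OF _ f]) (use p in simp)
 show "In_lim p (\<lambda>n. conv (klap (KerH n)) f) (\<lambda>x. \<Sum>k\<in>UNIV. riesz p k k f x)"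
  unfolding conv_klap_eq_sum[OF li] by (intro In_lim_sum In_lim_riesz p f) (use p in auto)
 show "In_lim p (\<lambda>n. conv (klap (KerH n)) f) (\<lambda>x. - alpha * f x)" by (rule In_lim_riesz(2)[OF p f])
qed (use p in simp)

lemma riesz_sym: "riesz p i j f = riesz p j i f"
proof -
 have "KerH n (axis i 1) (axis j 1) = KerH n (axis j 1) (axis i 1)" for n by (rule ext) (rule kernelD(9)[OF kernel_Ker])
 then show ?thesis unfolding riesz_def by simp
qed

text \<open>Convolutions ignore null sets, so the choice operator receives the same predicate twice;
  the two functions are therefore equal and not only a.e. equal.\<close>

lemma riesz_cong_AE:
 assumes "AE x in lborel. f x = g x" "borel_fun f" "borel_fun g"
 shows "riesz p i j f = riesz p i j g"
proof -
 have "conv (KerH n v w) f x = conv (KerH n v w) g x" for n v w x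
  unfolding conv_def
 proof (rule integral_cong_AE)
  have "borel_fun (KerH n v w)" by (rule bdd_cpt_measurable[OF kernelD(8)[OF kernel_Ker]])
  then have "borel_fun (\<lambda>y. KerH n v w (x - y))" by (rule measurable_compose[rotated]) measurable
  then show "(\<lambda>y. KerH n v w (x - y) * f y) \<in> borel_measurable lborel" "(\<lambda>y. KerH n v w (x - y) * g y) \<in> borel_measurable lborel"
   using assms(2,3) by simp_all
  show "AE y in lborel. KerH n v w (x - y) * f y = KerH n v w (x - y) * g y" using assms(1) by eventually_elim simp
 qed
 then have "conv (KerH n v w) f = conv (KerH n v w) g" for n v w by (rule ext)
 then show ?thesis unfolding riesz_def by simp
qed

text \<open>The prefactor undoes the \<open>- alpha\<close> contained in \<open>riesz\<close>, so
  that each summand is a true second derivative of an inverse Laplacian.\<close>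

definition div_curl_op :: "real => 3 => 3 => (3 => real^3 => real) => (real^3 => real) => real^3 => real" where
 "div_curl_op p i j r d x = (- 1 / alpha) * ((\<Sum>k\<in>UNIV. riesz p i k (r k) x) + riesz p i j d x)"

lemma Lspace_riesz_sum:
 assumes "1 < p" "\<And>k. Lspace p (r k)" "Lspace p d"
 shows "Lspace p (\<lambda>x. (\<Sum>k\<in>UNIV. riesz p i k (r k) x) + riesz p i j d x)"
 using assms by (intro Lspace_add Lspace_sum riesz(1)) auto

text \<open>
 This is \<open>\<Delta>w\<^sub>j = \<Sum>\<^sub>k \<partial>\<^sub>k(\<partial>\<^sub>kw\<^sub>j - \<partial>\<^sub>jw\<^sub>k) + \<partial>\<^sub>j div w\<close>, solved for \<open>\<partial>\<^sub>iw\<^sub>j\<close>.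
\<close>

lemma div_curl_representation:
 assumes w: "\<And>i j. wd UNIV (axis i 1) (w j) (g i j)" and g: "\<And>i j. Lspace 2 (g i j)"
 shows "AE x in lborel. g i j x = div_curl_op 2 i j (\<lambda>k x. g k j x - g j k x) (\<lambda>x. \<Sum>k\<in>UNIV. g k k x) x"
proof -
 define r where "r = (\<lambda>k x. g k j x - g j k x)"
 define d where "d = (\<lambda>x. \<Sum>k\<in>UNIV. g k k x)"
 have r: "Lspace 2 (r k)" for k unfolding r_def by (intro Lspace_diff g) simp
 have d: "Lspace 2 d" unfolding d_def by (intro Lspace_sum g) simp
 have li: "loc_int (g i j)" for i j by (rule Lspace_loc_int[OF _ g]) simp
 have lr: "loc_int (r k)" for k by (rule Lspace_loc_int[OF _ r]) simp
 let ?H = "\<lambda>n i j. KerH n (axis i 1) (axis j 1) :: real^3 => real"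
 have Hb: "bdd_cpt (?H n i j)" for n i j by (rule kernelD(8)[OF kernel_Ker])
 have sym: "?H n i j = ?H n j i" for n i j by (rule ext) (rule kernelD(9)[OF kernel_Ker])
 have id: "conv (klap (KerH n)) (g i j) = (\<lambda>x. (\<Sum>k\<in>UNIV. conv (?H n i k) (r k) x) + conv (?H n i j) d x)" for n
 proof
  fix x
  \<comment> \<open>Two exchanges: the derivatives \<open>i\<close> of \<open>w j\<close> and
    \<open>k\<close> of the kernel trade places, which leaves \<open>g k j = r k + g j k\<close>; in
    the second summand \<open>j\<close> and \<open>k\<close> trade places, which produces the
    divergence term \<open>g k k\<close>.\<close>
  have "conv (?H n k k) (g i j) x = conv (?H n i k) (r k) x + conv (?H n i j) (g k k) x" for k
  proof -
   have "conv (?H n k k) (g i j) x = conv (?H n i k) (\<lambda>x. r k x + g j k x) x"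
    unfolding r_def using conv_KerH_swap[OF w w, of n k "axis k 1" i j] by simp
   then show ?thesis
    unfolding conv_add_right[OF Hb lr li] using conv_KerH_swap[OF w w, of n k "axis i 1" j k] sym[of n i k] sym[of n i j] by simp
  qed
  then show "conv (klap (KerH n)) (g i j) x = (\<Sum>k\<in>UNIV. conv (?H n i k) (r k) x) + conv (?H n i j) d x"
   unfolding conv_klap_eq_sum[OF li] d_def conv_sum_right[OF Hb li] by (simp only: sum.distrib)
 qed
 have "AE x in lborel. - alpha * g i j x = (\<Sum>k\<in>UNIV. riesz 2 i k (r k) x) + riesz 2 i j d x"
 proof (rule In_lim_unique)
  show "In_lim 2 (\<lambda>n. conv (klap (KerH n)) (g i j)) (\<lambda>x. - alpha * g i j x)" by (rule In_lim_riesz(2)[OF _ g]) simp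
  show "In_lim 2 (\<lambda>n. conv (klap (KerH n)) (g i j)) (\<lambda>x. (\<Sum>k\<in>UNIV. riesz 2 i k (r k) x) + riesz 2 i j d x)"
   unfolding id by (intro In_lim_add In_lim_sum In_lim_riesz r d) simp_all
 qed simp
 then show ?thesis
 proof eventually_elim
  fix x assume e: "- alpha * g i j x = (\<Sum>k\<in>UNIV. riesz 2 i k (r k) x) + riesz 2 i j d x"
  have "g i j x = (- 1 / alpha) * (- alpha * g i j x)" using alpha_pos by simp
  then show "g i j x = div_curl_op 2 i j (\<lambda>k x. g k j x - g j k x) (\<lambda>x. \<Sum>k\<in>UNIV. g k k x) x"
   unfolding div_curl_op_def r_def[symmetric] d_def[symmetric] e .
 qed
qed

definition div_curl_const :: "real => real" where
 "div_curl_const s = (1 / alpha) powr s * (2 powr s * ((2 powr s) ^ 3 * riesz_const s + riesz_const s))"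

lemma div_curl_const_pos: "1 < s ==> 0 < div_curl_const s"
 unfolding div_curl_const_def using alpha_pos riesz_const(1)[of s]
 by (intro mult_pos_pos add_pos_pos) auto

lemma Lspace_div_curl_op:
 assumes "1 < p" "\<And>k. Lspace p (r k)" "Lspace p d"
 shows "Lspace p (div_curl_op p i j r d)"
 unfolding div_curl_op_def[abs_def] by (intro Lspace_cmult Lspace_riesz_sum assms)

text \<open>The transforms are formed in exponent \<open>p\<close> and estimated in exponent
  \<open>s\<close>. In this way functions built from square integrable data obey the bounds in every
  exponent in which the data are finite.\<close>

lemma In_div_curl_op:
 assumes p: "1 < p" and s: "1 < s" and r: "\<And>k. Lspace p (r k)" "\<And>k. Lspace s (r k)" and d: "Lspace p d" "Lspace s d"
 shows "In s (div_curl_op p i j r d) \<le> ennreal (div_curl_const s) * ((\<Sum>k\<in>UNIV. In s (r k)) + In s d)"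
proof -
 have s0: "0 < s" using s by simp
 let ?c = "ennreal (riesz_const s)"
 have [measurable]: "borel_fun (riesz p i k (r k))" "borel_fun (riesz p i j d)" for k
  using Lspace_measurable[OF riesz(1)[OF p r(1)]] Lspace_measurable[OF riesz(1)[OF p d(1)]] by auto
 have c: "0 < riesz_const s" by (rule riesz_const(1)[OF s])
 have b1: "In s (\<lambda>x. \<Sum>k\<in>UNIV. riesz p i k (r k) x) \<le> ennreal ((2 powr s) ^ 3) * (?c * (\<Sum>k\<in>UNIV. In s (r k)))"
 proof -
  have "In s (\<lambda>x. \<Sum>k\<in>UNIV. riesz p i k (r k) x) \<le> ennreal ((2 powr s) ^ card (UNIV::3 set)) * (\<Sum>k\<in>UNIV. In s (riesz p i k (r k)))"
   by (rule In_sum[OF s0]) auto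
  also have "\<dots> \<le> ennreal ((2 powr s) ^ 3) * (\<Sum>k\<in>UNIV. ?c * In s (r k))"
   by (intro mult_mono sum_mono In_riesz_le[OF p s r]) auto
  finally show ?thesis by (simp add: sum_distrib_left)
 qed
 have "In s (div_curl_op p i j r d) = ennreal (\<bar>- 1 / alpha\<bar> powr s) * In s (\<lambda>x. (\<Sum>k\<in>UNIV. riesz p i k (r k) x) + riesz p i j d x)"
  unfolding div_curl_op_def[abs_def] by (rule In_cmult) measurable
 also have "\<bar>- 1 / alpha\<bar> = 1 / alpha" using alpha_pos by simp
 also have "In s (\<lambda>x. (\<Sum>k\<in>UNIV. riesz p i k (r k) x) + riesz p i j d x) \<le> ennreal (2 powr s) * (In s (\<lambda>x. \<Sum>k\<in>UNIV. riesz p i k (r k) x) + In s (riesz p i j d))"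
  by (rule In_add[OF s0]) measurable
 also have "\<dots> \<le> ennreal (2 powr s) * (ennreal ((2 powr s) ^ 3) * (?c * (\<Sum>k\<in>UNIV. In s (r k))) + ?c * In s d)"
  by (intro mult_left_mono add_mono b1 In_riesz_le[OF p s d]) auto
 also have "\<dots> \<le> ennreal (2 powr s) * ((ennreal ((2 powr s) ^ 3) * ?c + ?c) * ((\<Sum>k\<in>UNIV. In s (r k)) + In s d))"
 proof (rule mult_left_mono)
  have "x * (c * S) + c * D \<le> (x * c + c) * (S + D)" for x c S D :: ennreal
   unfolding ring_distribs mult.assoc by (simp add: add.assoc add_increasing2 add_mono add_increasing)
  then show "ennreal ((2 powr s) ^ 3) * (?c * (\<Sum>k\<in>UNIV. In s (r k))) + ?c * In s d
   \<le> (ennreal ((2 powr s) ^ 3) * ?c + ?c) * ((\<Sum>k\<in>UNIV. In s (r k)) + In s d)" .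
 qed simp
 finally have "In s (div_curl_op p i j r d) \<le> ennreal ((1 / alpha) powr s) * (ennreal (2 powr s) * ((ennreal ((2 powr s) ^ 3) * ?c + ?c) * ((\<Sum>k\<in>UNIV. In s (r k)) + In s d)))"
  by (simp add: mult_left_mono)
 also have "\<dots> = ennreal (div_curl_const s) * ((\<Sum>k\<in>UNIV. In s (r k)) + In s d)"
 proof -
  have "ennreal (div_curl_const s) = ennreal ((1 / alpha) powr s) * (ennreal (2 powr s) * (ennreal ((2 powr s) ^ 3) * ?c + ?c))"
   unfolding div_curl_const_def using c alpha_pos by (simp add: ennreal_mult ennreal_plus)
  then show ?thesis by (simp only: mult.assoc)
 qed
 finally show ?thesis .
qed

lemma wd_div_curl_op:
 assumes p: "1 < p" and q: "1 < q" and r: "\<And>k. Lspace p (r k)" "\<And>k. Lspace q (r' k)" "\<And>k. wd UNIV v (r k) (r' k)"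
  and d: "Lspace p d" "Lspace q d'" "wd UNIV v d d'"
 shows "wd UNIV v (div_curl_op p i j r d) (div_curl_op q i j r' d')"
 unfolding div_curl_op_def[abs_def] by (intro wd_cmult wd_add wd_sum wd_riesz p q r d) auto

section \<open>Reflection across the boundary plane\<close>

definition refl3 :: "real^3 => real^3" where
 "refl3 x = x - (2 * x $ 3) *\<^sub>R axis 3 1"

lemma refl3_nth: "refl3 x $ i = (if i = 3 then - x $ 3 else x $ i)"
 unfolding refl3_def by (simp add: axis_def)

lemma refl3_refl3 [simp]: "refl3 (refl3 x) = x"
 by (simp add: vec_eq_iff refl3_nth)

lemma refl3_line: "refl3 (x + t *\<^sub>R v) = refl3 x + t *\<^sub>R refl3 v"
 by (simp add: vec_eq_iff refl3_nth algebra_simps)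

lemma norm_refl3 [simp]: "norm (refl3 x) = norm x"
 unfolding norm_eq_sqrt_inner by (simp add: inner_vec_def refl3_nth sum_3)

lemma continuous_on_refl3: "continuous_on S refl3"
 unfolding refl3_def[abs_def] by (intro continuous_intros)

lemma measurable_refl3 [measurable]: "refl3 \<in> borel \<rightarrow>\<^sub>M borel"
 by (rule borel_measurable_continuous_onI[OF continuous_on_refl3])

lemma lborel_distr_refl3: "distr lborel borel refl3 = lborel"
proof -
 define c where "c = (\<lambda>j :: real^3. if j = axis 3 1 then - 1 else 1 :: real)"
 have "0 + (\<Sum>j\<in>Basis. (c j * (x \<bullet> j)) *\<^sub>R j) = refl3 x" for x :: "real^3"
 proof -
  have "(\<Sum>j\<in>Basis. (c j * (x \<bullet> j)) *\<^sub>R j) = (\<Sum>j\<in>Basis. (x \<bullet> j) *\<^sub>R j - (if j = axis 3 1 then (2 * (x \<bullet> j)) *\<^sub>R j else 0))"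
   by (rule sum.cong) (auto simp: c_def simp flip: scaleR_diff_left scaleR_minus_left)
  also have "\<dots> = refl3 x"
   unfolding sum_subtractf euclidean_representation refl3_def
   by (simp add: sum.delta axis_in_Basis_iff inner_axis)
  finally show ?thesis by simp
 qed
 moreover have "(\<Prod>j\<in>Basis. \<bar>c j\<bar>) = 1" by (rule prod.neutral) (auto simp: c_def)
 ultimately show ?thesis
  using lborel_affine_euclidean[of c "0 :: real^3"] by (simp add: c_def density_1)
qed

lemma integral_refl3:
 fixes f :: "real^3 => real"
 assumes "borel_fun f"
 shows "(LBINT x. f (refl3 x)) = (LBINT x. f x)" "integrable lborel (\<lambda>x. f (refl3 x)) \<longleftrightarrow> integrable lborel f"
  "In p (\<lambda>x. f (refl3 x)) = In p f"
proof -
 note [measurable] = assms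
 show "(LBINT x. f (refl3 x)) = (LBINT x. f x)"
  by (subst (2) lborel_distr_refl3[symmetric]) (simp add: integral_distr)
 show "integrable lborel (\<lambda>x. f (refl3 x)) \<longleftrightarrow> integrable lborel f"
  by (subst (2) lborel_distr_refl3[symmetric]) (simp add: integrable_distr_eq)
 show "In p (\<lambda>x. f (refl3 x)) = In p f"
  unfolding In_def by (subst (2) lborel_distr_refl3[symmetric]) (simp add: nn_integral_distr)
qed

text \<open>The cubic step between 1 and 2. It is once continuously differentiable, which is all
  that a \<open>C1pair\<close> asks for.\<close>

definition cutoff :: "real => real" where
 "cutoff s = (if s \<le> 2 then if s \<le> 1 then 0 else 3 * (s - 1)\<^sup>2 - 2 * (s - 1) ^ 3 else 1)"

definition cutoff' :: "real => real" where
 "cutoff' s = (if s \<le> 2 then if s \<le> 1 then 0 else 6 * (s - 1) - 6 * (s - 1)\<^sup>2 else 0)"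

lemma DERIV_cutoff: "(cutoff has_real_derivative cutoff' s) (at s)"
 unfolding cutoff_def[abs_def] cutoff'_def[abs_def]
 by (intro DERIV_If_le) (auto intro!: derivative_eq_intros)

lemma continuous_cutoff': "continuous_on UNIV cutoff'"
proof -
 have "cutoff' = (\<lambda>s. max 0 (6 * (s - 1) - 6 * (s - 1)\<^sup>2))"
 proof
  fix s :: real
  have e: "6 * (s - 1) - 6 * (s - 1)\<^sup>2 = 6 * ((s - 1) * (2 - s))" by (simp add: power2_eq_square algebra_simps)
  show "cutoff' s = max 0 (6 * (s - 1) - 6 * (s - 1)\<^sup>2)"
   unfolding cutoff'_def e by (auto simp: max_def mult_le_0_iff zero_le_mult_iff)
 qed
 note e = this
 show ?thesis unfolding e by (intro continuous_intros)
qed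

lemma cutoff_bounds: "0 \<le> cutoff s" "cutoff s \<le> 1" "\<bar>cutoff' s\<bar> \<le> 6" "s \<le> 1 ==> cutoff s = 0" "s \<le> 1 ==> cutoff' s = 0"
 "2 \<le> s ==> cutoff s = 1" "2 \<le> s ==> cutoff' s = 0"
proof -
 have a: "0 \<le> 3 * r\<^sup>2 - 2 * r ^ 3 \<and> 3 * r\<^sup>2 - 2 * r ^ 3 \<le> 1 \<and> \<bar>6 * r - 6 * r\<^sup>2\<bar> \<le> 6" if r: "0 \<le> r" "r \<le> 1" for r :: real
 proof -
  have e: "3 * r\<^sup>2 - 2 * r ^ 3 = r\<^sup>2 * (3 - 2 * r)" "1 - (3 * r\<^sup>2 - 2 * r ^ 3) = (1 - r)\<^sup>2 * (1 + 2 * r)"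
   "6 * r - 6 * r\<^sup>2 = 6 * (r * (1 - r))"
   by (simp_all add: power2_eq_square power3_eq_cube algebra_simps)
  have "0 \<le> r\<^sup>2 * (3 - 2 * r)" "0 \<le> (1 - r)\<^sup>2 * (1 + 2 * r)" "0 \<le> r * (1 - r)" "r * (1 - r) \<le> 1"
   using r by (auto intro!: mult_nonneg_nonneg mult_le_one)
  then show ?thesis using e by auto
 qed
 show "0 \<le> cutoff s" "cutoff s \<le> 1" "\<bar>cutoff' s\<bar> \<le> 6" "s \<le> 1 ==> cutoff s = 0" "s \<le> 1 ==> cutoff' s = 0"
  "2 \<le> s ==> cutoff s = 1" "2 \<le> s ==> cutoff' s = 0"
  unfolding cutoff_def cutoff'_def using a[of "s - 1"] by auto
qed

lemma half_borel [measurable]: "half \<in> sets borel"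
 unfolding half_def by measurable

lemma has_dd_cutoff: "has_dd (\<lambda>x::real^3. cutoff (c * x $ 3)) v (\<lambda>x. c * v $ 3 * cutoff' (c * x $ 3))"
 unfolding has_dd_def
proof (intro allI)
 fix x :: "real^3" and t
 have "((\<lambda>t. c * (x + t *\<^sub>R v) $ 3) has_real_derivative c * v $ 3) (at t)"
  by (auto intro!: derivative_eq_intros)
 from DERIV_chain2[OF DERIV_cutoff this]
 show "((\<lambda>t. cutoff (c * (x + t *\<^sub>R v) $ 3)) has_real_derivative c * v $ 3 * cutoff' (c * (x + t *\<^sub>R v) $ 3)) (at t)"
  by (simp add: mult.commute)
qed

text \<open>
 The cutoff has slope of order \<open>n\<close> on a strip of width of order \<open>1 / n\<close>, so a factor which vanishes on
 the plane makes its contribution disappear.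
\<close>

lemma strip_integral_tendsto_0:
 fixes k :: "real^3 => real"
 assumes c: "continuous_on (closure half) k" and z: "\<And>x. x $ 3 = 0 ==> k x = 0" and R: "\<And>x. R < norm x ==> k x = 0"
 shows "(\<lambda>n. LBINT x. real n * cutoff' (real n * x $ 3) * k x) \<longlonglongrightarrow> 0"
proof (rule LIMSEQ_I)
 fix r :: real assume r: "0 < r"
 define S where "S = \<bar>R\<bar> + 1"
 \<comment> \<open>The strip meets the support in a box of volume at most
   \<open>8 * S\<^sup>2 / real n\<close>, and the slope is at most \<open>6 * real n\<close>;
   together they give \<open>48 * S\<^sup>2\<close>. The additional 1 makes the final inequality
   strict.\<close>
 define A where "A = 48 * S\<^sup>2 + 1"
 have S: "0 < S" and A: "0 < A" unfolding S_def A_def by (auto intro: add_nonneg_pos)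
 define D where "D = closure half \<inter> cball 0 S"
 have D: "compact D" unfolding D_def by (intro closed_Int_compact) auto
 have ch: "closure half = {x :: real^3. 0 \<le> x $ 3}"
 proof -
  have "half = {x :: real^3. axis 3 1 \<bullet> x > 0}" "{x :: real^3. axis 3 1 \<bullet> x \<ge> 0} = {x :: real^3. 0 \<le> x $ 3}"
   unfolding half_def by (auto simp: inner_axis')
  then show ?thesis using closure_halfspace_gt[of "axis 3 1 :: real^3" 0] by simp
 qed
 have "uniformly_continuous_on D k"
  by (rule compact_uniformly_continuous[OF continuous_on_subset[OF c] D]) (auto simp: D_def)
 then obtain d where d: "0 < d" "\<And>x y. x \<in> D ==> y \<in> D ==> dist y x < d ==> dist (k y) (k x) < r / A"
  unfolding uniformly_continuous_on_def using r A by (metis divide_pos_pos)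
 have near: "\<bar>k x\<bar> \<le> r / A" if x: "0 < x $ 3" "x $ 3 < d" for x
 proof (cases "norm x \<le> S")
  case True
  define y where "y = x - (x $ 3) *\<^sub>R axis 3 1"
  have y3: "y $ 3 = 0" unfolding y_def by (simp add: axis_def)
  have "norm y \<le> norm x"
   by (rule norm_le_componentwise_cart) (auto simp: y_def axis_def)
  then have "y \<in> D" "x \<in> D" using True x(1) y3 unfolding D_def ch by (auto simp: dist_norm)
  moreover have "dist x y = x $ 3" unfolding dist_norm y_def using x by simp
  ultimately have "dist (k x) (k y) < r / A" using d(2) x by simp
  then show ?thesis unfolding z[OF y3] dist_real_def by simp
 next
  case False
  then show ?thesis using R[of x] r A unfolding S_def by simp
 qed
 obtain N where N: "2 / d < real N" using reals_Archimedean2 by blast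
 have "norm ((LBINT x. real n * cutoff' (real n * x $ 3) * k x) - 0) < r" if n: "max N 1 \<le> n" for n
 proof -
  have n0: "0 < real n" and nN: "2 / d < real n" using n N by auto
  define Q where "Q = (cbox (vector [-S, -S, 0]) (vector [S, S, 2 / real n]) :: (real^3) set)"
  have vQ: "measure lborel Q = 8 * S\<^sup>2 / real n"
  proof -
   have "measure lborel Q = (\<Prod>i\<in>UNIV. (vector [S, S, 2 / real n] :: real^3) $ i - (vector [-S, -S, 0] :: real^3) $ i)"
    unfolding Q_def
    by (rule content_cbox_cart) (use S n0 in \<open>auto simp: interval_ne_empty_cart forall_3\<close>)
   also have "\<dots> = 8 * S\<^sup>2 / real n" unfolding UNIV_3 by (simp add: power2_eq_square)
   finally show ?thesis by simp
  qed
  have bound: "\<bar>real n * cutoff' (real n * x $ 3) * k x\<bar> \<le> real n * 6 * (r / A) * indicator Q x" for x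
  proof (cases "cutoff' (real n * x $ 3) * k x = 0")
   case True
   then show ?thesis using r A by (auto simp: mult.assoc)
  next
   case False
   then have "1 < real n * x $ 3" "real n * x $ 3 < 2" "norm x \<le> S"
    using cutoff_bounds(5,7)[of "real n * x $ 3"] R[of x] unfolding S_def by (force simp: not_le[symmetric])+
   moreover from this have "0 < real n * x $ 3" by linarith
   ultimately have x3: "0 < x $ 3" "x $ 3 < 2 / real n" and nx: "norm x \<le> S" using n0 by (auto simp: field_simps zero_less_mult_iff)
   have "2 / real n < d" using nN d(1) n0 by (simp add: field_simps)
   with x3 have kx: "\<bar>k x\<bar> \<le> r / A" by (intro near) auto
   have "\<bar>x $ i\<bar> \<le> S" for i using component_le_norm_cart[of x i] nx by linarith
   then have "x \<in> Q" unfolding Q_def mem_box_cart using x3 by (auto simp: forall_3 abs_le_iff minus_le_iff)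
   moreover have "\<bar>cutoff' (real n * x $ 3)\<bar> * \<bar>k x\<bar> \<le> 6 * (r / A)"
    using kx cutoff_bounds(3) by (intro mult_mono) auto
   ultimately show ?thesis using mult_left_mono[of "\<bar>cutoff' (real n * x $ 3)\<bar> * \<bar>k x\<bar>" "6 * (r / A)" "real n"]
    by (simp add: abs_mult mult.assoc)
  qed
  have iQ: "integrable lborel (\<lambda>x. real n * 6 * (r / A) * indicator Q x)"
   unfolding Q_def by (intro integrable_mult_right integrable_real_indicator emeasure_lborel_cbox_finite) simp
  have "\<bar>LBINT x. real n * cutoff' (real n * x $ 3) * k x\<bar> \<le> (LBINT x. real n * 6 * (r / A) * indicator Q x)"
  proof (cases "integrable lborel (\<lambda>x. real n * cutoff' (real n * x $ 3) * k x)")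
   case True
   have "\<bar>LBINT x. real n * cutoff' (real n * x $ 3) * k x\<bar> \<le> (LBINT x. \<bar>real n * cutoff' (real n * x $ 3) * k x\<bar>)"
    by (rule integral_abs_bound)
   also have "\<dots> \<le> (LBINT x. real n * 6 * (r / A) * indicator Q x)"
    by (rule integral_mono[OF integrable_abs[OF True] iQ bound])
   finally show ?thesis .
  next
   \<comment> \<open>The integral of a non-integrable function is 0 by convention, so the bound is
     trivial.\<close>
   case False
   then show ?thesis using r A by (simp add: not_integrable_integral_eq)
  qed
  also have "\<dots> = real n * 6 * (r / A) * (8 * S\<^sup>2 / real n)" using vQ unfolding Q_def by simp
  also have "\<dots> = (A - 1) * (r / A)" unfolding A_def using n0 by simp
  also have "\<dots> < r" using A r by (simp add: field_simps)
  finally show ?thesis by simp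
 qed
 then show "\<exists>N. \<forall>n\<ge>N. norm ((LBINT x. real n * cutoff' (real n * x $ 3) * k x) - 0) < r" by blast
qed

text \<open>The pair \<open>k\<close>, \<open>k'\<close> may reach the boundary plane; multiplied by
  the cutoff it becomes admissible for \<open>wd half\<close>. The derivative of the cutoff is 0 in
  tangential directions, and otherwise it meets a factor \<open>k * f\<close> that vanishes on the
  plane, so that \<open>strip_integral_tendsto_0\<close> removes it.\<close>

lemma half_integration_by_parts:
 assumes w: "wd half v f g" and li: "loc_int (\<lambda>x. indicator half x * f x)" "loc_int (\<lambda>x. indicator half x * g x)"
  and c: "C1pair UNIV v k k'"
  and bd: "v $ 3 = 0 \<or> continuous_on (closure half) f \<and> (\<forall>x. x $ 3 = 0 --> k x * f x = 0)"
 shows "(LBINT x. k' x * (indicator half x * f x)) = - (LBINT x. k x * (indicator half x * g x))"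
proof -
 note b = C1pair_bdd_cpt[OF c]
 have p: "has_dd k v k'" "continuous_on UNIV k" "continuous_on UNIV k'" using c unfolding C1pair_def by auto
 have [measurable]: "borel_fun f" "borel_fun g" "borel_fun k" "borel_fun k'"
  using wdD(3,4)[OF w] b by (auto dest: bdd_cpt_measurable)
 obtain R1 where R1: "\<And>x. R1 < norm x ==> k x = 0" using bdd_cptE[OF b(1)] by metis
 obtain R2 where R2: "\<And>x. R2 < norm x ==> k' x = 0" using bdd_cptE[OF b(2)] by metis
 define R where "R = max R1 R2"
 have R: "R < norm x ==> k x = 0" "R < norm x ==> k' x = 0" for x using R1 R2 unfolding R_def by auto
 have cc: "continuous_on UNIV cutoff" by (rule DERIV_continuous_on[OF DERIV_cutoff])
 have cm [measurable]: "borel_fun cutoff" "borel_fun cutoff'"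
  by (rule borel_measurable_continuous_onI[OF cc] borel_measurable_continuous_onI[OF continuous_cutoff'])+
 define z where "z = (\<lambda>n (x :: real^3). cutoff (real n * x $ 3))"
 define z' where "z' = (\<lambda>n (x :: real^3). real n * v $ 3 * cutoff' (real n * x $ 3))"
 have [measurable]: "borel_fun (z n)" "borel_fun (z' n)" for n
  unfolding z_def z'_def by measurable
 have l: "continuous_on UNIV (\<lambda>x :: real^3. real n * x $ 3)" for n by (intro continuous_intros)
 have c\<eta>: "continuous_on UNIV (z n)" "continuous_on UNIV (z' n)" for n
  unfolding z_def z'_def
  by (rule continuous_on_compose2[OF cc l] continuous_on_mult[OF continuous_on_const continuous_on_compose2[OF continuous_cutoff' l]]; simp)+
 have P: "C1pair half v (\<lambda>x. k x * z n x) (\<lambda>x. k' x * z n x + z' n x * k x)" for n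
  unfolding C1pair_def
 proof (intro conjI)
  show "has_dd (\<lambda>x. k x * z n x) v (\<lambda>x. k' x * z n x + z' n x * k x)"
   unfolding z_def z'_def by (rule has_dd_mult[OF p(1) has_dd_cutoff])
  show "continuous_on UNIV (\<lambda>x. k x * z n x)" "continuous_on UNIV (\<lambda>x. k' x * z n x + z' n x * k x)"
   by (intro continuous_on_add continuous_on_mult p c\<eta>)+
  let ?C = "cball 0 R \<inter> {x :: real^3. 1 \<le> real n * x $ 3}"
  have "closed {x :: real^3. 1 \<le> real n * x $ 3}" by (intro closed_Collect_le continuous_intros)
  then have "compact ?C" by (intro compact_Int_closed) auto
  moreover have "?C \<subseteq> half"
  proof
   fix x assume "x \<in> ?C"
   then have "0 < real n * x $ 3" by auto
   then show "x \<in> half" unfolding half_def by (simp add: zero_less_mult_iff)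
  qed
  moreover have "k x * z n x = 0 \<and> k' x * z n x + z' n x * k x = 0" if "x \<notin> ?C" for x
   using that R[of x] cutoff_bounds(4,5)[of "real n * x $ 3"] unfolding z_def z'_def by (cases "R < norm x") auto
  ultimately have "compact ?C \<and> ?C \<subseteq> half \<and> (\<forall>x. x \<notin> ?C --> k x * z n x = 0 \<and> k' x * z n x + z' n x * k x = 0)" by simp
  then show "\<exists>C. compact C \<and> C \<subseteq> half \<and> (\<forall>x. x \<notin> C --> k x * z n x = 0 \<and> k' x * z n x + z' n x * k x = 0)" by (intro exI[of _ ?C])
 qed
 have out: "z n x = 0" "z' n x = 0" if "x \<notin> half" for n x
 proof -
  have "real n * x $ 3 \<le> 1" using that unfolding half_def by (intro order_trans[OF mult_nonneg_nonpos]) auto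
  then show "z n x = 0" "z' n x = 0" unfolding z_def z'_def using cutoff_bounds(4,5) by auto
 qed
 have lim: "(\<lambda>n. LBINT x. \<phi> x * z n x * h x) \<longlonglongrightarrow> (LBINT x. \<phi> x * (indicator half x * h x))"
  "integrable lborel (\<lambda>x. \<phi> x * z n x * h x)"
  if \<phi>: "bdd_cpt \<phi>" and h: "loc_int (\<lambda>x. indicator half x * h x)" "borel_fun h" for \<phi> h n
 proof -
  have [measurable]: "borel_fun \<phi>" "borel_fun h" using h(2) bdd_cpt_measurable[OF \<phi>] by auto
  have i: "integrable lborel (\<lambda>x. \<bar>\<phi> x * (indicator half x * h x)\<bar>)"
   by (intro integrable_abs integrable_bdd_cpt_mult \<phi> h)
  have ae: "AE x in lborel. (\<lambda>n. \<phi> x * z n x * h x) \<longlonglongrightarrow> \<phi> x * (indicator half x * h x)"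
  proof (rule AE_I2)
   fix x
   show "(\<lambda>n. \<phi> x * z n x * h x) \<longlonglongrightarrow> \<phi> x * (indicator half x * h x)"
   proof (cases "x \<in> half")
    case True
    obtain N where N: "2 / x $ 3 < real N" using reals_Archimedean2 by blast
    have "\<phi> x * z n x * h x = \<phi> x * (indicator half x * h x)" if n: "n \<ge> N" for n
    proof -
     have "2 / x $ 3 < real n" using N n by linarith
     then have "2 \<le> real n * x $ 3" using True unfolding half_def by (simp add: field_simps)
     then show ?thesis unfolding z_def using True cutoff_bounds(6) by simp
    qed
    then show ?thesis by (intro tendsto_eventually) (auto simp: eventually_sequentially)
   qed (simp add: out)
  qed
  have le: "norm (\<phi> x * z n x * h x) \<le> \<bar>\<phi> x * (indicator half x * h x)\<bar>" for n x
  proof (cases "x \<in> half")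
   case True
   have "\<bar>z n x\<bar> \<le> 1" unfolding z_def using cutoff_bounds(1,2)[of "real n * x $ 3"] by simp
   then have "\<bar>\<phi> x * h x\<bar> * \<bar>z n x\<bar> \<le> \<bar>\<phi> x * h x\<bar> * 1" by (intro mult_left_mono) auto
   then show ?thesis using True by (simp add: abs_mult ac_simps)
  qed (simp add: out)
  have m: "(\<lambda>x. \<phi> x * z n x * h x) \<in> borel_measurable lborel" for n by simp
  have m': "(\<lambda>x. \<phi> x * (indicator half x * h x)) \<in> borel_measurable lborel" by simp
  show "(\<lambda>n. LBINT x. \<phi> x * z n x * h x) \<longlonglongrightarrow> (LBINT x. \<phi> x * (indicator half x * h x))"
   by (rule integral_dominated_convergence[OF m' m i ae]) (rule AE_I2[OF le])
  show "integrable lborel (\<lambda>x. \<phi> x * z n x * h x)"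
   by (rule Bochner_Integration.integrable_bound[OF i m]) (use le in auto)
 qed
 have lim': "(\<lambda>n. LBINT x. z' n x * (k x * f x)) \<longlonglongrightarrow> 0"
 proof (cases "v $ 3 = 0")
  case True
  then show ?thesis unfolding z'_def by simp
 next
  case False
  with bd have B: "continuous_on (closure half) f" "\<And>x. x $ 3 = 0 ==> k x * f x = 0" by auto
  have "(\<lambda>n. LBINT x. real n * cutoff' (real n * x $ 3) * (k x * f x)) \<longlonglongrightarrow> 0"
   by (rule strip_integral_tendsto_0[of _ R]) (use B R in \<open>auto intro!: continuous_on_mult continuous_on_subset[OF p(2)]\<close>)
  from tendsto_mult_right[OF this, of "v $ 3"]
  have "(\<lambda>n. v $ 3 * (LBINT x. real n * cutoff' (real n * x $ 3) * (k x * f x))) \<longlonglongrightarrow> 0" by (simp add: mult.commute)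
  moreover have "v $ 3 * (LBINT x. real n * cutoff' (real n * x $ 3) * (k x * f x)) = (LBINT x. z' n x * (k x * f x))" for n
   unfolding z'_def by (subst integral_mult_right_zero[symmetric]) (simp add: ac_simps)
  ultimately show ?thesis by simp
 qed
 have eq: "(LBINT x. k' x * z n x * f x) + (LBINT x. z' n x * (k x * f x)) = - (LBINT x. k x * z n x * g x)" for n
 proof -
  have i: "integrable lborel (\<lambda>x. k' x * z n x * f x)" by (rule lim(2)[OF b(2) li(1)]) simp
  have e: "(\<lambda>x. (k' x * z n x + z' n x * k x) * f x) = (\<lambda>x. k' x * z n x * f x + z' n x * (k x * f x))"
   by (simp add: fun_eq_iff algebra_simps)
  have "integrable lborel (\<lambda>x. k' x * z n x * f x + z' n x * (k x * f x))" using wdD(6)[OF w P[of n]] unfolding e .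
  from Bochner_Integration.integrable_diff[OF this i] have j: "integrable lborel (\<lambda>x. z' n x * (k x * f x))" by simp
  show ?thesis using wdD(5)[OF w P[of n]] unfolding e Bochner_Integration.integral_add[OF i j] .
 qed
 have "(\<lambda>n. (LBINT x. k' x * z n x * f x) + (LBINT x. z' n x * (k x * f x))) \<longlonglongrightarrow> (LBINT x. k' x * (indicator half x * f x)) + 0"
  by (rule tendsto_add[OF lim(1)[OF b(2) li(1)] lim']) simp
 moreover have "(\<lambda>n. - (LBINT x. k x * z n x * g x)) \<longlonglongrightarrow> - (LBINT x. k x * (indicator half x * g x))"
  by (rule tendsto_minus[OF lim(1)[OF b(1) li(2)]]) simp
 ultimately show ?thesis unfolding eq using LIMSEQ_unique by fastforce
qed

section \<open>Even and odd extensions and their weak derivatives\<close>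

definition ext3 :: "real => (real^3 => real) => real^3 => real" where
 "ext3 s f x = indicator half x * f x + s * (indicator half (refl3 x) * f (refl3 x))"

lemma ext3_half: "x \<in> half ==> ext3 s f x = f x"
 unfolding ext3_def half_def by (simp add: refl3_nth)

lemma ext3_measurable [measurable]: "borel_fun f ==> borel_fun (ext3 s f)"
 unfolding ext3_def[abs_def]
 by (intro borel_measurable_add borel_measurable_times borel_measurable_const measurable_compose[OF measurable_refl3] borel_measurable_indicator half_borel)

lemma In_ext3:
 assumes "0 < p" and [measurable]: "borel_fun f" and s: "\<bar>s\<bar> = 1"
 shows "In p (ext3 s f) \<le> ennreal (2 powr p * 2) * In p (\<lambda>x. indicator half x * f x)"
proof -
 define h where "h = (\<lambda>x. indicator half x * f x)"
 have m: "borel_fun h" unfolding h_def by (intro borel_measurable_times borel_measurable_indicator) auto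
 have m': "borel_fun (\<lambda>x. h (refl3 x))" by (rule measurable_compose[OF measurable_refl3 m])
 have "ext3 s f = (\<lambda>x. h x + s * h (refl3 x))" unfolding ext3_def[abs_def] h_def ..
 then have "In p (ext3 s f) \<le> ennreal (2 powr p) * (In p h + In p (\<lambda>x. s * h (refl3 x)))"
  using In_add[OF assms(1) m borel_measurable_times[OF borel_measurable_const m'], of s] by simp
 moreover have "In p (\<lambda>x. s * h (refl3 x)) = In p h"
  unfolding In_cmult[OF m'] integral_refl3(3)[OF m] by (simp add: s)
 ultimately show ?thesis unfolding h_def[symmetric] by (simp add: ennreal_mult' mult.assoc mult_2)
qed

lemma integrable_ext3:
 assumes b: "bdd_cpt w" and l: "loc_int (\<lambda>x. indicator half x * f x)" and [measurable]: "borel_fun f"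
 shows "integrable lborel (\<lambda>x. w x * ext3 s f x)"
  "(LBINT x. w x * ext3 s f x) = (LBINT x. (w x + s * w (refl3 x)) * (indicator half x * f x))"
proof -
 let ?f = "\<lambda>x. indicator half x * f x"
 have mf: "borel_fun (?f)" by (intro borel_measurable_times borel_measurable_indicator) auto
 note [measurable] = bdd_cpt_measurable[OF b]
 have b': "bdd_cpt (\<lambda>x. w (refl3 x))"
 proof -
  obtain M R where M: "\<And>x. \<bar>w x\<bar> \<le> M" "\<And>x. R < norm x ==> w x = 0" using bdd_cptE[OF b] by metis
  show ?thesis by (rule bdd_cptI[of _ M R]) (auto simp: M)
 qed
 have i1: "integrable lborel (\<lambda>x. w x * ?f x)" by (rule integrable_bdd_cpt_mult[OF b l])
 have i2: "integrable lborel (\<lambda>x. w (refl3 x) * ?f x)" by (rule integrable_bdd_cpt_mult[OF b' l])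
 have m: "borel_fun (\<lambda>x. w (refl3 x) * ?f x)"
  by (intro borel_measurable_times mf measurable_compose[OF measurable_refl3 bdd_cpt_measurable[OF b]])
 have i3: "integrable lborel (\<lambda>x. w x * ?f (refl3 x))"
  and e3: "(LBINT x. w x * ?f (refl3 x)) = (LBINT x. w (refl3 x) * ?f x)"
  using integral_refl3(1,2)[OF m] i2 by simp_all
 have e: "(\<lambda>x. w x * ext3 s f x) = (\<lambda>x. w x * ?f x + s * (w x * ?f (refl3 x)))"
  "(\<lambda>x. (w x + s * w (refl3 x)) * ?f x) = (\<lambda>x. w x * ?f x + s * (w (refl3 x) * ?f x))"
  unfolding ext3_def by (auto simp: fun_eq_iff algebra_simps)
 show "integrable lborel (\<lambda>x. w x * ext3 s f x)" unfolding e by (intro Bochner_Integration.integrable_add integrable_mult_right i1 i3)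
 show "(LBINT x. w x * ext3 s f x) = (LBINT x. (w x + s * w (refl3 x)) * ?f x)"
  unfolding e using i1 i2 i3 e3 by simp
qed

text \<open>The reflection is moved to the test pair, which turns \<open>k\<close> into
  \<open>k x + s * r * k (refl3 x)\<close> on the half-space. In the normal direction
  \<open>r = -1\<close>: for an even extension this combination vanishes on the plane, for an odd
  one \<open>f\<close> does, so no boundary term survives.\<close>

lemma wd_ext3:
 assumes w: "wd half v f g" and li: "loc_int (\<lambda>x. indicator half x * f x)" "loc_int (\<lambda>x. indicator half x * g x)"
  and v: "refl3 v = r *\<^sub>R v" and tt: "r * r = 1"
  and bd: "v $ 3 = 0 \<or> r = -1 \<and> continuous_on (closure half) f \<and> (s = 1 \<or> (\<forall>x. x $ 3 = 0 --> f x = 0))"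
 shows "wd UNIV v (ext3 s f) (ext3 (s * r) g)"
 unfolding wd_def loc_int_on_UNIV
proof (intro conjI allI impI)
 note m = wdD(3,4)[OF w]
 have cb: "bdd_cpt (indicator (cball 0 R) :: real^3 => real)" for R
  by (rule bdd_cptI[of _ 1 R]) (auto intro!: borel_measurable_indicator)
 show "loc_int (ext3 s f)" "loc_int (ext3 (s * r) g)"
  unfolding loc_int_def by (intro conjI allI ext3_measurable m integrable_ext3(1)[OF cb] li)+
 fix k k' assume c: "C1pair UNIV v k k'"
 note b = C1pair_bdd_cpt[OF c]
 have p: "has_dd k v k'" "continuous_on UNIV k" "continuous_on UNIV k'" using c unfolding C1pair_def by auto
 have dr: "has_dd (\<lambda>x. k (refl3 x)) v (\<lambda>x. r * k' (refl3 x))"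
  unfolding has_dd_def
 proof (intro allI)
  fix x t
  have "((\<lambda>u. k (refl3 x + u *\<^sub>R v)) has_real_derivative k' (refl3 x + (r * t) *\<^sub>R v)) (at (r * t))" by (rule has_ddD[OF p(1)])
  then have D: "((\<lambda>u. k (refl3 x + (r * u) *\<^sub>R v)) has_real_derivative k' (refl3 x + (r * t) *\<^sub>R v) * r) (at t)"
   by (rule DERIV_chain2[where f="\<lambda>u. k (refl3 x + u *\<^sub>R v)"]) (rule DERIV_cmult_Id)
  have e: "refl3 (x + u *\<^sub>R v) = refl3 x + (r * u) *\<^sub>R v" for u by (simp add: refl3_line v mult.commute)
  show "((\<lambda>t. k (refl3 (x + t *\<^sub>R v))) has_real_derivative r * k' (refl3 (x + t *\<^sub>R v))) (at t)"
   unfolding e using D by (simp only: mult.commute[of r])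
 qed
 have cr: "continuous_on UNIV (\<lambda>x. h (refl3 x))" if "continuous_on UNIV h" for h :: "real^3 => real"
  by (rule continuous_on_compose2[OF that continuous_on_refl3]) simp
 have C: "C1pair UNIV v (\<lambda>x. k x + (s * r) * k (refl3 x)) (\<lambda>x. k' x + s * k' (refl3 x))"
  unfolding C1pair_def
 proof (intro conjI)
  have dm: "has_dd (\<lambda>x. (s * r) * k (refl3 x)) v (\<lambda>x. s * k' (refl3 x))"
   unfolding has_dd_def
  proof (intro allI)
   fix x t
   have e: "s * r * (r * z) = s * z" for z using tt by (metis mult.assoc mult_1)
   show "((\<lambda>t. s * r * k (refl3 (x + t *\<^sub>R v))) has_real_derivative s * k' (refl3 (x + t *\<^sub>R v))) (at t)"
    using DERIV_cmult[OF has_ddD[OF dr, of x t], of "s * r"] unfolding e .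
  qed
  show "has_dd (\<lambda>x. k x + s * r * k (refl3 x)) v (\<lambda>x. k' x + s * k' (refl3 x))" by (rule has_dd_add[OF p(1) dm])
  show "continuous_on UNIV (\<lambda>x. k x + s * r * k (refl3 x))" "continuous_on UNIV (\<lambda>x. k' x + s * k' (refl3 x))"
   by (intro continuous_intros p cr)+
  obtain R1 where R1: "\<And>x. R1 < norm x ==> k x = 0" using bdd_cptE[OF b(1)] by metis
  obtain R2 where R2: "\<And>x. R2 < norm x ==> k' x = 0" using bdd_cptE[OF b(2)] by metis
  show "\<exists>C. compact C \<and> C \<subseteq> UNIV \<and> (\<forall>x. x \<notin> C --> k x + s * r * k (refl3 x) = 0 \<and> k' x + s * k' (refl3 x) = 0)"
   by (rule exI[of _ "cball 0 (max R1 R2)"]) (auto simp: R1 R2)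
 qed
 show "(LBINT x. k' x * ext3 s f x) = - (LBINT x. k x * ext3 (s * r) g x)"
 proof -
  have bd': "v $ 3 = 0 \<or> continuous_on (closure half) f \<and> (\<forall>x. x $ 3 = 0 --> (k x + (s * r) * k (refl3 x)) * f x = 0)"
  proof -
   have "refl3 x = x" if "x $ 3 = 0" for x using that unfolding refl3_def by simp
   then show ?thesis using bd by auto
  qed
  show ?thesis
   unfolding integrable_ext3(2)[OF b(2) li(1) m(1)] integrable_ext3(2)[OF b(1) li(2) m(2)]
   by (rule half_integration_by_parts[OF w li C bd'])
 qed
qed

definition hIn :: "real => (real^3 => real) => ennreal" where
 "hIn p f = In p (\<lambda>x. indicator half x * f x)"

lemma hIn_le_In: "0 < p ==> hIn p f \<le> In p f"
 unfolding hIn_def by (intro In_mono_AE) (auto simp: indicator_def)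

lemma half_measurable_mult: "borel_fun f ==> borel_fun (\<lambda>x. indicator half x * f x :: real)"
 by (intro borel_measurable_times borel_measurable_indicator half_borel)

lemma hIn_cmult:
 assumes "borel_fun f" shows "hIn p (\<lambda>x. c * f x) = ennreal (\<bar>c\<bar> powr p) * hIn p f"
 unfolding hIn_def using In_cmult[OF half_measurable_mult[OF assms], of p c] by (simp add: mult.left_commute)

lemma hIn_add:
 assumes p: "0 < p" and m: "borel_fun f" "borel_fun g"
 shows "hIn p (\<lambda>x. f x + g x) \<le> ennreal (2 powr p) * (hIn p f + hIn p g)"
 unfolding hIn_def using In_add[OF p half_measurable_mult[OF m(1)] half_measurable_mult[OF m(2)]] by (simp only: distrib_left)

lemma hIn_diff:
 assumes p: "0 < p" and m: "borel_fun f" "borel_fun g"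
 shows "hIn p (\<lambda>x. f x - g x) \<le> ennreal (2 powr p) * (hIn p f + hIn p g)"
 unfolding hIn_def right_diff_distrib by (rule In_diff[OF p half_measurable_mult[OF m(1)] half_measurable_mult[OF m(2)]])

lemma hIn_Lspace:
 assumes "borel_fun f" "hIn p f < \<infinity>" shows "Lspace p (\<lambda>x. indicator half x * f x)"
 unfolding Lspace_def using assms half_measurable_mult[OF assms(1)] unfolding hIn_def by simp

lemma Lspace_ext3:
 assumes p: "0 < p" and f: "borel_fun f" "hIn p f < \<infinity>" and s: "\<bar>s\<bar> = 1"
 shows "Lspace p (ext3 s f)"
 unfolding Lspace_def
 using In_ext3[OF p f(1) s] f(2) ext3_measurable[OF f(1)] unfolding hIn_def
 by (auto intro: le_less_trans simp: ennreal_mult_less_top)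

lemma ext3_diff: "ext3 s (\<lambda>x. f x - g x) x = ext3 s f x - ext3 s g x"
 unfolding ext3_def by (simp add: algebra_simps)

lemma ext3_sum: "ext3 s (\<lambda>x. \<Sum>k\<in>I. f k x) x = (\<Sum>k\<in>I. ext3 s (f k) x)"
 unfolding ext3_def by (simp add: sum.distrib sum_distrib_left)

text \<open>The parity of a coordinate direction under \<open>refl3\<close>. Each differentiation in
  direction \<open>i\<close> multiplies the parity of a reflected function by
  \<open>par3 i\<close>.\<close>

definition par3 :: "3 => real" where "par3 i = (if i = 3 then -1 else 1)"

lemma par3: "par3 i * par3 i = 1" "\<bar>par3 i\<bar> = 1" "\<bar>par3 i * par3 j\<bar> = 1" "i \<noteq> 3 ==> par3 i = 1"
 unfolding par3_def by auto

lemma refl3_axis: "refl3 (axis i 1) = par3 i *\<^sub>R axis i 1"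
 by (simp add: vec_eq_iff refl3_nth par3_def axis_def)

text \<open>In tangential directions both parities are admissible without any boundary condition,
  since a jump across the plane has no tangential derivative.\<close>

lemma wd_ext3_tangential:
 assumes w: "wd half (axis i 1) f g" and i: "i \<noteq> 3" and p: "1 \<le> p" "hIn p f < \<infinity>" and q: "1 \<le> q" "hIn q g < \<infinity>"
 shows "wd UNIV (axis i 1) (ext3 s f) (ext3 s g)"
proof -
 have "(axis i 1 :: real^3) $ 3 = 0" "refl3 (axis i 1) = 1 *\<^sub>R axis i 1"
  using i refl3_axis[of i] par3(4)[of i] by (auto simp: axis_def)
 from wd_ext3[OF w Lspace_loc_int[OF p(1) hIn_Lspace[OF wdD(3)[OF w] p(2)]] Lspace_loc_int[OF q(1) hIn_Lspace[OF wdD(4)[OF w] q(2)]] this(2), of s] this(1)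
 show ?thesis by simp
qed

section \<open>The decomposition on the half-space\<close>

definition uP_const :: "real => real" where
 "uP_const p = (1 / alpha) powr p * (riesz_const p * (2 powr p * 2))"

definition uF_const :: "real => real" where
 "uF_const p = div_curl_const p * (2 powr p * 2)"

text \<open>\<open>gP\<close> is the Hessian of a potential: its symmetry, \<open>riesz_sym\<close>,
  leaves the curl unchanged when it is subtracted, and its trace, \<open>riesz_trace\<close>,
  removes exactly the extended \<open>Q\<close> from the divergence. With parity
  \<open>par3 j\<close> for the component \<open>j\<close> the divergence is even and the curl entry
  \<open>k j\<close> has parity \<open>par3 k * par3 j\<close>.\<close>

lemma half_decomposition:
 fixes U :: "3 => real^3 => real" and G :: "3 => 3 => real^3 => real" and Q :: "real^3 => real"
 assumes D_def: "D = (\<lambda>x. (\<Sum>k\<in>UNIV. G k k x) - Q x)" and z_def: "z = (\<lambda>k j x. G k j x - G j k x)"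
  and w: "\<And>i j. wd half (axis i 1) (U j) (G i j)"
  and U: "\<And>j. continuous_on (closure half) (U j)" "\<And>x. x $ 3 = 0 ==> U 3 x = 0"
  and G: "\<And>i j. hIn 2 (G i j) < \<infinity>"
  and Q: "borel_fun Q" "\<And>x. \<bar>Q x\<bar> \<le> B" "hIn 2 Q < \<infinity>"
 obtains uP uF gP gF where
  "\<And>j x. x \<in> half ==> U j x = uP j x + uF j x"
  "\<And>i j. wd UNIV (axis i 1) (uP j) (gP i j)" "\<And>i j. wd UNIV (axis i 1) (uF j) (gF i j)"
  "\<And>p i j. 1 < p ==> hIn p Q < \<infinity> ==> hIn p (gP i j) \<le> ennreal (uP_const p) * hIn p Q"
  "\<And>i j. Lspace 2 (gF i j)"
  "\<And>k j x. x \<in> half ==> gF k j x - gF j k x = z k j x" "AE x in lborel. x \<in> half --> (\<Sum>k\<in>UNIV. gF k k x) = D x"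
  "\<And>i j. AE x in lborel. gF i j x = div_curl_op 2 i j (\<lambda>k. ext3 (par3 k * par3 j) (z k j)) (ext3 1 D) x"
proof -
 have Gm: "borel_fun (G i j)" for i j by (rule wdD(4)[OF w])
 have Um: "borel_fun (U j)" for j by (rule wdD(3)[OF w])
 define h where "h = ext3 1 Q"
 have hm: "borel_fun h" unfolding h_def by (rule ext3_measurable[OF Q(1)])
 have h2: "Lspace 2 h" unfolding h_def by (rule Lspace_ext3) (use Q in auto)
 have hb: "\<bar>h x\<bar> \<le> B + B" for x
 proof -
  have "\<bar>indicator half y * Q y\<bar> \<le> B" for y using Q(2)[of y] by (auto simp: indicator_def)
  from add_mono[OF this[of x] this[of "refl3 x"]] show ?thesis unfolding h_def ext3_def by linarith
 qed
 have hi: "integrable lborel (\<lambda>x. (h x)\<^sup>2)"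
 proof (rule integrableI_bounded)
  have "(\<integral>\<^sup>+ x. ennreal (norm ((h x)\<^sup>2)) \<partial>lborel) = In 2 h"
   unfolding In_def by (intro nn_integral_cong) (simp add: powr_numeral)
  then show "(\<integral>\<^sup>+ x. ennreal (norm ((h x)\<^sup>2)) \<partial>lborel) < \<infinity>" using h2 unfolding Lspace_def by simp
 qed (use hm in measurable)
 have "\<forall>j. \<exists>V. \<forall>i. wd UNIV (axis i 1) V (riesz 2 i j h)"
  using riesz_potential[OF h2 hb hi] by metis
 then obtain V where V: "\<And>i j. wd UNIV (axis i 1) (V j) (riesz 2 i j h)" by metis
 have li: "loc_int (\<lambda>x. indicator half x * U j x)" for j
  unfolding loc_int_def
 proof (intro conjI allI half_measurable_mult Um)
  fix R :: real
  have "compact (closure half \<inter> cball 0 R)" by (intro closed_Int_compact) auto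
  then have "bounded (U j ` (closure half \<inter> cball 0 R))"
   by (intro compact_imp_bounded compact_continuous_image continuous_on_subset[OF U(1)]) auto
  then obtain M where "\<forall>y\<in>U j ` (closure half \<inter> cball 0 R). norm y \<le> M" unfolding bounded_iff by blast
  then have M: "x \<in> closure half ==> norm x \<le> R ==> \<bar>U j x\<bar> \<le> M" for x by simp
  show "integrable lborel (\<lambda>x. indicator (cball 0 R) x * (indicator half x * U j x))"
  proof (rule bdd_cpt_integrable, rule bdd_cptI)
   show "borel_fun (\<lambda>x. indicator (cball 0 R) x * (indicator half x * U j x))"
    by (intro borel_measurable_times borel_measurable_indicator half_measurable_mult Um) auto
   show "\<bar>indicator (cball 0 R) x * (indicator half x * U j x)\<bar> \<le> \<bar>M\<bar>" for x
    using M[of x] closure_subset[of half] by (auto simp: indicator_def intro: order_trans[OF _ abs_ge_self])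
   show "indicator (cball 0 R) x * (indicator half x * U j x) = 0" if "R < norm x" for x using that by simp
  qed
 qed
 have lG: "loc_int (\<lambda>x. indicator half x * G i j x)" for i j
  by (rule Lspace_loc_int[OF _ hIn_Lspace[OF Gm G]]) simp
 define uP where "uP = (\<lambda>j x. (- 1 / alpha) * V j x)"
 define gP where "gP = (\<lambda>i j x. (- 1 / alpha) * riesz 2 i j h x)"
 define uF where "uF = (\<lambda>j x. ext3 (par3 j) (U j) x - uP j x)"
 define gF where "gF = (\<lambda>i j x. ext3 (par3 j * par3 i) (G i j) x - gP i j x)"
 have wP: "wd UNIV (axis i 1) (uP j) (gP i j)" for i j unfolding uP_def gP_def by (rule wd_cmult[OF V])
 \<comment> \<open>Only the component \<open>j = 3\<close> is extended oddly, and it vanishes on the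
   plane; the tangential components are extended evenly, for which continuity up to the plane is
   enough.\<close>
 have wE: "wd UNIV (axis i 1) (ext3 (par3 j) (U j)) (ext3 (par3 j * par3 i) (G i j))" for i j
 proof (rule wd_ext3[OF w li lG refl3_axis par3(1)])
  show "(axis i 1 :: real^3) $ 3 = 0 \<or> par3 i = - 1 \<and> continuous_on (closure half) (U j) \<and> (par3 j = 1 \<or> (\<forall>x. x $ 3 = 0 --> U j x = 0))"
   using U unfolding par3_def by (auto simp: axis_def)
 qed
 have wF: "wd UNIV (axis i 1) (uF j) (gF i j)" for i j unfolding uF_def gF_def by (rule wd_diff[OF wE wP])
 have r2: "Lspace 2 (riesz 2 i j h)" for i j by (rule riesz(1)[OF _ h2]) simp
 have gP2: "Lspace 2 (gP i j)" for i j unfolding gP_def by (rule Lspace_cmult[OF r2])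
 have gF2: "Lspace 2 (gF i j)" for i j
  unfolding gF_def by (intro Lspace_diff gP2 Lspace_ext3 Gm G par3) auto
 have c: "gF k j x - gF j k x = ext3 (par3 k * par3 j) (z k j) x" for k j x
 proof -
  have cm: "par3 j * par3 k = par3 k * par3 j" by (rule mult.commute)
  show ?thesis unfolding gF_def gP_def z_def ext3_diff cm riesz_sym[of 2 k j h] by simp
 qed
 have d: "AE x in lborel. (\<Sum>k\<in>UNIV. gF k k x) = ext3 1 D x"
 proof -
  have "AE x in lborel. (\<Sum>k\<in>UNIV. riesz 2 k k h x) = - alpha * h x" by (rule riesz_trace[OF _ h2]) simp
  then show ?thesis
  proof eventually_elim
   fix x assume e: "(\<Sum>k\<in>UNIV. riesz 2 k k h x) = - alpha * h x"
   have "(\<Sum>k\<in>UNIV. gF k k x) = ext3 1 (\<lambda>x. \<Sum>k\<in>UNIV. G k k x) x - (- 1 / alpha) * (\<Sum>k\<in>UNIV. riesz 2 k k h x)"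
    unfolding gF_def gP_def ext3_sum sum_subtractf by (simp only: par3(1) sum_distrib_left)
   also have "\<dots> = ext3 1 (\<lambda>x. \<Sum>k\<in>UNIV. G k k x) x - h x" unfolding e using alpha_pos by simp
   also have "\<dots> = ext3 1 D x" unfolding D_def ext3_diff h_def ..
   finally show "(\<Sum>k\<in>UNIV. gF k k x) = ext3 1 D x" .
  qed
 qed
 show thesis
 proof (rule that[of uP uF gP gF])
  fix j x assume x: "x \<in> half"
  show "U j x = uP j x + uF j x" unfolding uF_def using ext3_half[OF x] by simp
 next
  show "wd UNIV (axis i 1) (uP j) (gP i j)" "wd UNIV (axis i 1) (uF j) (gF i j)" "Lspace 2 (gF i j)" for i j by (rule wP wF gF2)+
 next
  fix p :: real and i j assume p: "1 < p" and Qp: "hIn p Q < \<infinity>"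
  have hp: "Lspace p h" unfolding h_def by (rule Lspace_ext3) (use p Q Qp in auto)
  have "hIn p (gP i j) \<le> In p (gP i j)" by (rule hIn_le_In) (use p in simp)
  also have "\<dots> = ennreal ((1 / alpha) powr p) * In p (riesz 2 i j h)"
   unfolding gP_def using In_cmult[OF Lspace_measurable[OF r2], of p "- 1 / alpha"] alpha_pos by simp
  also have "\<dots> \<le> ennreal ((1 / alpha) powr p) * (ennreal (riesz_const p) * (ennreal (2 powr p * 2) * hIn p Q))"
   unfolding hIn_def
   by (intro mult_left_mono order_trans[OF In_riesz_le[OF _ p h2 hp]] In_ext3[of p Q 1, folded h_def]) (use p Q in auto)
  also have "\<dots> = ennreal (uP_const p) * hIn p Q"
   unfolding uP_const_def using riesz_const(1)[OF p] alpha_pos by (simp add: ennreal_mult mult.assoc)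
  finally show "hIn p (gP i j) \<le> ennreal (uP_const p) * hIn p Q" .
 next
  show "gF k j x - gF j k x = z k j x" if "x \<in> half" for k j x unfolding c by (rule ext3_half[OF that])
  show "AE x in lborel. x \<in> half --> (\<Sum>k\<in>UNIV. gF k k x) = D x" using d by eventually_elim (simp add: ext3_half)
 next
  fix i j
  have dm: "borel_fun (\<lambda>x. \<Sum>k\<in>UNIV. gF k k x)"
   by (intro borel_measurable_sum Lspace_measurable[OF gF2])
  have Dm: "borel_fun (ext3 1 D)"
   unfolding D_def by (intro ext3_measurable borel_measurable_diff borel_measurable_sum Gm Q)
  have "AE x in lborel. gF i j x = div_curl_op 2 i j (\<lambda>k x. gF k j x - gF j k x) (\<lambda>x. \<Sum>k\<in>UNIV. gF k k x) x"
   by (rule div_curl_representation[OF wF gF2])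
  then show "AE x in lborel. gF i j x = div_curl_op 2 i j (\<lambda>k. ext3 (par3 k * par3 j) (z k j)) (ext3 1 D) x"
   unfolding c div_curl_op_def riesz_cong_AE[OF d dm Dm] .
 qed
qed

lemma half_gradient_bound:
 fixes D :: "real^3 => real" and w :: "3 => 3 => real^3 => real"
 assumes rep: "AE x in lborel. g x = div_curl_op 2 i j (\<lambda>k. ext3 (par3 k * par3 j) (w k j)) (ext3 1 D) x"
  and m: "\<And>k j. borel_fun (w k j)" "borel_fun D"
  and f2: "\<And>k j. hIn 2 (w k j) < \<infinity>" "hIn 2 D < \<infinity>"
  and p: "1 < p" and fp: "\<And>k j. hIn p (w k j) < \<infinity>" "hIn p D < \<infinity>"
 shows "hIn p g \<le> ennreal (uF_const p) * ((\<Sum>k\<in>UNIV. hIn p (w k j)) + hIn p D)"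
proof -
 have p0: "0 < p" using p by simp
 have eL: "Lspace 2 (ext3 (par3 k * par3 j) (w k j))" "Lspace p (ext3 (par3 k * par3 j) (w k j))"
  "Lspace 2 (ext3 1 D)" "Lspace p (ext3 1 D)" for k
  by (intro Lspace_ext3 p0 m f2 fp par3; simp)+
 have "hIn p g \<le> In p g" by (rule hIn_le_In[OF p0])
 also have "\<dots> = In p (div_curl_op 2 i j (\<lambda>k. ext3 (par3 k * par3 j) (w k j)) (ext3 1 D))" by (rule In_cong_AE[OF rep])
 also have "\<dots> \<le> ennreal (div_curl_const p) * ((\<Sum>k\<in>UNIV. In p (ext3 (par3 k * par3 j) (w k j))) + In p (ext3 1 D))"
  by (rule In_div_curl_op[OF _ p eL]) simp
 also have "\<dots> \<le> ennreal (div_curl_const p) * ((\<Sum>k\<in>UNIV. ennreal (2 powr p * 2) * hIn p (w k j)) + ennreal (2 powr p * 2) * hIn p D)"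
  unfolding hIn_def by (intro mult_left_mono add_mono sum_mono In_ext3 p0 m par3) auto
 also have "\<dots> = ennreal (uF_const p) * ((\<Sum>k\<in>UNIV. hIn p (w k j)) + hIn p D)"
  unfolding uF_const_def using div_curl_const_pos[OF p] by (simp add: ennreal_mult sum_distrib_left distrib_left mult.assoc)
 finally show ?thesis .
qed

text \<open>
 The first derivatives of \<open>u\<close> are differentiated through their representation in the tangential
 directions; the remaining second derivatives follow by commuting derivatives and from the
 definitions of divergence and curl.
\<close>

lemma half_second_derivatives:
 fixes D :: "real^3 => real" and z :: "3 => 3 => real^3 => real"
 assumes w: "\<And>i j. wd UNIV (axis i 1) (u j) (g i j)" and g: "\<And>i j. Lspace 2 (g i j)"
  and rep: "\<And>i j. AE x in lborel. g i j x = div_curl_op 2 i j (\<lambda>k. ext3 (par3 k * par3 j) (z k j)) (ext3 1 D) x"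
  and c: "\<And>k j. AE x in lborel. x \<in> half --> g k j x - g j k x = z k j x" "AE x in lborel. x \<in> half --> (\<Sum>k\<in>UNIV. g k k x) = D x"
  and f2: "\<And>k j. hIn 2 (z k j) < \<infinity>" "hIn 2 D < \<infinity>"
  and p: "1 < p" and a: "\<And>l. wd half (axis l 1) D (a l)" "\<And>l. hIn p (a l) < \<infinity>"
  and b: "\<And>l k j. wd half (axis l 1) (z k j) (b l k j)" "\<And>l k j. hIn p (b l k j) < \<infinity>"
 shows "\<exists>H. \<forall>l i j. wd half (axis l 1) (g i j) (H l i j) \<and>
  hIn p (H l i j) \<le> ennreal (2 powr p * (2 powr p * (uF_const p + uF_const p) + uF_const p + 1)) * ((\<Sum>l\<in>UNIV. \<Sum>k\<in>UNIV. \<Sum>j\<in>UNIV. hIn p (b l k j)) + (\<Sum>l\<in>UNIV. hIn p (a l)))"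
proof -
 have p0: "0 < p" "1 \<le> p" using p by auto
 have am: "borel_fun (a l)" and bm: "borel_fun (b l k j)" for l k j
  by (rule wdD(4)[OF a(1)] wdD(4)[OF b(1)])+
 have Dm: "borel_fun D" and zm: "borel_fun (z k j)" for k j
  by (rule wdD(3)[OF a(1)] wdD(3)[OF b(1)])+
 define T where "T = (\<Sum>l\<in>UNIV. \<Sum>k\<in>UNIV. \<Sum>j\<in>UNIV. hIn p (b l k j)) + (\<Sum>l\<in>UNIV. hIn p (a l))"
 have Ta: "hIn p (a l) \<le> T" for l
 proof -
  have "hIn p (a l) \<le> (\<Sum>l\<in>UNIV. hIn p (a l))" by (rule member_le_sum) auto
  then show ?thesis unfolding T_def by (simp add: add_increasing)
 qed
 have Tb: "hIn p (b l k j) \<le> T" for l k j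
 proof -
  have "hIn p (b l k j) \<le> (\<Sum>j\<in>UNIV. hIn p (b l k j))" by (rule member_le_sum) auto
  also have "\<dots> \<le> (\<Sum>k\<in>UNIV. \<Sum>j\<in>UNIV. hIn p (b l k j))" by (rule member_le_sum) auto
  also have "\<dots> \<le> (\<Sum>l\<in>UNIV. \<Sum>k\<in>UNIV. \<Sum>j\<in>UNIV. hIn p (b l k j))" by (rule member_le_sum) auto
  also have "\<dots> \<le> T" unfolding T_def by (simp add: add_increasing2)
  finally show ?thesis .
 qed
 have Tab: "(\<Sum>k\<in>UNIV. hIn p (b l k j)) + hIn p (a l) \<le> T" for l j
 proof -
  have "(\<Sum>k\<in>UNIV. hIn p (b l k j)) \<le> (\<Sum>k\<in>UNIV. \<Sum>j\<in>UNIV. hIn p (b l k j))"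
   by (intro sum_mono member_le_sum) auto
  also have "\<dots> \<le> (\<Sum>l\<in>UNIV. \<Sum>k\<in>UNIV. \<Sum>j\<in>UNIV. hIn p (b l k j))" by (rule member_le_sum) auto
  finally show ?thesis unfolding T_def by (intro add_mono member_le_sum) auto
 qed
 define S where "S = (\<lambda>l i j. div_curl_op p i j (\<lambda>k. ext3 (par3 k * par3 j) (b l k j)) (ext3 1 (a l)))"
 have eL: "Lspace 2 (ext3 (par3 k * par3 j) (z k j))" "Lspace p (ext3 (par3 k * par3 j) (b l k j))"
  "Lspace 2 (ext3 1 D)" "Lspace p (ext3 1 (a l))" for l k j
  by (intro Lspace_ext3 p0 zm bm Dm am f2 a b par3; simp)+
 have SL: "Lspace p (S l i j)" for l i j unfolding S_def by (intro Lspace_div_curl_op p eL)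
 have wS: "wd UNIV (axis l 1) (g i j) (S l i j)" if l: "l \<noteq> 3" for l i j
 proof (rule wd_cong_AE)
  show "wd UNIV (axis l 1) (div_curl_op 2 i j (\<lambda>k. ext3 (par3 k * par3 j) (z k j)) (ext3 1 D)) (S l i j)"
   unfolding S_def
  proof (intro wd_div_curl_op p eL)
   show "wd UNIV (axis l 1) (ext3 (par3 k * par3 j) (z k j)) (ext3 (par3 k * par3 j) (b l k j))" for k
    by (rule wd_ext3_tangential[OF b(1) l _ f2(1) p0(2) b(2)]) simp
   show "wd UNIV (axis l 1) (ext3 1 D) (ext3 1 (a l))"
    by (rule wd_ext3_tangential[OF a(1) l _ f2(2) p0(2) a(2)]) simp
  qed simp
  show "AE x in lborel. x \<in> UNIV --> div_curl_op 2 i j (\<lambda>k. ext3 (par3 k * par3 j) (z k j)) (ext3 1 D) x = g i j x"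
   using rep[of i j] by eventually_elim simp
 qed (use Lspace_measurable[OF g] Lspace_measurable[OF SL] in simp_all)
 have uF0: "0 \<le> uF_const p" unfolding uF_const_def using div_curl_const_pos[OF p] by simp
 have ST: "hIn p (S l i j) \<le> ennreal (uF_const p) * T" for l i j
 proof -
  have "hIn p (S l i j) \<le> In p (S l i j)" by (rule hIn_le_In[OF p0(1)])
  also have "\<dots> \<le> ennreal (div_curl_const p) * ((\<Sum>k\<in>UNIV. In p (ext3 (par3 k * par3 j) (b l k j))) + In p (ext3 1 (a l)))"
   unfolding S_def by (rule In_div_curl_op[OF p p eL(2) eL(2) eL(4) eL(4)])
  also have "\<dots> \<le> ennreal (div_curl_const p) * ((\<Sum>k\<in>UNIV. ennreal (2 powr p * 2) * hIn p (b l k j)) + ennreal (2 powr p * 2) * hIn p (a l))"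
   unfolding hIn_def by (intro mult_left_mono add_mono sum_mono In_ext3 p0 am bm par3) auto
  also have "\<dots> = ennreal (uF_const p) * ((\<Sum>k\<in>UNIV. hIn p (b l k j)) + hIn p (a l))"
   unfolding uF_const_def using div_curl_const_pos[OF p] by (simp add: ennreal_mult sum_distrib_left distrib_left mult.assoc)
  also have "\<dots> \<le> ennreal (uF_const p) * T" by (intro mult_left_mono Tab) simp
  finally show ?thesis .
 qed
 have Sm: "borel_fun (S l i j)" for l i j by (rule Lspace_measurable[OF SL])
 have w3: "wd UNIV (axis 3 1) (g i j) (S i 3 j)" if "i \<noteq> 3" for i j
  by (rule wd_commute[OF w w wS[OF that] _ g p0(2) SL]) simp
 have wh: "wd half v f f'" if "wd UNIV v f f'" for v f f' using wd_mono[OF that] by simp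
 \<comment> \<open>\<open>H l i j\<close> is the derivative \<open>l\<close> of the derivative
   \<open>i\<close> of component \<open>j\<close>. Only \<open>l = i = 3\<close> escapes the
   representation: for \<open>j \<noteq> 3\<close> the curl gives
   \<open>g 3 j = z 3 j + g j 3\<close>, and for \<open>j = 3\<close> the divergence gives
   \<open>g 3 3 = D - g 1 1 - g 2 2\<close>; what is differentiated there is again covered by the
   first two cases.\<close>
 define H where "H = (\<lambda>l i j. if l \<noteq> 3 then S l i j else if i \<noteq> 3 then S i 3 j else
   if j \<noteq> 3 then (\<lambda>x. b 3 3 j x + S j 3 3 x) else (\<lambda>x. a 3 x - (S 1 3 1 x + S 2 3 2 x)))"
 have wH: "wd half (axis l 1) (g i j) (H l i j)" for l i j
 proof (cases "l = 3 \<and> i = 3")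
  case False
  then show ?thesis unfolding H_def using wh[OF wS] wh[OF w3] by auto
 next
  case li: True
  show ?thesis
  proof (cases "j = 3")
   case False
   have "wd half (axis 3 1) (\<lambda>x. z 3 j x + g j 3 x) (\<lambda>x. b 3 3 j x + S j 3 3 x)" by (intro wd_add b(1) wh w3 False)
   moreover have "AE x in lborel. x \<in> half --> z 3 j x + g j 3 x = g 3 j x" using c(1)[of 3 j] by eventually_elim auto
   ultimately have "wd half (axis 3 1) (g 3 j) (\<lambda>x. b 3 3 j x + S j 3 3 x)"
    by (rule wd_cong_AE[OF _ Lspace_measurable[OF g] borel_measurable_add[OF bm Sm]]) simp
   then show ?thesis unfolding H_def using li False by simp
  next
   case True
   have "wd half (axis 3 1) (\<lambda>x. D x - (g 1 1 x + g 2 2 x)) (\<lambda>x. a 3 x - (S 1 3 1 x + S 2 3 2 x))"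
    by (intro wd_diff wd_add a(1) wh w3) auto
   moreover have "AE x in lborel. x \<in> half --> D x - (g 1 1 x + g 2 2 x) = g 3 3 x"
    using c(2) by eventually_elim (auto simp: sum_3)
   ultimately have "wd half (axis 3 1) (g 3 3) (\<lambda>x. a 3 x - (S 1 3 1 x + S 2 3 2 x))"
    by (rule wd_cong_AE[OF _ Lspace_measurable[OF g] borel_measurable_diff[OF am borel_measurable_add[OF Sm Sm]]]) simp
   then show ?thesis unfolding H_def using li True by simp
  qed
 qed
 define c where "c = uF_const p"
 \<comment> \<open>One value for all cases of \<open>H\<close>; the nested powers come from the last
   case, where three functions are combined by two triangle inequalities.\<close>
 define K where "K = 2 powr p * (2 powr p * (c + c) + c + 1)"
 have c0: "0 \<le> c" unfolding c_def by (rule uF0)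
 have p2: "1 \<le> 2 powr p" using p0 by (simp add: ge_one_powr_ge_zero)
 have KT: "ennreal r * T \<le> ennreal K * T" if "r \<le> K" for r by (intro mult_right_mono ennreal_leI that) simp
 have cK: "c \<le> 2 powr p * (2 powr p * (c + c) + c + 1)"
 proof -
  have "c \<le> 1 * (1 * (c + c) + c + 1)" using c0 by simp
  also have "\<dots> \<le> 2 powr p * (2 powr p * (c + c) + c + 1)" using p2 c0 by (intro mult_mono add_right_mono mult_right_mono) auto
  finally show ?thesis .
 qed
 have HT: "hIn p (H l i j) \<le> ennreal K * T" for l i j
 proof -
  have s: "hIn p (S l i j) \<le> ennreal K * T" for l i j
   using order_trans[OF ST KT] cK unfolding K_def c_def by blast
  have s1: "hIn p (\<lambda>x. b 3 3 j x + S j 3 3 x) \<le> ennreal K * T"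
  proof -
   have "hIn p (\<lambda>x. b 3 3 j x + S j 3 3 x) \<le> ennreal (2 powr p) * (hIn p (b 3 3 j) + hIn p (S j 3 3))" by (rule hIn_add[OF p0(1) bm Sm])
   also have "\<dots> \<le> ennreal (2 powr p) * (ennreal 1 * T + ennreal c * T)" unfolding c_def using Tb ST by (intro mult_left_mono add_mono) auto
   also have "\<dots> = ennreal (2 powr p * (1 + c)) * T" using c0 by (simp add: ennreal_mult mult.assoc distrib_right ennreal_plus)
   also have "\<dots> \<le> ennreal K * T" unfolding K_def using c0 by (intro KT[unfolded K_def] mult_left_mono) auto
   finally show ?thesis .
  qed
  have s2: "hIn p (\<lambda>x. a 3 x - (S 1 3 1 x + S 2 3 2 x)) \<le> ennreal K * T"
  proof -
   have "hIn p (\<lambda>x. a 3 x - (S 1 3 1 x + S 2 3 2 x)) \<le> ennreal (2 powr p) * (hIn p (a 3) + hIn p (\<lambda>x. S 1 3 1 x + S 2 3 2 x))"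
    by (rule hIn_diff[OF p0(1) am borel_measurable_add[OF Sm Sm]])
   also have "\<dots> \<le> ennreal (2 powr p) * (ennreal 1 * T + ennreal (2 powr p) * (ennreal c * T + ennreal c * T))"
    unfolding c_def using Ta ST by (intro mult_left_mono add_mono order_trans[OF hIn_add[OF p0(1) Sm Sm]]) auto
   also have "\<dots> = ennreal (2 powr p * (1 + 2 powr p * (c + c))) * T"
    using c0 by (simp add: ennreal_mult mult.assoc distrib_right ennreal_plus flip: mult_2)
   also have "\<dots> \<le> ennreal K * T" unfolding K_def using c0 by (intro KT[unfolded K_def] mult_left_mono) auto
   finally show ?thesis .
  qed
  show ?thesis unfolding H_def using s s1 s2 by auto
 qed
 show ?thesis using wH HT unfolding K_def c_def T_def by blast
qed

section \<open>Vector fields on the half-space\<close>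

definition vIn :: "real => (real^3 => 'b::real_normed_vector) => ennreal" where
 "vIn p f = (\<integral>\<^sup>+x\<in>half. ennreal (norm (f x) powr p) \<partial>lborel)"

definition rt :: "real => ennreal => ennreal" where
 "rt p I = (if I = \<infinity> then \<infinity> else ennreal (enn2real I powr (1 / p)))"

lemma Lp_half: "Lp half p f = rt p (vIn p f)"
 unfolding Lp_def rt_def vIn_def nn_integral_completion Let_def ..

lemma rt_mono: "0 < p ==> I \<le> J ==> rt p I \<le> rt p J"
 unfolding rt_def by (auto intro!: ennreal_leI powr_mono2 enn2real_mono simp: top_unique less_top)

text \<open>The sum is compared with twice its larger term, whence the 2 inside the root; if a term
  on the right is infinite, the claim is trivial.\<close>

lemma rt_le_sum:
 assumes p: "0 < p" and K: "0 < K" and le: "I \<le> ennreal K * (J + L)"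
 shows "rt p I \<le> ennreal ((2 * K) powr (1 / p)) * (rt p J + rt p L)"
proof (cases "J = \<infinity> \<or> L = \<infinity>")
 case True
 then show ?thesis using K by (auto simp: rt_def ennreal_mult_eq_top_iff ennreal_mult_top)
next
 case False
 then obtain j l where j: "J = ennreal j" "0 \<le> j" and l: "L = ennreal l" "0 \<le> l" by (cases J; cases L) auto
 have "I \<le> ennreal (2 * K * max j l)"
 proof -
  have "K * (j + l) \<le> 2 * K * max j l" using K by (simp add: mult.commute[of 2] mult.assoc)
  then have "ennreal (K * (j + l)) \<le> ennreal (2 * K * max j l)" by (rule ennreal_leI)
  moreover have "ennreal (K * (j + l)) = ennreal K * (J + L)" unfolding j(1) l(1) using K j l by (simp add: ennreal_mult)
  ultimately show ?thesis using le by simp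
 qed
 then have "rt p I \<le> rt p (ennreal (2 * K * max j l))" by (rule rt_mono[OF p])
 also have "\<dots> = ennreal ((2 * K) powr (1 / p) * max j l powr (1 / p))"
  unfolding rt_def using K j l by (simp add: powr_mult)
 also have "\<dots> \<le> ennreal ((2 * K) powr (1 / p) * (j powr (1 / p) + l powr (1 / p)))"
  by (intro ennreal_leI mult_left_mono) (auto simp: max_def)
 also have "\<dots> = ennreal ((2 * K) powr (1 / p)) * (rt p J + rt p L)"
  unfolding rt_def j(1) l(1) using j l by (simp add: ennreal_mult)
 finally show ?thesis .
qed

lemma vIn_cong_AE:
 "AE x in lborel. x \<in> half --> f x = g x ==> vIn p f = vIn p g"
 unfolding vIn_def by (intro nn_integral_cong_AE) (auto elim!: eventually_mono simp: indicator_def)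

lemma vIn_real: "vIn p f = hIn p f" if "0 < p"
 unfolding vIn_def hIn_def In_def using that by (intro nn_integral_cong) (auto simp: indicator_def)

lemma vIn_nth_le: "0 < p ==> vIn p (\<lambda>x. f x $ i) \<le> vIn p f"
 unfolding vIn_def
 by (intro nn_integral_mono mult_right_mono ennreal_leI powr_mono2) (auto simp: Finite_Cartesian_Product.norm_nth_le)

lemma vIn_le_sum:
 fixes f :: "real^3 => 'b::real_normed_vector^3"
 assumes p: "0 < p" and m: "\<And>i. borel_fun (\<lambda>x. norm (f x $ i))"
 shows "vIn p f \<le> ennreal (3 powr p) * (\<Sum>i\<in>UNIV. vIn p (\<lambda>x. f x $ i))"
proof -
 have le: "norm v powr p \<le> 3 powr p * (\<Sum>i\<in>UNIV. norm (v $ i) powr p)" for v :: "'b^3"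
 proof -
  have "Max (range (\<lambda>j. norm (v $ j))) \<in> range (\<lambda>j. norm (v $ j))" by (rule Max_in) auto
  then obtain i where "Max (range (\<lambda>j. norm (v $ j))) = norm (v $ i)" by (elim rangeE) (rule that)
  moreover have "norm (v $ j) \<le> Max (range (\<lambda>j. norm (v $ j)))" for j by (rule Max_ge) auto
  ultimately have i: "norm (v $ j) \<le> norm (v $ i)" for j by simp
  have "norm v \<le> (\<Sum>j\<in>UNIV. norm (v $ j))" unfolding norm_vec_def by (rule L2_set_le_sum) simp
  also have "\<dots> \<le> (\<Sum>j\<in>(UNIV :: 3 set). norm (v $ i))" by (rule sum_mono[OF i])
  finally have "norm v powr p \<le> (3 * norm (v $ i)) powr p" using p by (intro powr_mono2) auto
  also have "\<dots> = 3 powr p * norm (v $ i) powr p" by (simp add: powr_mult)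
  also have "norm (v $ i) powr p \<le> (\<Sum>i\<in>UNIV. norm (v $ i) powr p)" by (rule member_le_sum) auto
  finally show ?thesis by simp
 qed
 have "vIn p f \<le> (\<integral>\<^sup>+x. ennreal (3 powr p) * (\<Sum>i\<in>UNIV. ennreal (norm (f x $ i) powr p) * indicator half x) \<partial>lborel)"
  unfolding vIn_def
 proof (rule nn_integral_mono)
  fix x
  have "ennreal (norm (f x) powr p) \<le> ennreal (3 powr p) * (\<Sum>i\<in>UNIV. ennreal (norm (f x $ i) powr p))"
   using ennreal_leI[OF le[of "f x"]] by (simp add: ennreal_mult' sum_ennreal)
  then show "ennreal (norm (f x) powr p) * indicator half x \<le> ennreal (3 powr p) * (\<Sum>i\<in>UNIV. ennreal (norm (f x $ i) powr p) * indicator half x)"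
   by (auto simp: indicator_def)
 qed
 also have "\<dots> = ennreal (3 powr p) * (\<Sum>i\<in>UNIV. vIn p (\<lambda>x. f x $ i))"
 proof -
  have mm: "(\<lambda>x. ennreal (norm (f x $ i) powr p) * indicator half x) \<in> borel_measurable lborel" for i
   using m[of i] half_borel by measurable
  show ?thesis unfolding vIn_def
   by (subst nn_integral_cmult[OF borel_measurable_sum[OF mm]], subst nn_integral_sum[OF mm]) (rule refl)
 qed
 finally show ?thesis .
qed

lemma vIn_matrix_le:
 fixes f :: "real^3 => real^3^3"
 assumes p: "0 < p" and m: "\<And>i j. borel_fun (\<lambda>x. f x $ i $ j)" and le: "\<And>i j. hIn p (\<lambda>x. f x $ i $ j) \<le> T"
 shows "vIn p f \<le> ennreal (9 powr p * 9) * T"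
proof -
 have mi: "borel_fun (\<lambda>x. norm (f x $ i))" for i
  unfolding norm_vec_def L2_set_def using m by measurable
 have "vIn p f \<le> ennreal (3 powr p) * (\<Sum>i\<in>UNIV. vIn p (\<lambda>x. f x $ i))" by (rule vIn_le_sum[OF p mi])
 also have "\<dots> \<le> ennreal (3 powr p) * (\<Sum>i\<in>(UNIV :: 3 set). ennreal (3 powr p) * (\<Sum>j\<in>(UNIV :: 3 set). T))"
 proof (intro mult_left_mono sum_mono)
  fix i
  have "vIn p (\<lambda>x. f x $ i) \<le> ennreal (3 powr p) * (\<Sum>j\<in>UNIV. vIn p (\<lambda>x. f x $ i $ j))"
   by (rule vIn_le_sum[OF p]) (use m in measurable)
  also have "\<dots> \<le> ennreal (3 powr p) * (\<Sum>j\<in>(UNIV :: 3 set). T)"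
   unfolding vIn_real[OF p] by (intro mult_left_mono sum_mono le) simp
  finally show "vIn p (\<lambda>x. f x $ i) \<le> ennreal (3 powr p) * (\<Sum>j\<in>(UNIV :: 3 set). T)" .
 qed simp
 also have "\<dots> = ennreal (9 powr p * 9) * T"
 proof -
  have "(9::real) powr p = 3 powr p * 3 powr p" using powr_mult[of 3 3 p] by simp
  then show ?thesis by (simp add: ennreal_mult mult.assoc mult.left_commute[of 3] flip: mult.assoc[of 3 3])
 qed
 finally show ?thesis .
qed

lemma vIn_tensor_le:
 fixes f :: "real^3 => real^3^3^3"
 assumes p: "0 < p" and m: "\<And>l i j. borel_fun (\<lambda>x. f x $ l $ i $ j)" and le: "\<And>l i j. hIn p (\<lambda>x. f x $ l $ i $ j) \<le> T"
 shows "vIn p f \<le> ennreal (27 powr p * 27) * T"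
proof -
 have mi: "borel_fun (\<lambda>x. norm (f x $ l))" for l
  unfolding norm_vec_def L2_set_def using m by measurable
 have "vIn p f \<le> ennreal (3 powr p) * (\<Sum>l\<in>UNIV. vIn p (\<lambda>x. f x $ l))" by (rule vIn_le_sum[OF p mi])
 also have "\<dots> \<le> ennreal (3 powr p) * (\<Sum>l\<in>(UNIV :: 3 set). ennreal (9 powr p * 9) * T)"
  by (intro mult_left_mono sum_mono vIn_matrix_le p m le) simp
 also have "\<dots> = ennreal (27 powr p * 27) * T"
 proof -
  have "(27::real) powr p = 3 powr p * 9 powr p" using powr_mult[of 3 9 p] by simp
  then show ?thesis by (simp add: ennreal_mult mult.assoc mult.left_commute[of 3] flip: mult.assoc[of 3 9])
 qed
 finally show ?thesis .
qed

text \<open>\<open>grad_Lp\<close> is an infimum over weak gradients. An estimate valid for every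
  admissible pair of gradients passes to the infima by approximation, so uniqueness of weak
  gradients need not be invoked.\<close>

lemma INF_add_INF_le:
 fixes x :: ennreal
 assumes K: "0 < K" and le: "\<And>a b. a \<in> A ==> b \<in> B ==> x \<le> ennreal K * (f a + g b)"
 shows "x \<le> ennreal K * ((INF a\<in>A. f a) + (INF b\<in>B. g b))"
proof (cases "(INF a\<in>A. f a) = \<infinity> \<or> (INF b\<in>B. g b) = \<infinity>")
 case True
 then show ?thesis using K by (auto simp: ennreal_mult_top)
next
 case False
 show ?thesis
 proof (rule ennreal_le_epsilon)
  fix e :: real assume e: "0 < e"
  define d where "d = e / (2 * K)"
  have d: "0 < d" unfolding d_def using e K by simp
  obtain a where a: "a \<in> A" "f a < (INF a\<in>A. f a) + ennreal d" using INF_approx_ennreal[OF d refl, of f A] False by auto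
  obtain b where b: "b \<in> B" "g b < (INF b\<in>B. g b) + ennreal d" using INF_approx_ennreal[OF d refl, of g B] False by auto
  have "x \<le> ennreal K * (f a + g b)" by (rule le[OF a(1) b(1)])
  also have "\<dots> \<le> ennreal K * (((INF a\<in>A. f a) + ennreal d) + ((INF b\<in>B. g b) + ennreal d))"
   using a(2) b(2) by (intro mult_left_mono add_mono) auto
  also have "\<dots> = ennreal K * ((INF a\<in>A. f a) + (INF b\<in>B. g b)) + ennreal K * (ennreal d + ennreal d)"
   by (simp only: distrib_left add.assoc add.left_commute)
  also have "ennreal K * (ennreal d + ennreal d) = ennreal e"
   unfolding ennreal_plus[OF less_imp_le[OF d] less_imp_le[OF d], symmetric] using d K
   by (simp add: ennreal_mult[symmetric] d_def)
  finally show "x \<le> ennreal K * ((INF a\<in>A. f a) + (INF b\<in>B. g b)) + ennreal e" .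
 qed
qed

section \<open>Componentwise weak derivatives and Borel representatives\<close>

lemma has_weak_deriv_nth:
 fixes f g :: "'a::euclidean_space => 'b::euclidean_space^'n"
 shows "has_weak_deriv S v f g \<longleftrightarrow> (\<forall>i. has_weak_deriv S v (\<lambda>x. f x $ i) (\<lambda>x. g x $ i))"
proof -
 have "has_weak_deriv S v f g \<longleftrightarrow> (\<forall>i. \<forall>b\<in>Basis. has_weak_deriv S v (\<lambda>x. f x $ i \<bullet> b) (\<lambda>x. g x $ i \<bullet> b))"
  by (subst has_weak_deriv_componentwise) (auto simp: Basis_vec_def inner_axis)
 also have "\<dots> \<longleftrightarrow> (\<forall>i. has_weak_deriv S v (\<lambda>x. f x $ i) (\<lambda>x. g x $ i))"
  by (subst (2) has_weak_deriv_componentwise) simp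
 finally show ?thesis .
qed

text \<open>The function is the pointwise limit of its restrictions to a compact exhaustion of
  \<open>half\<close>, which are measurable by local integrability; a Lebesgue measurable function
  agrees a.e. with a Borel one.\<close>

lemma half_borel_representative:
 fixes f :: "real^3 => real"
 assumes f: "loc_set_integrable half f"
 obtains f' where "borel_fun f'" "AE x in lebesgue. x \<in> half --> f x = f' x"
proof -
 define K where "K = (\<lambda>n. cball (0 :: real^3) (real n) \<inter> {x. 1 \<le> real n * x $ 3})"
 have K: "compact (K n)" "K n \<subseteq> half" for n
 proof -
  have "closed {x :: real^3. 1 \<le> real n * x $ 3}" by (intro closed_Collect_le continuous_intros)
  then show "compact (K n)" unfolding K_def by (intro compact_Int_closed) auto
  have "0 < x $ 3" if "1 \<le> real n * x $ 3" for x :: "real^3"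
   using that by (metis mult_nonneg_nonpos not_less of_nat_0_le_iff order_trans not_one_le_zero)
  then show "K n \<subseteq> half" unfolding K_def half_def by auto
 qed
 have m: "(\<lambda>x. indicator (K n) x * f x) \<in> borel_measurable lebesgue" for n
  using f K unfolding loc_set_integrable_def set_integrable_def by (auto dest!: spec[of _ "K n"] borel_measurable_integrable)
 have lim: "(\<lambda>n. indicator (K n) x * f x) \<longlonglongrightarrow> indicator half x * f x" for x
 proof (cases "x \<in> half")
  case True
  obtain N where N: "max (norm x) (1 / x $ 3) < real N" using reals_Archimedean2 by blast
  have "x \<in> K n" if "N \<le> n" for n
  proof -
   have "norm x \<le> real n" "1 / x $ 3 \<le> real n" using N that by auto
   then show ?thesis using True unfolding K_def half_def by (simp add: field_simps)
  qed
  then show ?thesis using True by (intro tendsto_eventually) (auto simp: eventually_sequentially intro!: exI[of _ N])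
 next
  case False
  then have "indicator (K n) x = (0::real)" for n using K(2)[of n] by (auto simp: indicator_def)
  then show ?thesis using False by simp
 qed
 have "(\<lambda>x. indicator half x * f x) \<in> borel_measurable lebesgue" by (rule borel_measurable_LIMSEQ_real[OF lim m])
 then obtain f' where f': "f' \<in> borel_measurable lborel" "AE x in lborel. indicator half x * f x = f' x"
  using completion_ex_borel_measurable_real by blast
 show thesis
 proof (rule that)
  show "borel_fun f'" using f'(1) by simp
  show "AE x in lebesgue. x \<in> half --> f x = f' x"
   using AE_completion[OF f'(2)] by eventually_elim auto
 qed
qed

text \<open>\<open>9 powr p * 9\<close> passes from the entries of a matrix to its norm, 3 counts
  the curl entries that enter one component, and \<open>(1 / c) powr p\<close> converts pressure and
  effective flux, which carry the viscosity factor \<open>c\<close>, into parts of the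
  divergence.\<close>

definition grad_const :: "real => real => real" where
 "grad_const c p = 9 powr p * 9 * (uP_const p * (1 / c) powr p + uF_const p * (3 + (1 / c) powr p))"

text \<open>In the last factor 27 counts the derivatives of curl entries and 3 those of the
  divergence; the middle factor is the constant of \<open>half_second_derivatives\<close>.\<close>

definition hess_const :: "real => real => real" where
 "hess_const c p = 27 powr p * 27 * (2 powr p * (2 powr p * (uF_const p + uF_const p) + uF_const p + 1) * (27 + 3 * (1 / c) powr p))"

text \<open>A sum of roots, to dominate all three estimates at once. The leading 2 is for the
  pressure estimate, where \<open>rt_le_sum\<close> is applied with the same term twice.\<close>

definition Lp_const :: "real => real => real" where
 "Lp_const c p = 2 * ((2 * grad_const c p) powr (1 / p) + (2 * hess_const c p) powr (1 / p))"

lemma const_pos: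
 assumes "1 < p"
 shows "0 < uP_const p" "0 < uF_const p"
 unfolding uP_const_def uF_const_def using riesz_const(1)[OF assms] div_curl_const_pos[OF assms] alpha_pos by simp_all

lemma open_half: "open half"
 unfolding half_def by (intro open_Collect_less continuous_intros)

lemma measurable_nth:
 fixes f :: "'a => 'b::real_normed_vector^'n"
 assumes "f \<in> borel_measurable M" shows "(\<lambda>x. f x $ i) \<in> borel_measurable M"
proof -
 have "continuous_on UNIV (\<lambda>v :: 'b^'n. v $ i)" by (intro continuous_intros)
 from measurable_compose[OF assms borel_measurable_continuous_onI[OF this]] show ?thesis .
qed

definition borel_rep :: "(real^3 => real) => real^3 => real" where
 "borel_rep f = (SOME f'. borel_fun f' \<and> (AE x in lebesgue. x \<in> half --> f x = f' x))"

lemma borel_rep: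
 assumes "loc_set_integrable half f"
 shows "borel_fun (borel_rep f)" "AE x in lebesgue. x \<in> half --> f x = borel_rep f x"
proof -
 have "\<exists>f'. borel_fun f' \<and> (AE x in lebesgue. x \<in> half --> f x = f' x)"
  by (rule half_borel_representative[OF assms]) (intro exI conjI)
 from someI_ex[OF this, folded borel_rep_def]
 show "borel_fun (borel_rep f)" "AE x in lebesgue. x \<in> half --> f x = borel_rep f x" by auto
qed

lemma hIn_borel_rep:
 assumes "0 < p" "loc_set_integrable half f"
 shows "hIn p (borel_rep f) = vIn p f"
 using vIn_cong_AE[OF borel_rep(2)[OF assms(2), unfolded AE_completion_iff], of p] vIn_real[OF assms(1), of "borel_rep f"] by simp

lemma rt_top: "vIn p f = \<infinity> ==> Lp half p f = \<infinity>"
 unfolding Lp_half rt_def by simp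

text \<open>The quantifier over \<open>p\<close> stands inside, as one pair of fields has to serve
  all exponents.\<close>

definition Lp_split :: "real => (real^3 => real^3) => (real^3 => real) => (real^3 => real) => (real^3 => real^3^3) => (real^3 => real^3) => (real^3 => real^3) => bool" where
 "Lp_split c u Q F w uP uF \<longleftrightarrow> (\<forall>x\<in>half. u x = uP x + uF x) \<and> (\<forall>p>1.
   grad_Lp half p uP \<le> ennreal (Lp_const c p) * Lp half p Q \<and>
   grad_Lp half p uF \<le> ennreal (Lp_const c p) * (Lp half p F + Lp half p w) \<and>
   hess_Lp half p uF \<le> ennreal (Lp_const c p) * (grad_Lp half p F + grad_Lp half p w))"

text \<open>Two versions of the pressure part occur: \<open>Q0\<close> is the difference in the
  statement, on which no measurability is imposed, and \<open>Q\<close> is a bounded Borel function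
  equal to \<open>Q0 / c\<close> almost everywhere on the half-space, to which potential theory
  applies.\<close>

lemma Lp_decomposition:
 fixes u :: "real^3 => real^3" and Du :: "real^3 => real^3^3" and Q Q0 :: "real^3 => real" and c :: real
 defines "F \<equiv> \<lambda>x. c * (\<Sum>k\<in>UNIV. Du x $ k $ k) - Q0 x" and "r \<equiv> \<lambda>x. vorticity (Du x)"
 assumes c: "0 < c" and wg: "has_weak_grad half u Du"
  and um: "borel_fun u" and Dm: "borel_fun Du"
  and cont: "continuous_on (closure half) u" and bdry: "\<And>x. x $ 3 = 0 ==> u x $ 3 = 0"
  and D2: "vIn 2 Du < \<infinity>"
  and Q: "borel_fun Q" "\<And>x. \<bar>Q x\<bar> \<le> B" "hIn 2 Q < \<infinity>"
  and Q0: "AE x in lborel. x \<in> half --> Q0 x = c * Q x"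
 shows "\<exists>uP uF. Lp_split c u Q0 F r uP uF"
proof -
 define G where "G = (\<lambda>i j x. Du x $ i $ j)"
 define D where "D = (\<lambda>x. (\<Sum>k\<in>UNIV. G k k x) - Q x)"
 define w where "w = (\<lambda>k j x. G k j x - G j k x)"
 have Um: "borel_fun (\<lambda>x. u x $ j)" for j by (rule measurable_nth[OF um])
 have Gm: "borel_fun (G i j)" for i j unfolding G_def by (rule measurable_nth[OF measurable_nth[OF Dm]])
 have Dmeas: "borel_fun D" unfolding D_def by (intro borel_measurable_diff borel_measurable_sum Gm Q)
 have wm: "borel_fun (w k j)" for k j unfolding w_def by (intro borel_measurable_diff Gm)
 have wd: "wd half (axis i 1) (\<lambda>x. u x $ j) (G i j)" for i j
 proof (rule has_weak_deriv_imp_wd[OF open_half _ Um Gm])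
  have "has_weak_deriv half (axis i 1) u (\<lambda>x. Du x $ i)" using wg unfolding has_weak_grad_def by blast
  then show "has_weak_deriv half (axis i 1) (\<lambda>x. u x $ j) (\<lambda>x. Du x $ i $ j)" unfolding has_weak_deriv_nth by blast
 qed (simp_all add: G_def)
 have comp: "hIn p (\<lambda>x. f x $ i $ j) \<le> vIn p f" if p: "0 < p" for p i j and f :: "real^3 => real^3^3"
  unfolding vIn_real[OF p, symmetric] using order_trans[OF vIn_nth_le[OF p] vIn_nth_le[OF p]] by blast
 have G2: "hIn 2 (G i j) < \<infinity>" for i j
  using le_less_trans[OF comp D2] unfolding G_def by simp
 have w2: "hIn 2 (w k j) < \<infinity>" for k j
  unfolding w_def using hIn_diff[OF _ Gm Gm, of 2 k j j k] G2[of k j] G2[of j k]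
  by (auto intro: le_less_trans simp: ennreal_mult_less_top)
 have sum2: "hIn 2 (\<lambda>x. \<Sum>k\<in>UNIV. G k k x) < \<infinity>"
 proof -
  have "Lspace 2 (\<lambda>x. \<Sum>k\<in>UNIV. indicator half x * G k k x)" by (intro Lspace_sum hIn_Lspace Gm G2) simp
  then show ?thesis unfolding Lspace_def hIn_def sum_distrib_left by simp
 qed
 have Sm: "borel_fun (\<lambda>x. \<Sum>k\<in>UNIV. G k k x)" by (intro borel_measurable_sum Gm)
 have D2': "hIn 2 D < \<infinity>"
  unfolding D_def using hIn_diff[OF _ Sm Q(1), of 2] sum2 Q(3)
  by (auto intro: le_less_trans simp: ennreal_mult_less_top)
 have cU: "continuous_on (closure half) (\<lambda>x. u x $ j)" for j by (intro continuous_intros cont)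
 obtain uP uF gP gF where dec: "\<And>j x. x \<in> half ==> u x $ j = uP j x + uF j x"
  and wP: "\<And>i j. wd UNIV (axis i 1) (uP j) (gP i j)" and wF: "\<And>i j. wd UNIV (axis i 1) (uF j) (gF i j)"
  and gPb: "\<And>p i j. 1 < p ==> hIn p Q < \<infinity> ==> hIn p (gP i j) \<le> ennreal (uP_const p) * hIn p Q"
  and gF2: "\<And>i j. Lspace 2 (gF i j)"
  and curl: "\<And>k j x. x \<in> half ==> gF k j x - gF j k x = w k j x"
  and div: "AE x in lborel. x \<in> half --> (\<Sum>k\<in>UNIV. gF k k x) = D x"
  and rep: "\<And>i j. AE x in lborel. gF i j x = div_curl_op 2 i j (\<lambda>k. ext3 (par3 k * par3 j) (w k j)) (ext3 1 D) x"
  by (rule half_decomposition[OF D_def w_def wd cU bdry G2 Q]) (assumption, (rule that; (assumption | blast)))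
 have FD: "AE x in lborel. x \<in> half --> F x = c * D x"
  using Q0 by eventually_elim (simp add: F_def D_def G_def right_diff_distrib)
 define K where "K = (\<lambda>p. (1 / c) powr p)"
 have K: "0 < K p" for p unfolding K_def using c by simp
 have scale: "hIn p f = ennreal (K p) * vIn p f0" if p: "0 < p" and f: "borel_fun f" and f0: "AE x in lborel. x \<in> half --> f0 x = c * f x"
  for p f and f0 :: "real^3 => real"
 proof -
  have "vIn p f0 = hIn p (\<lambda>x. c * f x)" unfolding vIn_real[OF p, symmetric] by (rule vIn_cong_AE[OF f0])
  then show ?thesis
   using hIn_cmult[of "\<lambda>x. c * f x" p "1 / c"] f c unfolding K_def by simp
 qed
 define vP where "vP = (\<lambda>x. \<chi> j. uP j x)"
 define vF where "vF = (\<lambda>x. \<chi> j. uF j x)"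
 define hP where "hP = (\<lambda>x. \<chi> i j. gP i j x)"
 define hF where "hF = (\<lambda>x. \<chi> i j. gF i j x)"
 have sub: "wd half v f g" if "wd UNIV v f g" for v f g using wd_mono[OF that] by simp
 have hwP: "has_weak_grad half vP hP" and hwF: "has_weak_grad half vF hF"
  unfolding has_weak_grad_def vP_def hP_def vF_def hF_def
  by (subst has_weak_deriv_nth, simp add: wd_imp_has_weak_deriv[OF sub[OF wP]] wd_imp_has_weak_deriv[OF sub[OF wF]])+
 have gPm: "borel_fun (\<lambda>x. hP x $ i $ j)" "borel_fun (\<lambda>x. hF x $ i $ j)" for i j
  unfolding hP_def hF_def using wdD(4)[OF wP] wdD(4)[OF wF] by simp_all
 have vort: "r x $ j $ k = w k j x" for x j k unfolding r_def vorticity_def w_def G_def by simp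
 have "grad_Lp half p vP \<le> ennreal (Lp_const c p) * Lp half p Q0 \<and>
   grad_Lp half p vF \<le> ennreal (Lp_const c p) * (Lp half p F + Lp half p r) \<and>
   hess_Lp half p vF \<le> ennreal (Lp_const c p) * (grad_Lp half p F + grad_Lp half p r)" if p: "1 < p" for p
 proof -
  have p0: "0 < p" using p by simp
  note cp = const_pos[OF p]
  have pp: "0 < uP_const p * K p" "0 < uF_const p * (3 + K p)"
   by (intro mult_pos_pos add_pos_pos cp K; simp)+
  have gc: "0 < grad_const c p" "9 powr p * 9 * (uP_const p * K p) \<le> grad_const c p"
   "9 powr p * 9 * (uF_const p * (3 + K p)) \<le> grad_const c p"
  proof -
   have e: "grad_const c p = 9 powr p * 9 * (uP_const p * K p + uF_const p * (3 + K p))" unfolding grad_const_def K_def ..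
   show "0 < grad_const c p" unfolding e using cp K[of p] by (intro mult_pos_pos add_pos_pos) simp_all
   show "9 powr p * 9 * (uP_const p * K p) \<le> grad_const c p" "9 powr p * 9 * (uF_const p * (3 + K p)) \<le> grad_const c p"
    unfolding e using pp by (intro mult_left_mono; simp)+
  qed
  have hc: "0 < hess_const c p"
   unfolding hess_const_def K_def[symmetric] by (intro mult_pos_pos add_pos_pos cp K) simp_all
  define L where "L = Lp_const c p"
  have Lg: "2 * (2 * grad_const c p) powr (1 / p) \<le> L" "(2 * grad_const c p) powr (1 / p) \<le> L" and Lh: "(2 * hess_const c p) powr (1 / p) \<le> L"
   unfolding L_def Lp_const_def by simp_all
  have L0: "0 < L" unfolding L_def Lp_const_def using gc(1) hc by (simp add: add_pos_pos)
  have 1: "grad_Lp half p vP \<le> ennreal L * Lp half p Q0"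
  proof (cases "vIn p Q0 = \<infinity>")
   case True
   then show ?thesis using L0 by (simp add: rt_top ennreal_mult_top)
  next
   case False
   have sQ: "hIn p Q = ennreal (K p) * vIn p Q0" by (rule scale[OF p0 Q(1) Q0])
   then have "hIn p Q < \<infinity>" using False by (simp add: ennreal_mult_less_top less_top)
   then have b: "hIn p (\<lambda>x. hP x $ i $ j) \<le> ennreal (uP_const p) * (ennreal (K p) * vIn p Q0)" for i j
    using gPb[OF p] unfolding hP_def sQ by simp
   have "vIn p hP \<le> ennreal (9 powr p * 9) * (ennreal (uP_const p) * (ennreal (K p) * vIn p Q0))"
    by (rule vIn_matrix_le[OF p0 gPm(1) b])
   also have "\<dots> = ennreal (9 powr p * 9 * (uP_const p * K p)) * vIn p Q0"
    using cp K[of p] by (simp add: ennreal_mult mult.assoc)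
   also have "\<dots> \<le> ennreal (grad_const c p) * (vIn p Q0 + vIn p Q0)"
    by (intro mult_mono ennreal_leI gc) (auto simp: add_increasing)
   finally have "Lp half p hP \<le> ennreal ((2 * grad_const c p) powr (1 / p)) * (Lp half p Q0 + Lp half p Q0)"
    unfolding Lp_half by (rule rt_le_sum[OF p0 gc(1)])
   also have "\<dots> = ennreal (2 * (2 * grad_const c p) powr (1 / p)) * Lp half p Q0"
    by (simp add: ennreal_mult mult_2[symmetric] ac_simps)
   also have "\<dots> \<le> ennreal L * Lp half p Q0" by (intro mult_right_mono ennreal_leI Lg) simp
   finally show ?thesis unfolding grad_Lp_def using hwP by (intro INF_lower2[of hP]) auto
  qed
  have 2: "grad_Lp half p vF \<le> ennreal L * (Lp half p F + Lp half p r)"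
  proof (cases "vIn p F = \<infinity> \<or> vIn p r = \<infinity>")
   case True
   then show ?thesis using L0 by (auto simp: rt_top ennreal_mult_top)
  next
   case False
   have sD: "hIn p D = ennreal (K p) * vIn p F" by (rule scale[OF p0 Dmeas FD])
   then have Df: "hIn p D < \<infinity>" using False by (simp add: ennreal_mult_less_top less_top)
   have w\<omega>: "hIn p (w k j) \<le> vIn p r" for k j using comp[OF p0, of r j k] unfolding vort .
   then have wf: "hIn p (w k j) < \<infinity>" for k j using False le_less_trans less_top by (metis infinity_ennreal_def)
   have b: "hIn p (\<lambda>x. hF x $ i $ j) \<le> ennreal (uF_const p) * (ennreal (3 + K p) * (vIn p F + vIn p r))" for i j
   proof -
    have "hIn p (gF i j) \<le> ennreal (uF_const p) * ((\<Sum>k\<in>UNIV. hIn p (w k j)) + hIn p D)"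
     by (rule half_gradient_bound[OF rep wm Dmeas w2 D2' p wf Df])
    also have "(\<Sum>k\<in>UNIV. hIn p (w k j)) + hIn p D \<le> ennreal (3 + K p) * (vIn p F + vIn p r)"
    proof -
     have "(\<Sum>k\<in>UNIV. hIn p (w k j)) + hIn p D \<le> (\<Sum>k\<in>(UNIV::3 set). vIn p r) + ennreal (K p) * vIn p F"
      unfolding sD by (intro add_mono sum_mono w\<omega>) simp
     also have "\<dots> \<le> ennreal 3 * (vIn p F + vIn p r) + ennreal (K p) * (vIn p F + vIn p r)"
      by (intro add_mono) (auto simp: distrib_left add_increasing add_increasing2)
     also have "\<dots> = ennreal (3 + K p) * (vIn p F + vIn p r)" using K[of p] by (simp add: ennreal_plus distrib_right)
     finally show ?thesis .
    qed
    finally show ?thesis unfolding hF_def by (simp add: mult_left_mono)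
   qed
   have "vIn p hF \<le> ennreal (9 powr p * 9) * (ennreal (uF_const p) * (ennreal (3 + K p) * (vIn p F + vIn p r)))"
    by (rule vIn_matrix_le[OF p0 gPm(2) b])
   also have "\<dots> = ennreal (9 powr p * 9 * (uF_const p * (3 + K p))) * (vIn p F + vIn p r)"
    using cp K[of p] by (simp add: ennreal_mult mult.assoc)
   also have "\<dots> \<le> ennreal (grad_const c p) * (vIn p F + vIn p r)"
    by (intro mult_right_mono ennreal_leI gc) simp
   finally have "Lp half p hF \<le> ennreal ((2 * grad_const c p) powr (1 / p)) * (Lp half p F + Lp half p r)"
    unfolding Lp_half by (rule rt_le_sum[OF p0 gc(1)])
   also have "\<dots> \<le> ennreal L * (Lp half p F + Lp half p r)" by (intro mult_right_mono ennreal_leI Lg) simp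
   finally show ?thesis unfolding grad_Lp_def using hwF by (intro INF_lower2[of hF]) auto
  qed
  have 3: "hess_Lp half p vF \<le> ennreal L * (grad_Lp half p F + grad_Lp half p r)"
   unfolding grad_Lp_def
  proof (rule INF_add_INF_le[OF L0])
   fix a b assume "a \<in> {g. has_weak_grad half F g}" "b \<in> {g. has_weak_grad half r g}"
   then have wa: "has_weak_grad half F a" and wb: "has_weak_grad half r b" by auto
   show "hess_Lp half p vF \<le> ennreal L * (Lp half p a + Lp half p b)"
   proof (cases "vIn p a = \<infinity> \<or> vIn p b = \<infinity>")
    case True
    then show ?thesis using L0 by (auto simp: rt_top ennreal_mult_top)
   next
    case False
    have ha: "has_weak_deriv half (axis l 1) F (\<lambda>x. a x $ l)" for l using wa unfolding has_weak_grad_def by blast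
    have hb: "has_weak_deriv half (axis l 1) (\<lambda>x. w k j x) (\<lambda>x. b x $ l $ j $ k)" for l j k
    proof -
     have "has_weak_deriv half (axis l 1) r (\<lambda>x. b x $ l)" using wb unfolding has_weak_grad_def by blast
     then have "has_weak_deriv half (axis l 1) (\<lambda>x. r x $ j) (\<lambda>x. b x $ l $ j)" unfolding has_weak_deriv_nth[of _ _ r] by blast
     then show ?thesis unfolding has_weak_deriv_nth[of _ _ "\<lambda>x. r x $ j"] vort by blast
    qed
    \<comment> \<open>The weak gradients \<open>a\<close> and \<open>b\<close> are arbitrary
      Lebesgue measurable versions; \<open>wd\<close> asks for Borel ones.\<close>
    define a' where "a' = (\<lambda>l. borel_rep (\<lambda>x. a x $ l))"
    define b' where "b' = (\<lambda>l k j. borel_rep (\<lambda>x. b x $ l $ j $ k))"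
    have la: "loc_set_integrable half (\<lambda>x. a x $ l)" and lb: "loc_set_integrable half (\<lambda>x. b x $ l $ j $ k)" for l j k
     using ha[of l] hb[of l k j] unfolding has_weak_deriv_iff by simp_all
    have a': "borel_fun (a' l)" "AE x in lebesgue. x \<in> half --> a x $ l = a' l x" for l
     unfolding a'_def by (rule borel_rep[OF la])+
    have b': "borel_fun (b' l k j)" "AE x in lebesgue. x \<in> half --> b x $ l $ j $ k = b' l k j x" for l k j
     unfolding b'_def by (rule borel_rep[OF lb])+
    \<comment> \<open>\<open>F\<close> is \<open>c * D\<close> almost everywhere, so a weak gradient
      of \<open>F\<close> becomes one of \<open>D\<close> after division by
      \<open>c\<close>.\<close>
    have wa': "wd half (axis l 1) D (\<lambda>x. (1 / c) * a' l x)" for l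
    proof -
     have "wd half (axis l 1) (\<lambda>x. c * D x) (a' l)"
      by (rule has_weak_deriv_imp_wd[OF open_half ha _ a'(1) AE_completion[OF FD] a'(2)]) (use Dmeas in simp)
     from wd_cmult[OF this, of "1 / c"] show ?thesis using c by simp
    qed
    have wb': "wd half (axis l 1) (w k j) (b' l k j)" for l k j
     by (rule has_weak_deriv_imp_wd[OF open_half hb wm b'(1) _ b'(2)]) simp
    have na: "hIn p (\<lambda>x. (1 / c) * a' l x) \<le> ennreal (K p) * vIn p a" for l
    proof -
     have "hIn p (a' l) = vIn p (\<lambda>x. a x $ l)" unfolding a'_def by (rule hIn_borel_rep[OF p0 la])
     also have "\<dots> \<le> vIn p a" by (rule vIn_nth_le[OF p0])
     finally show ?thesis unfolding hIn_cmult[OF a'(1)] K_def using c by (simp add: mult_left_mono)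
    qed
    have nb: "hIn p (b' l k j) \<le> vIn p b" for l k j
    proof -
     have "hIn p (b' l k j) = vIn p (\<lambda>x. b x $ l $ j $ k)" unfolding b'_def by (rule hIn_borel_rep[OF p0 lb])
     also have "\<dots> \<le> vIn p b"
      by (rule order_trans[OF vIn_nth_le[OF p0] order_trans[OF vIn_nth_le[OF p0] vIn_nth_le[OF p0]]])
     finally show ?thesis .
    qed
    have fin: "ennreal (K p) * vIn p a < \<infinity>" "vIn p b < \<infinity>" using False by (simp_all add: ennreal_mult_less_top less_top)
    define M where "M = 2 powr p * (2 powr p * (uF_const p + uF_const p) + uF_const p + 1)"
    have M: "0 < M" unfolding M_def using cp by (intro mult_pos_pos add_pos_pos) auto
    define T where "T = (\<Sum>l\<in>(UNIV::3 set). \<Sum>k\<in>(UNIV::3 set). \<Sum>j\<in>(UNIV::3 set). hIn p (b' l k j)) + (\<Sum>l\<in>UNIV. hIn p (\<lambda>x. (1 / c) * a' l x))"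
    obtain H where H: "\<And>l i j. wd half (axis l 1) (gF i j) (H l i j)" "\<And>l i j. hIn p (H l i j) \<le> ennreal M * T"
     using half_second_derivatives[OF wF gF2 rep AE_I2 div w2 D2' p wa' le_less_trans[OF na fin(1)] wb' le_less_trans[OF nb fin(2)]] curl
     unfolding M_def T_def by metis
    have T: "T \<le> ennreal (27 + 3 * K p) * (vIn p a + vIn p b)"
    proof -
     have "T \<le> (\<Sum>l\<in>(UNIV::3 set). \<Sum>k\<in>(UNIV::3 set). \<Sum>j\<in>(UNIV::3 set). vIn p b) + (\<Sum>l\<in>(UNIV :: 3 set). ennreal (K p) * vIn p a)"
      unfolding T_def by (intro add_mono sum_mono na nb)
     also have "\<dots> = ennreal 27 * vIn p b + ennreal (3 * K p) * vIn p a"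
      using K[of p] by (simp add: ennreal_mult mult.assoc flip: mult.assoc[of 3 3] mult.assoc[of 3 9])
     also have "\<dots> \<le> ennreal 27 * (vIn p a + vIn p b) + ennreal (3 * K p) * (vIn p a + vIn p b)"
      by (intro add_mono mult_left_mono) (auto simp: add_increasing add_increasing2)
     also have "\<dots> = ennreal (27 + 3 * K p) * (vIn p a + vIn p b)" using K[of p] by (simp add: ennreal_plus distrib_right)
     finally show ?thesis .
    qed
    define h where "h = (\<lambda>x. \<chi> l i j. H l i j x)"
    have hw: "has_weak_grad half hF h"
     unfolding has_weak_grad_def hF_def h_def
     by (subst has_weak_deriv_nth, subst has_weak_deriv_nth) (simp add: wd_imp_has_weak_deriv[OF H(1)])
    have hm: "borel_fun (\<lambda>x. h x $ l $ i $ j)" for l i j unfolding h_def using wdD(4)[OF H(1)] by simp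
    have hb: "hIn p (\<lambda>x. h x $ l $ i $ j) \<le> ennreal M * (ennreal (27 + 3 * K p) * (vIn p a + vIn p b))" for l i j
     using order_trans[OF H(2) mult_left_mono[OF T]] unfolding h_def by simp
    have "vIn p h \<le> ennreal (27 powr p * 27) * (ennreal M * (ennreal (27 + 3 * K p) * (vIn p a + vIn p b)))"
     by (rule vIn_tensor_le[OF p0 hm hb])
    also have "\<dots> = ennreal (hess_const c p) * (vIn p a + vIn p b)"
     unfolding hess_const_def M_def[symmetric] K_def[symmetric] using M K[of p] by (simp add: ennreal_mult mult.assoc)
    finally have "Lp half p h \<le> ennreal ((2 * hess_const c p) powr (1 / p)) * (Lp half p a + Lp half p b)"
     unfolding Lp_half by (rule rt_le_sum[OF p0 hc])
    also have "\<dots> \<le> ennreal L * (Lp half p a + Lp half p b)" by (intro mult_right_mono ennreal_leI Lh) simp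
    finally show ?thesis unfolding hess_Lp_def using hwF hw by (intro INF_lower2[of h]) auto
   qed
  qed
  show ?thesis using 1 2 3 unfolding L_def by blast
 qed
 moreover have "u x = vP x + vF x" if "x \<in> half" for x
  unfolding vP_def vF_def using dec[OF that] by (simp add: vec_eq_iff)
 ultimately have "Lp_split c u Q0 F r vP vF" unfolding Lp_split_def by simp
 then show ?thesis by blast
qed

lemma Lp_const_pos: "1 < p ==> 0 < c ==> 0 < Lp_const c p"
proof -
 assume p: "1 < p" and c: "0 < c"
 have "0 < grad_const c p" unfolding grad_const_def using const_pos[OF p] c by (intro mult_pos_pos add_pos_pos) auto
 then show ?thesis unfolding Lp_const_def by (simp add: add_pos_nonneg)
qed

section \<open>Application to the Hoff solution\<close>

lemma pressure_law_Lipschitz: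
 assumes P: "pressure_law P rho_t rho_b"
 obtains L where "0 \<le> L" "\<And>r s. r \<in> {0..rho_b} ==> s \<in> {0..rho_b} ==> \<bar>P r - P s\<bar> \<le> L * \<bar>r - s\<bar>"
proof -
 obtain P1 P2 where d: "\<And>s. s \<in> {0..rho_b} ==> (P has_real_derivative P1 s) (at s within {0..rho_b})"
  "\<And>s. s \<in> {0..rho_b} ==> (P1 has_real_derivative P2 s) (at s within {0..rho_b})"
  using P unfolding pressure_law_def by blast
 have "continuous_on {0..rho_b} P1" by (rule DERIV_continuous_on[OF d(2)])
 then have "bounded (P1 ` {0..rho_b})" by (intro compact_imp_bounded compact_continuous_image) auto
 then obtain L where "\<forall>y\<in>P1 ` {0..rho_b}. norm y \<le> L" unfolding bounded_iff by blast
 then have L: "norm (P1 s) \<le> \<bar>L\<bar>" if "s \<in> {0..rho_b}" for s using that by force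
 show thesis
 proof (rule that)
  show "0 \<le> \<bar>L\<bar>" by simp
  show "\<bar>P r - P s\<bar> \<le> \<bar>L\<bar> * \<bar>r - s\<bar>" if "r \<in> {0..rho_b}" "s \<in> {0..rho_b}" for r s
   using field_differentiable_bound[of "{0..rho_b}" P P1 "\<bar>L\<bar>" r s] d(1) L that by simp
 qed
qed

text \<open>A supremum of reals says something only for a set that is bounded above. An upper bound
  of \<open>r\<close> bounds its essential lower bounds because \<open>half\<close> is not a null
  set.\<close>

lemma ess_inf_nonneg:
 assumes ae: "AE x in lebesgue. x \<in> half --> 0 \<le> r x \<and> r x \<le> b"
 shows "0 \<le> ess_inf r"
 unfolding ess_inf_def
proof (rule cSup_upper)
 show "0 \<in> {m. AE x in lebesgue. x \<in> half --> m \<le> r x}" using ae by (auto elim!: eventually_mono)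
 show "bdd_above {m. AE x in lebesgue. x \<in> half --> m \<le> r x}"
 proof (rule bdd_aboveI[of _ b], rule ccontr)
  fix m assume m: "m \<in> {m. AE x in lebesgue. x \<in> half --> m \<le> r x}" and "\<not> m \<le> b"
  then have "AE x in lebesgue. x \<notin> half" using ae by (auto elim!: eventually_elim2)
  then have "half \<in> null_sets lebesgue" using half_borel by (subst (asm) AE_iff_null_sets[symmetric]) auto
  then have "negligible half" unfolding negligible_iff_null_sets .
  moreover have "axis 3 1 \<in> half" unfolding half_def by simp
  ultimately show False using open_not_negligible[OF open_half] by auto
 qed
qed

lemma Hoelder_on_slice:
 assumes "Hoelder_on (S \<times> T) u" "t \<in> T"
 shows "continuous_on S (\<lambda>x. u (x, t))"
 unfolding continuous_on_iff
proof (intro ballI allI impI)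
 fix x and e :: real assume x: "x \<in> S" and e: "0 < e"
 obtain A L where a: "0 < A" and L: "\<And>z w. z \<in> S \<times> T ==> w \<in> S \<times> T ==> norm (u z - u w) \<le> L * dist z w powr A"
  using assms(1) unfolding Hoelder_on_def by blast
 define M where "M = \<bar>L\<bar> + 1"
 have M: "0 < M" "L \<le> M" unfolding M_def by auto
 define d where "d = (e / M) powr (1 / A)"
 have d: "0 < d" unfolding d_def using e M by simp
 have "dist (u (y, t)) (u (x, t)) < e" if y: "y \<in> S" "dist y x < d" for y
 proof -
  have "dist (u (y, t)) (u (x, t)) \<le> L * dist y x powr A"
   using L[of "(y, t)" "(x, t)"] x y assms(2) by (simp add: dist_norm[of "u _"] dist_Pair_Pair)
  also have "\<dots> \<le> M * dist y x powr A" by (intro mult_right_mono M) simp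
  also have "\<dots> < M * d powr A" using y(2) a M by (intro mult_strict_left_mono powr_less_mono2) auto
  also have "\<dots> = e" unfolding d_def powr_powr using a e M by simp
  finally show ?thesis .
 qed
 then show "\<exists>d>0. \<forall>y\<in>S. dist y x < d --> dist (u (y, t)) (u (x, t)) < e" using d by blast
qed

lemma bdpt_surj: "x $ 3 = 0 ==> bdpt (vector [x $ 1, x $ 2]) = x"
 unfolding bdpt_def by (simp add: vec_eq_iff forall_3)

lemma vIn_2_finite:
 assumes le: "AE x in lborel. x \<in> half --> (norm (f x))\<^sup>2 \<le> k * e x" and e: "borel_fun e"
  and fin: "(\<integral>\<^sup>+x\<in>half. ennreal (e x) \<partial>lborel) < \<infinity>" and k: "0 \<le> k"
 shows "vIn 2 f < \<infinity>"
proof -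
 have "vIn 2 f \<le> (\<integral>\<^sup>+x. ennreal k * (ennreal (e x) * indicator half x) \<partial>lborel)"
  unfolding vIn_def
 proof (rule nn_integral_mono_AE)
  show "AE x in lborel. ennreal (norm (f x) powr 2) * indicator half x \<le> ennreal k * (ennreal (e x) * indicator half x)"
   using le by eventually_elim (use k in \<open>auto simp: indicator_def powr_numeral ennreal_mult'[symmetric] intro!: ennreal_leI\<close>)
 qed
 also have "\<dots> = ennreal k * (\<integral>\<^sup>+x\<in>half. ennreal (e x) \<partial>lborel)"
  by (rule nn_integral_cmult) (use e half_borel in measurable)
 also have "\<dots> < \<infinity>" using fin by (simp add: ennreal_mult_less_top)
 finally show ?thesis .
qed

text \<open>At a fixed time the weight \<open>sigma t\<close> is positive, so the energy estimate
  bounds \<open>Du\<close> and \<open>rho - rho_t\<close> in the square mean; the Lipschitz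
  continuity of \<open>P\<close> carries the second bound over to the pressure.\<close>

lemma Hoff_solution_decomposition:
 assumes c: "0 < mu" "0 < lam" and P: "pressure_law P rho_t rho_b" and r: "0 < rho_t" "rho_t < rho_b"
  and rho0: "AE x in lebesgue. x \<in> half --> 0 \<le> rho0 x \<and> rho0 x \<le> rho_b1"
  and H: "Hoff_solution mu lam rho_t rho_b P K f rho0 u0 B rho u Du" and t: "0 < t"
 shows "\<exists>uP uF. Lp_split (lam + mu) (\<lambda>x. u (x, t)) (\<lambda>x. P (rho (x, t)) - P rho_t)
  (\<lambda>x. eff_flux mu lam P rho_t (Du (x, t)) (rho (x, t))) (\<lambda>x. vorticity (Du (x, t))) uP uF"
proof -
 define c where "c = lam + mu"
 have c0: "0 < c" unfolding c_def using assms(1,2) by simp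
 note W = H[unfolded Hoff_solution_def, THEN conjunct1] and Hd = H[unfolded Hoff_solution_def, THEN conjunct2, THEN conjunct2]
 note Ho = Hd[THEN conjunct1] and bds = Hd[THEN conjunct2, THEN conjunct1] and EE = Hd[THEN conjunct2, THEN conjunct2]
 have m: "borel_fun rho" "borel_fun u" "borel_fun Du"
  and wg: "has_weak_grad half (\<lambda>x. u (x, t)) (\<lambda>x. Du (x, t))" and bd: "\<And>y. u (bdpt y, t) $ 3 = 0"
  using W t unfolding weak_solution_def by simp_all
 have pt: "(\<lambda>x :: real^3. (x, t)) \<in> borel \<rightarrow>\<^sub>M borel"
  by (rule borel_measurable_continuous_onI) (intro continuous_intros)
 have rm: "borel_fun (\<lambda>x. rho (x, t))" and um: "borel_fun (\<lambda>x. u (x, t))"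
  and Dm: "borel_fun (\<lambda>x. Du (x, t))"
  by (rule measurable_compose[OF pt m(1)] measurable_compose[OF pt m(2)] measurable_compose[OF pt m(3)])+
 have cont: "continuous_on (closure half) (\<lambda>x. u (x, t))"
 proof -
  have "Hoelder_on (closure half \<times> {t..}) u" using Ho t by blast
  then show ?thesis by (rule Hoelder_on_slice) simp
 qed
 have rb: "AE x in lborel. x \<in> half --> 0 \<le> rho (x, t) \<and> rho (x, t) \<le> rho_b"
 proof -
  obtain c where c: "0 < c" "AE x in lebesgue. x \<in> half --> inverse c * ess_inf rho0 \<le> rho (x, t) \<and> rho (x, t) \<le> rho_b"
   using bds t by blast
  have "0 \<le> inverse c * ess_inf rho0" using c(1) ess_inf_nonneg[OF rho0] by simp
  with c(2) show ?thesis unfolding AE_completion_iff by (auto elim!: eventually_mono)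
 qed
 define e where "e = (\<lambda>x. rho (x, t) * (norm (u (x, t)))\<^sup>2 / 2 + \<bar>rho (x, t) - rho_t\<bar>\<^sup>2 + sigma t * (norm (Du (x, t)))\<^sup>2)"
 have em: "borel_fun e" unfolding e_def using rm um Dm by measurable
 have ef: "(\<integral>\<^sup>+x\<in>half. ennreal (e x) \<partial>lborel) < \<infinity>"
 proof -
  define E where "E = (\<lambda>t. \<integral>\<^sup>+x\<in>half. ennreal (rho (x, t) * (norm (u (x, t)))\<^sup>2 / 2
      + \<bar>rho (x, t) - rho_t\<bar>\<^sup>2 + sigma t * (norm (Du (x, t)))\<^sup>2) \<partial>lebesgue)"
  have "\<exists>X Y. (SUP t\<in>{0<..}. E t) + X + Y \<le> ennreal B"
   using EE unfolding energy_estimate_def E_def by blast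
  then obtain X Y where "(SUP t\<in>{0<..}. E t) + X + Y \<le> ennreal B" by blast
  moreover have "E t \<le> (SUP t\<in>{0<..}. E t)" by (rule SUP_upper) (use t in simp)
  ultimately have "E t \<le> ennreal B"
   by (meson add_increasing2 order_trans zero_le order_refl)
  then have "E t < \<infinity>" by (rule le_less_trans) simp
  then show ?thesis unfolding E_def e_def nn_integral_completion .
 qed
 have s: "0 < sigma t" unfolding sigma_def using t by simp
 have D2: "vIn 2 (\<lambda>x. Du (x, t)) < \<infinity>"
 proof (rule vIn_2_finite[OF _ em ef])
  show "AE x in lborel. x \<in> half --> (norm (Du (x, t)))\<^sup>2 \<le> (1 / sigma t) * e x"
   using rb by eventually_elim (use s in \<open>simp add: e_def field_simps\<close>)
 qed (use s in simp)
 obtain L where L: "0 \<le> L" "\<And>r s. r \<in> {0..rho_b} ==> s \<in> {0..rho_b} ==> \<bar>P r - P s\<bar> \<le> L * \<bar>r - s\<bar>"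
  using pressure_law_Lipschitz[OF P] by blast
 \<comment> \<open>\<open>P\<close> is controlled on \<open>{0..rho_b}\<close> only and may fail to
   be measurable elsewhere. Clamping yields a function that is Lipschitz on the whole line, and it
   changes nothing where the density lies in this interval, that is, almost everywhere.\<close>
 define cl where "cl = (\<lambda>r. max 0 (min rho_b r))"
 have cl: "cl r \<in> {0..rho_b}" "\<bar>cl r - cl s\<bar> \<le> \<bar>r - s\<bar>" for r s unfolding cl_def using r by auto
 have clt: "cl rho_t = rho_t" unfolding cl_def using r by simp
 have PL: "\<bar>P (cl r) - P (cl s)\<bar> \<le> L * \<bar>r - s\<bar>" for r s
  by (rule order_trans[OF L(2)[OF cl(1) cl(1)] mult_left_mono[OF cl(2) L(1)]])
 have PLt: "\<bar>P (cl r) - P rho_t\<bar> \<le> L * \<bar>r - rho_t\<bar>" for r using PL[of r rho_t] unfolding clt .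
 have Pc: "continuous_on UNIV (\<lambda>r. P (cl r))"
  by (rule lipschitz_on_continuous_on[of L], rule lipschitz_onI) (use PL L in \<open>auto simp: dist_real_def\<close>)
 define Q where "Q = (\<lambda>x. (P (cl (rho (x, t))) - P rho_t) / c)"
 have Qm: "borel_fun Q"
  unfolding Q_def using measurable_compose[OF rm borel_measurable_continuous_onI[OF Pc]] by measurable
 have Qb: "\<bar>Q x\<bar> \<le> L * (rho_b + rho_t) / c" for x
 proof -
  have "\<bar>P (cl (rho (x, t))) - P rho_t\<bar> \<le> L * \<bar>cl (rho (x, t)) - rho_t\<bar>"
   using L(2)[OF cl(1), of rho_t] r by simp
  also have "\<dots> \<le> L * (rho_b + rho_t)" using cl(1)[of "rho (x, t)"] r L(1) by (intro mult_left_mono) auto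
  finally show ?thesis unfolding Q_def using c0 by (simp add: divide_right_mono)
 qed
 have "vIn 2 Q < \<infinity>"
 proof (rule vIn_2_finite[OF _ em ef])
  show "AE x in lborel. x \<in> half --> (norm (Q x))\<^sup>2 \<le> (L / c)\<^sup>2 * e x"
   using rb
  proof eventually_elim
   fix x assume x: "x \<in> half --> 0 \<le> rho (x, t) \<and> rho (x, t) \<le> rho_b"
   show "x \<in> half --> (norm (Q x))\<^sup>2 \<le> (L / c)\<^sup>2 * e x"
   proof
    assume "x \<in> half"
    with x have rx: "0 \<le> rho (x, t)" by simp
    have "\<bar>Q x\<bar> \<le> (L / c) * \<bar>rho (x, t) - rho_t\<bar>"
     unfolding Q_def using divide_right_mono[OF PLt, of c "rho (x, t)"] c0 by (simp add: abs_divide)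
    then have "(norm (Q x))\<^sup>2 \<le> ((L / c) * \<bar>rho (x, t) - rho_t\<bar>)\<^sup>2" by (intro power_mono) auto
    also have "\<dots> = (L / c)\<^sup>2 * \<bar>rho (x, t) - rho_t\<bar>\<^sup>2" by (rule power_mult_distrib)
    also have "\<dots> \<le> (L / c)\<^sup>2 * e x" unfolding e_def using rx s by (intro mult_left_mono) auto
    finally show "(norm (Q x))\<^sup>2 \<le> (L / c)\<^sup>2 * e x" .
   qed
  qed
 qed simp
 then have Q2: "hIn 2 Q < \<infinity>" unfolding vIn_real[of 2, OF zero_less_numeral] .
 have Q0: "AE x in lborel. x \<in> half --> P (rho (x, t)) - P rho_t = c * Q x"
  using rb by eventually_elim (use c0 in \<open>auto simp: Q_def cl_def\<close>)
 have bdry: "u (x, t) $ 3 = 0" if "x $ 3 = 0" for x using bd[of "vector [x $ 1, x $ 2]"] unfolding bdpt_surj[OF that] .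
 have F: "(\<lambda>x. eff_flux mu lam P rho_t (Du (x, t)) (rho (x, t))) = (\<lambda>x. c * (\<Sum>k\<in>UNIV. Du (x, t) $ k $ k) - (P (rho (x, t)) - P rho_t))"
  unfolding eff_flux_def c_def by (simp add: fun_eq_iff)
 show ?thesis
  unfolding F c_def[symmetric]
  by (rule Lp_decomposition[OF c0 wg um Dm cont bdry D2 Qm Qb Q2 Q0])
qed

text \<open>The right sides obtained from \<open>Lp_split\<close> are enlarged to those stated by
  adding nonnegative terms. The fields at different times are chosen independently and put together
  by the axiom of choice.\<close>

theorem proposition1:
  fixes mu lam :: real
  assumes "0 < mu" and "0 < lam" and "lam < 5 * mu / 4"
  shows "\<exists>C :: real \<Rightarrow> real \<Rightarrow> real \<Rightarrow> real.
    (\<forall>p K_lo K_hi. 0 < C p K_lo K_hi) \<and>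
    (\<forall>(rho_t::real) (rho_b::real) (rho_b1::real) (P :: real \<Rightarrow> real) (K :: real^2 \<Rightarrow> real)
       (q::real) (M::real) (Cbar::real) (\<theta>::real).
      0 < rho_t \<and> rho_t < rho_b1 \<and> rho_b1 < rho_b \<and>
      pressure_law P rho_t rho_b \<and> friction_coeff K \<and>
      6 < q \<and> (q - 2)\<^sup>2 / (4 * (q - 1)) < mu / lam \<and> 0 < M \<and> 0 < Cbar \<and> 0 < \<theta> \<longrightarrow>
      (\<exists>\<epsilon>>0. \<forall>(C0::real) (Cf::real) (rho0 :: real^3 \<Rightarrow> real) (u0 :: real^3 \<Rightarrow> real^3)
          (f :: spacetime \<Rightarrow> real^3)
          (rho :: spacetime \<Rightarrow> real) (u :: spacetime \<Rightarrow> real^3) (Du :: spacetime \<Rightarrow> real^3^3).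
        0 < C0 \<and> 0 < Cf \<and> C0 + Cf \<le> \<epsilon> \<and>
        rho0 \<in> borel_measurable borel \<and> u0 \<in> borel_measurable borel \<and>
        (AE x in lebesgue. x \<in> half \<longrightarrow> 0 \<le> rho0 x \<and> rho0 x \<le> rho_b1) \<and>
        initial_energy P rho_t rho0 u0 \<le> ennreal C0 \<and>
        force_bound f Cf \<and>
        Mq q rho0 u0 f \<le> ennreal M \<and>
        Hoff_solution mu lam rho_t rho_b P K f rho0 u0 (Cbar * (C0 + Cf) powr \<theta>) rho u Du \<longrightarrow>
        (\<exists>(uP :: spacetime \<Rightarrow> real^3) (uF :: spacetime \<Rightarrow> real^3). \<forall>t>0.
          (\<forall>x\<in>half. u (x, t) = uP (x, t) + uF (x, t)) \<and>
          (\<forall>p K_lo K_hi. 1 < p \<and> 0 < K_lo \<and> (\<forall>y. K_lo \<le> K y \<and> K y \<le> K_hi) \<longrightarrow>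
            (let F = (\<lambda>x. eff_flux mu lam P rho_t (Du (x, t)) (rho (x, t)));
                 \<omega> = (\<lambda>x. vorticity (Du (x, t)));
                 N = Lp half p F + Lp half p \<omega>
                     + Lp half p (\<lambda>x. P (rho (x, t)) - P rho_t) + Lp half p (\<lambda>x. u (x, t))
             in
               grad_Lp half p (\<lambda>x. uP (x, t))
                 \<le> ennreal (C p K_lo K_hi) * Lp half p (\<lambda>x. P (rho (x, t)) - P rho_t) \<and>
               grad_Lp half p (\<lambda>x. uF (x, t)) \<le> ennreal (C p K_lo K_hi) * N \<and>
               hess_Lp half p (\<lambda>x. uF (x, t))
                 \<le> ennreal (C p K_lo K_hi) * (grad_Lp half p F + grad_Lp half p \<omega> + N))))))"
proof -
 \<comment> \<open>Positivity of \<open>C\<close> is claimed at every \<open>p\<close>, so exponents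
   up to 1 receive the default value 1.\<close>
 define C where "C = (\<lambda>p (_ :: real) (_ :: real). if 1 < p then Lp_const (lam + mu) p else 1)"
 have C: "0 < C p K_lo K_hi" for p K_lo K_hi unfolding C_def using Lp_const_pos[of p "lam + mu"] assms by simp
 have main: "\<exists>uP uF. \<forall>t>0.
     (\<forall>x\<in>half. u (x, t) = uP (x, t) + uF (x, t)) \<and>
     (\<forall>p K_lo K_hi. 1 < p \<and> 0 < K_lo \<and> (\<forall>y. K_lo \<le> K y \<and> K y \<le> K_hi) -->
      (let F = (\<lambda>x. eff_flux mu lam P rho_t (Du (x, t)) (rho (x, t)));
         \<omega> = (\<lambda>x. vorticity (Du (x, t)));
         N = Lp half p F + Lp half p \<omega>
           + Lp half p (\<lambda>x. P (rho (x, t)) - P rho_t) + Lp half p (\<lambda>x. u (x, t))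
       in
        grad_Lp half p (\<lambda>x. uP (x, t))
         \<le> ennreal (C p K_lo K_hi) * Lp half p (\<lambda>x. P (rho (x, t)) - P rho_t) \<and>
        grad_Lp half p (\<lambda>x. uF (x, t)) \<le> ennreal (C p K_lo K_hi) * N \<and>
        hess_Lp half p (\<lambda>x. uF (x, t))
         \<le> ennreal (C p K_lo K_hi) * (grad_Lp half p F + grad_Lp half p \<omega> + N)))"
  if P: "pressure_law P rho_t rho_b" and r: "0 < rho_t" "rho_t < rho_b"
   and rho0: "AE x in lebesgue. x \<in> half --> 0 \<le> rho0 x \<and> rho0 x \<le> rho_b1"
   and H: "Hoff_solution mu lam rho_t rho_b P K f rho0 u0 B rho u Du"
  for rho_t rho_b rho_b1 B :: real and P K f rho0 u0 rho u Du
 proof -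
  define S where "S = (\<lambda>t. Lp_split (lam + mu) (\<lambda>x. u (x, t)) (\<lambda>x. P (rho (x, t)) - P rho_t)
   (\<lambda>x. eff_flux mu lam P rho_t (Du (x, t)) (rho (x, t))) (\<lambda>x. vorticity (Du (x, t))))"
  have "\<forall>t. \<exists>w. 0 < t --> S t (fst w) (snd w)"
   using Hoff_solution_decomposition[OF assms(1,2) P r rho0 H] unfolding S_def by fastforce
  from choice[OF this] obtain w where w: "\<And>t. 0 < t ==> S t (fst (w t)) (snd (w t))" by blast
  show ?thesis
  proof (rule exI[of _ "\<lambda>z. fst (w (snd z)) (fst z)"], rule exI[of _ "\<lambda>z. snd (w (snd z)) (fst z)"], intro allI impI conjI, goal_cases)
   case (1 t)
   then show ?case using w[of t] unfolding S_def Lp_split_def by simp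
  next
   case (2 t p K_lo K_hi)
   have C: "C p K_lo K_hi = Lp_const (lam + mu) p" unfolding C_def using 2 by simp
   note g = w[OF 2(1), unfolded S_def Lp_split_def, THEN conjunct2, rule_format, of p]
   have le: "ennreal c * (F + \<omega>) \<le> ennreal c * (F + \<omega> + a + b)" "ennreal c * (F' + \<omega>') \<le> ennreal c * (F' + \<omega>' + (F + \<omega> + a + b))"
    for c and a b F \<omega> F' \<omega>' :: ennreal
    by (intro mult_left_mono; simp add: add_increasing2 add.assoc)+
   show ?case
    unfolding Let_def C fst_conv snd_conv using g 2 by (auto intro: order_trans[OF _ le(1)] order_trans[OF _ le(2)])
  qed
 qed
 show ?thesis
 proof (rule exI[of _ C], rule conjI, intro allI C, intro allI impI, rule exI[of _ 1], rule conjI, rule zero_less_one, intro allI impI)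
 qed (rule main; (elim conjE)?; (assumption | linarith))
qed

end
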